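(* Let $T\subset\mathbb{N}$ be a divisor stable subset and let $g=g(q)\in\mathbb{Z}[q]$. There is a unique isomorphism $$\overline{W}^{g(q)}_\bullet\xrightarrow{\ \sim\ }W^{(1-g(q))}_\bullet\quad\text{in }\mathcal{AFV}^+_{T/\mathbb{Z}[q]} .$$ Moreover this is the only isomorphism in this category of $\overline{W}^{g(q)}_\bullet$ with $W^{(r)}_\bullet$ for some $r\in\mathbb{Z}[q]$.
   Context: Conventions. Rings are commutative and associative, not necessarily unital (the result is about the non-unital categories); base rings $R$ and the $R$-algebras on which ring schemes are evaluated are unital. $\mathbb{N}=\{1,2,\dots\}$. A non-empty $S\subset\mathbb{N}$ is divisor stable if $n\in S$, $d\mid n$ imply $d\in S$. For $n\in S$ put $S/n=\{\nu\in S\mid \nu n\in S\}$ and $S(n)=\{\nu\in S\mid n\nmid\nu\}$. $S\preccurlyeq T$ means $S$ is a divisor stable subset of $T$. The category $\mathcal{RFV}_T$. An object is a projective system of rings $(A_S)_{S\preccurlyeq T}$ (a contravariant functor on the ordered set of $S\preccurlyeq T$, transition maps $\pi$) which is continuous, i.e. $A_S=\varprojlim A_{S_0}$ over the finite divisor stable $S_0\subset S$, together with, for all primes $p\in S\preccurlyeq T$, ring homomorphisms $F_p:A_S\to A_{S/p}$ and additive maps $V_p:A_{S/p}\to A_S$ such that: (1) $F_p(a)\equiv\pi(a)^p \bmod pA_{S/p}$ for $a\in A_S$; (2) for $p\in S_1\preccurlyeq S_2\preccurlyeq T$ one has $\pi F_p=F_p\pi:A_{S_2}\to A_{S_1/p}$;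 (3) $F_lF_p=F_pF_l:A_S\to A_{S/pl}$ for primes $p,l$ with $pl\in S$; (4) $\pi V_p=V_p\pi:A_{S_2/p}\to A_{S_1}$ for $p\in S_1\preccurlyeq S_2$; (5) $V_pV_l=V_lV_p:A_{S/pl}\to A_S$ for primes with $pl\in S$; (6) $F_pV_p=p$ on $A_{S/p}$, and $F_lV_p=V_pF_l:A_{S/p}\to A_{S/l}$ for primes $l\neq p$ with $pl\in S$; (7) the sequences of additive groups $0\to A_{S/p}\xrightarrow{V_p}A_S\xrightarrow{\pi}A_{S(p)}\to0$ are exact. The categories over $R$. An object of $\mathcal{RFV}_{T/R}$ is a continuous projective system $M_\bullet=(M_S)_{S\preccurlyeq T}$ of affine commutative ring schemes over $R$ with morphisms of ring schemes $F_p:M_S\to M_{S/p}$ and morphisms of additive group schemes $V_p:M_{S/p}\to M_S$ (primes $p\in S\preccurlyeq T$) such that for every $R$-algebra $C$ the system $(M_S(C))_S$ with the induced maps is an object of $\mathcal{RFV}_T$; morphisms are families of morphisms of ring schemes over $R$ compatible with $\pi,F_p,V_p$. $\mathcal{AFV}_{T/R}$ is the full subcategory of objects with $M_{\{1\}}\cong\mathbb{A}^1$ as schemes over $R$. $\mathcal{AFV}^+_{T/R}$ is the category of pairs $(M_\bullet,z)$ with $M_\bullet$ in $\mathcal{AFV}_{T/R}$ and $z$ a coordinate in zero of $M_{\{1\}}$, i.e. $M_{\{1\}}=\mathrm{spec}\,R[z]$ (polynomial ring) with $z$ vanishing on the zero section. A morphism $\varphi:(M_\bullet,z)\to(M'_\bullet,z')$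 is a morphism $M_\bullet\to M'_\bullet$ in $\mathcal{AFV}_{T/R}$ with $z=z'\circ\varphi_{\{1\}}$. The objects $W^{(r)}_\bullet$. For a ring $A$, $W_S(A)$ is the ring of $S$-Witt vectors: $W_S(A)=A^S$ as a set, with the unique functorial ring structure for which the ghost map $(a_d)_{d\in S}\mapsto(\sum_{d\mid n}d\,a_d^{n/d})_{n\in S}$ is a ring homomorphism to the product ring $A^S$; it has projections $\pi$, Frobenius maps $F_n:W_S(A)\to W_{S/n}(A)$, given on ghost components by $(a_\nu)_{\nu\in S}\mapsto(a_{n\nu})_{\nu\in S/n}$, and Verschiebung maps $V_n:W_{S/n}(A)\to W_S(A)$ sending $(a_\nu)_{\nu\in S/n}$ to the vector with $\mu$-th component $a_{\mu/n}$ if $n\mid\mu$ and $0$ otherwise. For $r\in\mathbb{Z}[q]$ and a unital $\mathbb{Z}[q]$-algebra $A$ let $A^{(r)}$ be the ring with additive group $(A,+)$ and multiplication $x*y=rxy$, and let $W^{(r)}_S(A)=W_S(A^{(r)})$ with the corresponding maps $\pi,F_p,V_p$. This gives an object $W^{(r)}_\bullet=(W^{(r)}_S)_{S\preccurlyeq T}$ of $\mathcal{AFV}^+_{T/\mathbb{Z}[q]}$, with the standard coordinate on $W^{(r)}_{\{1\}}=\mathbb{A}^1$. The objects $\overline{W}^{g(q)}_\bullet$. $\overline{W}^{1-q}_S$ is the non-unital ring scheme over $\mathbb{Z}[q]$ with $\overline{W}^{1-q}_S(A)=A^S$ as a set for unital $\mathbb{Z}[q]$-algebras $A$, whose ring structure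 is the unique one functorial in $A$ for which $$\mathcal{G}_S:A^S\to(A^{(q)})^S,\quad (a_n)_{n\in S}\mapsto\Big(\sum_{d\mid n}d\,q^{-1}\big(1-(1-q)^{n/d}\big)a_d^{n/d}\Big)_{n\in S}$$ is a ring homomorphism to the product ring (here $q^{-1}(1-(1-q)^m)$ denotes the polynomial $1+(1-q)+\dots+(1-q)^{m-1}$). It has the evident projections, and unique Frobenius and Verschiebung morphisms $F_n:\overline{W}^{1-q}_S\to\overline{W}^{1-q}_{S/n}$, $V_n:\overline{W}^{1-q}_{S/n}\to\overline{W}^{1-q}_S$ corresponding via the ghost maps to $(a_\nu)_{\nu\in S}\mapsto(a_{n\nu})_{\nu\in S/n}$ and to the map sending $(a_\nu)_{\nu\in S/n}$ to the vector with $\nu$-th component $n\,a_{\nu/n}$ if $n\mid\nu$ and $0$ otherwise. For $g(q)\in\mathbb{Z}[q]$ one sets $\overline{W}^{g(q)}_S=\overline{W}^{1-q}_S\otimes_{\mathbb{Z}[q],\beta}\mathbb{Z}[q]$ (base change), where $\beta:\mathbb{Z}[q]\to\mathbb{Z}[q]$ is the ring homomorphism with $\beta(q)=1-g(q)$. With the induced $\pi,F_p,V_p$ and the first coordinate (standard coordinate on $\overline{W}^{g(q)}_{\{1\}}=\mathbb{A}^1$), $\overline{W}^{g(q)}_\bullet=(\overline{W}^{g(q)}_S)_{S\preccurlyeq T}$ is an object of $\mathcal{AFV}^+_{T/\mathbb{Z}[q]}$. *)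

theory Defs
  imports
    "HOL-Computational_Algebra.Primes"
    "HOL-Computational_Algebra.Polynomial"
    "HOL-Algebra.Module"
begin

hide_const (open) Polynomial.smult

section \<open>Divisor stable sets\<close>

text \<open>The natural numbers here are the positive ones, hence the condition on \<open>0\<close>.\<close>

definition divisor_stable :: "nat set \<Rightarrow> bool" where
  "divisor_stable S \<longleftrightarrow> S \<noteq> {} \<and> 0 \<notin> S \<and> (\<forall>n\<in>S. \<forall>d. d dvd n \<longrightarrow> d \<in> S)"

definition ds_subset :: "nat set \<Rightarrow> nat set \<Rightarrow> bool"  (infix "\<preceq>\<^sub>d" 50) where
  "S \<preceq>\<^sub>d T \<longleftrightarrow> divisor_stable S \<and> S \<subseteq> T"

definition set_quot :: "nat set \<Rightarrow> nat \<Rightarrow> nat set"  (infixl "'/\<^sub>d" 75) where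
  "S /\<^sub>d n = {\<nu> \<in> S. \<nu> * n \<in> S}"

definition set_prime_to :: "nat set \<Rightarrow> nat \<Rightarrow> nat set" where
  "set_prime_to S n = {\<nu> \<in> S. \<not> n dvd \<nu>}"


section \<open>Commutative rings without unit\<close>

text \<open>
  Non-unital rings are carried by the library's ring record; its field \<^const>\<open>one\<close> has no
  meaning for them, and no notion below depends on it.
\<close>

locale nonunital_cring = abelian_group A for A (structure) +
  assumes nu_m_closed: "\<lbrakk>x \<in> carrier A; y \<in> carrier A\<rbrakk> \<Longrightarrow> x \<otimes> y \<in> carrier A"
    and nu_m_assoc: "\<lbrakk>x \<in> carrier A; y \<in> carrier A; z \<in> carrier A\<rbrakk>
      \<Longrightarrow> (x \<otimes> y) \<otimes> z = x \<otimes> (y \<otimes> z)"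
    and nu_m_comm: "\<lbrakk>x \<in> carrier A; y \<in> carrier A\<rbrakk> \<Longrightarrow> x \<otimes> y = y \<otimes> x"
    and nu_l_distr: "\<lbrakk>x \<in> carrier A; y \<in> carrier A; z \<in> carrier A\<rbrakk>
      \<Longrightarrow> (x \<oplus> y) \<otimes> z = x \<otimes> z \<oplus> y \<otimes> z"

definition add_hom :: "('a, 'm) ring_scheme \<Rightarrow> ('b, 'n) ring_scheme \<Rightarrow> ('a \<Rightarrow> 'b) set" where
  "add_hom A B = hom (add_monoid A) (add_monoid B)"

definition nu_ring_hom :: "('a, 'm) ring_scheme \<Rightarrow> ('b, 'n) ring_scheme \<Rightarrow> ('a \<Rightarrow> 'b) set" where
  "nu_ring_hom A B = add_hom A B \<inter> hom A B"

text \<open>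
  The library power starts from the unit; this one starts from \<open>x\<close> and is the \<open>n\<close>-th power
  for \<open>n \<ge> 1\<close> only.
\<close>

definition nu_pow :: "('a, 'm) ring_scheme \<Rightarrow> 'a \<Rightarrow> nat \<Rightarrow> 'a" where
  "nu_pow A x n = ((\<lambda>y. y \<otimes>\<^bsub>A\<^esub> x) ^^ (n - 1)) x"

definition power_ring :: "nat set \<Rightarrow> ('a, 'm) ring_scheme \<Rightarrow> (nat \<Rightarrow> 'a) ring" where
  "power_ring S A = \<lparr>
     carrier = S \<rightarrow>\<^sub>E carrier A,
     mult = (\<lambda>x y. \<lambda>n\<in>S. x n \<otimes>\<^bsub>A\<^esub> y n),
     one = (\<lambda>n\<in>S. \<one>\<^bsub>A\<^esub>),
     zero = (\<lambda>n\<in>S. \<zero>\<^bsub>A\<^esub>),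
     add = (\<lambda>x y. \<lambda>n\<in>S. x n \<oplus>\<^bsub>A\<^esub> y n)\<rparr>"


section \<open>The category of systems of rings with Frobenius and Verschiebung\<close>

text \<open>
  \<open>Trans M S S'\<close> is the transition map from \<open>Ring_at M S\<close> to \<open>Ring_at M S'\<close> for
  \<open>S' \<preceq>\<^sub>d S\<close>; \<open>Frob M p S\<close> maps \<open>Ring_at M S\<close> to \<open>Ring_at M (S /\<^sub>d p)\<close>, and
  \<open>Ver M p S\<close> maps in the opposite direction.
\<close>

record 'v rfv_system =
  Ring_at :: "nat set \<Rightarrow> 'v ring"
  Trans :: "nat set \<Rightarrow> nat set \<Rightarrow> 'v \<Rightarrow> 'v"
  Frob :: "nat \<Rightarrow> nat set \<Rightarrow> 'v \<Rightarrow> 'v"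
  Ver :: "nat \<Rightarrow> nat set \<Rightarrow> 'v \<Rightarrow> 'v"

definition projective_system :: "nat set \<Rightarrow> 'v rfv_system \<Rightarrow> bool" where
  "projective_system T M \<longleftrightarrow>
     (\<forall>S. S \<preceq>\<^sub>d T \<longrightarrow> nonunital_cring (Ring_at M S)) \<and>
     (\<forall>S S'. S \<preceq>\<^sub>d T \<and> S' \<preceq>\<^sub>d S \<longrightarrow> Trans M S S' \<in> nu_ring_hom (Ring_at M S) (Ring_at M S')) \<and>
     (\<forall>S. S \<preceq>\<^sub>d T \<longrightarrow> (\<forall>a\<in>carrier (Ring_at M S). Trans M S S a = a)) \<and>
     (\<forall>S S' S''. S \<preceq>\<^sub>d T \<and> S' \<preceq>\<^sub>d S \<and> S'' \<preceq>\<^sub>d S' \<longrightarrow>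
        (\<forall>a\<in>carrier (Ring_at M S). Trans M S' S'' (Trans M S S' a) = Trans M S S'' a))"

definition continuous_system :: "nat set \<Rightarrow> 'v rfv_system \<Rightarrow> bool" where
  "continuous_system T M \<longleftrightarrow>
     (\<forall>S. S \<preceq>\<^sub>d T \<longrightarrow>
        (\<forall>x. (\<forall>S0. S0 \<preceq>\<^sub>d S \<and> finite S0 \<longrightarrow> x S0 \<in> carrier (Ring_at M S0)) \<and>
             (\<forall>S0 S1. S0 \<preceq>\<^sub>d S \<and> finite S0 \<and> S1 \<preceq>\<^sub>d S0 \<longrightarrow> Trans M S0 S1 (x S0) = x S1) \<longrightarrow>
             (\<exists>!a. a \<in> carrier (Ring_at M S) \<and>
                (\<forall>S0. S0 \<preceq>\<^sub>d S \<and> finite S0 \<longrightarrow> Trans M S S0 a = x S0))))"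

definition RFV_object :: "nat set \<Rightarrow> 'v rfv_system \<Rightarrow> bool" where
  "RFV_object T M \<longleftrightarrow>
     projective_system T M \<and> continuous_system T M \<and>
     (\<forall>p S. prime p \<and> p \<in> S \<and> S \<preceq>\<^sub>d T \<longrightarrow>
        Frob M p S \<in> nu_ring_hom (Ring_at M S) (Ring_at M (S /\<^sub>d p)) \<and>
        Ver M p S \<in> add_hom (Ring_at M (S /\<^sub>d p)) (Ring_at M S)) \<and>
     (\<forall>p S. prime p \<and> p \<in> S \<and> S \<preceq>\<^sub>d T \<longrightarrow>
        (\<forall>a\<in>carrier (Ring_at M S). \<exists>b\<in>carrier (Ring_at M (S /\<^sub>d p)).
           Frob M p S a = nu_pow (Ring_at M (S /\<^sub>d p)) (Trans M S (S /\<^sub>d p) a) p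
             \<oplus>\<^bsub>Ring_at M (S /\<^sub>d p)\<^esub> [p] \<cdot>\<^bsub>Ring_at M (S /\<^sub>d p)\<^esub> b)) \<and>
     (\<forall>p S1 S2. prime p \<and> p \<in> S1 \<and> S1 \<preceq>\<^sub>d S2 \<and> S2 \<preceq>\<^sub>d T \<longrightarrow>
        (\<forall>a\<in>carrier (Ring_at M S2).
           Trans M (S2 /\<^sub>d p) (S1 /\<^sub>d p) (Frob M p S2 a) = Frob M p S1 (Trans M S2 S1 a))) \<and>
     (\<forall>p l S. prime p \<and> prime l \<and> p * l \<in> S \<and> S \<preceq>\<^sub>d T \<longrightarrow>
        (\<forall>a\<in>carrier (Ring_at M S).
           Frob M l (S /\<^sub>d p) (Frob M p S a) = Frob M p (S /\<^sub>d l) (Frob M l S a))) \<and>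
     (\<forall>p S1 S2. prime p \<and> p \<in> S1 \<and> S1 \<preceq>\<^sub>d S2 \<and> S2 \<preceq>\<^sub>d T \<longrightarrow>
        (\<forall>a\<in>carrier (Ring_at M (S2 /\<^sub>d p)).
           Trans M S2 S1 (Ver M p S2 a) = Ver M p S1 (Trans M (S2 /\<^sub>d p) (S1 /\<^sub>d p) a))) \<and>
     (\<forall>p l S. prime p \<and> prime l \<and> p * l \<in> S \<and> S \<preceq>\<^sub>d T \<longrightarrow>
        (\<forall>a\<in>carrier (Ring_at M (S /\<^sub>d (p * l))).
           Ver M p S (Ver M l (S /\<^sub>d p) a) = Ver M l S (Ver M p (S /\<^sub>d l) a))) \<and>
     (\<forall>p S. prime p \<and> p \<in> S \<and> S \<preceq>\<^sub>d T \<longrightarrow>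
        (\<forall>a\<in>carrier (Ring_at M (S /\<^sub>d p)).
           Frob M p S (Ver M p S a) = [p] \<cdot>\<^bsub>Ring_at M (S /\<^sub>d p)\<^esub> a)) \<and>
     (\<forall>p l S. prime p \<and> prime l \<and> l \<noteq> p \<and> p * l \<in> S \<and> S \<preceq>\<^sub>d T \<longrightarrow>
        (\<forall>a\<in>carrier (Ring_at M (S /\<^sub>d p)).
           Frob M l S (Ver M p S a) = Ver M p (S /\<^sub>d l) (Frob M l (S /\<^sub>d p) a))) \<and>
     (\<forall>p S. prime p \<and> p \<in> S \<and> S \<preceq>\<^sub>d T \<longrightarrow>
        inj_on (Ver M p S) (carrier (Ring_at M (S /\<^sub>d p))) \<and>
        Ver M p S ` carrier (Ring_at M (S /\<^sub>d p)) =
          {a \<in> carrier (Ring_at M S).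
             Trans M S (set_prime_to S p) a = \<zero>\<^bsub>Ring_at M (set_prime_to S p)\<^esub>} \<and>
        Trans M S (set_prime_to S p) ` carrier (Ring_at M S) =
          carrier (Ring_at M (set_prime_to S p)))"


section \<open>Affine ring schemes as representable functors\<close>

text \<open>
  An \<open>R\<close>-algebra is a \<^typ>\<open>('r, 'u) module\<close> satisfying \<^const>\<open>algebra\<close>; the type \<open>'u\<close> plays the
  role of a universe, adequate if it is infinite and not smaller than \<open>R\<close>: it then contains copies
  of the coordinate algebras of products of schemes whose own coordinate algebra is in \<open>'u\<close>, and
  Yoneda's lemma applies. Homomorphisms are extensional, so that they can be compared by equality.
\<close>

definition alg_hom :: "'r ring \<Rightarrow> ('r, 'u) module \<Rightarrow> ('r, 'u) module \<Rightarrow> ('u \<Rightarrow> 'u) set" where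
  "alg_hom R C D = {h \<in> ring_hom C D \<inter> extensional (carrier C).
     \<forall>r\<in>carrier R. \<forall>x\<in>carrier C. h (r \<odot>\<^bsub>C\<^esub> x) = r \<odot>\<^bsub>D\<^esub> h x}"

text \<open>
  A scheme over \<open>R\<close> is given by its functor of points on \<open>R\<close>-algebras. \<open>Points M C\<close> is the
  system of the rings of \<open>C\<close>-valued points with the maps induced on them, and \<open>Push M S C D h\<close> is
  the map from the \<open>C\<close>-valued to the \<open>D\<close>-valued points of the \<open>S\<close>-th scheme induced by
  a homomorphism \<open>h\<close> from \<open>C\<close> to \<open>D\<close>.
\<close>

record ('r, 'u, 'v) scheme_system =
  Points :: "('r, 'u) module \<Rightarrow> 'v rfv_system"
  Push :: "nat set \<Rightarrow> ('r, 'u) module \<Rightarrow> ('r, 'u) module \<Rightarrow> ('u \<Rightarrow> 'u) \<Rightarrow> 'v \<Rightarrow> 'v"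

abbreviation Pts :: "('r, 'u, 'v) scheme_system \<Rightarrow> nat set \<Rightarrow> ('r, 'u) module \<Rightarrow> 'v ring" where
  "Pts M S C \<equiv> Ring_at (Points M C) S"

definition ring_functor :: "'r ring \<Rightarrow> ('r, 'u, 'v) scheme_system \<Rightarrow> nat set \<Rightarrow> bool" where
  "ring_functor R M S \<longleftrightarrow>
     (\<forall>C. algebra R C \<longrightarrow> nonunital_cring (Pts M S C)) \<and>
     (\<forall>C D. algebra R C \<and> algebra R D \<longrightarrow>
        (\<forall>h\<in>alg_hom R C D. Push M S C D h \<in> nu_ring_hom (Pts M S C) (Pts M S D))) \<and>
     (\<forall>C. algebra R C \<longrightarrow>
        (\<forall>x\<in>carrier (Pts M S C). Push M S C C (\<lambda>c\<in>carrier C. c) x = x)) \<and>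
     (\<forall>C D E. algebra R C \<and> algebra R D \<and> algebra R E \<longrightarrow>
        (\<forall>h\<in>alg_hom R C D. \<forall>k\<in>alg_hom R D E. \<forall>x\<in>carrier (Pts M S C).
           Push M S C E (compose (carrier C) k h) x = Push M S D E k (Push M S C D h x)))"

text \<open>
  Affine means representable: there is an algebra \<open>B\<close> with a universal point \<open>u\<close>, so that the
  scheme is the spectrum of \<open>B\<close>.
\<close>

definition affine :: "'r ring \<Rightarrow> ('r, 'u, 'v) scheme_system \<Rightarrow> nat set \<Rightarrow> bool" where
  "affine R M S \<longleftrightarrow>
     (\<exists>B u. algebra R B \<and> u \<in> carrier (Pts M S B) \<and>
        (\<forall>C. algebra R C \<longrightarrow>
           (\<forall>x\<in>carrier (Pts M S C). \<exists>!h. h \<in> alg_hom R B C \<and> Push M S B C h u = x)))"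

text \<open>A morphism of schemes is a transformation natural in the algebra.\<close>

definition natural_in_algebra ::
  "'r ring \<Rightarrow> ('r, 'u, 'v) scheme_system \<Rightarrow> nat set \<Rightarrow> ('r, 'u, 'w) scheme_system \<Rightarrow> nat set
     \<Rightarrow> (('r, 'u) module \<Rightarrow> 'v \<Rightarrow> 'w) \<Rightarrow> bool" where
  "natural_in_algebra R M S M' S' f \<longleftrightarrow>
     (\<forall>C. algebra R C \<longrightarrow> f C \<in> carrier (Pts M S C) \<rightarrow> carrier (Pts M' S' C)) \<and>
     (\<forall>C D. algebra R C \<and> algebra R D \<longrightarrow>
        (\<forall>h\<in>alg_hom R C D. \<forall>x\<in>carrier (Pts M S C).
           f D (Push M S C D h x) = Push M' S' C D h (f C x)))"

definition RFV_over_object ::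
  "nat set \<Rightarrow> 'r ring \<Rightarrow> ('r, 'u, 'v) scheme_system \<Rightarrow> bool" where
  "RFV_over_object T R M \<longleftrightarrow>
     cring R \<and>
     (\<forall>S. S \<preceq>\<^sub>d T \<longrightarrow> ring_functor R M S \<and> affine R M S) \<and>
     (\<forall>S S'. S \<preceq>\<^sub>d T \<and> S' \<preceq>\<^sub>d S \<longrightarrow>
        natural_in_algebra R M S M S' (\<lambda>C. Trans (Points M C) S S')) \<and>
     (\<forall>p S. prime p \<and> p \<in> S \<and> S \<preceq>\<^sub>d T \<longrightarrow>
        natural_in_algebra R M S M (S /\<^sub>d p) (\<lambda>C. Frob (Points M C) p S) \<and>
        natural_in_algebra R M (S /\<^sub>d p) M S (\<lambda>C. Ver (Points M C) p S)) \<and>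
     (\<forall>C. algebra R C \<longrightarrow> RFV_object T (Points M C))"

text \<open>
  The values outside the relevant index set and outside the carriers are fixed, so that two
  morphisms are the same if and only if they are equal as functions.
\<close>

definition RFV_over_morphism ::
  "nat set \<Rightarrow> 'r ring \<Rightarrow> ('r, 'u, 'v) scheme_system \<Rightarrow> ('r, 'u, 'w) scheme_system
     \<Rightarrow> (nat set \<Rightarrow> ('r, 'u) module \<Rightarrow> 'v \<Rightarrow> 'w) \<Rightarrow> bool" where
  "RFV_over_morphism T R M M' \<phi> \<longleftrightarrow>
     (\<forall>S C. \<not> (S \<preceq>\<^sub>d T \<and> algebra R C) \<longrightarrow> \<phi> S C = undefined) \<and>
     (\<forall>S C. S \<preceq>\<^sub>d T \<and> algebra R C \<longrightarrow>
        \<phi> S C \<in> nu_ring_hom (Pts M S C) (Pts M' S C) \<inter> extensional (carrier (Pts M S C))) \<and>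
     (\<forall>S. S \<preceq>\<^sub>d T \<longrightarrow> natural_in_algebra R M S M' S (\<phi> S)) \<and>
     (\<forall>S S' C. S \<preceq>\<^sub>d T \<and> S' \<preceq>\<^sub>d S \<and> algebra R C \<longrightarrow>
        (\<forall>x\<in>carrier (Pts M S C).
           \<phi> S' C (Trans (Points M C) S S' x) = Trans (Points M' C) S S' (\<phi> S C x))) \<and>
     (\<forall>p S C. prime p \<and> p \<in> S \<and> S \<preceq>\<^sub>d T \<and> algebra R C \<longrightarrow>
        (\<forall>x\<in>carrier (Pts M S C).
           \<phi> (S /\<^sub>d p) C (Frob (Points M C) p S x) = Frob (Points M' C) p S (\<phi> S C x)) \<and>
        (\<forall>x\<in>carrier (Pts M (S /\<^sub>d p) C).
           \<phi> S C (Ver (Points M C) p S x) = Ver (Points M' C) p S (\<phi> (S /\<^sub>d p) C x)))"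

text \<open>
  The functor of points of the affine line is the forgetful functor. Hence a coordinate on the
  scheme at \<open>{1}\<close>, i.e. a function \<open>z\<close> making its coordinate ring the polynomial ring in \<open>z\<close>,
  is a natural bijection onto the carriers.
\<close>

definition coordinate ::
  "'r ring \<Rightarrow> ('r, 'u, 'v) scheme_system \<Rightarrow> (('r, 'u) module \<Rightarrow> 'v \<Rightarrow> 'u) \<Rightarrow> bool" where
  "coordinate R M z \<longleftrightarrow>
     (\<forall>C. algebra R C \<longrightarrow> bij_betw (z C) (carrier (Pts M {1} C)) (carrier C)) \<and>
     (\<forall>C D. algebra R C \<and> algebra R D \<longrightarrow>
        (\<forall>h\<in>alg_hom R C D. \<forall>x\<in>carrier (Pts M {1} C). z D (Push M {1} C D h x) = h (z C x)))"

definition coordinate_in_zero ::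
  "'r ring \<Rightarrow> ('r, 'u, 'v) scheme_system \<Rightarrow> (('r, 'u) module \<Rightarrow> 'v \<Rightarrow> 'u) \<Rightarrow> bool" where
  "coordinate_in_zero R M z \<longleftrightarrow>
     coordinate R M z \<and> (\<forall>C. algebra R C \<longrightarrow> z C \<zero>\<^bsub>Pts M {1} C\<^esub> = \<zero>\<^bsub>C\<^esub>)"

definition AFV_object :: "nat set \<Rightarrow> 'r ring \<Rightarrow> ('r, 'u, 'v) scheme_system \<Rightarrow> bool" where
  "AFV_object T R M \<longleftrightarrow> RFV_over_object T R M \<and> (\<exists>z. coordinate R M z)"

type_synonym ('r, 'u, 'v) coord_system =
  "('r, 'u, 'v) scheme_system \<times> (('r, 'u) module \<Rightarrow> 'v \<Rightarrow> 'u)"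

definition AFVp_object :: "nat set \<Rightarrow> 'r ring \<Rightarrow> ('r, 'u, 'v) coord_system \<Rightarrow> bool" where
  "AFVp_object T R X \<longleftrightarrow> AFV_object T R (fst X) \<and> coordinate_in_zero R (fst X) (snd X)"

definition AFVp_morphism ::
  "nat set \<Rightarrow> 'r ring \<Rightarrow> ('r, 'u, 'v) coord_system \<Rightarrow> ('r, 'u, 'w) coord_system
     \<Rightarrow> (nat set \<Rightarrow> ('r, 'u) module \<Rightarrow> 'v \<Rightarrow> 'w) \<Rightarrow> bool" where
  "AFVp_morphism T R X Y \<phi> \<longleftrightarrow>
     AFVp_object T R X \<and> AFVp_object T R Y \<and>
     RFV_over_morphism T R (fst X) (fst Y) \<phi> \<and>
     (\<forall>C. algebra R C \<longrightarrow>
        (\<forall>x\<in>carrier (Pts (fst X) {1} C). snd X C x = snd Y C (\<phi> {1} C x)))"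

definition AFVp_iso ::
  "nat set \<Rightarrow> 'r ring \<Rightarrow> ('r, 'u, 'v) coord_system \<Rightarrow> ('r, 'u, 'w) coord_system
     \<Rightarrow> (nat set \<Rightarrow> ('r, 'u) module \<Rightarrow> 'v \<Rightarrow> 'w) \<Rightarrow> bool" where
  "AFVp_iso T R X Y \<phi> \<longleftrightarrow>
     AFVp_morphism T R X Y \<phi> \<and>
     (\<exists>\<psi>. AFVp_morphism T R Y X \<psi> \<and>
        (\<forall>S C. S \<preceq>\<^sub>d T \<and> algebra R C \<longrightarrow>
           (\<forall>x\<in>carrier (Pts (fst X) S C). \<psi> S C (\<phi> S C x) = x) \<and>
           (\<forall>y\<in>carrier (Pts (fst Y) S C). \<phi> S C (\<psi> S C y) = y)))"

text \<open>
  Base change along \<open>f\<close> from \<open>R\<close> to \<open>R'\<close>: the \<open>C\<close>-valued points of the base change are the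
  points of the original scheme with values in \<open>C\<close> regarded as an \<open>R\<close>-algebra through \<open>f\<close>.
\<close>

definition restrict_scalars :: "('r \<Rightarrow> 's) \<Rightarrow> ('s, 'u) module \<Rightarrow> ('r, 'u) module" where
  "restrict_scalars f C = \<lparr>carrier = carrier C, mult = mult C, one = \<one>\<^bsub>C\<^esub>,
     zero = \<zero>\<^bsub>C\<^esub>, add = add C, smult = (\<lambda>r x. f r \<odot>\<^bsub>C\<^esub> x)\<rparr>"

definition base_change ::
  "('r \<Rightarrow> 's) \<Rightarrow> ('r, 'u, 'v) coord_system \<Rightarrow> ('s, 'u, 'v) coord_system" where
  "base_change f X =
     (\<lparr>Points = (\<lambda>C. Points (fst X) (restrict_scalars f C)),
       Push = (\<lambda>S C D. Push (fst X) S (restrict_scalars f C) (restrict_scalars f D))\<rparr>,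
      \<lambda>C. snd X (restrict_scalars f C))"


section \<open>Witt vectors of non-unital rings\<close>

text \<open>The map induced on \<open>S\<close>-indexed vectors by a map of rings, componentwise.\<close>

definition vec_map :: "nat set \<Rightarrow> ('a \<Rightarrow> 'b) \<Rightarrow> (nat \<Rightarrow> 'a) \<Rightarrow> nat \<Rightarrow> 'b" where
  "vec_map S h a = (\<lambda>n\<in>S. h (a n))"

definition witt_ghost :: "nat set \<Rightarrow> 'a ring \<Rightarrow> (nat \<Rightarrow> 'a) \<Rightarrow> nat \<Rightarrow> 'a" where
  "witt_ghost S A a =
     (\<lambda>n\<in>S. \<Oplus>\<^bsub>A\<^esub>d\<in>{d. d dvd n}. [d] \<cdot>\<^bsub>A\<^esub> nu_pow A (a d) (n div d))"

definition is_witt_ring :: "nat set \<Rightarrow> ('a ring \<Rightarrow> (nat \<Rightarrow> 'a) ring) \<Rightarrow> bool" where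
  "is_witt_ring S W \<longleftrightarrow>
     (\<forall>A. nonunital_cring A \<longrightarrow>
        nonunital_cring (W A) \<and> carrier (W A) = S \<rightarrow>\<^sub>E carrier A \<and>
        witt_ghost S A \<in> nu_ring_hom (W A) (power_ring S A)) \<and>
     (\<forall>A B h. nonunital_cring A \<and> nonunital_cring B \<and> h \<in> nu_ring_hom A B \<longrightarrow>
        vec_map S h \<in> nu_ring_hom (W A) (W B))"

text \<open>
  The functorial structures selected by \<open>SOME\<close> here and below are unique for infinite types up to
  their meaningless values: those at arguments outside the carriers or at records that are not
  rings, and the field \<^const>\<open>one\<close>. Over a finite type there need not be enough torsion-free
  rings for uniqueness.
\<close>

definition witt_ring :: "nat set \<Rightarrow> 'a ring \<Rightarrow> (nat \<Rightarrow> 'a) ring" where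
  "witt_ring S = (SOME W. is_witt_ring S W)"

definition is_witt_frob :: "nat \<Rightarrow> nat set \<Rightarrow> ('a ring \<Rightarrow> (nat \<Rightarrow> 'a) \<Rightarrow> nat \<Rightarrow> 'a) \<Rightarrow> bool" where
  "is_witt_frob n S F \<longleftrightarrow>
     (\<forall>A. nonunital_cring A \<longrightarrow>
        F A \<in> nu_ring_hom (witt_ring S A) (witt_ring (S /\<^sub>d n) A) \<and>
        (\<forall>a\<in>carrier (witt_ring S A).
           witt_ghost (S /\<^sub>d n) A (F A a) = (\<lambda>\<nu>\<in>S /\<^sub>d n. witt_ghost S A a (n * \<nu>)))) \<and>
     (\<forall>A B h. nonunital_cring A \<and> nonunital_cring B \<and> h \<in> nu_ring_hom A B \<longrightarrow>
        (\<forall>a\<in>carrier (witt_ring S A). F B (vec_map S h a) = vec_map (S /\<^sub>d n) h (F A a)))"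

definition witt_frob :: "nat \<Rightarrow> nat set \<Rightarrow> 'a ring \<Rightarrow> (nat \<Rightarrow> 'a) \<Rightarrow> nat \<Rightarrow> 'a" where
  "witt_frob n S = (SOME F. is_witt_frob n S F)"

definition witt_ver :: "nat \<Rightarrow> nat set \<Rightarrow> 'a ring \<Rightarrow> (nat \<Rightarrow> 'a) \<Rightarrow> nat \<Rightarrow> 'a" where
  "witt_ver n S A a = (\<lambda>\<mu>\<in>S. if n dvd \<mu> then a (\<mu> div n) else \<zero>\<^bsub>A\<^esub>)"


section \<open>The objects over \<open>\<int>[q]\<close>\<close>

text \<open>
  \<open>\<int>[q]\<close> is \<^typ>\<open>int poly\<close>, with \<open>q = [:0, 1:]\<close>.
\<close>

definition Zq :: "int poly ring" where
  "Zq = \<lparr>carrier = UNIV, mult = (*), one = 1, zero = 0, add = (+)\<rparr>"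

definition twist :: "int poly \<Rightarrow> (int poly, 'u) module \<Rightarrow> 'u ring" where
  "twist r C = \<lparr>carrier = carrier C, mult = (\<lambda>x y. r \<odot>\<^bsub>C\<^esub> (x \<otimes>\<^bsub>C\<^esub> y)), one = \<one>\<^bsub>C\<^esub>,
     zero = \<zero>\<^bsub>C\<^esub>, add = add C\<rparr>"

definition W_tw :: "int poly \<Rightarrow> (int poly, 'u, nat \<Rightarrow> 'u) coord_system" where
  "W_tw r =
     (\<lparr>Points = (\<lambda>C. \<lparr>
         Ring_at = (\<lambda>S. witt_ring S (twist r C)),
         Trans = (\<lambda>S S' a. restrict a S'),
         Frob = (\<lambda>p S. witt_frob p S (twist r C)),
         Ver = (\<lambda>p S. witt_ver p S (twist r C))\<rparr>),
       Push = (\<lambda>S C D. vec_map S)\<rparr>,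
      \<lambda>C a. a 1)"

text \<open>The polynomial \<open>q\<^sup>-\<^sup>1 (1 - (1 - q)\<^sup>m)\<close>.\<close>

definition q_coeff :: "nat \<Rightarrow> int poly" where
  "q_coeff m = (\<Sum>i<m. (1 - [:0, 1:]) ^ i)"

definition wbar_ghost ::
  "nat set \<Rightarrow> (int poly, 'u) module \<Rightarrow> (nat \<Rightarrow> 'u) \<Rightarrow> nat \<Rightarrow> 'u" where
  "wbar_ghost S C a =
     (\<lambda>n\<in>S. \<Oplus>\<^bsub>C\<^esub>d\<in>{d. d dvd n}. (of_nat d * q_coeff (n div d)) \<odot>\<^bsub>C\<^esub> (a d [^]\<^bsub>C\<^esub> (n div d)))"

definition is_wbar_ring ::
  "nat set \<Rightarrow> ((int poly, 'u) module \<Rightarrow> (nat \<Rightarrow> 'u) ring) \<Rightarrow> bool" where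
  "is_wbar_ring S W \<longleftrightarrow>
     (\<forall>C. algebra Zq C \<longrightarrow>
        nonunital_cring (W C) \<and> carrier (W C) = S \<rightarrow>\<^sub>E carrier C \<and>
        wbar_ghost S C \<in> nu_ring_hom (W C) (power_ring S (twist [:0, 1:] C))) \<and>
     (\<forall>C D. algebra Zq C \<and> algebra Zq D \<longrightarrow>
        (\<forall>h\<in>alg_hom Zq C D. vec_map S h \<in> nu_ring_hom (W C) (W D)))"

definition wbar_ring :: "nat set \<Rightarrow> (int poly, 'u) module \<Rightarrow> (nat \<Rightarrow> 'u) ring" where
  "wbar_ring S = (SOME W. is_wbar_ring S W)"

definition is_wbar_frob ::
  "nat \<Rightarrow> nat set \<Rightarrow> ((int poly, 'u) module \<Rightarrow> (nat \<Rightarrow> 'u) \<Rightarrow> nat \<Rightarrow> 'u) \<Rightarrow> bool" where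
  "is_wbar_frob n S F \<longleftrightarrow>
     (\<forall>C. algebra Zq C \<longrightarrow>
        F C \<in> nu_ring_hom (wbar_ring S C) (wbar_ring (S /\<^sub>d n) C) \<and>
        (\<forall>a\<in>carrier (wbar_ring S C).
           wbar_ghost (S /\<^sub>d n) C (F C a) = (\<lambda>\<nu>\<in>S /\<^sub>d n. wbar_ghost S C a (n * \<nu>)))) \<and>
     (\<forall>C D. algebra Zq C \<and> algebra Zq D \<longrightarrow>
        (\<forall>h\<in>alg_hom Zq C D. \<forall>a\<in>carrier (wbar_ring S C).
           F D (vec_map S h a) = vec_map (S /\<^sub>d n) h (F C a)))"

definition wbar_frob ::
  "nat \<Rightarrow> nat set \<Rightarrow> (int poly, 'u) module \<Rightarrow> (nat \<Rightarrow> 'u) \<Rightarrow> nat \<Rightarrow> 'u" where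
  "wbar_frob n S = (SOME F. is_wbar_frob n S F)"

definition is_wbar_ver ::
  "nat \<Rightarrow> nat set \<Rightarrow> ((int poly, 'u) module \<Rightarrow> (nat \<Rightarrow> 'u) \<Rightarrow> nat \<Rightarrow> 'u) \<Rightarrow> bool" where
  "is_wbar_ver n S V \<longleftrightarrow>
     (\<forall>C. algebra Zq C \<longrightarrow>
        V C \<in> add_hom (wbar_ring (S /\<^sub>d n) C) (wbar_ring S C) \<and>
        (\<forall>a\<in>carrier (wbar_ring (S /\<^sub>d n) C).
           wbar_ghost S C (V C a) =
             (\<lambda>\<nu>\<in>S. if n dvd \<nu> then [n] \<cdot>\<^bsub>C\<^esub> wbar_ghost (S /\<^sub>d n) C a (\<nu> div n) else \<zero>\<^bsub>C\<^esub>))) \<and>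
     (\<forall>C D. algebra Zq C \<and> algebra Zq D \<longrightarrow>
        (\<forall>h\<in>alg_hom Zq C D. \<forall>a\<in>carrier (wbar_ring (S /\<^sub>d n) C).
           V D (vec_map (S /\<^sub>d n) h a) = vec_map S h (V C a)))"

definition wbar_ver ::
  "nat \<Rightarrow> nat set \<Rightarrow> (int poly, 'u) module \<Rightarrow> (nat \<Rightarrow> 'u) \<Rightarrow> nat \<Rightarrow> 'u" where
  "wbar_ver n S = (SOME V. is_wbar_ver n S V)"

definition Wbar_one_minus_q :: "(int poly, 'u, nat \<Rightarrow> 'u) coord_system" where
  "Wbar_one_minus_q =
     (\<lparr>Points = (\<lambda>C. \<lparr>
         Ring_at = (\<lambda>S. wbar_ring S C),
         Trans = (\<lambda>S S' a. restrict a S'),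
         Frob = (\<lambda>p S. wbar_frob p S C),
         Ver = (\<lambda>p S. wbar_ver p S C)\<rparr>),
       Push = (\<lambda>S C D. vec_map S)\<rparr>,
      \<lambda>C a. a 1)"

text \<open>The base change is along the endomorphism \<open>\<beta>\<close> of \<open>\<int>[q]\<close> with \<open>\<beta>(q) = 1 - g\<close>.\<close>

definition Wbar :: "int poly \<Rightarrow> (int poly, 'u, nat \<Rightarrow> 'u) coord_system" where
  "Wbar g = base_change (\<lambda>f. f \<circ>\<^sub>p (1 - g)) Wbar_one_minus_q"

end

theory Submission
  imports Defs "HOL-Library.Poly_Mapping" "HOL-Library.Countable_Set"
begin

text \<open>
  The proof compares ghost components. Put \<open>q = 1 - g\<close>. Multiplied by \<open>q\<close>, the ghost component
  \<open>\<Sum> d q\<^sup>-\<^sup>1 (1 - (1 - q)\<^sup>m) a\<^sub>d\<^sup>m\<close> (the sum being over \<open>d\<close> dividing \<open>n\<close>, with \<open>m = n div d\<close>) becomes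
  the difference of the usual ghost components of the vectors \<open>(a\<^sub>d)\<close> and \<open>((1 - q) a\<^sub>d)\<close>. The
  difference of these two Witt vectors vanishes modulo \<open>q\<close>, so its components are \<open>q \<phi>\<^sub>n\<close> with
  polynomials \<open>\<phi>\<^sub>n\<close>, and in the ring with multiplication \<open>q x y\<close> the vector \<open>(\<phi>\<^sub>n)\<close> has precisely
  the deformed ghost components (\<open>phi_identity\<close>, \<open>Phi_ghost\<close>). Since \<open>\<phi>\<^sub>n\<close> is \<open>X\<^sub>n\<close> plus terms at proper
  divisors (\<open>phi_triangular\<close>), it defines a natural bijection (\<open>Phi_bij\<close>), along which the deformed
  structure is the Witt vector structure of the twisted ring.

  Integrality comes from Dwork's lemma \<open>ghost_unghost\<close> on polynomial rings, with the Frobenius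
  lifts \<open>X\<^sub>i \<mapsto> X\<^sub>i\<^sup>p\<close>. It yields the polynomials for the sum, the product, the Frobenius maps and the
  remainder in \<open>F\<^sub>p(a) = a\<^sup>p + p b\<close>. Ring axioms and the compatibilities of the structure maps are
  identities between natural operations; they are checked on ghost components over a generic
  torsion-free ring, a copy of a polynomial ring inside the infinite type, and then specialized
  (\<open>witt_identity\<close>, \<open>alg_identity\<close>). The same principle shows that the structures that are merely
  selected by a choice operator agree with those given by the polynomials. For rings without
  unit the generic ring consists of polynomials without constant term, which are evaluated after
  adjoining a unit.

  For uniqueness, the \<open>n\<close>-th ghost component of a vector is the first component of its image under
  the Frobenius maps at the prime factors of \<open>n\<close>. A morphism that respects the coordinates
  therefore respects ghost components (\<open>ghost_transport\<close>), and is determined over the generic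
  algebra and hence everywhere. The multiplications on \<open>{1}\<close> are \<open>(1 - g) x y\<close> and \<open>r x y\<close>; as the
  coordinates are preserved, \<open>r = 1 - g\<close> (\<open>morphism_unique\<close>).
\<close>

section \<open>Integer polynomials in countably many variables\<close>

type_synonym mpoly = "(nat \<Rightarrow>\<^sub>0 nat) \<Rightarrow>\<^sub>0 int"

definition Var :: "nat \<Rightarrow> mpoly" where
  "Var i = Poly_Mapping.single (Poly_Mapping.single i 1) 1"

definition monom_ev :: "('a, 'm) ring_scheme \<Rightarrow> (nat \<Rightarrow> 'a) \<Rightarrow> (nat \<Rightarrow>\<^sub>0 nat) \<Rightarrow> 'a" where
  "monom_ev R v m = finprod R (\<lambda>i. v i [^]\<^bsub>R\<^esub> Poly_Mapping.lookup m i) (Poly_Mapping.keys m)"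

definition ev :: "('a, 'm) ring_scheme \<Rightarrow> (nat \<Rightarrow> 'a) \<Rightarrow> mpoly \<Rightarrow> 'a" where
  "ev R v f = finsum R (\<lambda>m. [Poly_Mapping.lookup f m] \<cdot>\<^bsub>R\<^esub> monom_ev R v m) (Poly_Mapping.keys f)"

lemma single_mpoly_induct:
  fixes P :: "mpoly \<Rightarrow> bool"
  assumes 0: "P 0" and add: "\<And>f g. P f \<Longrightarrow> P g \<Longrightarrow> P (f + g)"
    and single: "\<And>m c. P (Poly_Mapping.single m c)"
  shows "P f"
proof (induction f rule: update_induct)
  case const then show ?case by (rule 0)
next
  case (update f a b)
  have "Poly_Mapping.update a b f = f + Poly_Mapping.single a b"
    using update(1) by (intro poly_mapping_eqI)
      (auto simp: lookup_update lookup_add lookup_single when_def in_keys_iff)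
  then show ?case using add[OF update(3) single] by simp
qed

text \<open>The polynomial ring is generated by the variables, so that properties of homomorphisms can be checked on them.\<close>

theorem mpoly_induct [case_names one var add neg mult]:
  fixes P :: "mpoly \<Rightarrow> bool"
  assumes one: "P 1" and var: "\<And>i. P (Var i)"
    and add: "\<And>f g. P f \<Longrightarrow> P g \<Longrightarrow> P (f + g)"
    and neg: "\<And>f. P f \<Longrightarrow> P (- f)"
    and mult: "\<And>f g. P f \<Longrightarrow> P g \<Longrightarrow> P (f * g)"
  shows "P f"
proof (rule single_mpoly_induct)
  show zero: "P 0" using add[OF one neg[OF one]] by simp
  show "P (f + g)" if "P f" "P g" for f g using add that .
  have nat: "P (of_nat n)" for n by (induction n) (auto intro: zero add one)
  have int: "P (of_int c)" for c
    by (cases c rule: int_cases2) (auto intro: nat neg)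
  have pow: "P (Var i ^ k)" for i k by (induction k) (auto intro: one var mult)
  have vp: "Var i ^ k = Poly_Mapping.single (Poly_Mapping.single i k) 1" for i k
    by (induction k) (auto simp: Var_def mult_single single_add[symmetric] simp flip: single_one)
  have mon: "P (Poly_Mapping.single m 1)" for m
  proof (induction m rule: update_induct)
    case const then show ?case using one by simp
  next
    case (update f a b)
    have "Poly_Mapping.update a b f = f + Poly_Mapping.single a b"
      using update(1) by (intro poly_mapping_eqI)
        (auto simp: lookup_update lookup_add lookup_single when_def in_keys_iff)
    then have "Poly_Mapping.single (Poly_Mapping.update a b f) 1
        = Poly_Mapping.single f 1 * (Var a ^ b)"
      by (simp add: vp mult_single)
    then show ?case using mult[OF update(3) pow] by simp
  qed
  show "P (Poly_Mapping.single m c)" for m c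
  proof -
    have "Poly_Mapping.single m c = of_int c * Poly_Mapping.single m 1"
      by (simp add: mult_single flip: single_of_int)
    then show ?thesis using mult[OF int mon] by simp
  qed
qed

context cring
begin

lemma monom_ev_closed [simp]: "(\<And>i. v i \<in> carrier R) \<Longrightarrow> monom_ev R v m \<in> carrier R"
  unfolding monom_ev_def by (rule finprod_closed) auto

lemma monom_ev_superset:
  assumes "\<And>i. v i \<in> carrier R" "finite K" "Poly_Mapping.keys m \<subseteq> K"
  shows "monom_ev R v m = finprod R (\<lambda>i. v i [^] Poly_Mapping.lookup m i) K"
  unfolding monom_ev_def using assms
  by (intro finprod_mono_neutral_cong_left) (auto simp: in_keys_iff)

lemma monom_ev_add:
  assumes v: "\<And>i. v i \<in> carrier R"
  shows "monom_ev R v (m + n) = monom_ev R v m \<otimes> monom_ev R v n"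
proof -
  let ?K = "Poly_Mapping.keys m \<union> Poly_Mapping.keys n"
  have "monom_ev R v (m + n) = finprod R (\<lambda>i. v i [^] Poly_Mapping.lookup (m + n) i) ?K"
    by (rule monom_ev_superset) (use v Poly_Mapping.keys_add[of m n] in auto)
  also have "\<dots> = finprod R (\<lambda>i. v i [^] Poly_Mapping.lookup m i \<otimes> v i [^] Poly_Mapping.lookup n i) ?K"
    using v by (intro finprod_cong) (auto simp: lookup_add nat_pow_mult simp_implies_def)
  also have "\<dots> = finprod R (\<lambda>i. v i [^] Poly_Mapping.lookup m i) ?K \<otimes> finprod R (\<lambda>i. v i [^] Poly_Mapping.lookup n i) ?K"
    using v by (intro finprod_multf) auto
  also have "\<dots> = monom_ev R v m \<otimes> monom_ev R v n"
    using v by (simp add: monom_ev_superset[of v ?K])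
  finally show ?thesis .
qed

lemma ev_closed [simp]: "(\<And>i. v i \<in> carrier R) \<Longrightarrow> ev R v f \<in> carrier R"
  unfolding ev_def by (rule finsum_closed) auto

lemma ev_superset:
  assumes "\<And>i. v i \<in> carrier R" "finite K" "Poly_Mapping.keys f \<subseteq> K"
  shows "ev R v f = finsum R (\<lambda>m. [Poly_Mapping.lookup f m] \<cdot> monom_ev R v m) K"
  unfolding ev_def using assms
  by (intro add.finprod_mono_neutral_cong_left) (auto simp: in_keys_iff add_pow_int_ge)

lemma ev_add:
  assumes v: "\<And>i. v i \<in> carrier R"
  shows "ev R v (f + g) = ev R v f \<oplus> ev R v g"
proof -
  let ?K = "Poly_Mapping.keys f \<union> Poly_Mapping.keys g"
  have "ev R v (f + g) = finsum R (\<lambda>m. [Poly_Mapping.lookup (f + g) m] \<cdot> monom_ev R v m) ?K"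
    by (rule ev_superset) (use v Poly_Mapping.keys_add[of f g] in auto)
  also have "\<dots> = finsum R (\<lambda>m. [Poly_Mapping.lookup f m] \<cdot> monom_ev R v m \<oplus> [Poly_Mapping.lookup g m] \<cdot> monom_ev R v m) ?K"
    using v by (intro finsum_cong) (auto simp: lookup_add add.int_pow_mult simp_implies_def)
  also have "\<dots> = finsum R (\<lambda>m. [Poly_Mapping.lookup f m] \<cdot> monom_ev R v m) ?K \<oplus> finsum R (\<lambda>m. [Poly_Mapping.lookup g m] \<cdot> monom_ev R v m) ?K"
    using v by (intro finsum_addf) auto
  also have "\<dots> = ev R v f \<oplus> ev R v g"
    using v by (simp add: ev_superset[of v ?K])
  finally show ?thesis .
qed

lemma ev_zero [simp]: "ev R v 0 = \<zero>"
  by (simp add: ev_def)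

lemma ev_single:
  assumes v: "\<And>i. v i \<in> carrier R"
  shows "ev R v (Poly_Mapping.single m c) = [c] \<cdot> monom_ev R v m"
  using v by (subst ev_superset[of v "{m}"]) auto

lemma ev_one:
  assumes v: "\<And>i. v i \<in> carrier R"
  shows "ev R v 1 = \<one>"
  using ev_single[of v 0 1, OF v] by (simp add: monom_ev_def)

lemma ev_Var:
  assumes v: "\<And>i. v i \<in> carrier R"
  shows "ev R v (Var i) = v i"
  using v by (simp add: Var_def ev_single[OF v] monom_ev_superset[of v "{i}"])

lemma ev_mult:
  assumes v: "\<And>i. v i \<in> carrier R"
  shows "ev R v (f * g) = ev R v f \<otimes> ev R v g"
proof (induction f rule: single_mpoly_induct)
  case 2 then show ?case using v by (simp add: distrib_right ev_add l_distr)
next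
  case (3 m c)
  show ?case
  proof (induction g rule: single_mpoly_induct)
    case 2 then show ?case using v by (simp add: distrib_left ev_add r_distr)
  next
    case (3 n d)
    have "[(c * d)] \<cdot> (monom_ev R v m \<otimes> monom_ev R v n) = [c] \<cdot> monom_ev R v m \<otimes> [d] \<cdot> monom_ev R v n"
      using v by (simp add: add_pow_ldistr_int add_pow_rdistr_int add.int_pow_pow mult.commute)
    then show ?case using v by (simp add: mult_single ev_single monom_ev_add)
  qed (use v in simp)
qed (use v in simp)

lemma ev_neg:
  assumes v: "\<And>i. v i \<in> carrier R"
  shows "ev R v (- f) = \<ominus> ev R v f"
proof -
  have "ev R v (- f) \<oplus> ev R v f = \<zero>"
    using ev_add[of v "- f" f, OF v] by simp
  then show ?thesis using v by (simp add: minus_equality)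
qed

end

text \<open>Ring homomorphisms from the polynomials. Composites of evaluations with other maps are not
  of the form \<^term>\<open>ev R v\<close> as they stand; they are recognized by \<open>is_ev_eq\<close>.\<close>

definition is_ev :: "('a, 'm) ring_scheme \<Rightarrow> (mpoly \<Rightarrow> 'a) \<Rightarrow> bool" where
  "is_ev R h \<longleftrightarrow> (\<forall>f. h f \<in> carrier R) \<and> h 1 = \<one>\<^bsub>R\<^esub> \<and> (\<forall>f g. h (f + g) = h f \<oplus>\<^bsub>R\<^esub> h g)
     \<and> (\<forall>f g. h (f * g) = h f \<otimes>\<^bsub>R\<^esub> h g)"

context cring
begin

lemma is_ev_ev: "(\<And>i. v i \<in> carrier R) \<Longrightarrow> is_ev R (ev R v)"
  by (simp add: is_ev_def ev_add ev_mult ev_one)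

lemma is_ev_neg:
  assumes "is_ev R h" shows "h (- f) = \<ominus> h f" "h 0 = \<zero>" "h (f - g) = h f \<ominus> h g"
proof -
  have c: "h f \<in> carrier R" for f using assms by (simp add: is_ev_def)
  have "h 0 \<oplus> h 0 = h 0" using assms unfolding is_ev_def by (metis add.left_neutral)
  then show 0: "h 0 = \<zero>" using c by (metis add.l_cancel_one')
  have "h (- f) \<oplus> h f = \<zero>" for f using assms 0 unfolding is_ev_def by (metis add.left_inverse)
  then have n: "h (- f) = \<ominus> h f" for f
    by (intro minus_equality[symmetric] c)
  show "h (- f) = \<ominus> h f" by (rule n)
  show "h (f - g) = h f \<ominus> h g"
    using assms n unfolding is_ev_def minus_eq by (metis diff_conv_add_uminus)
qed

lemma is_ev_eq:
  assumes h: "is_ev R h" and k: "is_ev R k" and e: "\<And>i. h (Var i) = k (Var i)"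
  shows "h f = k f"
proof (induction f rule: mpoly_induct)
  case one then show ?case using h k by (simp add: is_ev_def)
next
  case (add f g) then show ?case using h k by (simp add: is_ev_def)
next
  case (neg f) then show ?case using h k by (simp add: is_ev_neg)
next
  case (mult f g) then show ?case using h k by (simp add: is_ev_def)
qed (rule e)

lemma is_ev_pow: "is_ev R h \<Longrightarrow> h (f ^ n) = h f [^] n"
  by (induction n) (auto simp: is_ev_def m_comm)

lemma is_ev_of_nat: "is_ev R h \<Longrightarrow> h (of_nat n) = [n] \<cdot> \<one>"
proof (induction n)
  case 0 then show ?case by (simp add: is_ev_neg)
next
  case (Suc n)
  then show ?case by (simp add: is_ev_def) (metis add.nat_pow_Suc2 one_closed add.nat_pow_Suc add.commute)
qed

lemma is_ev_of_nat_mult: "is_ev R h \<Longrightarrow> h (of_nat n * f) = [n] \<cdot> h f"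
  using is_ev_of_nat[of h n] add_pow_ldistr[of \<one> "h f" n] by (simp add: is_ev_def)

lemma is_ev_sum: "is_ev R h \<Longrightarrow> h (sum f A) = finsum R (\<lambda>a. h (f a)) A"
proof (induction A rule: infinite_finite_induct)
  case (insert x F) then show ?case by (simp add: is_ev_def Pi_def)
qed (auto simp: is_ev_neg)

end

definition MP :: "mpoly ring" where
  "MP = \<lparr>carrier = UNIV, mult = (*), one = 1, zero = 0, add = (+)\<rparr>"

lemma MP_simps [simp]: "carrier MP = UNIV" "mult MP = (*)" "one MP = 1" "zero MP = 0" "add MP = (+)"
  by (simp_all add: MP_def)

lemma cring_MP: "cring MP"
proof (rule cringI)
  show "abelian_group MP"
    by (rule abelian_groupI) (auto simp: algebra_simps intro: exI[of _ "- _"])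
  show "comm_monoid MP" by (rule comm_monoidI) (auto simp: algebra_simps)
qed (auto simp: algebra_simps)

definition sub :: "(nat \<Rightarrow> mpoly) \<Rightarrow> mpoly \<Rightarrow> mpoly" where
  "sub = ev MP"

lemma is_ev_sub: "is_ev MP (sub v)"
  unfolding sub_def by (rule cring.is_ev_ev[OF cring_MP]) simp

lemma sub_Var [simp]: "sub v (Var i) = v i"
  unfolding sub_def by (rule cring.ev_Var[OF cring_MP]) simp

lemma sub_one [simp]: "sub v 1 = 1" and sub_zero [simp]: "sub v 0 = 0"
  and sub_add [simp]: "sub v (f + g) = sub v f + sub v g"
  and sub_mult [simp]: "sub v (f * g) = sub v f * sub v g"
  using is_ev_sub[of v] cring.is_ev_neg[OF cring_MP is_ev_sub, of v] by (auto simp: is_ev_def)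

lemma sub_neg [simp]: "sub v (- f) = - sub v f"
  by (rule minus_unique[symmetric]) (simp flip: sub_add)

lemma sub_diff [simp]: "sub v (f - g) = sub v f - sub v g"
  using sub_add[of v f "- g"] by simp

lemma sub_power [simp]: "sub v (f ^ n) = sub v f ^ n"
  by (induction n) auto

lemma sub_sum: "sub v (sum f A) = (\<Sum>a\<in>A. sub v (f a))"
  by (induction A rule: infinite_finite_induct) auto

lemma sub_of_nat [simp]: "sub v (of_nat n) = of_nat n"
  by (induction n) auto

lemma ev_sub:
  assumes R: "cring R" and v: "\<And>i. v i \<in> carrier R"
  shows "ev R v (sub w f) = ev R (\<lambda>i. ev R v (w i)) f"
proof -
  interpret cring R by (rule R)
  show ?thesis
    by (rule is_ev_eq[of "\<lambda>f. ev R v (sub w f)"])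
      (use v in \<open>auto simp: is_ev_def ev_add ev_mult ev_one ev_Var intro!: is_ev_ev\<close>)
qed

lemma sub_sub: "sub v (sub w f) = sub (\<lambda>i. sub v (w i)) f"
  unfolding sub_def using ev_sub[OF cring_MP] by (simp add: sub_def)

lemma sub_id [simp]: "sub Var f = f"
  by (induction f rule: mpoly_induct) auto

section \<open>Ghost components of polynomials and Dwork's criterion\<close>

definition ghost :: "(nat \<Rightarrow> mpoly) \<Rightarrow> nat \<Rightarrow> mpoly" where
  "ghost a n = (\<Sum>d | d dvd n. of_nat d * a d ^ (n div d))"

definition frob :: "nat \<Rightarrow> mpoly \<Rightarrow> mpoly" where
  "frob p = sub (\<lambda>i. Var i ^ p)"

lemma frob_simps [simp]:
  "frob p (f + g) = frob p f + frob p g" "frob p (f - g) = frob p f - frob p g" "frob p (- f) = - frob p f"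
  "frob p (f * g) = frob p f * frob p g" "frob p (f ^ k) = frob p f ^ k" "frob p 1 = 1" "frob p 0 = 0"
  "frob p (of_nat k) = of_nat k" "frob p (Var i) = Var i ^ p"
  by (simp_all add: frob_def)

lemma frob_sum: "frob p (sum f A) = (\<Sum>a\<in>A. frob p (f a))"
  by (simp add: frob_def sub_sum)

lemma of_nat_dvd_of_nat: "m dvd n \<Longrightarrow> of_nat m dvd (of_nat n :: 'a :: comm_semiring_1)"
  by (auto simp: dvd_def)

lemma multiplicity_prime_mult:
  "prime p \<Longrightarrow> n > 0 \<Longrightarrow> multiplicity p (p * n) = Suc (multiplicity p (n :: nat))"
  using prime_gt_1_nat[of p] by (subst multiplicity_times_same) auto

lemma diff_dvd_power_diff: "x - y dvd x ^ n - (y :: 'a :: comm_ring_1) ^ n"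
  by (simp add: power_diff_sumr2)

lemma prime_dvd_add_power:
  assumes "prime p"
  shows "of_nat p dvd (f + g) ^ p - f ^ p - (g :: 'a :: comm_ring_1) ^ p"
proof -
  have p: "p > 1" using assms prime_gt_1_nat by blast
  have "{..p} = insert 0 (insert p {0<..<p})" using p by auto
  then have "(f + g) ^ p = (\<Sum>k\<in>insert 0 (insert p {0<..<p}). of_nat (p choose k) * f ^ k * g ^ (p - k))"
    by (simp only: binomial_ring)
  then have "(f + g) ^ p - f ^ p - g ^ p = (\<Sum>k\<in>{0<..<p}. of_nat (p choose k) * f ^ k * g ^ (p - k))"
    using p by simp
  moreover have "of_nat p dvd (of_nat (p choose k) * f ^ k * g ^ (p - k) :: 'a)" if "k \<in> {0<..<p}" for k
  proof -
    have "p dvd p choose k" using that assms p by (intro dvd_choose_prime) auto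
    then have "(of_nat p :: 'a) dvd of_nat (p choose k)" by (rule of_nat_dvd_of_nat)
    then show ?thesis by (metis dvd_mult2)
  qed
  ultimately show ?thesis by (metis (no_types, lifting) dvd_sum)
qed

text \<open>Modulo \<open>p\<close> both sides are ring homomorphisms in \<open>f\<close>, and they agree on the variables.\<close>

lemma frob_cong_power:
  assumes p: "prime p"
  shows "of_nat p dvd frob p f - f ^ p"
proof (induction f rule: mpoly_induct)
  case (add f g)
  have "of_nat p dvd (frob p f - f ^ p) + (frob p g - g ^ p) - ((f + g) ^ p - f ^ p - g ^ p)"
    by (intro dvd_add dvd_diff add prime_dvd_add_power p)
  then show ?case by (simp add: algebra_simps)
next
  case (neg f)
  show ?case
  proof (cases "p = 2")
    case True
    have "frob p (- f) - (- f) ^ p = - (frob p f - f ^ p) - of_nat p * f ^ p"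
      using True by (simp add: algebra_simps)
    then show ?thesis using neg by (metis dvd_diff dvd_minus_iff dvd_triv_left)
  next
    case False
    then have "odd p" using p primes_dvd_imp_eq two_is_prime_nat by blast
    then have "frob p (- f) - (- f) ^ p = - (frob p f - f ^ p)" by simp
    then show ?thesis using neg by (metis dvd_minus_iff)
  qed
next
  case (mult f g)
  have "frob p (f * g) - (f * g) ^ p = frob p f * (frob p g - g ^ p) + (frob p f - f ^ p) * g ^ p"
    by (simp add: algebra_simps power_mult_distrib)
  then show ?case using mult by (metis dvd_add dvd_mult dvd_mult2)
qed auto

text \<open>The quotient of \<open>x\<^sup>p - y\<^sup>p\<close> by \<open>x - y\<close> is a sum of \<open>p\<close> products all congruent to
  \<open>y\<close> to the power \<open>p - 1\<close> modulo \<open>p\<close>, hence it contributes a further factor \<open>p\<close>.\<close>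

lemma prime_power_dvd_power_diff:
  fixes x y :: "'a :: comm_ring_1"
  assumes "k \<ge> 1" "of_nat (p ^ k) dvd x - y"
  shows "of_nat (p ^ Suc k) dvd x ^ p - y ^ p"
proof -
  have px: "of_nat p dvd x - y"
    using assms by (metis One_nat_def dvd_power_le dvd_refl dvd_trans of_nat_dvd_of_nat power_one_right)
  have "(\<Sum>i<p. y ^ (p - Suc i) * x ^ i) = (\<Sum>i<p. y ^ (p - Suc i) * (x ^ i - y ^ i)) + of_nat p * y ^ (p - 1)"
  proof -
    have "y ^ (p - Suc i) * x ^ i = y ^ (p - Suc i) * (x ^ i - y ^ i) + y ^ (p - 1)" if "i < p" for i
      using that by (simp add: algebra_simps flip: power_add)
    then show ?thesis by (simp add: sum.distrib)
  qed
  moreover have "of_nat p dvd (\<Sum>i<p. y ^ (p - Suc i) * (x ^ i - y ^ i))"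
    by (intro dvd_sum dvd_mult) (use px diff_dvd_power_diff dvd_trans in blast)
  ultimately have "of_nat p dvd (\<Sum>i<p. y ^ (p - Suc i) * x ^ i)" by simp
  with assms(2) have "of_nat (p ^ k) * of_nat p dvd (x - y) * (\<Sum>i<p. y ^ (p - Suc i) * x ^ i)"
    by (rule mult_dvd_mono)
  then show ?thesis by (simp add: power_diff_sumr2 mult.commute)
qed

lemma prime_power_dvd_power_power_diff:
  fixes x y :: "'a :: comm_ring_1"
  assumes "of_nat p dvd x - y"
  shows "of_nat (p ^ Suc j) dvd x ^ (p ^ j) - y ^ (p ^ j)"
proof (induction j)
  case 0 then show ?case using assms by simp
next
  case (Suc j)
  from prime_power_dvd_power_diff[OF _ Suc] show ?case by (simp add: power_mult[symmetric] mult.commute)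
qed

lemma dvd_multiplicity_split:
  assumes "prime p" "d dvd (n :: nat)" "n > 0"
  shows "multiplicity p d + multiplicity p (n div d) = multiplicity p n"
proof -
  from assms obtain e where e: "n = d * e" by blast
  with assms have "d > 0" "e > 0" by auto
  then show ?thesis using assms e by (simp add: prime_elem_multiplicity_mult_distrib)
qed

lemma not_dvd_div_prime:
  assumes "prime p" "d dvd p * n" "\<not> d dvd n" "n > (0::nat)"
  shows "p ^ multiplicity p (p * n) dvd d"
proof -
  from assms(2) obtain e where e: "p * n = d * e" by blast
  have "\<not> p dvd e"
  proof
    assume "p dvd e"
    then obtain c where c: "e = p * c" by blast
    have "p * n = p * (d * c)" unfolding e c by (rule mult.left_commute)
    then have "n = d * c" using prime_gt_0_nat[OF assms(1)] by (metis mult_cancel1 less_irrefl)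
    then show False using assms(3) by simp
  qed
  then have "multiplicity p e = 0" by (simp add: not_dvd_imp_multiplicity_0)
  moreover have "multiplicity p d + multiplicity p (p * n div d) = multiplicity p (p * n)"
    using assms by (intro dvd_multiplicity_split) (auto simp: prime_gt_0_nat)
  moreover have "p * n div d = e"
    using e assms by (metis dvd_0_left_iff less_numeral_extra(3) mult_eq_0_iff nonzero_mult_div_cancel_left not_prime_0)
  ultimately show ?thesis by (metis add.right_neutral multiplicity_dvd)
qed

text \<open>Modulo \<open>p\<^sup>k\<close>, where \<open>p\<^sup>k\<close> exactly divides \<open>p n\<close>, the terms of the \<open>pn\<close>-th ghost
  component with \<open>d\<close> not dividing \<open>n\<close> vanish, and the others are the terms of the \<open>n\<close>-th one
  with Frobenius applied.\<close>

lemma ghost_frob_cong: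
  assumes p: "prime p" and n: "n > 0"
  shows "of_nat (p ^ multiplicity p (p * n)) dvd ghost a (p * n) - frob p (ghost a n)"
proof -
  let ?k = "multiplicity p (p * n)"
  have k: "?k = Suc (multiplicity p n)"
    using p n by (simp add: multiplicity_prime_mult)
  have fin: "finite {d. d dvd p * n}" using p n by (intro finite_divisors_nat) (auto simp: prime_gt_0_nat)
  have sub: "{d. d dvd n} \<subseteq> {d. d dvd p * n}" by auto
  have "ghost a (p * n) = (\<Sum>d | d dvd n. of_nat d * a d ^ (p * n div d))
      + (\<Sum>d\<in>{d. d dvd p * n} - {d. d dvd n}. of_nat d * a d ^ (p * n div d))"
    unfolding ghost_def using sum.subset_diff[OF sub fin, of "\<lambda>d. of_nat d * a d ^ (p * n div d)"]
    by (simp add: add.commute)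
  then have "ghost a (p * n) - frob p (ghost a n)
      = (\<Sum>d | d dvd n. of_nat d * (a d ^ (p * n div d) - frob p (a d) ^ (n div d)))
      + (\<Sum>d\<in>{d. d dvd p * n} - {d. d dvd n}. of_nat d * a d ^ (p * n div d))"
    by (simp add: ghost_def frob_sum sum_subtractf algebra_simps)
  moreover have "of_nat (p ^ ?k) dvd of_nat d * (a d ^ (p * n div d) - frob p (a d) ^ (n div d))"
    if d: "d dvd n" for d
  proof -
    let ?i = "multiplicity p (n div d)"
    obtain e where e: "n div d = p ^ ?i * e" using multiplicity_dvd[of p "n div d"] by blast
    have "p * n div d = p * (n div d)" using d by (simp add: div_mult_swap)
    then have 1: "a d ^ (p * n div d) = ((a d ^ p) ^ p ^ ?i) ^ e" by (metis e power_mult)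
    have 2: "frob p (a d) ^ (n div d) = (frob p (a d) ^ p ^ ?i) ^ e" by (metis e power_mult)
    have "of_nat p dvd a d ^ p - frob p (a d)"
      using frob_cong_power[OF p, of "a d"] by (metis dvd_minus_iff minus_diff_eq)
    from prime_power_dvd_power_power_diff[OF this]
    have "of_nat (p ^ Suc ?i) dvd a d ^ (p * n div d) - frob p (a d) ^ (n div d)"
      unfolding 1 2 using diff_dvd_power_diff dvd_trans by blast
    moreover have "of_nat (p ^ multiplicity p d) dvd (of_nat d :: mpoly)"
      by (intro of_nat_dvd_of_nat multiplicity_dvd)
    ultimately have "of_nat (p ^ multiplicity p d) * of_nat (p ^ Suc ?i)
        dvd of_nat d * (a d ^ (p * n div d) - frob p (a d) ^ (n div d))"
      by (intro mult_dvd_mono)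
    moreover have "?k = multiplicity p d + Suc ?i"
      using dvd_multiplicity_split[OF p d n] k by simp
    ultimately show ?thesis by (simp only: power_add of_nat_mult)
  qed
  moreover have "of_nat (p ^ ?k) dvd of_nat d * a d ^ (p * n div d)"
    if "d dvd p * n" "\<not> d dvd n" for d
    using not_dvd_div_prime[OF p that n] by (intro dvd_mult2 of_nat_dvd_of_nat)
  ultimately show ?thesis by (auto intro!: dvd_add dvd_sum)
qed

text \<open>The congruences that characterize, with respect to the Frobenius lifts \<open>X\<^sub>i \<mapsto> X\<^sub>i\<^sup>p\<close>, the sequences
  that are ghost components of vectors of polynomials.\<close>

definition dwork :: "nat set \<Rightarrow> (nat \<Rightarrow> mpoly) \<Rightarrow> bool" where
  "dwork S b \<longleftrightarrow> (\<forall>p n. prime p \<and> p * n \<in> S \<longrightarrow>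
     of_nat (p ^ multiplicity p (p * n)) dvd b (p * n) - frob p (b n))"

lemma dwork_ghost: "divisor_stable S \<Longrightarrow> dwork S (ghost a)"
  unfolding dwork_def by (intro allI impI ghost_frob_cong) (auto simp: divisor_stable_def intro!: Nat.gr0I)

lemma dwork_add: "dwork S b \<Longrightarrow> dwork S c \<Longrightarrow> dwork S (\<lambda>n. b n + c n)"
  unfolding dwork_def by (auto simp: add_diff_add intro!: dvd_add)

lemma dwork_minus: "dwork S b \<Longrightarrow> dwork S (\<lambda>n. - b n)"
  unfolding dwork_def by (metis (no_types) dvd_minus_iff frob_simps(3) minus_diff_minus)

lemma dwork_mult:
  assumes "dwork S b" "dwork S c" shows "dwork S (\<lambda>n. b n * c n)"
  unfolding dwork_def
proof (intro allI impI, elim conjE)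
  fix p n assume pn: "prime p" "p * n \<in> S"
  have "b (p * n) * c (p * n) - frob p (b n * c n)
      = b (p * n) * (c (p * n) - frob p (c n)) + (b (p * n) - frob p (b n)) * frob p (c n)"
    by (simp add: algebra_simps)
  then show "of_nat (p ^ multiplicity p (p * n)) dvd b (p * n) * c (p * n) - frob p (b n * c n)"
    using assms pn unfolding dwork_def by (metis dvd_add dvd_mult dvd_mult2)
qed

lemma of_nat_coprime_dvd_mult:
  fixes x :: "'a :: comm_ring_1"
  assumes "coprime a b" "of_nat a dvd x" "of_nat b dvd x"
  shows "of_nat (a * b) dvd x"
proof -
  obtain u v where "u * int a + v * int b = 1"
    using assms(1) bezout_int[of "int a" "int b"] by auto
  then have "of_int (u * int a + v * int b) = (1 :: 'a)" by simp
  then have "x = of_int u * (of_nat a * x) + of_int v * (of_nat b * x)"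
    by (simp flip: distrib_right mult.assoc)
  moreover have "of_nat (a * b) dvd of_nat a * x" "of_nat (a * b) dvd of_nat b * x"
    using mult_dvd_mono[OF dvd_refl assms(3), of "of_nat a"] mult_dvd_mono[OF dvd_refl assms(2), of "of_nat b"]
    by (simp_all add: mult.commute)
  ultimately show ?thesis by (metis dvd_add dvd_mult)
qed

lemma of_nat_coprime_dvd_cancel:
  fixes x :: "'a :: comm_ring_1"
  assumes "coprime a b" "of_nat a dvd of_nat b * x"
  shows "of_nat a dvd x"
proof -
  obtain u v where "u * int a + v * int b = 1"
    using assms(1) bezout_int[of "int a" "int b"] by auto
  then have "of_int (u * int a + v * int b) = (1 :: 'a)" by simp
  then have "x = of_int u * (of_nat a * x) + of_int v * (of_nat b * x)"
    by (simp flip: distrib_right mult.assoc)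
  then show ?thesis using assms by (metis dvd_add dvd_mult dvd_triv_left)
qed

lemma of_nat_dvd_if_prime_powers:
  fixes x :: "'a :: comm_ring_1"
  assumes n: "n > 0" and p: "\<And>p. prime p \<Longrightarrow> p dvd n \<Longrightarrow> of_nat (p ^ multiplicity p n) dvd x"
  shows "of_nat n dvd x"
proof -
  have "of_nat (\<Prod>p\<in>Q. p ^ multiplicity p n) dvd x" if "finite Q" "Q \<subseteq> prime_factors n" for Q
    using that
  proof (induction Q)
    case (insert q Q)
    have "coprime (q ^ multiplicity q n) (\<Prod>p\<in>Q. p ^ multiplicity p n)"
      using insert by (intro prod_coprime_right coprime_power_left_iff[THEN iffD2] coprime_power_right_iff[THEN iffD2])
         (auto intro!: primes_coprime simp: coprime_power_left_iff coprime_power_right_iff)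
    moreover have "of_nat (q ^ multiplicity q n) dvd x" using insert.prems by (intro p) auto
    moreover have "of_nat (\<Prod>p\<in>Q. p ^ multiplicity p n) dvd x" using insert by simp
    ultimately show ?case unfolding prod.insert[OF insert.hyps]
      by (rule of_nat_coprime_dvd_mult)
  qed auto
  then show ?thesis using prime_factorization_nat[of n] n by (metis finite_set_mset order_refl)
qed

text \<open>The components of the vector with ghost components \<open>b\<close>, found one after the other; the division
  by \<open>n\<close> that is chosen here is possible under the condition \<open>dwork\<close>.\<close>

fun unghost :: "(nat \<Rightarrow> mpoly) \<Rightarrow> nat \<Rightarrow> mpoly" where
  "unghost b n = (SOME c. of_nat n * c =
     b n - (\<Sum>d\<in>{d. d dvd n \<and> d < n}. of_nat d * unghost b d ^ (n div d)))"

declare unghost.simps [simp del]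

lemma divisors_split: "n > 0 \<Longrightarrow> {d. d dvd n} = insert n {d. d dvd n \<and> d < (n::nat)}"
  by (auto dest: dvd_imp_le)

lemma ghost_split:
  "n > 0 \<Longrightarrow> ghost a n = of_nat n * a n + (\<Sum>d\<in>{d. d dvd n \<and> d < n}. of_nat d * a d ^ (n div d))"
  unfolding ghost_def by (subst divisors_split) auto

text \<open>Dwork's lemma. Let \<open>n = p m\<close>. The condition on \<open>b\<close> and \<open>ghost_frob_cong\<close> for the components already
  found compare both \<open>b\<^sub>n\<close> and the new ghost component with the Frobenius of \<open>b\<^sub>m\<close>, modulo the \<open>p\<close>-part
  of \<open>n\<close>. As this holds for all \<open>p\<close>, the equation for the component at \<open>n\<close> is divisible by \<open>n\<close>.\<close>

theorem ghost_unghost: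
  assumes S: "divisor_stable S" and b: "dwork S b"
  shows "n \<in> S \<Longrightarrow> ghost (unghost b) n = b n"
proof (induction n rule: less_induct)
  case (less n)
  have n0: "n > 0" using S less(2) by (auto simp: divisor_stable_def intro!: Nat.gr0I)
  let ?L = "\<Sum>d\<in>{d. d dvd n \<and> d < n}. of_nat d * unghost b d ^ (n div d)"
  have "of_nat n dvd b n - ?L"
  proof (rule of_nat_dvd_if_prime_powers[OF n0])
    fix p assume p: "prime p" "p dvd n"
    then obtain m where m: "n = p * m" by blast
    have m0: "m > 0" "m < n" using n0 m p prime_gt_1_nat[of p] by auto
    have mS: "m \<in> S" using S less(2) m unfolding divisor_stable_def by (metis dvd_triv_right)
    have d1: "of_nat (p ^ multiplicity p n) dvd (b n - frob p (b m))"
      using b p less(2) m by (auto simp: dwork_def)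
    have d2: "of_nat (p ^ multiplicity p n) dvd ghost (unghost b) n - frob p (b m)"
      using ghost_frob_cong[OF p(1) m0(1), of "unghost b"] unfolding less(1)[OF m0(2) mS] m .
    have d3: "of_nat (p ^ multiplicity p n) dvd of_nat n * unghost b n"
      by (intro dvd_mult2 of_nat_dvd_of_nat multiplicity_dvd)
    have eq: "(b n - frob p (b m)) - (ghost (unghost b) n - frob p (b m)) + of_nat n * unghost b n = b n - ?L"
    proof -
      have "(x - y) - (G - y) + A = x - L" if "G = A + L" for x y G A L :: mpoly
        using that by simp
      from this[OF ghost_split[OF n0]] show ?thesis .
    qed
    show "of_nat (p ^ multiplicity p n) dvd b n - ?L"
      using dvd_add[OF dvd_diff[OF d1 d2] d3] unfolding eq .
  qed
  then have "\<exists>c. of_nat n * c = b n - ?L" unfolding dvd_def by metis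
  then have "of_nat n * unghost b n = b n - ?L"
    by (subst unghost.simps) (rule someI_ex)
  then show ?case using ghost_split[OF n0, of "unghost b"] by simp
qed

text \<open>As the polynomial ring is torsion-free, the component at \<open>n\<close> can be found from the leading term
  \<open>n a\<^sub>n\<close> of the ghost component.\<close>

lemma ghost_inj:
  assumes S: "divisor_stable S" and e: "\<And>n. n \<in> S \<Longrightarrow> ghost a n = ghost b n"
  shows "n \<in> S \<Longrightarrow> a n = b n"
proof (induction n rule: less_induct)
  case (less n)
  have n0: "n > 0" using S less(2) by (auto simp: divisor_stable_def intro!: Nat.gr0I)
  have "a d = b d" if "d dvd n" "d < n" for d
    using that S less by (auto simp: divisor_stable_def)
  then have "of_nat n * a n = of_nat n * b n"
    using e[OF less(2)] by (simp add: ghost_split[OF n0])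
  then show ?case using n0 by simp
qed

lemma sub_ghost: "sub v (ghost a n) = ghost (\<lambda>d. sub v (a d)) n"
  by (simp add: ghost_def sub_sum)

lemma ghost_zero [simp]: "n > 0 \<Longrightarrow> ghost (\<lambda>_. 0) n = 0"
  unfolding ghost_def by (intro sum.neutral) (auto simp: zero_power dvd_div_eq_0_iff)

text \<open>Two consequences of the criterion, from which the Frobenius maps and the congruence
  \<open>F\<^sub>p(a) \<equiv> a\<^sup>p\<close> modulo \<open>p\<close> are obtained.\<close>

lemma dwork_shift:
  assumes S: "divisor_stable S" and b: "dwork S b" and k: "k > 0"
  shows "dwork (S /\<^sub>d k) (\<lambda>\<nu>. b (k * \<nu>))"
  unfolding dwork_def
proof (intro allI impI, elim conjE)
  fix p n assume p: "prime p" "p * n \<in> S /\<^sub>d k"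
  have S': "p * (k * n) \<in> S" using p by (auto simp: set_quot_def algebra_simps)
  then have n: "n > 0" using S by (auto simp: divisor_stable_def intro!: Nat.gr0I)
  have "p ^ multiplicity p (p * n) dvd p ^ multiplicity p (p * (k * n))"
    using p k n by (intro le_imp_power_dvd dvd_imp_multiplicity_le) (auto simp: prime_gt_0_nat)
  moreover have "of_nat (p ^ multiplicity p (p * (k * n))) dvd b (p * (k * n)) - frob p (b (k * n))"
    using b p S' by (auto simp: dwork_def)
  moreover have "p * (k * n) = k * (p * n)" by simp
  ultimately show "of_nat (p ^ multiplicity p (p * n)) dvd b (k * (p * n)) - frob p (b (k * n))"
    by (metis (no_types, lifting) dvd_trans of_nat_dvd_of_nat)
qed

lemma dwork_prime_dvd:
  assumes S: "divisor_stable S" and b: "dwork S b" and p: "prime p" and n: "p * n \<in> S"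
  shows "of_nat p dvd b (p * n) - b n ^ p"
proof -
  have n0: "n > 0" using S n by (auto simp: divisor_stable_def intro!: Nat.gr0I)
  have "p dvd p ^ multiplicity p (p * n)"
    using n0 p by (simp add: multiplicity_prime_mult)
  then have "of_nat p dvd b (p * n) - frob p (b n)"
    using b p n unfolding dwork_def by (meson dvd_trans of_nat_dvd_of_nat)
  then have "of_nat p dvd (b (p * n) - frob p (b n)) + (frob p (b n) - b n ^ p)"
    using frob_cong_power[OF p] by (intro dvd_add)
  then show ?thesis by simp
qed

text \<open>At a prime other than \<open>p\<close> one may divide by \<open>p\<close>. At \<open>p\<close> itself both the shifted sequence and,
  by \<open>prime_power_dvd_power_diff\<close>, the \<open>p\<close>-th powers satisfy congruences that are better by one factor.\<close>

lemma dwork_remainder: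
  assumes S: "divisor_stable S" and b: "dwork S b" and p: "prime p"
    and c: "\<And>n. p * n \<in> S \<Longrightarrow> of_nat p * c n = b (p * n) - b n ^ p"
  shows "dwork (S /\<^sub>d p) c"
  unfolding dwork_def
proof (intro allI impI, elim conjE)
  fix l n assume l: "prime l" "l * n \<in> S /\<^sub>d p"
  have S': "p * (l * n) \<in> S" "l * n \<in> S" "p * n \<in> S" "l * (p * n) \<in> S"
    using l S by (auto simp: set_quot_def divisor_stable_def algebra_simps)
  have n: "n > 0" using S S' by (auto simp: divisor_stable_def intro!: Nat.gr0I)
  let ?k = "multiplicity l (l * n)"
  let ?x = "c (l * n) - frob l (c n)"
  have "of_nat p * frob l (c n) = frob l (of_nat p * c n)" by simp
  then have x: "of_nat p * ?x = (b (l * (p * n)) - frob l (b (p * n))) - (b (l * n) ^ p - frob l (b n) ^ p)"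
    using c[OF S'(1)] c[OF S'(3)] by (simp add: right_diff_distrib mult.left_commute)
  have 1: "of_nat (l ^ multiplicity l (l * (p * n))) dvd b (l * (p * n)) - frob l (b (p * n))"
    using b l S' by (auto simp: dwork_def)
  have 2: "of_nat (l ^ ?k) dvd b (l * n) - frob l (b n)"
    using b l S' by (auto simp: dwork_def)
  show "of_nat (l ^ ?k) dvd ?x"
  proof (cases "l = p")
    case True
    have k: "multiplicity p (p * (p * n)) = Suc (multiplicity p (p * n))" "multiplicity p (p * n) \<ge> 1"
      using n p prime_gt_0_nat[OF p] by (simp_all add: multiplicity_prime_mult)
    have "of_nat (l ^ Suc ?k) dvd of_nat p * ?x"
      unfolding x using dvd_diff[OF 1[unfolded True k(1)] prime_power_dvd_power_diff[OF k(2) 2[unfolded True]]]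
      unfolding True .
    then have "of_nat p * of_nat (l ^ ?k) dvd of_nat p * ?x" using True by simp
    then show ?thesis using p by (simp add: prime_gt_0_nat del: of_nat_power)
  next
    case False
    have "?k \<le> multiplicity l (l * (p * n))"
      using l n p by (intro dvd_imp_multiplicity_le) (auto simp: prime_gt_0_nat)
    then have "of_nat (l ^ ?k) dvd b (l * (p * n)) - frob l (b (p * n))"
      using 1 by (meson dvd_trans le_imp_power_dvd of_nat_dvd_of_nat)
    then have "of_nat (l ^ ?k) dvd of_nat p * ?x"
      unfolding x by (rule dvd_diff[OF _ dvd_trans[OF 2 diff_dvd_power_diff]])
    moreover have "coprime (l ^ ?k) p" using False l p by (simp add: primes_coprime)
    ultimately show ?thesis by (rule of_nat_coprime_dvd_cancel[rotated])
  qed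
qed

section \<open>Evaluation of polynomials without constant term in rings without unit\<close>

lemma add_pow_zero_int [simp]: "[(0 :: int)] \<cdot>\<^bsub>A\<^esub> x = \<zero>\<^bsub>A\<^esub>"
  by (simp add: add_pow_int_ge) (simp add: add_pow_def)

context nonunital_cring
begin

lemma nu_r_distr:
  "\<lbrakk>x \<in> carrier A; y \<in> carrier A; z \<in> carrier A\<rbrakk> \<Longrightarrow> x \<otimes> (y \<oplus> z) = x \<otimes> y \<oplus> x \<otimes> z"
  using nu_l_distr[of y z x] nu_m_comm[of x] by simp

lemma mult_hom: "y \<in> carrier A \<Longrightarrow> (\<lambda>x. x \<otimes> y) \<in> hom (add_monoid A) (add_monoid A)"
  by (auto simp: hom_def nu_m_closed nu_l_distr)

lemma int_mult_l: "x \<in> carrier A \<Longrightarrow> y \<in> carrier A \<Longrightarrow> [(k::int)] \<cdot> x \<otimes> y = [k] \<cdot> (x \<otimes> y)"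
  using hom_int_pow[OF mult_hom, of y x k] a_group by (simp add: add_pow_def)

lemma int_mult_r: "x \<in> carrier A \<Longrightarrow> y \<in> carrier A \<Longrightarrow> x \<otimes> [(k::int)] \<cdot> y = [k] \<cdot> (x \<otimes> y)"
  using int_mult_l[of y x k] nu_m_comm by simp

lemma nu_zero: "y \<in> carrier A \<Longrightarrow> \<zero> \<otimes> y = \<zero>" "y \<in> carrier A \<Longrightarrow> y \<otimes> \<zero> = \<zero>"
  using int_mult_l[of \<zero> y 0] nu_m_comm[of \<zero> y] by (simp_all add: add_pow_int_ge)

lemma nu_m_lcomm: "\<lbrakk>x \<in> carrier A; y \<in> carrier A; z \<in> carrier A\<rbrakk> \<Longrightarrow> x \<otimes> (y \<otimes> z) = y \<otimes> (x \<otimes> z)"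
  by (metis nu_m_assoc nu_m_comm)

lemma nu_pow_closed [simp]: "x \<in> carrier A \<Longrightarrow> nu_pow A x n \<in> carrier A"
proof -
  assume x: "x \<in> carrier A"
  have "((\<lambda>y. y \<otimes> x) ^^ k) x \<in> carrier A" for k by (induction k) (auto simp: x nu_m_closed)
  then show ?thesis by (simp add: nu_pow_def)
qed

end

text \<open>\<open>\<int> \<times> A\<close> with the multiplication that makes \<open>(1, 0)\<close> a unit.\<close>

definition unitize :: "('a, 'm) ring_scheme \<Rightarrow> (int \<times> 'a) ring" where
  "unitize A = \<lparr>carrier = UNIV \<times> carrier A,
     mult = (\<lambda>(m, x) (n, y). (m * n, [m] \<cdot>\<^bsub>A\<^esub> y \<oplus>\<^bsub>A\<^esub> [n] \<cdot>\<^bsub>A\<^esub> x \<oplus>\<^bsub>A\<^esub> x \<otimes>\<^bsub>A\<^esub> y)),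
     one = (1, \<zero>\<^bsub>A\<^esub>), zero = (0, \<zero>\<^bsub>A\<^esub>), add = (\<lambda>(m, x) (n, y). (m + n, x \<oplus>\<^bsub>A\<^esub> y))\<rparr>"

lemma unitize_simps [simp]:
  "carrier (unitize A) = UNIV \<times> carrier A"
  "(m, x) \<otimes>\<^bsub>unitize A\<^esub> (n, y) = (m * n, [m] \<cdot>\<^bsub>A\<^esub> y \<oplus>\<^bsub>A\<^esub> [n] \<cdot>\<^bsub>A\<^esub> x \<oplus>\<^bsub>A\<^esub> x \<otimes>\<^bsub>A\<^esub> y)"
  "\<one>\<^bsub>unitize A\<^esub> = (1, \<zero>\<^bsub>A\<^esub>)" "\<zero>\<^bsub>unitize A\<^esub> = (0, \<zero>\<^bsub>A\<^esub>)"
  "(m, x) \<oplus>\<^bsub>unitize A\<^esub> (n, y) = (m + n, x \<oplus>\<^bsub>A\<^esub> y)"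
  by (simp_all add: unitize_def)

lemma fst_unitize [simp]:
  "fst (x \<oplus>\<^bsub>unitize A\<^esub> y) = fst x + fst y" "fst (x \<otimes>\<^bsub>unitize A\<^esub> y) = fst x * fst y"
  "snd (x \<oplus>\<^bsub>unitize A\<^esub> y) = snd x \<oplus>\<^bsub>A\<^esub> snd y"
  by (simp_all add: unitize_def split: prod.splits)

lemma (in nonunital_cring) cring_unitize: "cring (unitize A)"
proof -
  have int_distr: "[(k::int)] \<cdot> (x \<oplus> y) = [k] \<cdot> x \<oplus> [k] \<cdot> y"
    if "x \<in> carrier A" "y \<in> carrier A" for k x y
    using that by (simp add: add.int_pow_mult_distrib a_comm)
  have int_int: "[(k::int)] \<cdot> ([l] \<cdot> x) = [(l * k)] \<cdot> x" if "x \<in> carrier A" for k l :: int and x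
    using that by (simp add: add.int_pow_pow mult.commute)
  have int_add: "[(k + l)] \<cdot> x = [k] \<cdot> x \<oplus> [l] \<cdot> x" if "x \<in> carrier A" for k l :: int and x
    using that by (simp add: add.int_pow_mult)
  have ag: "abelian_group (unitize A)"
  proof (rule abelian_groupI)
    fix x assume "x \<in> carrier (unitize A)"
    then show "\<exists>y\<in>carrier (unitize A). y \<oplus>\<^bsub>unitize A\<^esub> x = \<zero>\<^bsub>unitize A\<^esub>"
      by (intro bexI[of _ "(- fst x, \<ominus> snd x)"]) (auto simp: l_neg)
  qed (auto simp: a_ac)
  have cm: "comm_monoid (unitize A)"
  proof (rule comm_monoidI)
    fix x y z assume xyz: "x \<in> carrier (unitize A)" "y \<in> carrier (unitize A)" "z \<in> carrier (unitize A)"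
    obtain k a l b m c where [simp]: "x = (k, a)" "y = (l, b)" "z = (m, c)" by (metis surj_pair)
    have [simp]: "a \<in> carrier A" "b \<in> carrier A" "c \<in> carrier A" using xyz by auto
    show "x \<otimes>\<^bsub>unitize A\<^esub> y \<otimes>\<^bsub>unitize A\<^esub> z = x \<otimes>\<^bsub>unitize A\<^esub> (y \<otimes>\<^bsub>unitize A\<^esub> z)"
      by (simp add: int_distr int_int int_mult_l int_mult_r nu_l_distr nu_r_distr nu_m_closed nu_m_assoc
          a_ac mult.commute mult.left_commute)
  next
    fix x y assume xyz: "x \<in> carrier (unitize A)" "y \<in> carrier (unitize A)"
    then show "x \<otimes>\<^bsub>unitize A\<^esub> y = y \<otimes>\<^bsub>unitize A\<^esub> x"
      by (cases x; cases y) (auto simp: a_ac nu_m_closed intro: nu_m_comm)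
  qed (auto simp: nu_m_closed nu_zero)
  show ?thesis
  proof (rule cringI[OF ag cm])
    fix x y z assume xyz: "x \<in> carrier (unitize A)" "y \<in> carrier (unitize A)" "z \<in> carrier (unitize A)"
    obtain k a l b m c where [simp]: "x = (k, a)" "y = (l, b)" "z = (m, c)" by (metis surj_pair)
    have [simp]: "a \<in> carrier A" "b \<in> carrier A" "c \<in> carrier A" using xyz by auto
    show "(x \<oplus>\<^bsub>unitize A\<^esub> y) \<otimes>\<^bsub>unitize A\<^esub> z = x \<otimes>\<^bsub>unitize A\<^esub> z \<oplus>\<^bsub>unitize A\<^esub> y \<otimes>\<^bsub>unitize A\<^esub> z"
      by (simp add: int_distr int_add nu_l_distr nu_m_closed a_ac distrib_right)
  qed
qed

text \<open>The augmentation ideal: these polynomials have values in rings without unit.\<close>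

definition AUG :: "mpoly set" where
  "AUG = {f. sub (\<lambda>_. 0) f = 0}"

lemma AUG_closed [simp]:
  "0 \<in> AUG" "Var i \<in> AUG" "f \<in> AUG \<Longrightarrow> g \<in> AUG \<Longrightarrow> f + g \<in> AUG" "f \<in> AUG \<Longrightarrow> - f \<in> AUG"
  "f \<in> AUG \<Longrightarrow> g \<in> AUG \<Longrightarrow> f - g \<in> AUG" "f \<in> AUG \<Longrightarrow> f * g \<in> AUG" "g \<in> AUG \<Longrightarrow> f * g \<in> AUG"
  by (simp_all add: AUG_def)

lemma AUG_power [simp]: "f \<in> AUG \<Longrightarrow> n > 0 \<Longrightarrow> f ^ n \<in> AUG"
  by (simp add: AUG_def)

lemma AUG_sum: "(\<And>i. i \<in> I \<Longrightarrow> f i \<in> AUG) \<Longrightarrow> sum f I \<in> AUG"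
  by (induction I rule: infinite_finite_induct) auto

definition nev :: "('a, 'm) ring_scheme \<Rightarrow> (nat \<Rightarrow> 'a) \<Rightarrow> mpoly \<Rightarrow> 'a" where
  "nev A v f = snd (ev (unitize A) (\<lambda>i. (0, v i)) f)"

context nonunital_cring
begin

lemma ev_unitize_AUG:
  assumes v: "\<And>i. v i \<in> carrier A" and f: "f \<in> AUG"
  shows "ev (unitize A) (\<lambda>i. (0, v i)) f = (0, nev A v f)"
proof -
  interpret U: cring "unitize A" by (rule cring_unitize)
  have c: "(0, v i) \<in> carrier (unitize A)" "(0, \<zero>) \<in> carrier (unitize A)" for i using v by auto
  have "fst (ev (unitize A) (\<lambda>i. (0, v i)) g) = fst (ev (unitize A) (\<lambda>i. (0, \<zero>)) g)" for g
  proof (induction g rule: mpoly_induct)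
    case (add f g)
    then show ?case using c by (simp add: U.ev_add)
  next
    case (neg f)
    have *: "fst (ev (unitize A) w (- f)) = - fst (ev (unitize A) w f)"
      if w: "\<And>i. w i \<in> carrier (unitize A)" for w
    proof -
      have "fst (ev (unitize A) w (- f) \<oplus>\<^bsub>unitize A\<^esub> ev (unitize A) w f) = fst \<zero>\<^bsub>unitize A\<^esub>"
        using U.ev_add[of w "- f" f] w by (simp del: fst_unitize unitize_simps add: unitize_simps(1))
      then show ?thesis by simp
    qed
    show ?case using neg * c by simp
  next
    case (mult f g)
    then show ?case using c by (simp add: U.ev_mult)
  qed (use c in \<open>simp_all add: U.ev_one U.ev_Var\<close>)
  moreover have "ev (unitize A) (\<lambda>i. (0, v i)) (sub (\<lambda>_. 0) f) = ev (unitize A) (\<lambda>i. (0, \<zero>)) f"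
    using c by (subst ev_sub[OF cring_unitize]) auto
  then have "ev (unitize A) (\<lambda>i. (0, \<zero>)) f = (0, \<zero>)" using f by (simp add: AUG_def)
  ultimately have "fst (ev (unitize A) (\<lambda>i. (0, v i)) f) = 0" by simp
  then show ?thesis by (simp add: nev_def prod_eq_iff)
qed

lemma nev_closed [simp]:
  assumes v: "\<And>i. v i \<in> carrier A" shows "nev A v f \<in> carrier A"
proof -
  interpret U: cring "unitize A" by (rule cring_unitize)
  have "ev (unitize A) (\<lambda>i. (0, v i)) f \<in> carrier (unitize A)" using v by (intro U.ev_closed) auto
  then show ?thesis by (auto simp: nev_def)
qed

lemma nev_Var: assumes v: "\<And>i. v i \<in> carrier A" shows "nev A v (Var i) = v i"
proof -
  interpret U: cring "unitize A" by (rule cring_unitize)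
  show ?thesis using v by (simp add: nev_def U.ev_Var)
qed

lemma nev_add:
  assumes v: "\<And>i. v i \<in> carrier A"
  shows "nev A v (f + g) = nev A v f \<oplus> nev A v g"
proof -
  interpret U: cring "unitize A" by (rule cring_unitize)
  show ?thesis using v by (simp add: nev_def U.ev_add)
qed

lemma nev_zero [simp]: "nev A v 0 = \<zero>"
proof -
  interpret U: cring "unitize A" by (rule cring_unitize)
  show ?thesis by (simp add: nev_def)
qed

lemma nev_neg:
  assumes v: "\<And>i. v i \<in> carrier A"
  shows "nev A v (- f) = \<ominus> nev A v f"
  using nev_add[of v "- f" f, OF v] v by (simp add: minus_equality)

lemma nev_mult:
  assumes v: "\<And>i. v i \<in> carrier A" and f: "f \<in> AUG" and g: "g \<in> AUG"
  shows "nev A v (f * g) = nev A v f \<otimes> nev A v g"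
proof -
  interpret U: cring "unitize A" by (rule cring_unitize)
  have "ev (unitize A) (\<lambda>i. (0, v i)) (f * g) = (0, nev A v f) \<otimes>\<^bsub>unitize A\<^esub> (0, nev A v g)"
    using v ev_unitize_AUG[of v f, OF v f] ev_unitize_AUG[of v g, OF v g]
    by (subst U.ev_mult) auto
  then show ?thesis using v f g ev_unitize_AUG[of v "f * g", OF v] by (simp add: nu_m_closed)
qed

lemma nev_power:
  assumes v: "\<And>i. v i \<in> carrier A" and f: "f \<in> AUG" and n: "n > 0"
  shows "nev A v (f ^ n) = nu_pow A (nev A v f) n"
proof -
  have "nev A v (f ^ Suc k) = nu_pow A (nev A v f) (Suc k)" for k
  proof (induction k)
    case (Suc k)
    have "nev A v (f ^ Suc k * f) = nev A v (f ^ Suc k) \<otimes> nev A v f"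
      using f by (intro nev_mult v) (auto simp del: power_Suc)
    then show ?case using Suc by (simp add: nu_pow_def mult.commute)
  qed (simp add: nu_pow_def)
  then show ?thesis using n by (metis gr0_implies_Suc)
qed

lemma nev_of_nat_mult:
  assumes v: "\<And>i. v i \<in> carrier A"
  shows "nev A v (of_nat n * f) = [n] \<cdot> nev A v f"
  by (induction n) (auto simp: distrib_right nev_add[of v, OF v] v add.nat_pow_Suc a_comm)

lemma nev_sum:
  assumes v: "\<And>i. v i \<in> carrier A"
  shows "nev A v (sum f I) = finsum A (\<lambda>i. nev A v (f i)) I"
  by (induction I rule: infinite_finite_induct) (auto simp: nev_add[of v, OF v] v Pi_def)

end

lemma nev_hom:
  assumes A: "nonunital_cring A" and B: "nonunital_cring B" and h: "h \<in> nu_ring_hom A B"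
    and v: "\<And>i. v i \<in> carrier A"
  shows "h (nev A v f) = nev B (\<lambda>i. h (v i)) f"
proof -
  interpret A: nonunital_cring A by (rule A)
  interpret B: nonunital_cring B by (rule B)
  interpret UA: cring "unitize A" by (rule A.cring_unitize)
  interpret UB: cring "unitize B" by (rule B.cring_unitize)
  have hm: "h \<in> hom (add_monoid A) (add_monoid B)" and h': "h \<in> hom A B"
    using h by (auto simp: nu_ring_hom_def add_hom_def)
  have hc: "x \<in> carrier A \<Longrightarrow> h x \<in> carrier B" for x using hm by (auto simp: hom_def)
  have ha: "h (x \<oplus>\<^bsub>A\<^esub> y) = h x \<oplus>\<^bsub>B\<^esub> h y" if "x \<in> carrier A" "y \<in> carrier A" for x y
    using that hm by (auto simp: hom_def)
  have ht: "h (x \<otimes>\<^bsub>A\<^esub> y) = h x \<otimes>\<^bsub>B\<^esub> h y" if "x \<in> carrier A" "y \<in> carrier A" for x y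
    using that h' by (auto simp: hom_def)
  have hi: "h ([(k::int)] \<cdot>\<^bsub>A\<^esub> x) = [k] \<cdot>\<^bsub>B\<^esub> h x" if "x \<in> carrier A" for k x
    using hom_int_pow[OF hm, of x k] that A.a_group B.a_group by (simp add: add_pow_def)
  have h0: "h \<zero>\<^bsub>A\<^esub> = \<zero>\<^bsub>B\<^esub>" using hi[of "\<zero>\<^bsub>A\<^esub>" 0] by (simp add: add_pow_int_ge)
  let ?h = "\<lambda>(m :: int, x). (m, h x)"
  have "is_ev (unitize B) (\<lambda>f. ?h (ev (unitize A) (\<lambda>i. (0, v i)) f))"
    unfolding is_ev_def
  proof (intro conjI allI)
    have c: "(0, v i) \<in> carrier (unitize A)" for i using v by auto
    then have e: "ev (unitize A) (\<lambda>i. (0, v i)) f \<in> carrier (unitize A)" for f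
      by (intro UA.ev_closed)
    show "?h (ev (unitize A) (\<lambda>i. (0, v i)) f) \<in> carrier (unitize B)" for f
      using e[of f] by (auto simp: hc)
    show "?h (ev (unitize A) (\<lambda>i. (0, v i)) 1) = \<one>\<^bsub>unitize B\<^esub>"
      using c by (simp add: UA.ev_one h0)
    show "?h (ev (unitize A) (\<lambda>i. (0, v i)) (f + g)) =
        ?h (ev (unitize A) (\<lambda>i. (0, v i)) f) \<oplus>\<^bsub>unitize B\<^esub> ?h (ev (unitize A) (\<lambda>i. (0, v i)) g)" for f g
      using c e[of f] e[of g] by (auto simp: UA.ev_add ha)
    show "?h (ev (unitize A) (\<lambda>i. (0, v i)) (f * g)) =
        ?h (ev (unitize A) (\<lambda>i. (0, v i)) f) \<otimes>\<^bsub>unitize B\<^esub> ?h (ev (unitize A) (\<lambda>i. (0, v i)) g)" for f g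
      using c e[of f] e[of g] by (auto simp: UA.ev_mult ha ht hi A.nu_m_closed)
  qed
  moreover have "is_ev (unitize B) (ev (unitize B) (\<lambda>i. (0, h (v i))))"
    using v hc by (intro UB.is_ev_ev) auto
  ultimately have "?h (ev (unitize A) (\<lambda>i. (0, v i)) f) = ev (unitize B) (\<lambda>i. (0, h (v i))) f"
    by (rule UB.is_ev_eq) (use v hc in \<open>simp add: UA.ev_Var UB.ev_Var\<close>)
  then have "snd (?h (ev (unitize A) (\<lambda>i. (0, v i)) f)) = nev B (\<lambda>i. h (v i)) f"
    by (simp only: nev_def)
  then show ?thesis by (cases "ev (unitize A) (\<lambda>i. (0, v i)) f") (simp add: nev_def)
qed

section \<open>Ghost components over rings without unit\<close>

lemma add_homD:
  assumes "h \<in> add_hom A B"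
  shows "x \<in> carrier A \<Longrightarrow> h x \<in> carrier B"
    and "x \<in> carrier A \<Longrightarrow> y \<in> carrier A \<Longrightarrow> h (x \<oplus>\<^bsub>A\<^esub> y) = h x \<oplus>\<^bsub>B\<^esub> h y"
  using assms by (auto simp: add_hom_def hom_def)

lemma add_homI:
  assumes "\<And>x. x \<in> carrier A \<Longrightarrow> h x \<in> carrier B"
    and "\<And>x y. x \<in> carrier A \<Longrightarrow> y \<in> carrier A \<Longrightarrow> h (x \<oplus>\<^bsub>A\<^esub> y) = h x \<oplus>\<^bsub>B\<^esub> h y"
  shows "h \<in> add_hom A B"
  using assms by (auto simp: add_hom_def hom_def)

lemma add_hom_nat_pow:
  assumes "abelian_group A" "abelian_group B" "h \<in> add_hom A B" "x \<in> carrier A"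
  shows "h ([(n :: nat)] \<cdot>\<^bsub>A\<^esub> x) = [n] \<cdot>\<^bsub>B\<^esub> h x"
  using hom_nat_pow[of h "add_monoid A" "add_monoid B" x n] assms
  by (simp add: add_pow_def add_hom_def abelian_group.a_group)

lemma add_hom_zero:
  assumes "abelian_group A" "abelian_group B" "h \<in> add_hom A B"
  shows "h \<zero>\<^bsub>A\<^esub> = \<zero>\<^bsub>B\<^esub>"
  using hom_one[of h "add_monoid A" "add_monoid B"] assms
  by (simp add: add_hom_def abelian_group.a_group)

lemma add_hom_finsum:
  assumes A: "abelian_group A" and B: "abelian_group B" and h: "h \<in> add_hom A B"
    and f: "\<And>i. i \<in> I \<Longrightarrow> f i \<in> carrier A"
  shows "h (finsum A f I) = finsum B (\<lambda>i. h (f i)) I"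
proof -
  interpret A: abelian_group A by (rule A)
  interpret B: abelian_group B by (rule B)
  show ?thesis using f
  proof (induction I rule: infinite_finite_induct)
    case (insert i I)
    then have "f \<in> I \<rightarrow> carrier A" "f i \<in> carrier A" by auto
    with insert show ?case
      by (simp add: Pi_def add_homD[OF h])
  qed (simp_all add: add_hom_zero[OF A B h])
qed

lemma nu_ring_homD:
  assumes "h \<in> nu_ring_hom A B"
  shows "h \<in> add_hom A B" "x \<in> carrier A \<Longrightarrow> h x \<in> carrier B"
    and "x \<in> carrier A \<Longrightarrow> y \<in> carrier A \<Longrightarrow> h (x \<oplus>\<^bsub>A\<^esub> y) = h x \<oplus>\<^bsub>B\<^esub> h y"
    and "x \<in> carrier A \<Longrightarrow> y \<in> carrier A \<Longrightarrow> h (x \<otimes>\<^bsub>A\<^esub> y) = h x \<otimes>\<^bsub>B\<^esub> h y"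
  using assms by (auto simp: nu_ring_hom_def add_hom_def hom_def)

lemma nu_ring_homI:
  assumes "\<And>x. x \<in> carrier A \<Longrightarrow> h x \<in> carrier B"
    and "\<And>x y. x \<in> carrier A \<Longrightarrow> y \<in> carrier A \<Longrightarrow> h (x \<oplus>\<^bsub>A\<^esub> y) = h x \<oplus>\<^bsub>B\<^esub> h y"
    and "\<And>x y. x \<in> carrier A \<Longrightarrow> y \<in> carrier A \<Longrightarrow> h (x \<otimes>\<^bsub>A\<^esub> y) = h x \<otimes>\<^bsub>B\<^esub> h y"
  shows "h \<in> nu_ring_hom A B"
  using assms by (auto simp: nu_ring_hom_def add_hom_def hom_def)

lemma nu_pow_one [simp]: "nu_pow A x (Suc 0) = x"
  by (simp add: nu_pow_def)

lemma nu_pow_Suc: "n > 0 \<Longrightarrow> nu_pow A x (Suc n) = nu_pow A x n \<otimes>\<^bsub>A\<^esub> x"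
  by (cases n) (simp_all add: nu_pow_def)

lemma nu_ring_hom_pow:
  assumes A: "nonunital_cring A" and h: "h \<in> nu_ring_hom A B" and x: "x \<in> carrier A"
  shows "h (nu_pow A x n) = nu_pow B (h x) n"
proof -
  interpret A: nonunital_cring A by (rule A)
  have *: "h (nu_pow A x (Suc k)) = nu_pow B (h x) (Suc k)" for k
    by (induction k) (auto simp: nu_pow_Suc nu_ring_homD[OF h] x)
  then show ?thesis by (cases n) (use *[of 0] in \<open>simp_all add: nu_pow_def\<close>)
qed

lemma nu_abelian: "nonunital_cring A \<Longrightarrow> abelian_group A"
  by (simp add: nonunital_cring_def)

lemma ds_pos: "divisor_stable S \<Longrightarrow> n \<in> S \<Longrightarrow> n > 0"
  by (auto simp: divisor_stable_def intro!: Nat.gr0I)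

lemma ds_dvd: "divisor_stable S \<Longrightarrow> n \<in> S \<Longrightarrow> d dvd n \<Longrightarrow> d \<in> S"
  by (auto simp: divisor_stable_def)

lemma ds_finite: "divisor_stable S \<Longrightarrow> n \<in> S \<Longrightarrow> finite {d. d dvd n}"
  using ds_pos by (simp add: finite_divisors_nat)

lemma ds_one: "divisor_stable S \<Longrightarrow> 1 \<in> S"
  unfolding divisor_stable_def by auto

lemma ds_quot: "divisor_stable S \<Longrightarrow> n \<in> S \<Longrightarrow> divisor_stable (S /\<^sub>d n)"
  unfolding divisor_stable_def set_quot_def
  by auto (metis (no_types, lifting) One_nat_def divisor_stable_def dvd_1_left mult_1 mult_dvd_mono dvd_refl)+

lemma ds_positive: "divisor_stable {0<..}"
  unfolding divisor_stable_def by (auto intro!: Nat.gr0I)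

lemma vec_map_in: "a \<in> S \<rightarrow>\<^sub>E X \<Longrightarrow> (\<And>x. x \<in> X \<Longrightarrow> h x \<in> Y) \<Longrightarrow> vec_map S h a \<in> S \<rightarrow>\<^sub>E Y"
  by (auto simp: vec_map_def)

lemma witt_ghost_closed:
  assumes "nonunital_cring A" "divisor_stable S" "a \<in> S \<rightarrow>\<^sub>E carrier A"
  shows "witt_ghost S A a \<in> S \<rightarrow>\<^sub>E carrier A"
proof -
  interpret A: nonunital_cring A by fact
  show ?thesis using assms(3) ds_dvd[OF assms(2)]
    by (auto simp: witt_ghost_def intro!: A.finsum_closed A.nu_pow_closed)
qed

definition torsion_free :: "('a, 'm) ring_scheme \<Rightarrow> bool" where
  "torsion_free A \<longleftrightarrow> (\<forall>n>0. \<forall>x\<in>carrier A. [(n::nat)] \<cdot>\<^bsub>A\<^esub> x = \<zero>\<^bsub>A\<^esub> \<longrightarrow> x = \<zero>\<^bsub>A\<^esub>)"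

lemma torsion_free_cancel:
  assumes A: "abelian_group A" "torsion_free A" and n: "n > 0"
    and x: "x \<in> carrier A" "y \<in> carrier A" and e: "[(n::nat)] \<cdot>\<^bsub>A\<^esub> x = [n] \<cdot>\<^bsub>A\<^esub> y"
  shows "x = y"
proof -
  interpret A: abelian_group A by fact
  have "[n] \<cdot>\<^bsub>A\<^esub> (x \<ominus>\<^bsub>A\<^esub> y) = [n] \<cdot>\<^bsub>A\<^esub> x \<oplus>\<^bsub>A\<^esub> [n] \<cdot>\<^bsub>A\<^esub> (\<ominus>\<^bsub>A\<^esub> y)"
    unfolding A.minus_eq using x by (intro A.add.nat_pow_distrib) auto
  also have "\<dots> = \<zero>\<^bsub>A\<^esub>"
    using x e by (simp add: A.add.nat_pow_distrib[symmetric] A.r_neg)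
  finally have "x \<ominus>\<^bsub>A\<^esub> y = \<zero>\<^bsub>A\<^esub>" using A(2) n x by (auto simp: torsion_free_def)
  then have "x \<oplus>\<^bsub>A\<^esub> (\<ominus>\<^bsub>A\<^esub> y) = y \<oplus>\<^bsub>A\<^esub> (\<ominus>\<^bsub>A\<^esub> y)" using x by (simp add: A.minus_eq A.r_neg)
  then show ?thesis using x by simp
qed

text \<open>Over a torsion-free ring each component is determined by the ghost component of the same
  index and the components at proper divisors.\<close>

lemma witt_ghost_inj:
  assumes A: "nonunital_cring A" and tf: "torsion_free A" and S: "divisor_stable S"
    and a: "a \<in> S \<rightarrow>\<^sub>E carrier A" and b: "b \<in> S \<rightarrow>\<^sub>E carrier A"
    and e: "witt_ghost S A a = witt_ghost S A b"
  shows "a = b"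
proof -
  interpret A: nonunital_cring A by (rule A)
  have split: "witt_ghost S A c n = [n] \<cdot>\<^bsub>A\<^esub> c n \<oplus>\<^bsub>A\<^esub>
       (\<Oplus>\<^bsub>A\<^esub>d\<in>{d. d dvd n \<and> d < n}. [d] \<cdot>\<^bsub>A\<^esub> nu_pow A (c d) (n div d))"
    if c: "c \<in> S \<rightarrow>\<^sub>E carrier A" and n: "n \<in> S" for c n
  proof -
    have c': "c d \<in> carrier A" if "d dvd n" for d using c ds_dvd[OF S n] that by auto
    have n0: "n > 0" using ds_pos[OF S n] .
    have "witt_ghost S A c n = finsum A (\<lambda>d. [d] \<cdot>\<^bsub>A\<^esub> nu_pow A (c d) (n div d)) (insert n {d. d dvd n \<and> d < n})"
      using n by (simp add: witt_ghost_def divisors_split[OF n0])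
    then show ?thesis using n0 c' by (simp add: Pi_def)
  qed
  have "n \<in> S \<Longrightarrow> a n = b n" for n
  proof (induction n rule: less_induct)
    case (less n)
    have ab: "a n \<in> carrier A" "b n \<in> carrier A" using a b less(2) by auto
    have bd: "d dvd n \<Longrightarrow> b d \<in> carrier A" for d using b ds_dvd[OF S less(2)] by auto
    let ?L = "\<lambda>c. \<Oplus>\<^bsub>A\<^esub>d\<in>{d. d dvd n \<and> d < n}. [d] \<cdot>\<^bsub>A\<^esub> nu_pow A (c d) (n div d)"
    have L: "?L a = ?L b"
      using less(1) ds_dvd[OF S less(2)] bd by (intro A.finsum_cong') auto
    have "[n] \<cdot>\<^bsub>A\<^esub> a n \<oplus>\<^bsub>A\<^esub> ?L b = [n] \<cdot>\<^bsub>A\<^esub> b n \<oplus>\<^bsub>A\<^esub> ?L b"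
      using fun_cong[OF e, of n] split[OF a less(2)] split[OF b less(2)] L by simp
    moreover have "?L b \<in> carrier A" using bd by (intro A.finsum_closed) auto
    ultimately have "[n] \<cdot>\<^bsub>A\<^esub> a n = [n] \<cdot>\<^bsub>A\<^esub> b n" using ab by simp
    then show ?case
      using torsion_free_cancel[OF nu_abelian[OF A] tf ds_pos[OF S less(2)] ab] by simp
  qed
  then show ?thesis using a b by (intro ext) (metis PiE_arb)
qed

lemma AUG_ghost: "(\<And>d. d > 0 \<Longrightarrow> P d \<in> AUG) \<Longrightarrow> n > 0 \<Longrightarrow> ghost P n \<in> AUG"
  unfolding ghost_def by (intro AUG_sum AUG_closed AUG_power) (auto intro!: Nat.gr0I simp: dvd_div_eq_0_iff)

text \<open>Evaluation respects the sums and products of which ghost components are made. All formulas for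
  ghost components of natural operations come from polynomial identities through this lemma.\<close>

lemma nev_ghost:
  assumes A: "nonunital_cring A" and S: "divisor_stable S" and v: "\<And>i. v i \<in> carrier A"
    and P: "\<And>n. n > 0 \<Longrightarrow> P n \<in> AUG"
  shows "witt_ghost S A (\<lambda>n\<in>S. nev A v (P n)) = (\<lambda>n\<in>S. nev A v (ghost P n))"
proof
  interpret A: nonunital_cring A by (rule A)
  fix n
  show "witt_ghost S A (\<lambda>n\<in>S. nev A v (P n)) n = (\<lambda>n\<in>S. nev A v (ghost P n)) n"
  proof (cases "n \<in> S")
    case True
    have n0: "n > 0" using ds_pos[OF S True] .
    have d: "d \<in> S" "d > 0" "n div d > 0" if "d dvd n" for d
      using ds_dvd[OF S True that] ds_pos[OF S] that n0
      by (auto simp: dvd_div_eq_0_iff intro!: Nat.gr0I)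
    have "nev A v (ghost P n) = (\<Oplus>\<^bsub>A\<^esub>d\<in>{d. d dvd n}. nev A v (of_nat d * P d ^ (n div d)))"
      unfolding ghost_def by (rule A.nev_sum[of v, OF v])
    also have "\<dots> = (\<Oplus>\<^bsub>A\<^esub>d\<in>{d. d dvd n}. [d] \<cdot>\<^bsub>A\<^esub> nu_pow A ((\<lambda>n\<in>S. nev A v (P n)) d) (n div d))"
      using d v P by (intro A.finsum_cong') (auto simp: A.nev_of_nat_mult[of v, OF v] A.nev_power[of v, OF v])
    finally show ?thesis using True by (simp add: witt_ghost_def)
  qed (simp add: witt_ghost_def)
qed

section \<open>A generic ring\<close>

lemma countable_poly_mapping:
  assumes "countable (UNIV :: 'a set)" "countable (UNIV :: 'b::zero set)"
  shows "countable (UNIV :: ('a \<Rightarrow>\<^sub>0 'b) set)"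
proof -
  let ?g = "\<lambda>f :: 'a \<Rightarrow>\<^sub>0 'b. (\<lambda>k. (k, Poly_Mapping.lookup f k)) ` Poly_Mapping.keys f"
  have g: "(k, c) \<in> ?g f \<longleftrightarrow> c \<noteq> 0 \<and> Poly_Mapping.lookup f k = c" for f k c
    by (auto simp: in_keys_iff)
  have "inj ?g"
  proof (rule injI, rule poly_mapping_eqI)
    fix f g :: "'a \<Rightarrow>\<^sub>0 'b" and k assume "?g f = ?g g"
    then have "\<And>c. c \<noteq> 0 \<and> Poly_Mapping.lookup f k = c \<longleftrightarrow> c \<noteq> 0 \<and> Poly_Mapping.lookup g k = c"
      unfolding g[symmetric] by (simp only:)
    then show "Poly_Mapping.lookup f k = Poly_Mapping.lookup g k" by metis
  qed
  moreover have "countable (UNIV :: ('a \<times> 'b) set)"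
    using countable_SIGMA[of "UNIV :: 'a set" "\<lambda>_. UNIV :: 'b set"] assms by simp
  then have "countable {A :: ('a \<times> 'b) set. finite A}"
    using countable_Collect_finite_subset[of "UNIV :: ('a \<times> 'b) set"] by simp
  then have "countable (range ?g)" by (rule countable_subset[rotated]) auto
  ultimately show ?thesis by (metis countable_image_inj_eq)
qed

lemma countable_mpoly: "countable (UNIV :: mpoly set)"
  by (intro countable_poly_mapping) auto

text \<open>The polynomial ring is countable and hence can be copied into every infinite type. The copies
  serve as generic rings and as coordinate rings.\<close>

definition emb :: "mpoly \<Rightarrow> 'u" where "emb = (SOME f. inj f)"

definition unemb :: "'u \<Rightarrow> mpoly" where "unemb = inv_into UNIV emb"

lemma inj_emb:
  assumes "infinite (UNIV :: 'u set)"
  shows "inj (emb :: mpoly \<Rightarrow> 'u)"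
proof -
  obtain f :: "nat \<Rightarrow> 'u" where "inj f"
    using infinite_countable_subset[OF assms] by auto
  then have "inj (f \<circ> to_nat_on (UNIV :: mpoly set))"
    using countable_mpoly by (intro inj_compose) (auto simp: inj_on_to_nat_on)
  then show ?thesis unfolding emb_def by (metis someI_ex)
qed

lemma unemb_emb: "infinite (UNIV :: 'u set) \<Longrightarrow> unemb (emb f :: 'u) = f"
  by (simp add: unemb_def inj_emb)

text \<open>Polynomials without constant term, as a ring with carrier in the given type.\<close>

definition GR :: "'u ring" where
  "GR = \<lparr>carrier = emb ` AUG, mult = (\<lambda>x y. emb (unemb x * unemb y)), one = emb 0,
     zero = emb 0, add = (\<lambda>x y. emb (unemb x + unemb y))\<rparr>"

lemma GR_simps [simp]:
  "carrier GR = emb ` AUG" "x \<otimes>\<^bsub>GR\<^esub> y = emb (unemb x * unemb y)" "\<zero>\<^bsub>GR\<^esub> = emb 0"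
  "x \<oplus>\<^bsub>GR\<^esub> y = emb (unemb x + unemb y)"
  by (simp_all add: GR_def)

context
  assumes inf: "infinite (UNIV :: 'u set)"
begin

lemma unemb_emb_GR [simp]: "unemb (emb f :: 'u) = f"
  using inf by (rule unemb_emb)

lemma emb_eq [simp]: "(emb f :: 'u) = emb g \<longleftrightarrow> f = g"
  using inj_emb[OF inf] by (auto dest: injD)

lemma nonunital_cring_GR: "nonunital_cring (GR :: 'u ring)"
proof (intro nonunital_cring.intro nonunital_cring_axioms.intro)
  show "abelian_group (GR :: 'u ring)"
  proof (rule abelian_groupI)
    fix x :: 'u assume "x \<in> carrier GR"
    then show "\<exists>y\<in>carrier GR. y \<oplus>\<^bsub>GR\<^esub> x = \<zero>\<^bsub>GR\<^esub>"
      by (intro bexI[of _ "emb (- unemb x)"]) auto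
  qed (auto simp: algebra_simps)
qed (auto simp: algebra_simps)

lemma GR_add_pow: "f \<in> AUG \<Longrightarrow> [(n :: nat)] \<cdot>\<^bsub>GR\<^esub> (emb f :: 'u) = emb (of_nat n * f)"
proof (induction n)
  case 0
  then show ?case by (simp add: add_pow_def)
next
  case (Suc n)
  interpret G: nonunital_cring "GR :: 'u ring" by (rule nonunital_cring_GR)
  have "[(Suc n)] \<cdot>\<^bsub>GR\<^esub> (emb f :: 'u) = [n] \<cdot>\<^bsub>GR\<^esub> (emb f) \<oplus>\<^bsub>GR\<^esub> emb f"
    using Suc by (intro G.add.nat_pow_Suc)
  then show ?case using Suc by (simp add: distrib_right add.commute)
qed

lemma torsion_free_GR: "torsion_free (GR :: 'u ring)"
  unfolding torsion_free_def by (auto simp: GR_add_pow)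

lemma GR_hom:
  assumes "nonunital_cring A" "\<And>i. v i \<in> carrier A"
  shows "(\<lambda>x :: 'u. nev A v (unemb x)) \<in> nu_ring_hom GR A"
proof -
  interpret A: nonunital_cring A by fact
  show ?thesis
    by (rule nu_ring_homI) (auto simp: assms(2) A.nev_add[of v] A.nev_mult[of v])
qed

end

text \<open>The variable with index \<open>(k, n)\<close> stands for the \<open>n\<close>-th component of the \<open>k\<close>-th vector.\<close>

definition asg :: "('a, 'm) ring_scheme \<Rightarrow> nat set \<Rightarrow> (nat \<Rightarrow> nat \<Rightarrow> 'a) \<Rightarrow> nat \<Rightarrow> 'a" where
  "asg A S x i = (case prod_decode i of (k, n) \<Rightarrow> if n \<in> S then x k n else \<zero>\<^bsub>A\<^esub>)"

definition X :: "nat \<Rightarrow> nat \<Rightarrow> mpoly" where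
  "X k n = Var (prod_encode (k, n))"

lemma X_AUG [simp]: "X k n \<in> AUG"
  by (simp add: X_def)

definition GX :: "nat set \<Rightarrow> nat \<Rightarrow> nat \<Rightarrow> 'u" where
  "GX S k = (\<lambda>n\<in>S. emb (X k n))"

lemma asg_closed: "nonunital_cring A \<Longrightarrow> (\<And>k. x k \<in> S \<rightarrow>\<^sub>E carrier A) \<Longrightarrow> asg A S x i \<in> carrier A"
  using abelian_monoid.zero_closed[OF abelian_group.axioms(1)[OF nu_abelian], of A]
  by (auto simp: asg_def split: prod.splits)

lemma nev_asg_X:
  assumes "nonunital_cring A" "\<And>k. x k \<in> S \<rightarrow>\<^sub>E carrier A"
  shows "(\<lambda>n\<in>S. nev A (asg A S x) (X k n)) = x k"
proof -
  interpret A: nonunital_cring A by fact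
  have "nev A (asg A S x) (X k n) = x k n" if "n \<in> S" for n
    using that A.nev_Var[of "asg A S x", OF asg_closed[OF assms]] by (simp add: X_def asg_def)
  then have "(\<lambda>n\<in>S. nev A (asg A S x) (X k n)) = restrict (x k) S" by (intro restrict_ext)
  also have "\<dots> = x k" using assms(2)[of k] by (simp add: PiE_restrict)
  finally show ?thesis .
qed

text \<open>Identities between natural operations on vectors need to be checked on the generic vectors
  over the torsion-free generic ring only, where they can be checked on ghost components.\<close>

lemma GR_cover:
  fixes A :: "('u, 'm) ring_scheme"
  assumes inf: "infinite (UNIV :: 'u set)" and A: "nonunital_cring A" and x: "\<And>k. x k \<in> S \<rightarrow>\<^sub>E carrier A"
  shows "\<exists>h \<in> nu_ring_hom (GR :: 'u ring) A. \<forall>k. vec_map S h (GX S k) = x k"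
proof (intro bexI allI)
  let ?h = "\<lambda>y :: 'u. nev A (asg A S x) (unemb y)"
  show "?h \<in> nu_ring_hom GR A" by (rule GR_hom[OF inf A asg_closed[OF A x]])
  show "vec_map S ?h (GX S k) = x k" for k
    using nev_asg_X[of A x S k, OF A x] by (simp add: vec_map_def GX_def unemb_emb[OF inf] cong: restrict_cong)
qed

lemma GX_in: "(GX S k :: nat \<Rightarrow> 'u) \<in> S \<rightarrow>\<^sub>E carrier GR"
  by (simp add: GX_def)

section \<open>Existence of the Witt vector rings and their Frobenius maps\<close>

text \<open>The natural operation on vectors with the given polynomials as components.\<close>

definition vop :: "(nat \<Rightarrow> mpoly) \<Rightarrow> ('a, 'm) ring_scheme \<Rightarrow> nat set \<Rightarrow> nat set \<Rightarrow> (nat \<Rightarrow> nat \<Rightarrow> 'a) \<Rightarrow> nat \<Rightarrow> 'a" where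
  "vop F A S S' x = (\<lambda>n\<in>S'. nev A (asg A S x) (F n))"

definition two :: "'a \<Rightarrow> 'a \<Rightarrow> nat \<Rightarrow> 'a" where
  "two x y k = (if k = 0 then x else y)"

lemma two_simps [simp]: "two x y 0 = x" "two x y (Suc 0) = y"
  by (simp_all add: two_def)

lemma two_in: "x \<in> D \<Longrightarrow> y \<in> D \<Longrightarrow> two x y k \<in> D"
  by (simp add: two_def)

lemma vop_closed:
  assumes A: "nonunital_cring A" and x: "\<And>k. x k \<in> S \<rightarrow>\<^sub>E carrier A"
  shows "vop F A S S' x \<in> S' \<rightarrow>\<^sub>E carrier A"
  unfolding vop_def using nonunital_cring.nev_closed[OF A, of "asg A S x", OF asg_closed[OF A x]] by auto

lemma vop_nat:
  assumes A: "nonunital_cring A" and B: "nonunital_cring B" and h: "h \<in> nu_ring_hom A B"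
    and x: "\<And>k. x k \<in> S \<rightarrow>\<^sub>E carrier A"
  shows "vec_map S' h (vop F A S S' x) = vop F B S S' (\<lambda>k. vec_map S h (x k))"
proof -
  have "h \<zero>\<^bsub>A\<^esub> = \<zero>\<^bsub>B\<^esub>" by (rule add_hom_zero[OF nu_abelian nu_abelian nu_ring_homD(1)]) fact+
  then have "h (asg A S x i) = asg B S (\<lambda>k. vec_map S h (x k)) i" for i
    by (auto simp: asg_def vec_map_def split: prod.splits)
  then have "h (nev A (asg A S x) f) = nev B (asg B S (\<lambda>k. vec_map S h (x k))) f" for f
    using nev_hom[OF A B h, of "asg A S x" f] asg_closed[OF A x] by simp
  then show ?thesis by (auto simp: vop_def vec_map_def)
qed

lemma nev_ghost_X:
  assumes A: "nonunital_cring A" and S: "divisor_stable S" and x: "\<And>k. x k \<in> S \<rightarrow>\<^sub>E carrier A" and n: "n \<in> S"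
  shows "nev A (asg A S x) (ghost (X k) n) = witt_ghost S A (x k) n"
proof -
  have "witt_ghost S A (\<lambda>n\<in>S. nev A (asg A S x) (X k n)) = (\<lambda>n\<in>S. nev A (asg A S x) (ghost (X k) n))"
    by (rule nev_ghost[OF A S asg_closed[OF A x]]) simp
  then show ?thesis
    unfolding nev_asg_X[of A x S k, OF A x] using n by simp
qed

lemma vop_ghost:
  assumes A: "nonunital_cring A" and S': "divisor_stable S'" and x: "\<And>k. x k \<in> S \<rightarrow>\<^sub>E carrier A"
    and F: "\<And>n. n > 0 \<Longrightarrow> F n \<in> AUG" and n: "n \<in> S'"
  shows "witt_ghost S' A (vop F A S S' x) n = nev A (asg A S x) (ghost F n)"
  using fun_cong[OF nev_ghost[of A S' "asg A S x" F, OF A S' asg_closed[OF A x] F], of n] n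
  by (simp add: vop_def)

text \<open>That the components have no constant term follows from the uniqueness of ghost components,
  after setting all variables to zero.\<close>

lemma unghost_pos:
  assumes b: "dwork {0<..} b" and c: "\<And>n. n > 0 \<Longrightarrow> b n \<in> AUG" and n: "n > 0"
  shows "ghost (unghost b) n = b n" "unghost b n \<in> AUG"
proof -
  have g: "ghost (unghost b) n = b n" if "n > 0" for n
    using ghost_unghost[OF ds_positive b] that by simp
  then show "ghost (unghost b) n = b n" using n .
  have "sub (\<lambda>_. 0) (unghost b n) = 0"
  proof (rule ghost_inj[OF ds_positive])
    fix m :: nat assume "m \<in> {0<..}"
    then show "ghost (\<lambda>d. sub (\<lambda>_. 0) (unghost b d)) m = ghost (\<lambda>_. 0) m"
      using c[of m] g[of m] by (simp add: AUG_def sub_ghost[symmetric])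
  qed (use n in simp)
  then show "unghost b n \<in> AUG" by (simp add: AUG_def)
qed

definition sum_poly :: "nat \<Rightarrow> mpoly" where "sum_poly = unghost (\<lambda>n. ghost (X 0) n + ghost (X 1) n)"
definition mul_poly :: "nat \<Rightarrow> mpoly" where "mul_poly = unghost (\<lambda>n. ghost (X 0) n * ghost (X 1) n)"
definition neg_poly :: "nat \<Rightarrow> mpoly" where "neg_poly = unghost (\<lambda>n. - ghost (X 0) n)"
definition frob_poly :: "nat \<Rightarrow> nat \<Rightarrow> mpoly" where "frob_poly p = unghost (\<lambda>n. ghost (X 0) (p * n))"
text \<open>The vector \<open>b\<close> in \<open>F\<^sub>p(a) = a\<^sup>p + p b\<close>, for generic \<open>a\<close>.\<close>

definition rem_poly :: "nat \<Rightarrow> nat \<Rightarrow> mpoly" where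
  "rem_poly p = unghost (\<lambda>n. SOME c. of_nat p * c = ghost (X 0) (p * n) - ghost (X 0) n ^ p)"

lemma ghost_X_AUG [simp]: "n > 0 \<Longrightarrow> ghost (X k) n \<in> AUG"
  by (rule AUG_ghost) simp

lemma dwork_X: "dwork {0<..} (ghost a)"
  by (rule dwork_ghost[OF ds_positive])

lemma sum_poly: assumes "n > 0" shows "ghost sum_poly n = ghost (X 0) n + ghost (X 1) n" "sum_poly n \<in> AUG"
  unfolding sum_poly_def by (rule unghost_pos[OF dwork_add[OF dwork_X dwork_X] _ assms]; simp)+

lemma mul_poly: assumes "n > 0" shows "ghost mul_poly n = ghost (X 0) n * ghost (X 1) n" "mul_poly n \<in> AUG"
  unfolding mul_poly_def by (rule unghost_pos[OF dwork_mult[OF dwork_X dwork_X] _ assms]; simp)+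

lemma neg_poly: assumes "n > 0" shows "ghost neg_poly n = - ghost (X 0) n" "neg_poly n \<in> AUG"
  unfolding neg_poly_def by (rule unghost_pos[OF dwork_minus[OF dwork_X] _ assms]; simp)+

lemma positive_quot: "p > 0 \<Longrightarrow> {0<..} /\<^sub>d p = {0<..}"
  by (auto simp: set_quot_def)

lemma frob_poly:
  assumes "p > 0" "n > 0" shows "ghost (frob_poly p) n = ghost (X 0) (p * n)" "frob_poly p n \<in> AUG"
proof -
  have "dwork {0<..} (\<lambda>n. ghost (X 0) (p * n))"
    using dwork_shift[OF ds_positive dwork_X assms(1), of "X 0"] positive_quot[OF assms(1)] by simp
  from unghost_pos[OF this _ assms(2)] assms(1)
  show "ghost (frob_poly p) n = ghost (X 0) (p * n)" "frob_poly p n \<in> AUG" by (simp_all add: frob_poly_def)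
qed

lemma rem_poly:
  assumes p: "prime p" and n: "n > 0"
  shows "of_nat p * ghost (rem_poly p) n = ghost (X 0) (p * n) - ghost (X 0) n ^ p" "rem_poly p n \<in> AUG"
proof -
  have p0: "p > 0" using p by (rule prime_gt_0_nat)
  define c where "c n = (SOME c. of_nat p * c = ghost (X 0) (p * n) - ghost (X 0) n ^ p)" for n
  have c: "of_nat p * c n = ghost (X 0) (p * n) - ghost (X 0) n ^ p" if "n > 0" for n
  proof -
    have "of_nat p dvd ghost (X 0) (p * n) - ghost (X 0) n ^ p"
      using p0 that by (intro dwork_prime_dvd[OF ds_positive dwork_X p]) simp
    then obtain e where e: "ghost (X 0) (p * n) - ghost (X 0) n ^ p = of_nat p * e" by (rule dvdE)
    show ?thesis unfolding c_def by (rule someI[of _ e]) (rule e[symmetric])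
  qed
  have "dwork ({0<..} /\<^sub>d p) c"
    by (rule dwork_remainder[OF ds_positive dwork_X p]) (use c p0 in auto)
  then have d: "dwork {0<..} c" using positive_quot[OF p0] by simp
  have "c n \<in> AUG" if "n > 0" for n
  proof -
    have "ghost (X 0) (p * n) - ghost (X 0) n ^ p \<in> AUG" using that p0 by simp
    then have "sub (\<lambda>_. 0) (of_nat p * c n) = 0" unfolding c[OF that, symmetric] by (simp add: AUG_def)
    then show ?thesis using p0 by (simp add: AUG_def)
  qed
  from unghost_pos[OF d this n] c[OF n]
  show "of_nat p * ghost (rem_poly p) n = ghost (X 0) (p * n) - ghost (X 0) n ^ p" "rem_poly p n \<in> AUG"
    by (simp_all add: rem_poly_def c_def)
qed

definition witt_model :: "nat set \<Rightarrow> 'a ring \<Rightarrow> (nat \<Rightarrow> 'a) ring" where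
  "witt_model S A = \<lparr>carrier = S \<rightarrow>\<^sub>E carrier A, mult = (\<lambda>x y. vop mul_poly A S S (two x y)),
     one = undefined, zero = (\<lambda>n\<in>S. \<zero>\<^bsub>A\<^esub>), add = (\<lambda>x y. vop sum_poly A S S (two x y))\<rparr>"

lemma witt_model_simps [simp]:
  "carrier (witt_model S A) = S \<rightarrow>\<^sub>E carrier A"
  "x \<otimes>\<^bsub>witt_model S A\<^esub> y = vop mul_poly A S S (two x y)"
  "\<zero>\<^bsub>witt_model S A\<^esub> = (\<lambda>n\<in>S. \<zero>\<^bsub>A\<^esub>)"
  "x \<oplus>\<^bsub>witt_model S A\<^esub> y = vop sum_poly A S S (two x y)"
  by (simp_all add: witt_model_def)

lemma power_ring_simps [simp]:
  "carrier (power_ring S A) = S \<rightarrow>\<^sub>E carrier A"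
  "x \<otimes>\<^bsub>power_ring S A\<^esub> y = (\<lambda>n\<in>S. x n \<otimes>\<^bsub>A\<^esub> y n)"
  "\<zero>\<^bsub>power_ring S A\<^esub> = (\<lambda>n\<in>S. \<zero>\<^bsub>A\<^esub>)"
  "x \<oplus>\<^bsub>power_ring S A\<^esub> y = (\<lambda>n\<in>S. x n \<oplus>\<^bsub>A\<^esub> y n)"
  by (simp_all add: power_ring_def)

lemma nonunital_cringI:
  fixes W (structure)
  assumes "\<And>x y. x \<in> carrier W \<Longrightarrow> y \<in> carrier W \<Longrightarrow> x \<oplus> y \<in> carrier W" "\<zero> \<in> carrier W"
    "\<And>x y. x \<in> carrier W \<Longrightarrow> y \<in> carrier W \<Longrightarrow> x \<otimes> y \<in> carrier W"
    "\<And>x y z. x \<in> carrier W \<Longrightarrow> y \<in> carrier W \<Longrightarrow> z \<in> carrier W \<Longrightarrow> (x \<oplus> y) \<oplus> z = x \<oplus> (y \<oplus> z)"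
    "\<And>x y. x \<in> carrier W \<Longrightarrow> y \<in> carrier W \<Longrightarrow> x \<oplus> y = y \<oplus> x"
    "\<And>x. x \<in> carrier W \<Longrightarrow> \<zero> \<oplus> x = x"
    "\<And>x. x \<in> carrier W \<Longrightarrow> \<exists>y\<in>carrier W. y \<oplus> x = \<zero>"
    "\<And>x y z. x \<in> carrier W \<Longrightarrow> y \<in> carrier W \<Longrightarrow> z \<in> carrier W \<Longrightarrow> (x \<otimes> y) \<otimes> z = x \<otimes> (y \<otimes> z)"
    "\<And>x y. x \<in> carrier W \<Longrightarrow> y \<in> carrier W \<Longrightarrow> x \<otimes> y = y \<otimes> x"
    "\<And>x y z. x \<in> carrier W \<Longrightarrow> y \<in> carrier W \<Longrightarrow> z \<in> carrier W \<Longrightarrow> (x \<oplus> y) \<otimes> z = x \<otimes> z \<oplus> y \<otimes> z"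
  shows "nonunital_cring W"
  by (intro nonunital_cring.intro nonunital_cring_axioms.intro abelian_groupI) (assumption | rule assms)+

lemma witt_ghost_ext:
  assumes "\<And>n. n \<in> S \<Longrightarrow> witt_ghost S A a n = witt_ghost S A b n"
  shows "witt_ghost S A a = witt_ghost S A b"
  using assms by (intro ext) (auto simp: witt_ghost_def)

context
  fixes S :: "nat set" and A :: "'a ring"
  assumes S: "divisor_stable S" and A: "nonunital_cring A"
begin

interpretation A: nonunital_cring A by (rule A)

lemma model_closed:
  assumes "x \<in> S \<rightarrow>\<^sub>E carrier A" "y \<in> S \<rightarrow>\<^sub>E carrier A"
  shows "vop F A S S (two x y) \<in> S \<rightarrow>\<^sub>E carrier A"
  using assms by (intro vop_closed A two_in)

lemma model_ghost:
  assumes x: "x \<in> S \<rightarrow>\<^sub>E carrier A" and y: "y \<in> S \<rightarrow>\<^sub>E carrier A" and n: "n \<in> S"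
  shows "witt_ghost S A (vop sum_poly A S S (two x y)) n = witt_ghost S A x n \<oplus>\<^bsub>A\<^esub> witt_ghost S A y n"
    and "witt_ghost S A (vop mul_poly A S S (two x y)) n = witt_ghost S A x n \<otimes>\<^bsub>A\<^esub> witt_ghost S A y n"
    and "witt_ghost S A (vop neg_poly A S S (two x y)) n = \<ominus>\<^bsub>A\<^esub> witt_ghost S A x n"
proof -
  have t: "\<And>k. two x y k \<in> S \<rightarrow>\<^sub>E carrier A" using x y by (rule two_in)
  have n0: "n > 0" using ds_pos[OF S n] .
  note c = asg_closed[of A "two x y" S, OF A t]
  note g = nev_ghost_X[of A S "two x y" n, OF A S t n]
  show "witt_ghost S A (vop sum_poly A S S (two x y)) n = witt_ghost S A x n \<oplus>\<^bsub>A\<^esub> witt_ghost S A y n"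
    using vop_ghost[of A S "two x y" S sum_poly n, OF A S t sum_poly(2) n] sum_poly(1)[OF n0] g[of 0] g[of 1]
    by (simp add: A.nev_add[of "asg A S (two x y)", OF c])
  show "witt_ghost S A (vop mul_poly A S S (two x y)) n = witt_ghost S A x n \<otimes>\<^bsub>A\<^esub> witt_ghost S A y n"
    using vop_ghost[of A S "two x y" S mul_poly n, OF A S t mul_poly(2) n] mul_poly(1)[OF n0] g[of 0] g[of 1] n0
    by (simp add: A.nev_mult[of "asg A S (two x y)", OF c])
  show "witt_ghost S A (vop neg_poly A S S (two x y)) n = \<ominus>\<^bsub>A\<^esub> witt_ghost S A x n"
    using vop_ghost[of A S "two x y" S neg_poly n, OF A S t neg_poly(2) n] neg_poly(1)[OF n0] g[of 0]
    by (simp add: A.nev_neg[of "asg A S (two x y)", OF c])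
qed

lemma nu_pow_zero: "nu_pow A \<zero>\<^bsub>A\<^esub> n = \<zero>\<^bsub>A\<^esub>"
proof -
  have "((\<lambda>y. y \<otimes>\<^bsub>A\<^esub> \<zero>\<^bsub>A\<^esub>) ^^ k) \<zero>\<^bsub>A\<^esub> = \<zero>\<^bsub>A\<^esub>" for k by (induction k) (auto simp: A.nu_zero)
  then show ?thesis by (simp add: nu_pow_def)
qed

lemma witt_ghost_zero: "n \<in> S \<Longrightarrow> witt_ghost S A (\<lambda>n\<in>S. \<zero>\<^bsub>A\<^esub>) n = \<zero>\<^bsub>A\<^esub>"
  unfolding witt_ghost_def using ds_dvd[OF S]
  by (auto simp: nu_pow_zero intro!: A.add.finprod_one_eqI)

lemma nonunital_cring_model_torsion_free:
  assumes tf: "torsion_free A" shows "nonunital_cring (witt_model S A)"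
proof (rule nonunital_cringI)
  fix x assume x: "x \<in> carrier (witt_model S A)"
  have z: "(\<lambda>n\<in>S. \<zero>\<^bsub>A\<^esub>) \<in> S \<rightarrow>\<^sub>E carrier A" by auto
  note gc = PiE_mem[OF witt_ghost_closed[OF A S]]
  note inj = witt_ghost_inj[OF A tf S]
  show "\<exists>y\<in>carrier (witt_model S A). y \<oplus>\<^bsub>witt_model S A\<^esub> x = \<zero>\<^bsub>witt_model S A\<^esub>"
    using x z
    by (intro bexI[of _ "vop neg_poly A S S (two x x)"])
      (auto intro!: inj witt_ghost_ext model_closed simp: model_ghost model_closed witt_ghost_zero A.l_neg gc)
next
  note gc = PiE_mem[OF witt_ghost_closed[OF A S]]
  note inj = witt_ghost_inj[OF A tf S]
  have z: "(\<lambda>n\<in>S. \<zero>\<^bsub>A\<^esub>) \<in> S \<rightarrow>\<^sub>E carrier A" by auto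
  fix x assume "x \<in> carrier (witt_model S A)"
  then show "\<zero>\<^bsub>witt_model S A\<^esub> \<oplus>\<^bsub>witt_model S A\<^esub> x = x"
    using z by (auto intro!: inj witt_ghost_ext model_closed simp: model_ghost witt_ghost_zero gc)
  fix y assume "x \<in> carrier (witt_model S A)" "y \<in> carrier (witt_model S A)"
  then show "x \<oplus>\<^bsub>witt_model S A\<^esub> y = y \<oplus>\<^bsub>witt_model S A\<^esub> x" "x \<otimes>\<^bsub>witt_model S A\<^esub> y = y \<otimes>\<^bsub>witt_model S A\<^esub> x"
    by (auto intro!: inj witt_ghost_ext model_closed simp: model_ghost gc A.a_comm A.nu_m_comm)
  fix z assume "x \<in> carrier (witt_model S A)" "y \<in> carrier (witt_model S A)" "z \<in> carrier (witt_model S A)"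
  then show "x \<oplus>\<^bsub>witt_model S A\<^esub> y \<oplus>\<^bsub>witt_model S A\<^esub> z = x \<oplus>\<^bsub>witt_model S A\<^esub> (y \<oplus>\<^bsub>witt_model S A\<^esub> z)"
    "x \<otimes>\<^bsub>witt_model S A\<^esub> y \<otimes>\<^bsub>witt_model S A\<^esub> z = x \<otimes>\<^bsub>witt_model S A\<^esub> (y \<otimes>\<^bsub>witt_model S A\<^esub> z)"
    "(x \<oplus>\<^bsub>witt_model S A\<^esub> y) \<otimes>\<^bsub>witt_model S A\<^esub> z =
       x \<otimes>\<^bsub>witt_model S A\<^esub> z \<oplus>\<^bsub>witt_model S A\<^esub> y \<otimes>\<^bsub>witt_model S A\<^esub> z"
    by (auto intro!: inj witt_ghost_ext model_closed
        simp: model_ghost model_closed gc A.a_assoc A.nu_m_assoc A.nu_l_distr)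
qed (auto intro!: model_closed simp del: PiE_iff)

end

lemma model_nat:
  assumes A: "nonunital_cring A" and B: "nonunital_cring B" and h: "h \<in> nu_ring_hom A B"
    and x: "x \<in> S \<rightarrow>\<^sub>E carrier A" and y: "y \<in> S \<rightarrow>\<^sub>E carrier A"
  shows "vec_map S h (vop F A S S (two x y)) = vop F B S S (two (vec_map S h x) (vec_map S h y))"
proof -
  have "(\<lambda>k. vec_map S h (two x y k)) = two (vec_map S h x) (vec_map S h y)"
    by (auto simp: two_def)
  then show ?thesis using vop_nat[OF A B h, of "two x y" S S F] two_in[OF x y] by simp
qed

text \<open>The axioms involve at most three elements, which are simultaneously images of elements of a
  structure satisfying them.\<close>

lemma nonunital_cring_covered:
  assumes V: "nonunital_cring V"
    and closed: "\<zero>\<^bsub>W\<^esub> \<in> carrier W"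
      "\<And>x y. x \<in> carrier W \<Longrightarrow> y \<in> carrier W \<Longrightarrow> x \<oplus>\<^bsub>W\<^esub> y \<in> carrier W"
      "\<And>x y. x \<in> carrier W \<Longrightarrow> y \<in> carrier W \<Longrightarrow> x \<otimes>\<^bsub>W\<^esub> y \<in> carrier W"
    and cover: "\<And>x y z. x \<in> carrier W \<Longrightarrow> y \<in> carrier W \<Longrightarrow> z \<in> carrier W \<Longrightarrow>
      \<exists>h\<in>nu_ring_hom V W. h \<zero>\<^bsub>V\<^esub> = \<zero>\<^bsub>W\<^esub> \<and> x \<in> h ` carrier V \<and> y \<in> h ` carrier V \<and> z \<in> h ` carrier V"
  shows "nonunital_cring W"
proof -
  interpret V: nonunital_cring V by (rule V)
  have ax: "(x \<oplus>\<^bsub>W\<^esub> y) \<oplus>\<^bsub>W\<^esub> z = x \<oplus>\<^bsub>W\<^esub> (y \<oplus>\<^bsub>W\<^esub> z) \<and> x \<oplus>\<^bsub>W\<^esub> y = y \<oplus>\<^bsub>W\<^esub> x \<and> \<zero>\<^bsub>W\<^esub> \<oplus>\<^bsub>W\<^esub> x = x \<and>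
      (\<exists>y\<in>carrier W. y \<oplus>\<^bsub>W\<^esub> x = \<zero>\<^bsub>W\<^esub>) \<and>
      (x \<otimes>\<^bsub>W\<^esub> y) \<otimes>\<^bsub>W\<^esub> z = x \<otimes>\<^bsub>W\<^esub> (y \<otimes>\<^bsub>W\<^esub> z) \<and> x \<otimes>\<^bsub>W\<^esub> y = y \<otimes>\<^bsub>W\<^esub> x \<and>
      (x \<oplus>\<^bsub>W\<^esub> y) \<otimes>\<^bsub>W\<^esub> z = x \<otimes>\<^bsub>W\<^esub> z \<oplus>\<^bsub>W\<^esub> y \<otimes>\<^bsub>W\<^esub> z"
    if xyz: "x \<in> carrier W" "y \<in> carrier W" "z \<in> carrier W" for x y z
  proof -
    from cover[OF xyz] obtain h u v w where h: "h \<in> nu_ring_hom V W" "h \<zero>\<^bsub>V\<^esub> = \<zero>\<^bsub>W\<^esub>"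
      and uvw: "u \<in> carrier V" "v \<in> carrier V" "w \<in> carrier V" and [simp]: "x = h u" "y = h v" "z = h w"
      by (elim bexE conjE imageE)
    note hom = nu_ring_homD(3,4)[OF h(1), symmetric] V.nu_m_closed h(2)[symmetric]
    have "h (\<ominus>\<^bsub>V\<^esub> u) \<oplus>\<^bsub>W\<^esub> h u = h \<zero>\<^bsub>V\<^esub>" using uvw by (simp add: hom(1) V.l_neg)
    then have inv: "\<exists>y\<in>carrier W. y \<oplus>\<^bsub>W\<^esub> h u = h \<zero>\<^bsub>V\<^esub>"
      using uvw by (intro bexI[of _ "h (\<ominus>\<^bsub>V\<^esub> u)"] nu_ring_homD(2)[OF h(1)]) auto
    show ?thesis
      using uvw inv by (simp add: hom V.a_ac V.nu_m_assoc V.nu_r_distr V.nu_m_comm V.nu_m_lcomm)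
  qed
  note ax1 = ax[THEN conjunct1] and ax' = ax[THEN conjunct2]
  note ax2 = ax'[THEN conjunct1] and ax' = ax'[THEN conjunct2]
  note ax3 = ax'[THEN conjunct1] and ax' = ax'[THEN conjunct2]
  note ax4 = ax'[THEN conjunct1] and ax' = ax'[THEN conjunct2]
  note ax5 = ax'[THEN conjunct1] and ax' = ax'[THEN conjunct2]
  note ax6 = ax'[THEN conjunct1] and ax7 = ax'[THEN conjunct2]
  show ?thesis
    by (rule nonunital_cringI; (rule closed ax1 ax2 ax3 ax4 ax5 ax6 ax7; assumption)?)
qed

lemma nonunital_cring_model:
  fixes A :: "'u ring"
  assumes inf: "infinite (UNIV :: 'u set)" and S: "divisor_stable S" and A: "nonunital_cring A"
  shows "nonunital_cring (witt_model S A)"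
proof (rule nonunital_cring_covered)
  let ?G = "GR :: 'u ring"
  have G: "nonunital_cring ?G" using nonunital_cring_GR[OF inf] .
  interpret A: nonunital_cring A by (rule A)
  show "nonunital_cring (witt_model S ?G)"
    by (rule nonunital_cring_model_torsion_free[OF S G torsion_free_GR[OF inf]])
  show "\<zero>\<^bsub>witt_model S A\<^esub> \<in> carrier (witt_model S A)" by simp
  show "x \<oplus>\<^bsub>witt_model S A\<^esub> y \<in> carrier (witt_model S A)" "x \<otimes>\<^bsub>witt_model S A\<^esub> y \<in> carrier (witt_model S A)"
    if "x \<in> carrier (witt_model S A)" "y \<in> carrier (witt_model S A)" for x y
    using that unfolding witt_model_simps by (rule model_closed[OF S A])+
  fix x y z assume x: "x \<in> carrier (witt_model S A)" "y \<in> carrier (witt_model S A)" "z \<in> carrier (witt_model S A)"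
  define f where "f k = (if k = 0 then x else two y z (k - 1))" for k :: nat
  have f: "f k \<in> S \<rightarrow>\<^sub>E carrier A" for k using x by (simp add: f_def two_def del: PiE_iff)
  obtain h where h: "h \<in> nu_ring_hom ?G A" and hf: "\<forall>k. vec_map S h (GX S k) = f k"
    using GR_cover[of A f S, OF inf A f] by (elim bexE)
  have "h (emb 0) = \<zero>\<^bsub>A\<^esub>"
    using add_hom_zero[OF nu_abelian[OF G] nu_abelian[OF A] nu_ring_homD(1)[OF h]] by simp
  then have z: "vec_map S h \<zero>\<^bsub>witt_model S ?G\<^esub> = \<zero>\<^bsub>witt_model S A\<^esub>"
    by (simp add: vec_map_def cong: restrict_cong)
  have hom: "vec_map S h \<in> nu_ring_hom (witt_model S ?G) (witt_model S A)"
    unfolding witt_model_def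
    by (rule nu_ring_homI) (simp_all add: vec_map_in[OF _ nu_ring_homD(2)[OF h]] model_nat[OF G A h] del: PiE_iff)
  have img: "f k \<in> vec_map S h ` carrier (witt_model S ?G)" for k
    using hf GX_in[of S k] unfolding witt_model_simps by (metis image_eqI)
  have "f 0 = x" "f 1 = y" "f 2 = z" by (simp_all add: f_def)
  with z hom img[of 0] img[of 1] img[of 2]
  show "\<exists>h\<in>nu_ring_hom (witt_model S ?G) (witt_model S A). h \<zero>\<^bsub>witt_model S ?G\<^esub> = \<zero>\<^bsub>witt_model S A\<^esub> \<and>
      x \<in> h ` carrier (witt_model S ?G) \<and> y \<in> h ` carrier (witt_model S ?G) \<and> z \<in> h ` carrier (witt_model S ?G)"
    by (intro bexI[of _ "vec_map S h"]) simp_all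
qed

theorem is_witt_ring_model:
  assumes inf: "infinite (UNIV :: 'u set)" and S: "divisor_stable S"
  shows "is_witt_ring S (witt_model S :: 'u ring \<Rightarrow> _)"
  unfolding is_witt_ring_def
proof (intro conjI allI impI, goal_cases)
  case (1 A) then show ?case by (rule nonunital_cring_model[OF inf S])
next
  case (2 A) then show ?case by simp
next
  case (3 A)
  then show ?case
    using witt_ghost_closed[OF 3 S] model_ghost[OF S 3]
    by (intro nu_ring_homI) (auto simp: fun_eq_iff witt_ghost_def simp del: PiE_iff)
next
  case (4 A B h)
  then have h: "nonunital_cring A" "nonunital_cring B" "h \<in> nu_ring_hom A B" by auto
  show ?case
    by (rule nu_ring_homI) (simp_all add: vec_map_in[OF _ nu_ring_homD(2)[OF h(3)]] model_nat[OF h] del: PiE_iff)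
qed

lemma is_witt_ring_witt_ring:
  assumes "infinite (UNIV :: 'u set)" "divisor_stable S"
  shows "is_witt_ring S (witt_ring S :: 'u ring \<Rightarrow> _)"
  unfolding witt_ring_def by (rule someI[where P = "is_witt_ring S"]) (rule is_witt_ring_model[OF assms])

section \<open>The system of Witt vector rings of a ring without unit\<close>

lemma ds_subset_ds: "S \<preceq>\<^sub>d T \<Longrightarrow> divisor_stable S" "S \<preceq>\<^sub>d T \<Longrightarrow> S \<subseteq> T"
  by (simp_all add: ds_subset_def)

lemma quot_mem: "\<nu> \<in> S /\<^sub>d p \<Longrightarrow> p * \<nu> \<in> S" "\<nu> \<in> S /\<^sub>d p \<Longrightarrow> \<nu> \<in> S" "S /\<^sub>d p \<subseteq> S"
  by (auto simp: set_quot_def mult.commute)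

lemma quot_memI: "divisor_stable S \<Longrightarrow> p * \<nu> \<in> S \<Longrightarrow> \<nu> \<in> S /\<^sub>d p"
  using ds_dvd[of S "p * \<nu>" \<nu>] by (simp add: set_quot_def mult.commute)

lemma quot_quot:
  assumes "divisor_stable S" shows "(S /\<^sub>d p) /\<^sub>d l = S /\<^sub>d (p * l)"
proof -
  have "\<nu> \<in> S" "\<nu> * p \<in> S" "\<nu> * l \<in> S" if "\<nu> * (p * l) \<in> S" for \<nu>
    by (rule ds_dvd[OF assms that]; simp add: mult_dvd_mono)+
  then show ?thesis by (auto simp: set_quot_def mult_ac)
qed

lemma ghost_restrict:
  assumes A: "nonunital_cring A" and S: "divisor_stable S'" "S' \<subseteq> S" "n \<in> S'" and a: "a \<in> S \<rightarrow>\<^sub>E carrier A"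
  shows "witt_ghost S' A (restrict a S') n = witt_ghost S A a n"
proof -
  interpret A: nonunital_cring A by (rule A)
  have "d \<in> S'" "a d \<in> carrier A" if "d dvd n" for d
    using ds_dvd[OF S(1,3) that] S(2) a by auto
  then show ?thesis
    using S by (auto simp: witt_ghost_def subsetD intro!: A.finsum_cong')
qed

lemma vec_map_restrict: "S' \<subseteq> S \<Longrightarrow> vec_map S' h (restrict a S') = restrict (vec_map S h a) S'"
  by (auto simp: vec_map_def restrict_def fun_eq_iff)

lemma restrict_in: "a \<in> S \<rightarrow>\<^sub>E D \<Longrightarrow> S' \<subseteq> S \<Longrightarrow> restrict a S' \<in> S' \<rightarrow>\<^sub>E D"
  by auto

context
  assumes inf: "infinite (UNIV :: 'u set)"
begin

lemma nonunital_witt_ring: "divisor_stable S \<Longrightarrow> nonunital_cring (A :: 'u ring) \<Longrightarrow> nonunital_cring (witt_ring S A)"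
  and carrier_witt_ring: "divisor_stable S \<Longrightarrow> nonunital_cring (A :: 'u ring) \<Longrightarrow> carrier (witt_ring S A) = S \<rightarrow>\<^sub>E carrier A"
  and witt_ghost_hom: "divisor_stable S \<Longrightarrow> nonunital_cring (A :: 'u ring) \<Longrightarrow>
    witt_ghost S A \<in> nu_ring_hom (witt_ring S A) (power_ring S A)"
  using is_witt_ring_witt_ring[OF inf] unfolding is_witt_ring_def by blast+

lemma vec_map_witt_hom: "divisor_stable S \<Longrightarrow> nonunital_cring (A :: 'u ring) \<Longrightarrow> nonunital_cring (B :: 'u ring) \<Longrightarrow>
    h \<in> nu_ring_hom A B \<Longrightarrow> vec_map S h \<in> nu_ring_hom (witt_ring S A) (witt_ring S B)"
  using is_witt_ring_witt_ring[OF inf] unfolding is_witt_ring_def by blast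

lemma witt_ghost_component_hom:
  assumes "divisor_stable S" "nonunital_cring (A :: 'u ring)" "n \<in> S"
  shows "(\<lambda>x. witt_ghost S A x n) \<in> nu_ring_hom (witt_ring S A) A"
  using nu_ring_homD[OF witt_ghost_hom[OF assms(1,2)]] assms(3)
  by (intro nu_ring_homI) (auto simp: PiE_iff)

lemma nonunital_GR: "nonunital_cring (GR :: 'u ring)"
  by (rule nonunital_cring_GR[OF inf])

lemma witt_vector_eqI_generic:
  assumes "divisor_stable S" "a \<in> S \<rightarrow>\<^sub>E carrier (GR :: 'u ring)" "b \<in> S \<rightarrow>\<^sub>E carrier GR"
    and "\<And>n. n \<in> S \<Longrightarrow> witt_ghost S GR a n = witt_ghost S GR b n"
  shows "a = b"
  by (rule witt_ghost_inj[OF nonunital_GR torsion_free_GR[OF inf] assms(1-3)])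
    (rule witt_ghost_ext[OF assms(4)])

text \<open>Two natural operations agree on all rings if they have the same ghost components on the
  generic ring: ghost components are injective there, and every family of vectors is the
  image of the generic one under a homomorphism.\<close>

lemma witt_identity:
  fixes A :: "'u ring" and f g :: "'u ring \<Rightarrow> (nat \<Rightarrow> nat \<Rightarrow> 'u) \<Rightarrow> nat \<Rightarrow> 'u"
  assumes S': "divisor_stable S'" and A: "nonunital_cring A"
    and closed: "\<And>Y. (\<And>k. Y k \<in> S \<rightarrow>\<^sub>E carrier GR) \<Longrightarrow> f GR Y \<in> S' \<rightarrow>\<^sub>E carrier GR"
      "\<And>Y. (\<And>k. Y k \<in> S \<rightarrow>\<^sub>E carrier GR) \<Longrightarrow> g GR Y \<in> S' \<rightarrow>\<^sub>E carrier GR"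
    and ghost: "\<And>Y n. (\<And>k. Y k \<in> S \<rightarrow>\<^sub>E carrier GR) \<Longrightarrow> n \<in> S' \<Longrightarrow>
      witt_ghost S' GR (f GR Y) n = witt_ghost S' GR (g GR Y) n"
    and nat: "\<And>h Y. h \<in> nu_ring_hom GR A \<Longrightarrow> (\<And>k. Y k \<in> S \<rightarrow>\<^sub>E carrier GR) \<Longrightarrow>
      vec_map S' h (f GR Y) = f A (\<lambda>k. vec_map S h (Y k))"
      "\<And>h Y. h \<in> nu_ring_hom GR A \<Longrightarrow> (\<And>k. Y k \<in> S \<rightarrow>\<^sub>E carrier GR) \<Longrightarrow>
      vec_map S' h (g GR Y) = g A (\<lambda>k. vec_map S h (Y k))"
    and x: "\<And>k. x k \<in> S \<rightarrow>\<^sub>E carrier A"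
  shows "f A x = g A x"
proof -
  obtain h where h: "h \<in> nu_ring_hom (GR :: 'u ring) A" "\<forall>k. vec_map S h (GX S k) = x k"
    using GR_cover[of A x S, OF inf A x] by blast
  have "f GR (GX S) = g GR (GX S)"
    by (rule witt_vector_eqI_generic[OF S' closed(1) closed(2) ghost]) (rule GX_in)+
  then have "vec_map S' h (f GR (GX S)) = vec_map S' h (g GR (GX S))" by simp
  then show ?thesis using nat[of h "GX S", OF h(1) GX_in] h(2) by simp
qed

lemma witt_ring_zero:
  assumes S: "divisor_stable S" and A: "nonunital_cring (A :: 'u ring)"
  shows "\<zero>\<^bsub>witt_ring S A\<^esub> = (\<lambda>n\<in>S. \<zero>\<^bsub>A\<^esub>)"
proof -
  note z = abelian_monoid.zero_closed[OF abelian_group.axioms(1)[OF nu_abelian]]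
  show ?thesis
  proof (rule witt_identity[where f = "\<lambda>A _. \<zero>\<^bsub>witt_ring S A\<^esub>" and g = "\<lambda>A _. \<lambda>n\<in>S. \<zero>\<^bsub>A\<^esub>"
        and S = S and x = "\<lambda>_. \<lambda>n\<in>S. \<zero>\<^bsub>A\<^esub>", OF S A])
    show "\<zero>\<^bsub>witt_ring S (GR :: 'u ring)\<^esub> \<in> S \<rightarrow>\<^sub>E carrier GR"
      using z[OF nonunital_witt_ring[OF S nonunital_GR]] by (simp add: carrier_witt_ring[OF S nonunital_GR])
    show "(\<lambda>n\<in>S. \<zero>\<^bsub>GR :: 'u ring\<^esub>) \<in> S \<rightarrow>\<^sub>E carrier GR" by auto
  next
    fix n assume n: "n \<in> S"
    have "witt_ghost S GR \<zero>\<^bsub>witt_ring S GR\<^esub> n = \<zero>\<^bsub>GR :: 'u ring\<^esub>"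
      using add_hom_zero[OF nu_abelian nu_abelian nu_ring_homD(1)[OF witt_ghost_component_hom]] S n nonunital_GR nonunital_witt_ring
      by blast
    then show "witt_ghost S GR \<zero>\<^bsub>witt_ring S GR\<^esub> n = witt_ghost S (GR :: 'u ring) (\<lambda>n\<in>S. \<zero>\<^bsub>GR\<^esub>) n"
      using witt_ghost_zero[OF S nonunital_GR n] by simp
  next
    fix h assume h: "h \<in> nu_ring_hom (GR :: 'u ring) A"
    show "vec_map S h \<zero>\<^bsub>witt_ring S GR\<^esub> = \<zero>\<^bsub>witt_ring S A\<^esub>"
      by (rule add_hom_zero[OF nu_abelian nu_abelian nu_ring_homD(1)[OF vec_map_witt_hom[OF S nonunital_GR A h]]])
        (rule nonunital_witt_ring S nonunital_GR A)+
    show "vec_map S h (\<lambda>n\<in>S. \<zero>\<^bsub>GR\<^esub>) = (\<lambda>n\<in>S. \<zero>\<^bsub>A\<^esub>)"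
      using add_hom_zero[OF nu_abelian[OF nonunital_GR] nu_abelian[OF A] nu_ring_homD(1)[OF h]]
      by (simp add: vec_map_def cong: restrict_cong)
  qed (use z[OF A] in \<open>auto\<close>)
qed

lemma frob_op:
  assumes S: "divisor_stable S" and A: "nonunital_cring (A :: 'u ring)" and p: "p \<in> S"
    and a: "a \<in> S \<rightarrow>\<^sub>E carrier A"
  shows "vop (frob_poly p) A S (S /\<^sub>d p) (\<lambda>_. a) \<in> S /\<^sub>d p \<rightarrow>\<^sub>E carrier A"
    and "\<nu> \<in> S /\<^sub>d p \<Longrightarrow> witt_ghost (S /\<^sub>d p) A (vop (frob_poly p) A S (S /\<^sub>d p) (\<lambda>_. a)) \<nu> = witt_ghost S A a (p * \<nu>)"
proof -
  show "vop (frob_poly p) A S (S /\<^sub>d p) (\<lambda>_. a) \<in> S /\<^sub>d p \<rightarrow>\<^sub>E carrier A"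
    by (rule vop_closed[OF A a])
  assume \<nu>: "\<nu> \<in> S /\<^sub>d p"
  have S': "divisor_stable (S /\<^sub>d p)" using ds_quot[OF S p] .
  have 0: "p > 0" "\<nu> > 0" using ds_pos[OF S p] ds_pos[OF S' \<nu>] .
  have "witt_ghost (S /\<^sub>d p) A (vop (frob_poly p) A S (S /\<^sub>d p) (\<lambda>_. a)) \<nu>
      = nev A (asg A S (\<lambda>_. a)) (ghost (frob_poly p) \<nu>)"
    by (rule vop_ghost[OF A S' a frob_poly(2)[OF 0(1)] \<nu>])
  also have "\<dots> = witt_ghost S A a (p * \<nu>)"
    unfolding frob_poly(1)[OF 0] by (rule nev_ghost_X[OF A S a quot_mem(1)[OF \<nu>]])
  finally show "witt_ghost (S /\<^sub>d p) A (vop (frob_poly p) A S (S /\<^sub>d p) (\<lambda>_. a)) \<nu> = witt_ghost S A a (p * \<nu>)" .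
qed

lemma witt_ring_closed:
  assumes "divisor_stable S" "nonunital_cring (A :: 'u ring)" "x \<in> S \<rightarrow>\<^sub>E carrier A" "y \<in> S \<rightarrow>\<^sub>E carrier A"
  shows "x \<oplus>\<^bsub>witt_ring S A\<^esub> y \<in> S \<rightarrow>\<^sub>E carrier A" "x \<otimes>\<^bsub>witt_ring S A\<^esub> y \<in> S \<rightarrow>\<^sub>E carrier A"
  using abelian_monoid.a_closed[OF abelian_group.axioms(1)[OF nu_abelian[OF nonunital_witt_ring[OF assms(1,2)]]], of x y]
    nonunital_cring.nu_m_closed[OF nonunital_witt_ring[OF assms(1,2)], of x y] assms(3,4)
  by (simp_all only: carrier_witt_ring[OF assms(1,2)])

lemma witt_ghost_ops:
  assumes "divisor_stable S" "nonunital_cring (A :: 'u ring)" "x \<in> S \<rightarrow>\<^sub>E carrier A" "y \<in> S \<rightarrow>\<^sub>E carrier A"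
    and "n \<in> S"
  shows "witt_ghost S A (x \<oplus>\<^bsub>witt_ring S A\<^esub> y) n = witt_ghost S A x n \<oplus>\<^bsub>A\<^esub> witt_ghost S A y n"
    "witt_ghost S A (x \<otimes>\<^bsub>witt_ring S A\<^esub> y) n = witt_ghost S A x n \<otimes>\<^bsub>A\<^esub> witt_ghost S A y n"
  using nu_ring_homD(3,4)[OF witt_ghost_component_hom[OF assms(1,2,5)], of x y] assms(3,4)
  by (simp_all only: carrier_witt_ring[OF assms(1,2)])

lemma vec_map_witt_ops:
  assumes S: "divisor_stable S" and A: "nonunital_cring (A :: 'u ring)" and B: "nonunital_cring (B :: 'u ring)"
    and h: "h \<in> nu_ring_hom A B" and x: "x \<in> S \<rightarrow>\<^sub>E carrier A" "y \<in> S \<rightarrow>\<^sub>E carrier A"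
  shows "vec_map S h (x \<oplus>\<^bsub>witt_ring S A\<^esub> y) = vec_map S h x \<oplus>\<^bsub>witt_ring S B\<^esub> vec_map S h y"
    "vec_map S h (x \<otimes>\<^bsub>witt_ring S A\<^esub> y) = vec_map S h x \<otimes>\<^bsub>witt_ring S B\<^esub> vec_map S h y"
  using nu_ring_homD(3,4)[OF vec_map_witt_hom[OF S A B h], of x y] x by (simp_all only: carrier_witt_ring[OF S A])

text \<open>A natural map between vector rings which acts on ghost components by sums and products
  is a ring homomorphism.\<close>

lemma witt_hom_by_ghost:
  fixes f :: "'u ring \<Rightarrow> (nat \<Rightarrow> 'u) \<Rightarrow> nat \<Rightarrow> 'u"
  assumes S: "divisor_stable S" and S': "divisor_stable S'" and A: "nonunital_cring A"
    and closed: "\<And>B a. nonunital_cring B \<Longrightarrow> a \<in> S \<rightarrow>\<^sub>E carrier B \<Longrightarrow> f B a \<in> S' \<rightarrow>\<^sub>E carrier B"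
    and nat: "\<And>h a. h \<in> nu_ring_hom GR A \<Longrightarrow> a \<in> S \<rightarrow>\<^sub>E carrier GR \<Longrightarrow> vec_map S' h (f GR a) = f A (vec_map S h a)"
    and add: "\<And>a b n. a \<in> S \<rightarrow>\<^sub>E carrier GR \<Longrightarrow> b \<in> S \<rightarrow>\<^sub>E carrier GR \<Longrightarrow> n \<in> S' \<Longrightarrow>
       witt_ghost S' GR (f GR (a \<oplus>\<^bsub>witt_ring S GR\<^esub> b)) n
         = witt_ghost S' GR (f GR a) n \<oplus>\<^bsub>GR\<^esub> witt_ghost S' GR (f GR b) n"
  shows "f A \<in> add_hom (witt_ring S A) (witt_ring S' A)"
    and "(\<And>a b n. a \<in> S \<rightarrow>\<^sub>E carrier GR \<Longrightarrow> b \<in> S \<rightarrow>\<^sub>E carrier GR \<Longrightarrow> n \<in> S' \<Longrightarrow>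
       witt_ghost S' GR (f GR (a \<otimes>\<^bsub>witt_ring S GR\<^esub> b)) n
         = witt_ghost S' GR (f GR a) n \<otimes>\<^bsub>GR\<^esub> witt_ghost S' GR (f GR b) n) \<Longrightarrow>
       f A \<in> nu_ring_hom (witt_ring S A) (witt_ring S' A)"
proof -
  note G = nonunital_GR
  note Gc = closed[OF G]
  have a: "f A (x \<oplus>\<^bsub>witt_ring S A\<^esub> y) = f A x \<oplus>\<^bsub>witt_ring S' A\<^esub> f A y"
    if xy: "x \<in> S \<rightarrow>\<^sub>E carrier A" "y \<in> S \<rightarrow>\<^sub>E carrier A" for x y
  proof -
    have "f A (two x y 0 \<oplus>\<^bsub>witt_ring S A\<^esub> two x y 1) = f A (two x y 0) \<oplus>\<^bsub>witt_ring S' A\<^esub> f A (two x y 1)"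
      by (rule witt_identity[where f = "\<lambda>A Y. f A (Y 0 \<oplus>\<^bsub>witt_ring S A\<^esub> Y 1)"
            and g = "\<lambda>A Y. f A (Y 0) \<oplus>\<^bsub>witt_ring S' A\<^esub> f A (Y 1)" and S = S, OF S' A])
        (simp_all only: witt_ring_closed[OF S G] witt_ring_closed[OF S' G] Gc witt_ghost_ops[OF S' G] add
          nat vec_map_witt_ops[OF S G A] vec_map_witt_ops[OF S' G A] two_in[OF xy])
    then show ?thesis by simp
  qed
  then show "f A \<in> add_hom (witt_ring S A) (witt_ring S' A)"
    by (intro add_homI) (simp_all only: carrier_witt_ring[OF S A] carrier_witt_ring[OF S' A] closed[OF A])
  assume mult: "\<And>a b n. a \<in> S \<rightarrow>\<^sub>E carrier GR \<Longrightarrow> b \<in> S \<rightarrow>\<^sub>E carrier GR \<Longrightarrow> n \<in> S' \<Longrightarrow>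
       witt_ghost S' GR (f GR (a \<otimes>\<^bsub>witt_ring S GR\<^esub> b)) n
         = witt_ghost S' GR (f GR a) n \<otimes>\<^bsub>GR\<^esub> witt_ghost S' GR (f GR b) n"
  have m: "f A (x \<otimes>\<^bsub>witt_ring S A\<^esub> y) = f A x \<otimes>\<^bsub>witt_ring S' A\<^esub> f A y"
    if xy: "x \<in> S \<rightarrow>\<^sub>E carrier A" "y \<in> S \<rightarrow>\<^sub>E carrier A" for x y
  proof -
    have "f A (two x y 0 \<otimes>\<^bsub>witt_ring S A\<^esub> two x y 1) = f A (two x y 0) \<otimes>\<^bsub>witt_ring S' A\<^esub> f A (two x y 1)"
      by (rule witt_identity[where f = "\<lambda>A Y. f A (Y 0 \<otimes>\<^bsub>witt_ring S A\<^esub> Y 1)"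
            and g = "\<lambda>A Y. f A (Y 0) \<otimes>\<^bsub>witt_ring S' A\<^esub> f A (Y 1)" and S = S, OF S' A])
        (simp_all only: witt_ring_closed[OF S G] witt_ring_closed[OF S' G] Gc witt_ghost_ops[OF S' G] mult
          nat vec_map_witt_ops[OF S G A] vec_map_witt_ops[OF S' G A] two_in[OF xy])
    then show ?thesis by simp
  qed
  with a show "f A \<in> nu_ring_hom (witt_ring S A) (witt_ring S' A)"
    by (intro nu_ring_homI) (simp_all only: carrier_witt_ring[OF S A] carrier_witt_ring[OF S' A] closed[OF A])
qed

lemma is_witt_frob_witt_frob:
  assumes S: "divisor_stable S" and p: "p \<in> S"
  shows "is_witt_frob p S (witt_frob p S :: 'u ring \<Rightarrow> _)"
proof -
  have S': "divisor_stable (S /\<^sub>d p)" using ds_quot[OF S p] .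
  let ?F = "\<lambda>A :: 'u ring. \<lambda>a. vop (frob_poly p) A S (S /\<^sub>d p) (\<lambda>_. a)"
  have nat: "vec_map (S /\<^sub>d p) h (?F A a) = ?F B (vec_map S h a)"
    if "nonunital_cring A" "nonunital_cring B" "h \<in> nu_ring_hom A B" "a \<in> S \<rightarrow>\<^sub>E carrier A" for A B h a
    using vop_nat[OF that(1-3), of "\<lambda>_. a" S] that(4) by simp
  have hom: "?F A \<in> nu_ring_hom (witt_ring S A) (witt_ring (S /\<^sub>d p) A)" if A: "nonunital_cring A" for A
    by (rule witt_hom_by_ghost(2)[OF S S' A])
      (simp_all only: frob_op[OF S _ p] nat nonunital_GR A witt_ring_closed[OF S] witt_ghost_ops[OF S] quot_mem)
  have gh: "witt_ghost (S /\<^sub>d p) A (?F A a) = (\<lambda>\<nu>\<in>S /\<^sub>d p. witt_ghost S A a (p * \<nu>))"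
    if A: "nonunital_cring A" and a: "a \<in> S \<rightarrow>\<^sub>E carrier A" for A a
  proof
    fix \<nu>
    show "witt_ghost (S /\<^sub>d p) A (?F A a) \<nu> = (\<lambda>\<nu>\<in>S /\<^sub>d p. witt_ghost S A a (p * \<nu>)) \<nu>"
      using frob_op(2)[OF S A p a] by (cases "\<nu> \<in> S /\<^sub>d p") (simp, simp add: witt_ghost_def)
  qed
  have "is_witt_frob p S ?F"
    unfolding is_witt_frob_def by (auto simp: carrier_witt_ring[OF S] hom gh simp del: PiE_iff intro!: nat[symmetric])
  then show ?thesis unfolding witt_frob_def by (rule someI[where P = "is_witt_frob p S"])
qed

lemma witt_frob_hom:
  assumes "divisor_stable S" "p \<in> S" "nonunital_cring (A :: 'u ring)"
  shows "witt_frob p S A \<in> nu_ring_hom (witt_ring S A) (witt_ring (S /\<^sub>d p) A)"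
  using is_witt_frob_witt_frob[OF assms(1,2)] assms(3) unfolding is_witt_frob_def by blast

lemma witt_frob_closed:
  assumes "divisor_stable S" "p \<in> S" "nonunital_cring (A :: 'u ring)" "a \<in> S \<rightarrow>\<^sub>E carrier A"
  shows "witt_frob p S A a \<in> S /\<^sub>d p \<rightarrow>\<^sub>E carrier A"
  using nu_ring_homD(2)[OF witt_frob_hom[OF assms(1-3)], of a] assms(4)
  by (simp only: carrier_witt_ring assms(1,3) ds_quot[OF assms(1,2)])

lemma witt_frob_ghost:
  assumes "divisor_stable S" "p \<in> S" "nonunital_cring (A :: 'u ring)" "a \<in> S \<rightarrow>\<^sub>E carrier A" "\<nu> \<in> S /\<^sub>d p"
  shows "witt_ghost (S /\<^sub>d p) A (witt_frob p S A a) \<nu> = witt_ghost S A a (p * \<nu>)"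
proof -
  have "witt_ghost (S /\<^sub>d p) A (witt_frob p S A a) = (\<lambda>\<nu>\<in>S /\<^sub>d p. witt_ghost S A a (p * \<nu>))"
    using is_witt_frob_witt_frob[OF assms(1,2)] assms(3,4) carrier_witt_ring[OF assms(1,3)]
    unfolding is_witt_frob_def by blast
  then show ?thesis using assms(5) by simp
qed

lemma witt_frob_nat:
  assumes "divisor_stable S" "p \<in> S" "nonunital_cring (A :: 'u ring)" "nonunital_cring (B :: 'u ring)"
    "h \<in> nu_ring_hom A B" "a \<in> S \<rightarrow>\<^sub>E carrier A"
  shows "vec_map (S /\<^sub>d p) h (witt_frob p S A a) = witt_frob p S B (vec_map S h a)"
  using is_witt_frob_witt_frob[OF assms(1,2)] assms(3-) carrier_witt_ring[OF assms(1,3)]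
  unfolding is_witt_frob_def by metis

lemma witt_ver_closed:
  assumes "divisor_stable S" "p \<in> S" "nonunital_cring (A :: 'u ring)" "a \<in> S /\<^sub>d p \<rightarrow>\<^sub>E carrier A"
  shows "witt_ver p S A a \<in> S \<rightarrow>\<^sub>E carrier A"
proof -
  interpret A: nonunital_cring A by fact
  have "\<mu> div p \<in> S /\<^sub>d p" if "\<mu> \<in> S" "p dvd \<mu>" for \<mu>
    using that by (intro quot_memI assms) auto
  then have "a (\<mu> div p) \<in> carrier A" if "\<mu> \<in> S" "p dvd \<mu>" for \<mu>
    using assms(4) that by (blast dest: PiE_mem)
  then show ?thesis by (auto simp: witt_ver_def)
qed

text \<open>Only the divisors of \<open>n\<close> that are multiples of \<open>p\<close> contribute to the sum.\<close>

lemma witt_ver_ghost: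
  assumes S: "divisor_stable S" and p: "p \<in> S" and A: "nonunital_cring (A :: 'u ring)"
    and a: "a \<in> S /\<^sub>d p \<rightarrow>\<^sub>E carrier A" and n: "n \<in> S"
  shows "witt_ghost S A (witt_ver p S A a) n =
    (if p dvd n then [p] \<cdot>\<^bsub>A\<^esub> witt_ghost (S /\<^sub>d p) A a (n div p) else \<zero>\<^bsub>A\<^esub>)"
proof -
  interpret A: nonunital_cring A by (rule A)
  note np0 = nu_pow_zero[OF S A]
  have p0: "p > 0" using ds_pos[OF S p] .
  have S': "divisor_stable (S /\<^sub>d p)" using ds_quot[OF S p] .
  let ?t = "\<lambda>d. [d] \<cdot>\<^bsub>A\<^esub> nu_pow A (witt_ver p S A a d) (n div d)"
  have vc: "?t d \<in> carrier A" if "d dvd n" for d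
    using PiE_mem[OF witt_ver_closed[OF S p A a] ds_dvd[OF S n that]] by simp
  have v0: "?t d = \<zero>\<^bsub>A\<^esub>" if "d dvd n" "\<not> p dvd d" for d
    using that ds_dvd[OF S n that(1)] by (simp add: witt_ver_def np0)
  show ?thesis
  proof (cases "p dvd n")
    case False
    then have "?t d = \<zero>\<^bsub>A\<^esub>" if "d dvd n" for d using v0[OF that] that dvd_trans by blast
    then have "witt_ghost S A (witt_ver p S A a) n = \<zero>\<^bsub>A\<^esub>"
      using n by (auto simp: witt_ghost_def intro!: A.add.finprod_one_eqI)
    then show ?thesis using False by simp
  next
    case True
    then obtain m where m: "n = p * m" by blast
    have mS: "m \<in> S /\<^sub>d p" using quot_memI[OF S] n m by simp
    have m0: "m > 0" using ds_pos[OF S' mS] .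
    have ae: "a e \<in> carrier A" if "e dvd m" for e using a ds_dvd[OF S' mS that] by auto
    have vc': "?t (p * e) \<in> carrier A" if "e dvd m" for e by (rule vc) (use m that in simp)
    have "witt_ghost S A (witt_ver p S A a) n = finsum A ?t {d. d dvd n}"
      using n by (simp add: witt_ghost_def)
    also have "\<dots> = finsum A ?t ((*) p ` {e. e dvd m})"
    proof (rule A.add.finprod_mono_neutral_cong_right)
      show "finite {d. d dvd n}" using ds_finite[OF S n] .
      show "?t d = \<zero>\<^bsub>A\<^esub>" if d: "d \<in> {d. d dvd n} - (*) p ` {e. e dvd m}" for d
      proof (rule v0)
        show "d dvd n" using d by auto
        show "\<not> p dvd d"
        proof
          assume "p dvd d"
          then obtain e where "d = p * e" by blast
          with d m p0 show False by auto
        qed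
      qed
    qed (use m vc in auto)
    also have "\<dots> = finsum A (\<lambda>e. ?t (p * e)) {e. e dvd m}"
      by (rule A.finsum_reindex) (use vc' p0 in \<open>auto simp: inj_on_def\<close>)
    also have "\<dots> = finsum A (\<lambda>e. [p] \<cdot>\<^bsub>A\<^esub> ([e] \<cdot>\<^bsub>A\<^esub> nu_pow A (a e) (m div e))) {e. e dvd m}"
    proof (rule A.finsum_cong')
      fix e assume e: "e \<in> {e. e dvd m}"
      then have "p * e \<in> S" using ds_dvd[OF S n] m by auto
      then have "witt_ver p S A a (p * e) = a e" using p0 by (simp add: witt_ver_def)
      moreover have "n div (p * e) = m div e" using m p0 by simp
      ultimately show "?t (p * e) = [p] \<cdot>\<^bsub>A\<^esub> ([e] \<cdot>\<^bsub>A\<^esub> nu_pow A (a e) (m div e))"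
        using ae e by (simp add: A.add.nat_pow_pow mult.commute)
    qed (use ae in auto)
    also have "\<dots> = [p] \<cdot>\<^bsub>A\<^esub> finsum A (\<lambda>e. [e] \<cdot>\<^bsub>A\<^esub> nu_pow A (a e) (m div e)) {e. e dvd m}"
      by (rule add_hom_finsum[OF nu_abelian[OF A] nu_abelian[OF A], symmetric])
        (use ae in \<open>auto intro!: add_homI simp: A.add.nat_pow_distrib\<close>)
    also have "\<dots> = [p] \<cdot>\<^bsub>A\<^esub> witt_ghost (S /\<^sub>d p) A a m"
      using mS by (simp add: witt_ghost_def)
    finally show ?thesis using True m p0 by simp
  qed
qed

lemma witt_ver_nat:
  assumes S: "divisor_stable S" "p \<in> S" and A: "nonunital_cring (A :: 'u ring)" "nonunital_cring (B :: 'u ring)"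
    and h: "h \<in> nu_ring_hom A B"
  shows "vec_map S h (witt_ver p S A a) = witt_ver p S B (vec_map (S /\<^sub>d p) h a)"
proof -
  have "\<mu> div p \<in> S /\<^sub>d p" if "\<mu> \<in> S" "p dvd \<mu>" for \<mu>
    using that by (intro quot_memI S) auto
  then show ?thesis
    using add_hom_zero[OF nu_abelian[OF A(1)] nu_abelian[OF A(2)] nu_ring_homD(1)[OF h]]
    by (auto simp: vec_map_def witt_ver_def fun_eq_iff)
qed

lemma witt_ver_hom:
  assumes S: "divisor_stable S" and p: "p \<in> S" and A: "nonunital_cring (A :: 'u ring)"
  shows "witt_ver p S A \<in> add_hom (witt_ring (S /\<^sub>d p) A) (witt_ring S A)"
proof (rule witt_hom_by_ghost(1)[OF ds_quot[OF S p] S A])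
  note S' = ds_quot[OF S p]
  interpret G: nonunital_cring "GR :: 'u ring" by (rule nonunital_GR)
  fix a b :: "nat \<Rightarrow> 'u" and n assume ab: "a \<in> S /\<^sub>d p \<rightarrow>\<^sub>E carrier GR" "b \<in> S /\<^sub>d p \<rightarrow>\<^sub>E carrier GR" and n: "n \<in> S"
  have c: "witt_ghost (S /\<^sub>d p) GR x (n div p) \<in> carrier GR" if "p dvd n" "x \<in> S /\<^sub>d p \<rightarrow>\<^sub>E carrier GR" for x :: "nat \<Rightarrow> 'u"
    using witt_ghost_closed[OF nonunital_GR S' that(2)] quot_memI[OF S, of p "n div p"] n that(1) by (simp add: PiE_iff)
  have "n div p \<in> S /\<^sub>d p" if "p dvd n" using quot_memI[OF S, of p "n div p"] n that by simp
  then show "witt_ghost S GR (witt_ver p S GR (a \<oplus>\<^bsub>witt_ring (S /\<^sub>d p) GR\<^esub> b)) n =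
    witt_ghost S GR (witt_ver p S GR a) n \<oplus>\<^bsub>GR\<^esub> witt_ghost S GR (witt_ver p S GR b) n"
    using c ab n
    by (simp add: witt_ver_ghost[OF S p nonunital_GR] witt_ring_closed[OF S' nonunital_GR] witt_ghost_ops[OF S' nonunital_GR]
        G.add.nat_pow_distrib del: PiE_iff GR_simps)
qed (simp_all only: witt_ver_closed[OF S p] witt_ver_nat[OF S p nonunital_GR A])

lemma restrict_witt_hom:
  assumes S: "divisor_stable S" and S': "divisor_stable S'" "S' \<subseteq> S" and A: "nonunital_cring (A :: 'u ring)"
  shows "(\<lambda>a. restrict a S') \<in> nu_ring_hom (witt_ring S A) (witt_ring S' A)"
  by (rule witt_hom_by_ghost(2)[OF S S'(1) A])
    (simp_all only: restrict_in[OF _ S'(2)] vec_map_restrict[OF S'(2)] ghost_restrict[OF nonunital_GR S']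
      witt_ring_closed[OF S nonunital_GR] witt_ghost_ops[OF S nonunital_GR] subsetD[OF S'(2)])

end

lemma set_prime_to_ds:
  assumes S: "divisor_stable S" and p: "prime p"
  shows "divisor_stable (set_prime_to S p)"
proof -
  have "1 \<in> set_prime_to S p" using ds_one[OF S] p by (simp add: set_prime_to_def prime_nat_iff)
  moreover have "d \<in> set_prime_to S p" if "n \<in> set_prime_to S p" "d dvd n" for n d
    using that ds_dvd[OF S, of n d] dvd_trans[of p d n] by (auto simp: set_prime_to_def)
  moreover have "0 \<notin> set_prime_to S p" by (simp add: set_prime_to_def)
  ultimately show ?thesis unfolding divisor_stable_def by blast
qed

definition witt_system :: "'u ring \<Rightarrow> (nat \<Rightarrow> 'u) rfv_system" where
  "witt_system A = \<lparr>Ring_at = (\<lambda>S. witt_ring S A), Trans = (\<lambda>S S' a. restrict a S'),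
     Frob = (\<lambda>p S. witt_frob p S A), Ver = (\<lambda>p S. witt_ver p S A)\<rparr>"

lemma witt_system_simps [simp]:
  "Ring_at (witt_system A) S = witt_ring S A" "Trans (witt_system A) S S' a = restrict a S'"
  "Frob (witt_system A) p S = witt_frob p S A" "Ver (witt_system A) p S = witt_ver p S A"
  by (simp_all add: witt_system_def)

text \<open>The component at \<open>n\<close> of the glued vector is found on the set of divisors of \<open>n\<close>, which is the
  smallest divisor stable set containing \<open>n\<close>.\<close>

lemma ex1_vector_from_finite:
  assumes S: "divisor_stable S"
    and x: "\<And>S0. S0 \<preceq>\<^sub>d S \<Longrightarrow> finite S0 \<Longrightarrow> x S0 \<in> S0 \<rightarrow>\<^sub>E D"
    and r: "\<And>S0 S1. S0 \<preceq>\<^sub>d S \<Longrightarrow> finite S0 \<Longrightarrow> S1 \<preceq>\<^sub>d S0 \<Longrightarrow> restrict (x S0) S1 = x S1"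
  shows "\<exists>!a. a \<in> S \<rightarrow>\<^sub>E D \<and> (\<forall>S0. S0 \<preceq>\<^sub>d S \<and> finite S0 \<longrightarrow> restrict a S0 = x S0)"
proof -
  let ?D = "\<lambda>n :: nat. {d. d dvd n}"
  have D: "?D n \<preceq>\<^sub>d S0" if "divisor_stable S0" "n \<in> S0" for n S0
    using ds_pos[OF that] ds_dvd[OF that] unfolding ds_subset_def divisor_stable_def
    by (auto intro: dvd_trans)
  have fD: "finite (?D n)" if "n \<in> S" for n using ds_finite[OF S that] .
  show ?thesis
  proof (rule ex1I)
    let ?a = "\<lambda>n\<in>S. x (?D n) n"
    have "x (?D n) n \<in> D" if "n \<in> S" for n
      using x[OF D[OF S that] fD[OF that]] by (rule PiE_mem) simp
    moreover have "restrict ?a S0 = x S0" if S0: "S0 \<preceq>\<^sub>d S" "finite S0" for S0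
    proof -
      have "?a n = x S0 n" if n: "n \<in> S0" for n
        using fun_cong[OF r[OF S0 D[OF ds_subset_ds(1)[OF S0(1)] n]], of n] n ds_subset_ds(2)[OF S0(1)] by auto
      then have "restrict ?a S0 = restrict (x S0) S0" by (intro restrict_ext) 
      then show ?thesis using x[OF S0] by (simp add: PiE_restrict)
    qed
    ultimately show "?a \<in> S \<rightarrow>\<^sub>E D \<and> (\<forall>S0. S0 \<preceq>\<^sub>d S \<and> finite S0 \<longrightarrow> restrict ?a S0 = x S0)" by auto
    fix b assume b: "b \<in> S \<rightarrow>\<^sub>E D \<and> (\<forall>S0. S0 \<preceq>\<^sub>d S \<and> finite S0 \<longrightarrow> restrict b S0 = x S0)"
    have "b n = ?a n" if n: "n \<in> S" for n
    proof -
      have "restrict b (?D n) = x (?D n)" using b D[OF S n] fD[OF n] by blast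
      from fun_cong[OF this, of n] show ?thesis using n by simp
    qed
    then show "b = ?a" using b by (intro ext) (metis PiE_arb restrict_apply)
  qed
qed

context
  assumes inf: "infinite (UNIV :: 'u set)"
begin

context
  fixes A :: "'u ring"
  assumes A: "nonunital_cring A"
begin

lemma witt_identity_unary:
  assumes S: "divisor_stable S" and S': "divisor_stable S'" and a: "a \<in> S \<rightarrow>\<^sub>E carrier A"
    and closed: "\<And>x. x \<in> S \<rightarrow>\<^sub>E carrier GR \<Longrightarrow> f GR x \<in> S' \<rightarrow>\<^sub>E carrier GR"
      "\<And>x. x \<in> S \<rightarrow>\<^sub>E carrier GR \<Longrightarrow> g GR x \<in> S' \<rightarrow>\<^sub>E carrier GR"
    and ghost: "\<And>x n. x \<in> S \<rightarrow>\<^sub>E carrier GR \<Longrightarrow> n \<in> S' \<Longrightarrow>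
      witt_ghost S' GR (f GR x) n = witt_ghost S' GR (g GR x) n"
    and nat: "\<And>h x. h \<in> nu_ring_hom GR A \<Longrightarrow> x \<in> S \<rightarrow>\<^sub>E carrier GR \<Longrightarrow>
        vec_map S' h (f GR x) = f A (vec_map S h x)"
      "\<And>h x. h \<in> nu_ring_hom GR A \<Longrightarrow> x \<in> S \<rightarrow>\<^sub>E carrier GR \<Longrightarrow>
        vec_map S' h (g GR x) = g A (vec_map S h x)"
  shows "f A a = g (A :: 'u ring) a"
  by (rule witt_identity[OF inf S' A, of S "\<lambda>A Y. f A (Y 0)" "\<lambda>A Y. g A (Y 0)" "\<lambda>_. a"])
    (simp_all only: closed ghost nat a)

lemma frob_frob_commute:
  assumes S: "divisor_stable S" and pl: "prime p" "prime l" "p * l \<in> S" and a: "a \<in> S \<rightarrow>\<^sub>E carrier A"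
  shows "witt_frob l (S /\<^sub>d p) A (witt_frob p S A a) = witt_frob p (S /\<^sub>d l) A (witt_frob l S A a)"
proof (rule witt_identity_unary[OF S _ a, where S' = "S /\<^sub>d (p * l)" and f = "\<lambda>A a. witt_frob l (S /\<^sub>d p) A (witt_frob p S A a)"
      and g = "\<lambda>A a. witt_frob p (S /\<^sub>d l) A (witt_frob l S A a)"])
  show "divisor_stable (S /\<^sub>d (p * l))" by (rule ds_quot[OF S pl(3)])
  note G = nonunital_GR[OF inf]
  have p: "p \<in> S" "l \<in> S" "l \<in> S /\<^sub>d p" "p \<in> S /\<^sub>d l"
    using ds_dvd[OF S pl(3)] quot_memI[OF S pl(3)] quot_memI[OF S, of l p] pl(3) by (auto simp: mult.commute)
  note Sp = ds_quot[OF S p(1)] and Sl = ds_quot[OF S p(2)]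
  note q1 = quot_quot[OF S, of p l] and q2 = quot_quot[OF S, of l p, unfolded mult.commute[of l p]]
  fix x :: "nat \<Rightarrow> 'u" assume x: "x \<in> S \<rightarrow>\<^sub>E carrier GR"
  note Fp = witt_frob_closed[OF inf S p(1) G x] and Fl = witt_frob_closed[OF inf S p(2) G x]
  show "witt_frob l (S /\<^sub>d p) GR (witt_frob p S GR x) \<in> S /\<^sub>d (p * l) \<rightarrow>\<^sub>E carrier GR"
    using witt_frob_closed[OF inf Sp p(3) G Fp] unfolding q1 .
  show "witt_frob p (S /\<^sub>d l) GR (witt_frob l S GR x) \<in> S /\<^sub>d (p * l) \<rightarrow>\<^sub>E carrier GR"
    using witt_frob_closed[OF inf Sl p(4) G Fl] unfolding q2 .
  { fix n assume n: "n \<in> S /\<^sub>d (p * l)"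
    then have n1: "n \<in> S /\<^sub>d p /\<^sub>d l" "n \<in> S /\<^sub>d l /\<^sub>d p" by (simp_all only: q1 q2)
    show "witt_ghost (S /\<^sub>d (p * l)) GR (witt_frob l (S /\<^sub>d p) GR (witt_frob p S GR x)) n =
        witt_ghost (S /\<^sub>d (p * l)) GR (witt_frob p (S /\<^sub>d l) GR (witt_frob l S GR x)) n"
      using witt_frob_ghost[OF inf Sp p(3) G Fp n1(1)] witt_frob_ghost[OF inf Sl p(4) G Fl n1(2)]
        witt_frob_ghost[OF inf S p(1) G x quot_mem(1)[OF n1(1)]] witt_frob_ghost[OF inf S p(2) G x quot_mem(1)[OF n1(2)]]
      unfolding q1 q2 by (simp add: mult.left_commute) }
  { fix h assume h: "h \<in> nu_ring_hom (GR :: 'u ring) A"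
    show "vec_map (S /\<^sub>d (p * l)) h (witt_frob l (S /\<^sub>d p) GR (witt_frob p S GR x)) =
         witt_frob l (S /\<^sub>d p) A (witt_frob p S A (vec_map S h x))"
      using witt_frob_nat[OF inf Sp p(3) G A h Fp] witt_frob_nat[OF inf S p(1) G A h x] unfolding q1 by simp
    show "vec_map (S /\<^sub>d (p * l)) h (witt_frob p (S /\<^sub>d l) GR (witt_frob l S GR x)) =
         witt_frob p (S /\<^sub>d l) A (witt_frob l S A (vec_map S h x))"
      using witt_frob_nat[OF inf Sl p(4) G A h Fl] witt_frob_nat[OF inf S p(2) G A h x] unfolding q2 by simp }
qed

lemma restrict_frob:
  assumes S: "divisor_stable S2" and S1: "divisor_stable S1" "S1 \<subseteq> S2" and p: "p \<in> S1" and a: "a \<in> S2 \<rightarrow>\<^sub>E carrier A"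
  shows "restrict (witt_frob p S2 A a) (S1 /\<^sub>d p) = witt_frob p S1 A (restrict a S1)"
proof (rule witt_identity_unary[OF S _ a, where S' = "S1 /\<^sub>d p" and f = "\<lambda>A a. restrict (witt_frob p S2 A a) (S1 /\<^sub>d p)"
      and g = "\<lambda>A a. witt_frob p S1 A (restrict a S1)"])
  have p2: "p \<in> S2" using p S1 by auto
  show S1': "divisor_stable (S1 /\<^sub>d p)" by (rule ds_quot[OF S1(1) p])
  note S2' = ds_quot[OF S p2]
  have sub: "S1 /\<^sub>d p \<subseteq> S2 /\<^sub>d p" using S1(2) by (auto simp: set_quot_def)
  note G = nonunital_GR[OF inf]
  fix x :: "nat \<Rightarrow> 'u" assume x: "x \<in> S2 \<rightarrow>\<^sub>E carrier GR"
  note F2 = witt_frob_closed[OF inf S p2 G x] and R = restrict_in[OF x S1(2)]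
  show "restrict (witt_frob p S2 GR x) (S1 /\<^sub>d p) \<in> S1 /\<^sub>d p \<rightarrow>\<^sub>E carrier GR" by (rule restrict_in[OF F2 sub])
  show "witt_frob p S1 GR (restrict x S1) \<in> S1 /\<^sub>d p \<rightarrow>\<^sub>E carrier GR" by (rule witt_frob_closed[OF inf S1(1) p G R])
  { fix n assume n: "n \<in> S1 /\<^sub>d p"
    show "witt_ghost (S1 /\<^sub>d p) GR (restrict (witt_frob p S2 GR x) (S1 /\<^sub>d p)) n
      = witt_ghost (S1 /\<^sub>d p) GR (witt_frob p S1 GR (restrict x S1)) n"
      using ghost_restrict[OF G S1' sub n F2] witt_frob_ghost[OF inf S p2 G x subsetD[OF sub n]]
        witt_frob_ghost[OF inf S1(1) p G R n] ghost_restrict[OF G S1 quot_mem(1)[OF n] x] by simp }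
  { fix h assume h: "h \<in> nu_ring_hom (GR :: 'u ring) A"
    show "vec_map (S1 /\<^sub>d p) h (restrict (witt_frob p S2 GR x) (S1 /\<^sub>d p)) =
       restrict (witt_frob p S2 A (vec_map S2 h x)) (S1 /\<^sub>d p)"
      using vec_map_restrict[OF sub, of h] witt_frob_nat[OF inf S p2 G A h x] by simp
    show "vec_map (S1 /\<^sub>d p) h (witt_frob p S1 GR (restrict x S1)) = witt_frob p S1 A (restrict (vec_map S2 h x) S1)"
      using witt_frob_nat[OF inf S1(1) p G A h R] vec_map_restrict[OF S1(2), of h] by simp }
qed

lemma restrict_ver:
  assumes S: "divisor_stable S2" and S1: "divisor_stable S1" "S1 \<subseteq> S2"
  shows "restrict (witt_ver p S2 A a) S1 = witt_ver p S1 A (restrict a (S1 /\<^sub>d p))"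
proof
  fix n
  have "n div p \<in> S1 /\<^sub>d p" if "n \<in> S1" "p dvd n" using that by (intro quot_memI[OF S1(1)]) auto
  then show "restrict (witt_ver p S2 A a) S1 n = witt_ver p S1 A (restrict a (S1 /\<^sub>d p)) n"
    using S1(2) by (auto simp: witt_ver_def)
qed

lemma ver_ver_commute:
  assumes S: "divisor_stable S" and pl: "p > 0" "l > 0"
  shows "witt_ver p S A (witt_ver l (S /\<^sub>d p) A a) = witt_ver l S A (witt_ver p (S /\<^sub>d l) A a)"
proof
  fix n
  have q: "m div k \<in> S /\<^sub>d k" if "m \<in> S" "k dvd m" for m k
    using that by (intro quot_memI[OF S]) auto
  have "p dvd n \<and> l dvd n div p \<longleftrightarrow> l * p dvd n" for p l :: nat
  proof (cases "p = 0")
    case False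
    then show ?thesis using dvd_div_iff_mult[of p n l] dvd_mult_right[of l p n] by blast
  qed auto
  then have "p dvd n \<and> l dvd n div p \<longleftrightarrow> l dvd n \<and> p dvd n div l" by (simp add: mult.commute)
  moreover have "n div p div l = n div l div p" by (simp flip: div_mult2_eq add: mult.commute)
  ultimately show "witt_ver p S A (witt_ver l (S /\<^sub>d p) A a) n = witt_ver l S A (witt_ver p (S /\<^sub>d l) A a) n"
    using q by (auto simp: witt_ver_def)
qed

lemma witt_multiple_power:
  assumes S: "divisor_stable S" and B: "nonunital_cring (B :: 'u ring)" and x: "x \<in> S \<rightarrow>\<^sub>E carrier B"
  shows "[(k::nat)] \<cdot>\<^bsub>witt_ring S B\<^esub> x \<in> S \<rightarrow>\<^sub>E carrier B" "nu_pow (witt_ring S B) x k \<in> S \<rightarrow>\<^sub>E carrier B"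
    "n \<in> S \<Longrightarrow> witt_ghost S B ([(k::nat)] \<cdot>\<^bsub>witt_ring S B\<^esub> x) n = [k] \<cdot>\<^bsub>B\<^esub> witt_ghost S B x n"
    "n \<in> S \<Longrightarrow> witt_ghost S B (nu_pow (witt_ring S B) x k) n = nu_pow B (witt_ghost S B x n) k"
proof -
  note W = nonunital_witt_ring[OF inf S B]
  interpret W: nonunital_cring "witt_ring S B" by (rule W)
  have x': "x \<in> carrier (witt_ring S B)" using x carrier_witt_ring[OF inf S B] by simp
  show "[(k::nat)] \<cdot>\<^bsub>witt_ring S B\<^esub> x \<in> S \<rightarrow>\<^sub>E carrier B" "nu_pow (witt_ring S B) x k \<in> S \<rightarrow>\<^sub>E carrier B"
    using W.add.nat_pow_closed[OF x', of k] W.nu_pow_closed[OF x', of k] carrier_witt_ring[OF inf S B] by simp_all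
  assume n: "n \<in> S"
  note h = witt_ghost_component_hom[OF inf S B n]
  show "witt_ghost S B ([(k::nat)] \<cdot>\<^bsub>witt_ring S B\<^esub> x) n = [k] \<cdot>\<^bsub>B\<^esub> witt_ghost S B x n"
    by (rule add_hom_nat_pow[OF nu_abelian[OF W] nu_abelian[OF B] nu_ring_homD(1)[OF h] x'])
  show "witt_ghost S B (nu_pow (witt_ring S B) x k) n = nu_pow B (witt_ghost S B x n) k"
    by (rule nu_ring_hom_pow[OF W h x'])
qed

lemma witt_multiple_power_nat:
  assumes S: "divisor_stable S" and h: "h \<in> nu_ring_hom (GR :: 'u ring) A" and x: "x \<in> S \<rightarrow>\<^sub>E carrier GR"
  shows "vec_map S h ([(k::nat)] \<cdot>\<^bsub>witt_ring S GR\<^esub> x) = [k] \<cdot>\<^bsub>witt_ring S A\<^esub> vec_map S h x"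
    "vec_map S h (nu_pow (witt_ring S GR) x k) = nu_pow (witt_ring S A) (vec_map S h x) k"
proof -
  note G = nonunital_GR[OF inf]
  have x': "x \<in> carrier (witt_ring S GR)" using x carrier_witt_ring[OF inf S G] by simp
  note hW = vec_map_witt_hom[OF inf S G A h]
  show "vec_map S h ([(k::nat)] \<cdot>\<^bsub>witt_ring S GR\<^esub> x) = [k] \<cdot>\<^bsub>witt_ring S A\<^esub> vec_map S h x"
    by (rule add_hom_nat_pow[OF nu_abelian[OF nonunital_witt_ring[OF inf S G]] nu_abelian[OF nonunital_witt_ring[OF inf S A]] nu_ring_homD(1)[OF hW] x'])
  show "vec_map S h (nu_pow (witt_ring S GR) x k) = nu_pow (witt_ring S A) (vec_map S h x) k"
    by (rule nu_ring_hom_pow[OF nonunital_witt_ring[OF inf S G] hW x'])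
qed

lemma frob_ver:
  assumes S: "divisor_stable S" and p: "p \<in> S" and a: "a \<in> S /\<^sub>d p \<rightarrow>\<^sub>E carrier A"
  shows "witt_frob p S A (witt_ver p S A a) = [p] \<cdot>\<^bsub>witt_ring (S /\<^sub>d p) A\<^esub> a"
proof (rule witt_identity_unary[OF _ _ a, where S' = "S /\<^sub>d p" and f = "\<lambda>A a. witt_frob p S A (witt_ver p S A a)"
      and g = "\<lambda>A a. [p] \<cdot>\<^bsub>witt_ring (S /\<^sub>d p) A\<^esub> a"])
  show S': "divisor_stable (S /\<^sub>d p)" "divisor_stable (S /\<^sub>d p)" by (rule ds_quot[OF S p])+
  note G = nonunital_GR[OF inf]
  fix x :: "nat \<Rightarrow> 'u" assume x: "x \<in> S /\<^sub>d p \<rightarrow>\<^sub>E carrier GR"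
  note V = witt_ver_closed[OF inf S p G x]
  show "witt_frob p S GR (witt_ver p S GR x) \<in> S /\<^sub>d p \<rightarrow>\<^sub>E carrier GR" by (rule witt_frob_closed[OF inf S p G V])
  show "[p] \<cdot>\<^bsub>witt_ring (S /\<^sub>d p) GR\<^esub> x \<in> S /\<^sub>d p \<rightarrow>\<^sub>E carrier GR" by (rule witt_multiple_power(1)[OF S'(1) G x])
  { fix n assume n: "n \<in> S /\<^sub>d p"
    show "witt_ghost (S /\<^sub>d p) GR (witt_frob p S GR (witt_ver p S GR x)) n =
        witt_ghost (S /\<^sub>d p) GR ([p] \<cdot>\<^bsub>witt_ring (S /\<^sub>d p) GR\<^esub> x) n"
      using witt_frob_ghost[OF inf S p G V n] witt_ver_ghost[OF inf S p G x quot_mem(1)[OF n]] ds_pos[OF S p]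
        witt_multiple_power(3)[OF S'(1) G x n] by simp }
  { fix h assume h: "h \<in> nu_ring_hom (GR :: 'u ring) A"
    show "vec_map (S /\<^sub>d p) h (witt_frob p S GR (witt_ver p S GR x)) =
        witt_frob p S A (witt_ver p S A (vec_map (S /\<^sub>d p) h x))"
      using witt_frob_nat[OF inf S p G A h V] witt_ver_nat[OF inf S p G A h, of x] by simp
    show "vec_map (S /\<^sub>d p) h ([p] \<cdot>\<^bsub>witt_ring (S /\<^sub>d p) GR\<^esub> x) =
        [p] \<cdot>\<^bsub>witt_ring (S /\<^sub>d p) A\<^esub> vec_map (S /\<^sub>d p) h x" by (rule witt_multiple_power_nat(1)[OF S'(1) h x]) }
qed

lemma frob_ver_commute:
  assumes S: "divisor_stable S" and pl: "prime p" "prime l" "l \<noteq> p" "p * l \<in> S" and a: "a \<in> S /\<^sub>d p \<rightarrow>\<^sub>E carrier A"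
  shows "witt_frob l S A (witt_ver p S A a) = witt_ver p (S /\<^sub>d l) A (witt_frob l (S /\<^sub>d p) A a)"
proof (rule witt_identity_unary[OF _ _ a, where S' = "S /\<^sub>d l" and f = "\<lambda>A a. witt_frob l S A (witt_ver p S A a)"
      and g = "\<lambda>A a. witt_ver p (S /\<^sub>d l) A (witt_frob l (S /\<^sub>d p) A a)"])
  note G = nonunital_GR[OF inf]
  have p: "p \<in> S" "l \<in> S" "l \<in> S /\<^sub>d p" "p \<in> S /\<^sub>d l"
    using ds_dvd[OF S pl(4)] quot_memI[OF S pl(4)] quot_memI[OF S, of l p] pl(4) by (auto simp: mult.commute)
  show Sp: "divisor_stable (S /\<^sub>d p)" and Sl: "divisor_stable (S /\<^sub>d l)" by (rule ds_quot[OF S] p)+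
  have q: "S /\<^sub>d p /\<^sub>d l = S /\<^sub>d l /\<^sub>d p" by (simp add: quot_quot[OF S] mult.commute)
  fix x :: "nat \<Rightarrow> 'u" assume x: "x \<in> S /\<^sub>d p \<rightarrow>\<^sub>E carrier GR"
  note V = witt_ver_closed[OF inf S p(1) G x] and F = witt_frob_closed[OF inf Sp p(3) G x, unfolded q]
  show "witt_frob l S GR (witt_ver p S GR x) \<in> S /\<^sub>d l \<rightarrow>\<^sub>E carrier GR" by (rule witt_frob_closed[OF inf S p(2) G V])
  show "witt_ver p (S /\<^sub>d l) GR (witt_frob l (S /\<^sub>d p) GR x) \<in> S /\<^sub>d l \<rightarrow>\<^sub>E carrier GR"
    by (rule witt_ver_closed[OF inf Sl p(4) G F])
  { fix n assume n: "n \<in> S /\<^sub>d l"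
    have "coprime p l" using pl by (simp add: primes_coprime)
    then have d: "p dvd l * n \<longleftrightarrow> p dvd n" by (simp add: coprime_dvd_mult_right_iff)
    show "witt_ghost (S /\<^sub>d l) GR (witt_frob l S GR (witt_ver p S GR x)) n =
        witt_ghost (S /\<^sub>d l) GR (witt_ver p (S /\<^sub>d l) GR (witt_frob l (S /\<^sub>d p) GR x)) n"
    proof (cases "p dvd n")
      case False
      then show ?thesis
        using witt_frob_ghost[OF inf S p(2) G V n] witt_ver_ghost[OF inf S p(1) G x quot_mem(1)[OF n]]
          witt_ver_ghost[OF inf Sl p(4) G F n] d by simp
    next
      case True
      then have m: "n div p \<in> S /\<^sub>d l /\<^sub>d p" using quot_memI[OF Sl, of p "n div p"] n by simp
      have "l * n div p = l * (n div p)" using True by (simp add: div_mult_swap)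
      then show ?thesis
        using True witt_frob_ghost[OF inf S p(2) G V n] witt_ver_ghost[OF inf S p(1) G x quot_mem(1)[OF n]]
          witt_ver_ghost[OF inf Sl p(4) G F n] witt_frob_ghost[OF inf Sp p(3) G x, unfolded q, OF m] d by simp
    qed }
  { fix h assume h: "h \<in> nu_ring_hom (GR :: 'u ring) A"
    show "vec_map (S /\<^sub>d l) h (witt_frob l S GR (witt_ver p S GR x)) =
        witt_frob l S A (witt_ver p S A (vec_map (S /\<^sub>d p) h x))"
      using witt_frob_nat[OF inf S p(2) G A h V] witt_ver_nat[OF inf S p(1) G A h, of x] by simp
    show "vec_map (S /\<^sub>d l) h (witt_ver p (S /\<^sub>d l) GR (witt_frob l (S /\<^sub>d p) GR x)) =
        witt_ver p (S /\<^sub>d l) A (witt_frob l (S /\<^sub>d p) A (vec_map (S /\<^sub>d p) h x))"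
      using witt_ver_nat[OF inf Sl p(4) G A h, of "witt_frob l (S /\<^sub>d p) GR x"] witt_frob_nat[OF inf Sp p(3) G A h x] by (simp add: q) }
qed

text \<open>The required element is given by the polynomials \<open>rem_poly p\<close>, which exist by \<open>dwork_remainder\<close>.\<close>

lemma witt_frob_congruence:
  assumes S: "divisor_stable S" and p: "prime p" "p \<in> S" and a: "a \<in> S \<rightarrow>\<^sub>E carrier A"
  shows "\<exists>b\<in>S /\<^sub>d p \<rightarrow>\<^sub>E carrier A. witt_frob p S A a = nu_pow (witt_ring (S /\<^sub>d p) A) (restrict a (S /\<^sub>d p)) p
     \<oplus>\<^bsub>witt_ring (S /\<^sub>d p) A\<^esub> [p] \<cdot>\<^bsub>witt_ring (S /\<^sub>d p) A\<^esub> b"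
proof (rule bexI)
  let ?S = "S /\<^sub>d p"
  let ?r = "\<lambda>(A :: 'u ring) a. vop (rem_poly p) A S ?S (\<lambda>_. a)"
  note G = nonunital_GR[OF inf]
  show "?r A a \<in> ?S \<rightarrow>\<^sub>E carrier A" by (rule vop_closed[OF A a])
  show "witt_frob p S A a = nu_pow (witt_ring ?S A) (restrict a ?S) p \<oplus>\<^bsub>witt_ring ?S A\<^esub> [p] \<cdot>\<^bsub>witt_ring ?S A\<^esub> ?r A a"
  proof (rule witt_identity_unary[OF S _ a, where S' = "?S" and f = "\<lambda>A a. witt_frob p S A a"
      and g = "\<lambda>A a. nu_pow (witt_ring ?S A) (restrict a ?S) p \<oplus>\<^bsub>witt_ring ?S A\<^esub> [p] \<cdot>\<^bsub>witt_ring ?S A\<^esub> ?r A a"])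
    show S': "divisor_stable ?S" by (rule ds_quot[OF S p(2)])
    fix x :: "nat \<Rightarrow> 'u" assume x: "x \<in> S \<rightarrow>\<^sub>E carrier GR"
    note R = restrict_in[OF x quot_mem(3), of p]
    have r: "?r GR x \<in> ?S \<rightarrow>\<^sub>E carrier GR" by (rule vop_closed[OF G x])
    note P = witt_multiple_power(2)[OF S' G R, of p] and M = witt_multiple_power(1)[OF S' G r, of p]
    show "witt_frob p S GR x \<in> ?S \<rightarrow>\<^sub>E carrier GR" by (rule witt_frob_closed[OF inf S p(2) G x])
    show "nu_pow (witt_ring ?S GR) (restrict x ?S) p \<oplus>\<^bsub>witt_ring ?S GR\<^esub> [p] \<cdot>\<^bsub>witt_ring ?S GR\<^esub> ?r GR x \<in> ?S \<rightarrow>\<^sub>E carrier GR"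
      by (rule witt_ring_closed(1)[OF inf S' G P M])
    { fix n assume n: "n \<in> ?S"
      have n0: "n > 0" "p > 0" using ds_pos[OF S' n] ds_pos[OF S p(2)] .
      interpret G: nonunital_cring "GR :: 'u ring" by (rule G)
      let ?v = "asg GR S (\<lambda>_. x)"
      have v: "?v i \<in> carrier GR" for i by (rule asg_closed[OF G x])
      have "ghost (X 0) (p * n) = ghost (X 0) n ^ p + of_nat p * ghost (rem_poly p) n"
        using rem_poly(1)[OF p(1) n0(1)] by (simp add: algebra_simps)
      then have "nev GR ?v (ghost (X 0) (p * n)) = nev GR ?v (ghost (X 0) n ^ p) \<oplus>\<^bsub>GR\<^esub> nev GR ?v (of_nat p * ghost (rem_poly p) n)"
        using G.nev_add[of ?v "ghost (X 0) n ^ p" "of_nat p * ghost (rem_poly p) n", OF v] by (simp only:)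
      also have "nev GR ?v (ghost (X 0) n ^ p) = nu_pow GR (nev GR ?v (ghost (X 0) n)) p"
        by (rule G.nev_power[of ?v, OF v]) (use n0 in auto)
      also have "nev GR ?v (of_nat p * ghost (rem_poly p) n) = [p] \<cdot>\<^bsub>GR\<^esub> nev GR ?v (ghost (rem_poly p) n)"
        by (rule G.nev_of_nat_mult[of ?v, OF v])
      finally have "witt_ghost S GR x (p * n) = nu_pow GR (witt_ghost S GR x n) p \<oplus>\<^bsub>GR\<^esub> [p] \<cdot>\<^bsub>GR\<^esub> witt_ghost ?S GR (?r GR x) n"
        using nev_ghost_X[of GR S "\<lambda>_. x" _ 0, OF G S x] quot_mem(1,2)[OF n]
          vop_ghost[of GR ?S "\<lambda>_. x" S "rem_poly p" n, OF G S' x rem_poly(2)[OF p(1)] n] by (simp only:)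
      then show "witt_ghost ?S GR (witt_frob p S GR x) n = witt_ghost ?S GR
          (nu_pow (witt_ring ?S GR) (restrict x ?S) p \<oplus>\<^bsub>witt_ring ?S GR\<^esub> [p] \<cdot>\<^bsub>witt_ring ?S GR\<^esub> ?r GR x) n"
        using witt_frob_ghost[OF inf S p(2) G x n] witt_ghost_ops(1)[OF inf S' G P M n] witt_multiple_power(4)[OF S' G R n, of p]
          witt_multiple_power(3)[OF S' G r n, of p] ghost_restrict[OF G S' quot_mem(3) n x] by (simp only:) }
    { fix h assume h: "h \<in> nu_ring_hom (GR :: 'u ring) A"
      show "vec_map ?S h (witt_frob p S GR x) = witt_frob p S A (vec_map S h x)"
        by (rule witt_frob_nat[OF inf S p(2) G A h x])
      show "vec_map ?S h (nu_pow (witt_ring ?S GR) (restrict x ?S) p \<oplus>\<^bsub>witt_ring ?S GR\<^esub> [p] \<cdot>\<^bsub>witt_ring ?S GR\<^esub> ?r GR x) =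
        nu_pow (witt_ring ?S A) (restrict (vec_map S h x) ?S) p \<oplus>\<^bsub>witt_ring ?S A\<^esub> [p] \<cdot>\<^bsub>witt_ring ?S A\<^esub> ?r A (vec_map S h x)"
        using vec_map_witt_ops(1)[OF inf S' G A h P M] witt_multiple_power_nat(1)[OF S' h r, of p] witt_multiple_power_nat(2)[OF S' h R, of p]
          vec_map_restrict[OF quot_mem(3)[of S p], of h x] vop_nat[of GR A h "\<lambda>_. x" S ?S "rem_poly p", OF G A h x] by (simp only:) }
  qed
qed

lemma witt_ver_exact:
  assumes S: "divisor_stable S" and p: "prime p" "p \<in> S"
  shows "inj_on (witt_ver p S A) (S /\<^sub>d p \<rightarrow>\<^sub>E carrier A)"
    and "witt_ver p S A ` (S /\<^sub>d p \<rightarrow>\<^sub>E carrier A) =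
       {a \<in> S \<rightarrow>\<^sub>E carrier A. restrict a (set_prime_to S p) = (\<lambda>n\<in>set_prime_to S p. \<zero>\<^bsub>A\<^esub>)}"
    and "(\<lambda>a. restrict a (set_prime_to S p)) ` (S \<rightarrow>\<^sub>E carrier A) = set_prime_to S p \<rightarrow>\<^sub>E carrier A"
proof -
  interpret A: nonunital_cring A by (rule A)
  have p0: "p > 0" using ds_pos[OF S p(2)] .
  have V: "witt_ver p S A a (p * \<nu>) = a \<nu>" if "\<nu> \<in> S /\<^sub>d p" for a \<nu>
    using quot_mem(1)[OF that] p0 by (simp add: witt_ver_def)
  show "inj_on (witt_ver p S A) (S /\<^sub>d p \<rightarrow>\<^sub>E carrier A)"
  proof (rule inj_onI)
    fix a b assume ab: "a \<in> S /\<^sub>d p \<rightarrow>\<^sub>E carrier A" "b \<in> S /\<^sub>d p \<rightarrow>\<^sub>E carrier A"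
      and e: "witt_ver p S A a = witt_ver p S A b"
    show "a = b" using V[of _ a] V[of _ b] unfolding e by (intro PiE_ext[OF ab]) simp
  qed
  have sub: "set_prime_to S p \<subseteq> S" by (auto simp: set_prime_to_def)
  show "witt_ver p S A ` (S /\<^sub>d p \<rightarrow>\<^sub>E carrier A) =
       {a \<in> S \<rightarrow>\<^sub>E carrier A. restrict a (set_prime_to S p) = (\<lambda>n\<in>set_prime_to S p. \<zero>\<^bsub>A\<^esub>)}" (is "?L = ?R")
  proof
    show "?L \<subseteq> ?R"
    proof
      fix b assume "b \<in> ?L"
      then obtain a where a: "a \<in> S /\<^sub>d p \<rightarrow>\<^sub>E carrier A" and b: "b = witt_ver p S A a" by auto
      have "b n = \<zero>\<^bsub>A\<^esub>" if "n \<in> set_prime_to S p" for n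
        using that by (simp add: b witt_ver_def set_prime_to_def)
      then show "b \<in> ?R" using witt_ver_closed[OF inf S p(2) A a] b by (auto intro: restrict_ext)
    qed
    show "?R \<subseteq> ?L"
    proof
      fix b assume b: "b \<in> ?R"
      let ?a = "\<lambda>\<nu>\<in>S /\<^sub>d p. b (p * \<nu>)"
      have bc: "b \<in> S \<rightarrow>\<^sub>E carrier A" using b by simp
      have a: "?a \<in> S /\<^sub>d p \<rightarrow>\<^sub>E carrier A" using PiE_mem[OF bc quot_mem(1)] by simp
      have "b = witt_ver p S A ?a"
      proof (rule PiE_ext[OF bc witt_ver_closed[OF inf S p(2) A a]])
        fix n assume n: "n \<in> S"
        show "b n = witt_ver p S A ?a n"
        proof (cases "p dvd n")
          case True
          then have "n div p \<in> S /\<^sub>d p" using n by (intro quot_memI[OF S]) simp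
          then show ?thesis using True n by (simp add: witt_ver_def)
        next
          case False
          then have "n \<in> set_prime_to S p" using n by (simp add: set_prime_to_def)
          moreover have "restrict b (set_prime_to S p) n = (\<lambda>n\<in>set_prime_to S p. \<zero>\<^bsub>A\<^esub>) n" using b by simp
          ultimately show ?thesis using False n by (simp add: witt_ver_def)
        qed
      qed
      then show "b \<in> ?L" using a by (intro image_eqI)
    qed
  qed
  show "(\<lambda>a. restrict a (set_prime_to S p)) ` (S \<rightarrow>\<^sub>E carrier A) = set_prime_to S p \<rightarrow>\<^sub>E carrier A" (is "?L = ?R")
  proof
    show "?L \<subseteq> ?R" using restrict_in[OF _ sub] by blast
    show "?R \<subseteq> ?L"
    proof
      fix b assume b: "b \<in> ?R"
      let ?a = "\<lambda>n\<in>S. if n \<in> set_prime_to S p then b n else \<zero>\<^bsub>A\<^esub>"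
      have a: "?a \<in> S \<rightarrow>\<^sub>E carrier A" using PiE_mem[OF b] by simp
      have e: "restrict ?a (set_prime_to S p) = b"
      proof
        fix n show "restrict ?a (set_prime_to S p) n = b n"
          using PiE_arb[OF b] sub by (cases "n \<in> set_prime_to S p") auto
      qed
      show "b \<in> ?L" by (rule image_eqI[OF _ a]) (rule e[symmetric])
    qed
  qed
qed

theorem RFV_object_witt_system: "RFV_object T (witt_system A)"
proof -
  note S = ds_subset_ds(1)
  have tr: "divisor_stable S'" "S' \<subseteq> S" if "S' \<preceq>\<^sub>d S" for S' S using ds_subset_ds[OF that] .
  have quot: "S /\<^sub>d p \<preceq>\<^sub>d S" if "S \<preceq>\<^sub>d T" "p \<in> S" for S p
    using ds_quot[OF S[OF that(1)] that(2)] quot_mem(3) by (simp add: ds_subset_def)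
  have prime_to: "divisor_stable (set_prime_to S p)" if "S \<preceq>\<^sub>d T" "prime p" for S p
    by (rule set_prime_to_ds[OF S[OF that(1)] that(2)])
  have ps: "projective_system T (witt_system A)"
    unfolding projective_system_def witt_system_simps
  proof (intro conjI allI impI ballI; (elim conjE)?)
    fix S S' assume s: "S \<preceq>\<^sub>d T" "S' \<preceq>\<^sub>d S"
    show "(\<lambda>a. restrict a S') \<in> nu_ring_hom (witt_ring S A) (witt_ring S' A)"
      by (rule restrict_witt_hom[OF inf tr(1)[OF s(1)] tr[OF s(2)] A])
  next
    fix S S' S'' a assume s: "S \<preceq>\<^sub>d T" "S' \<preceq>\<^sub>d S" "S'' \<preceq>\<^sub>d S'" "a \<in> carrier (witt_ring S A)"
    show "restrict (restrict a S') S'' = restrict a S''" using tr(2)[OF s(3)] by (simp add: Int_absorb1)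
  qed (use nonunital_witt_ring[OF inf tr(1) A] carrier_witt_ring[OF inf tr(1) A] in \<open>auto simp: PiE_restrict\<close>)
  have cs: "continuous_system T (witt_system A)"
    unfolding continuous_system_def witt_system_simps
  proof (intro allI impI, elim conjE)
    fix S x assume s: "S \<preceq>\<^sub>d T" and x: "\<forall>S0. S0 \<preceq>\<^sub>d S \<and> finite S0 \<longrightarrow> x S0 \<in> carrier (witt_ring S0 A)"
      "\<forall>S0 S1. S0 \<preceq>\<^sub>d S \<and> finite S0 \<and> S1 \<preceq>\<^sub>d S0 \<longrightarrow> restrict (x S0) S1 = x S1"
    have "x S0 \<in> S0 \<rightarrow>\<^sub>E carrier A" if "S0 \<preceq>\<^sub>d S" "finite S0" for S0
      using x(1) that carrier_witt_ring[OF inf tr(1)[OF that(1)] A] by auto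
    from ex1_vector_from_finite[OF tr(1)[OF s], of x "carrier A", OF this] x(2)
    show "\<exists>!a. a \<in> carrier (witt_ring S A) \<and> (\<forall>S0. S0 \<preceq>\<^sub>d S \<and> finite S0 \<longrightarrow> restrict a S0 = x S0)"
      unfolding carrier_witt_ring[OF inf tr(1)[OF s] A] by blast
  qed
  show ?thesis
    unfolding RFV_object_def witt_system_simps
  proof (intro conjI allI impI ps cs; (elim conjE)?)
    fix p S assume s: "prime p" "p \<in> S" "S \<preceq>\<^sub>d T"
    note dS = S[OF s(3)] and dS' = ds_quot[OF S[OF s(3)] s(2)]
    note car = carrier_witt_ring[OF inf dS A] carrier_witt_ring[OF inf dS' A] carrier_witt_ring[OF inf prime_to[OF s(3,1)] A]
    show "witt_frob p S A \<in> nu_ring_hom (witt_ring S A) (witt_ring (S /\<^sub>d p) A)" by (rule witt_frob_hom[OF inf dS s(2) A])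
    show "witt_ver p S A \<in> add_hom (witt_ring (S /\<^sub>d p) A) (witt_ring S A)" by (rule witt_ver_hom[OF inf dS s(2) A])
    show "\<forall>a\<in>carrier (witt_ring S A). \<exists>b\<in>carrier (witt_ring (S /\<^sub>d p) A).
        witt_frob p S A a = nu_pow (witt_ring (S /\<^sub>d p) A) (restrict a (S /\<^sub>d p)) p
          \<oplus>\<^bsub>witt_ring (S /\<^sub>d p) A\<^esub> [p] \<cdot>\<^bsub>witt_ring (S /\<^sub>d p) A\<^esub> b"
      unfolding car by (intro ballI witt_frob_congruence[OF dS s(1,2)])
    show "\<forall>a\<in>carrier (witt_ring (S /\<^sub>d p) A). witt_frob p S A (witt_ver p S A a) = [p] \<cdot>\<^bsub>witt_ring (S /\<^sub>d p) A\<^esub> a"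
      unfolding car by (intro ballI frob_ver[OF dS s(2)])
    show "inj_on (witt_ver p S A) (carrier (witt_ring (S /\<^sub>d p) A))"
      unfolding car by (rule witt_ver_exact(1)[OF dS s(1,2)])
    show "witt_ver p S A ` carrier (witt_ring (S /\<^sub>d p) A) =
        {a \<in> carrier (witt_ring S A). restrict a (set_prime_to S p) = \<zero>\<^bsub>witt_ring (set_prime_to S p) A\<^esub>}"
      unfolding car witt_ring_zero[OF inf prime_to[OF s(3,1)] A] by (rule witt_ver_exact(2)[OF dS s(1,2)])
    show "(\<lambda>a. restrict a (set_prime_to S p)) ` carrier (witt_ring S A) = carrier (witt_ring (set_prime_to S p) A)"
      unfolding car by (rule witt_ver_exact(3)[OF dS s(1,2)])
  next
    fix p S1 S2 assume s: "prime p" "p \<in> S1" "S1 \<preceq>\<^sub>d S2" "S2 \<preceq>\<^sub>d T"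
    have p2: "p \<in> S2" using tr(2)[OF s(3)] s(2) by auto
    show "\<forall>a\<in>carrier (witt_ring S2 A). restrict (witt_frob p S2 A a) (S1 /\<^sub>d p) = witt_frob p S1 A (restrict a S1)"
      unfolding carrier_witt_ring[OF inf S[OF s(4)] A] by (intro ballI restrict_frob[OF S[OF s(4)] tr[OF s(3)] s(2)])
    show "\<forall>a\<in>carrier (witt_ring (S2 /\<^sub>d p) A). restrict (witt_ver p S2 A a) S1 = witt_ver p S1 A (restrict a (S1 /\<^sub>d p))"
      by (intro ballI restrict_ver[OF S[OF s(4)] tr[OF s(3)]])
  next
    fix p l S assume s: "prime p" "prime l" "p * l \<in> S" "S \<preceq>\<^sub>d T"
    show "\<forall>a\<in>carrier (witt_ring S A). witt_frob l (S /\<^sub>d p) A (witt_frob p S A a) = witt_frob p (S /\<^sub>d l) A (witt_frob l S A a)"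
      unfolding carrier_witt_ring[OF inf S[OF s(4)] A] by (intro ballI frob_frob_commute[OF S[OF s(4)] s(1-3)])
    show "\<forall>a\<in>carrier (witt_ring (S /\<^sub>d (p * l)) A). witt_ver p S A (witt_ver l (S /\<^sub>d p) A a) = witt_ver l S A (witt_ver p (S /\<^sub>d l) A a)"
      by (intro ballI ver_ver_commute[OF S[OF s(4)]] prime_gt_0_nat s)
  next
    fix p l S assume s: "prime p" "prime l" "l \<noteq> p" "p * l \<in> S" "S \<preceq>\<^sub>d T"
    have p: "p \<in> S" using ds_dvd[OF S[OF s(5)] s(4)] by simp
    show "\<forall>a\<in>carrier (witt_ring (S /\<^sub>d p) A). witt_frob l S A (witt_ver p S A a) = witt_ver p (S /\<^sub>d l) A (witt_frob l (S /\<^sub>d p) A a)"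
      unfolding carrier_witt_ring[OF inf ds_quot[OF S[OF s(5)] p] A] by (intro ballI frob_ver_commute[OF S[OF s(5)] s(1-4)])
  qed
qed

end

end

section \<open>Algebras over \<open>\<int>[q]\<close>\<close>

lemma Zq_simps [simp]: "carrier Zq = UNIV" "\<one>\<^bsub>Zq\<^esub> = 1" "\<zero>\<^bsub>Zq\<^esub> = 0" "x \<oplus>\<^bsub>Zq\<^esub> y = x + y" "x \<otimes>\<^bsub>Zq\<^esub> y = x * y"
  by (simp_all add: Zq_def)

lemma cring_Zq: "cring Zq"
proof (rule cringI)
  show "abelian_group Zq" by (rule abelian_groupI) (auto simp: algebra_simps intro: exI[of _ "- _"])
  show "comm_monoid Zq" by (rule comm_monoidI) (auto simp: algebra_simps)
qed (auto simp: algebra_simps)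

context
  fixes C :: "(int poly, 'a) module"
  assumes C: "algebra Zq C"
begin

lemma alg_cring: "cring C" using C by (rule algebra.M_cring)

interpretation C: cring C by (rule alg_cring)

lemma alg_module: "module Zq C" using C by (rule algebra.module)

lemma alg_smult:
  "x \<in> carrier C \<Longrightarrow> r \<odot>\<^bsub>C\<^esub> x \<in> carrier C"
  "x \<in> carrier C \<Longrightarrow> (r + s) \<odot>\<^bsub>C\<^esub> x = r \<odot>\<^bsub>C\<^esub> x \<oplus>\<^bsub>C\<^esub> s \<odot>\<^bsub>C\<^esub> x"
  "x \<in> carrier C \<Longrightarrow> y \<in> carrier C \<Longrightarrow> r \<odot>\<^bsub>C\<^esub> (x \<oplus>\<^bsub>C\<^esub> y) = r \<odot>\<^bsub>C\<^esub> x \<oplus>\<^bsub>C\<^esub> r \<odot>\<^bsub>C\<^esub> y"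
  "x \<in> carrier C \<Longrightarrow> (r * s) \<odot>\<^bsub>C\<^esub> x = r \<odot>\<^bsub>C\<^esub> (s \<odot>\<^bsub>C\<^esub> x)"
  "x \<in> carrier C \<Longrightarrow> 1 \<odot>\<^bsub>C\<^esub> x = x"
  using module.smult_closed[OF alg_module, of r x] module.smult_l_distr[OF alg_module, of r s x]
    module.smult_r_distr[OF alg_module, of r x y] module.smult_assoc1[OF alg_module, of r s x]
    module.smult_one[OF alg_module, of x] by simp_all

lemma alg_smult_mult:
  "x \<in> carrier C \<Longrightarrow> y \<in> carrier C \<Longrightarrow> (r \<odot>\<^bsub>C\<^esub> x) \<otimes>\<^bsub>C\<^esub> y = r \<odot>\<^bsub>C\<^esub> (x \<otimes>\<^bsub>C\<^esub> y)"
  "x \<in> carrier C \<Longrightarrow> y \<in> carrier C \<Longrightarrow> x \<otimes>\<^bsub>C\<^esub> (r \<odot>\<^bsub>C\<^esub> y) = r \<odot>\<^bsub>C\<^esub> (x \<otimes>\<^bsub>C\<^esub> y)"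
proof -
  show l: "(r \<odot>\<^bsub>C\<^esub> x) \<otimes>\<^bsub>C\<^esub> y = r \<odot>\<^bsub>C\<^esub> (x \<otimes>\<^bsub>C\<^esub> y)" if "x \<in> carrier C" "y \<in> carrier C" for x y
    using algebra.smult_assoc2[OF C, of r x y] that by simp
  show "x \<otimes>\<^bsub>C\<^esub> (r \<odot>\<^bsub>C\<^esub> y) = r \<odot>\<^bsub>C\<^esub> (x \<otimes>\<^bsub>C\<^esub> y)" if "x \<in> carrier C" "y \<in> carrier C"
    using l[OF that(2,1)] that alg_smult(1) by (simp add: C.m_comm)
qed

lemma alg_smult_of_nat: "x \<in> carrier C \<Longrightarrow> of_nat d \<odot>\<^bsub>C\<^esub> x = [d] \<cdot>\<^bsub>C\<^esub> x"
proof (induction d)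
  case 0
  then show ?case using module.smult_l_null[OF alg_module, of x] by simp
next
  case (Suc d)
  then show ?case using alg_smult(2)[of x "of_nat d" 1] alg_smult(5)[of x]
    by (simp add: add.commute[of 1])
qed

lemma twist_simps [simp]:
  "carrier (twist r C) = carrier C" "x \<otimes>\<^bsub>twist r C\<^esub> y = r \<odot>\<^bsub>C\<^esub> (x \<otimes>\<^bsub>C\<^esub> y)" "\<zero>\<^bsub>twist r C\<^esub> = \<zero>\<^bsub>C\<^esub>"
  "x \<oplus>\<^bsub>twist r C\<^esub> y = x \<oplus>\<^bsub>C\<^esub> y"
  by (simp_all add: twist_def)

lemma twist_additive:
  "[(d::nat)] \<cdot>\<^bsub>twist r C\<^esub> x = [d] \<cdot>\<^bsub>C\<^esub> x" "finsum (twist r C) = finsum C"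
  by (simp_all add: twist_def add_pow_def nat_pow_def finsum_def finprod_def fun_eq_iff)

lemma nonunital_twist: "nonunital_cring (twist r C)"
proof (intro nonunital_cring.intro nonunital_cring_axioms.intro)
  show "abelian_group (twist r C)"
    by (rule abelian_groupI) (auto simp: C.a_ac intro: bexI[of _ "\<ominus>\<^bsub>C\<^esub> _"] C.l_neg)
qed (simp_all add: alg_smult alg_smult_mult C.m_ac C.r_distr)

lemma nu_pow_twist:
  assumes x: "x \<in> carrier C" and n: "n > 0"
  shows "nu_pow (twist r C) x n = r ^ (n - 1) \<odot>\<^bsub>C\<^esub> (x [^]\<^bsub>C\<^esub> n)"
proof -
  have "nu_pow (twist r C) x (Suc k) = r ^ k \<odot>\<^bsub>C\<^esub> (x [^]\<^bsub>C\<^esub> Suc k)" for k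
  proof (induction k)
    case 0
    then show ?case using x by (simp add: alg_smult)
  next
    case (Suc k)
    then show ?case using x by (simp add: nu_pow_Suc alg_smult alg_smult_mult)
  qed
  then show ?thesis using n by (metis Suc_pred')
qed

end

lemma alg_homD:
  assumes "h \<in> alg_hom Zq C D"
  shows "h \<in> ring_hom C D" "h \<in> extensional (carrier C)" "x \<in> carrier C \<Longrightarrow> h x \<in> carrier D"
    "x \<in> carrier C \<Longrightarrow> y \<in> carrier C \<Longrightarrow> h (x \<oplus>\<^bsub>C\<^esub> y) = h x \<oplus>\<^bsub>D\<^esub> h y"
    "x \<in> carrier C \<Longrightarrow> y \<in> carrier C \<Longrightarrow> h (x \<otimes>\<^bsub>C\<^esub> y) = h x \<otimes>\<^bsub>D\<^esub> h y"
    "h \<one>\<^bsub>C\<^esub> = \<one>\<^bsub>D\<^esub>" "x \<in> carrier C \<Longrightarrow> h (r \<odot>\<^bsub>C\<^esub> x) = r \<odot>\<^bsub>D\<^esub> h x"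
  using assms by (auto simp: alg_hom_def ring_hom_def)

lemma alg_hom_twist:
  assumes "algebra Zq C" "h \<in> alg_hom Zq C D"
  shows "h \<in> nu_ring_hom (twist r C) (twist r D)"
proof -
  interpret C: cring C using assms(1) by (rule alg_cring)
  show ?thesis
    by (rule nu_ring_homI) (simp_all add: twist_def alg_homD[OF assms(2)])
qed

text \<open>Index \<open>0\<close> is not that of a component of a vector, so the variable there is free to serve as \<open>q\<close>.\<close>

definition Qi :: nat where "Qi = prod_encode (2, 0)"

abbreviation Q :: mpoly where "Q \<equiv> Var Qi"

text \<open>The structure map that makes the polynomial ring an algebra over \<open>\<int>[q]\<close>, \<open>q\<close> being one of the variables.\<close>

definition qpoly :: "int poly \<Rightarrow> mpoly" where
  "qpoly p = poly (map_poly of_int p) Q"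

lemma qpoly_0 [simp]: "qpoly 0 = 0" by (simp add: qpoly_def)

lemma qpoly_pCons: "qpoly (pCons a p) = of_int a + Q * qpoly p"
  by (simp add: qpoly_def map_poly_pCons)

lemma qpoly_add [simp]: "qpoly (p + r) = qpoly p + qpoly r"
  by (induction p r rule: poly_induct2) (simp_all add: qpoly_pCons algebra_simps)

lemma qpoly_smult: "qpoly (Polynomial.smult a p) = of_int a * qpoly p"
  by (induction p) (simp_all add: qpoly_pCons algebra_simps)

lemma qpoly_mult [simp]: "qpoly (p * r) = qpoly p * qpoly r"
  by (induction p) (simp_all add: qpoly_pCons qpoly_smult algebra_simps)

lemma qpoly_1 [simp]: "qpoly 1 = 1" by (simp add: one_pCons qpoly_pCons)

lemma qpoly_q: "qpoly [:0, 1:] = Q" by (simp add: qpoly_pCons)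

lemma qpoly_minus [simp]: "qpoly (p - r) = qpoly p - qpoly r"
  using qpoly_add[of "p - r" r] by simp

lemma qpoly_power [simp]: "qpoly (p ^ n) = qpoly p ^ n" by (induction n) simp_all

lemma qpoly_of_nat [simp]: "qpoly (of_nat n) = of_nat n" by (induction n) simp_all

lemma sub_of_int [simp]: "sub v (of_int a) = of_int a"
  by (cases a rule: int_cases2) simp_all

lemma sub_qpoly: "v Qi = Q \<Longrightarrow> sub v (qpoly p) = qpoly p"
  by (induction p) (simp_all add: qpoly_pCons)

lemma q_coeff: "[:0, 1:] * q_coeff m = 1 - (1 - [:0, 1:]) ^ m"
proof -
  let ?x = "1 - [:0, 1:] :: int poly"
  have "(1 - ?x) * (\<Sum>i<m. ?x ^ i) = 1 - ?x ^ m" by (rule one_diff_power_eq[symmetric])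
  then show ?thesis by (simp add: q_coeff_def)
qed

lemma qpoly_q_coeff: "Q * qpoly (q_coeff m) = 1 - (1 - Q) ^ m"
  using arg_cong[OF q_coeff[of m], of qpoly]
  by (simp only: qpoly_mult qpoly_q qpoly_minus qpoly_power qpoly_1)

lemma ev_qpoly:
  fixes C :: "(int poly, 'a) module"
  assumes C: "algebra Zq C" and v: "\<And>i. v i \<in> carrier C" and q: "v Qi = [:0, 1:] \<odot>\<^bsub>C\<^esub> \<one>\<^bsub>C\<^esub>"
  shows "ev C v (qpoly p) = p \<odot>\<^bsub>C\<^esub> \<one>\<^bsub>C\<^esub>" and "ev C v (qpoly p * f) = p \<odot>\<^bsub>C\<^esub> ev C v f"
proof -
  interpret C: cring C using C by (rule alg_cring)
  note sm = alg_smult[OF C] alg_smult_mult[OF C]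
  have n: "ev C v (of_nat a) = of_nat a \<odot>\<^bsub>C\<^esub> \<one>\<^bsub>C\<^esub>" for a
    using C.is_ev_of_nat[OF C.is_ev_ev[of v], OF v, of a] alg_smult_of_nat[OF C, of "\<one>\<^bsub>C\<^esub>" a] by simp
  have "(- (of_nat a)) \<odot>\<^bsub>C\<^esub> \<one>\<^bsub>C\<^esub> \<oplus>\<^bsub>C\<^esub> of_nat a \<odot>\<^bsub>C\<^esub> \<one>\<^bsub>C\<^esub> = \<zero>\<^bsub>C\<^esub>" for a
    using sm(2)[of "\<one>\<^bsub>C\<^esub>" "- of_nat a" "of_nat a"] alg_smult_of_nat[OF C, of "\<one>\<^bsub>C\<^esub>" 0] by simp
  then have m: "(- (of_nat a)) \<odot>\<^bsub>C\<^esub> \<one>\<^bsub>C\<^esub> = \<ominus>\<^bsub>C\<^esub> (of_nat a \<odot>\<^bsub>C\<^esub> \<one>\<^bsub>C\<^esub>)" for a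
    using sm(1) by (intro C.minus_equality[symmetric]) auto
  have i: "ev C v (of_int a) = of_int a \<odot>\<^bsub>C\<^esub> \<one>\<^bsub>C\<^esub>" for a
    by (cases a rule: int_cases2) (simp_all add: n m C.ev_neg[of v, OF v])
  show e: "ev C v (qpoly p) = p \<odot>\<^bsub>C\<^esub> \<one>\<^bsub>C\<^esub>"
  proof (induction p)
    case 0
    then show ?case using alg_smult_of_nat[OF C, of "\<one>\<^bsub>C\<^esub>" 0] by simp
  next
    case (pCons a p)
    have pc: "pCons a p = of_int a + [:0, 1:] * p" by (simp add: of_int_poly)
    have "ev C v (qpoly (pCons a p)) = of_int a \<odot>\<^bsub>C\<^esub> \<one>\<^bsub>C\<^esub> \<oplus>\<^bsub>C\<^esub> ([:0, 1:] \<odot>\<^bsub>C\<^esub> \<one>\<^bsub>C\<^esub>) \<otimes>\<^bsub>C\<^esub> (p \<odot>\<^bsub>C\<^esub> \<one>\<^bsub>C\<^esub>)"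
      by (simp add: qpoly_pCons C.ev_add[of v, OF v] C.ev_mult[of v, OF v] C.ev_Var[of v, OF v] i pCons q)
    also have "\<dots> = (of_int a + [:0, 1:] * p) \<odot>\<^bsub>C\<^esub> \<one>\<^bsub>C\<^esub>" using sm(1) by (simp add: sm(2,6) sm(4)[symmetric])
    finally show ?case by (simp only: pc)
  qed
  show "ev C v (qpoly p * f) = p \<odot>\<^bsub>C\<^esub> ev C v f"
    using v sm(1) by (simp add: C.ev_mult[of v, OF v] e sm(6))
qed

text \<open>Describing the polynomials in the variables \<open>V\<close> as the fixed points of the substitution of \<open>0\<close> for
  the other variables turns questions about occurring variables into equations.\<close>

definition DV :: "nat set \<Rightarrow> mpoly set" where
  "DV V = {f. sub (\<lambda>i. if i \<in> V then Var i else 0) f = f}"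

lemma DV_closed [simp]:
  "0 \<in> DV V" "1 \<in> DV V" "f \<in> DV V \<Longrightarrow> g \<in> DV V \<Longrightarrow> f + g \<in> DV V" "f \<in> DV V \<Longrightarrow> - f \<in> DV V"
  "f \<in> DV V \<Longrightarrow> g \<in> DV V \<Longrightarrow> f - g \<in> DV V" "f \<in> DV V \<Longrightarrow> g \<in> DV V \<Longrightarrow> f * g \<in> DV V"
  "f \<in> DV V \<Longrightarrow> f ^ n \<in> DV V" "of_nat n \<in> DV V" "i \<in> V \<Longrightarrow> Var i \<in> DV V" "Qi \<in> V \<Longrightarrow> qpoly p \<in> DV V"
  by (simp_all add: DV_def sub_qpoly)

lemma DV_sum: "(\<And>i. i \<in> I \<Longrightarrow> f i \<in> DV V) \<Longrightarrow> sum f I \<in> DV V"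
  by (induction I rule: infinite_finite_induct) auto

lemma DV_mono: "V \<subseteq> V' \<Longrightarrow> f \<in> DV V \<Longrightarrow> f \<in> DV V'"
proof -
  assume V: "V \<subseteq> V'" and f: "f \<in> DV V"
  let ?s = "\<lambda>V i. if i \<in> V then Var i else 0"
  have "sub (?s V') (sub (?s V) f) = sub (?s V) f"
    unfolding sub_sub using V by (intro arg_cong[where f = "\<lambda>v. sub v f"] ext) auto
  then show "f \<in> DV V'" using f by (simp add: DV_def)
qed

lemma DV_sub_in: "sub (\<lambda>i. if i \<in> V then Var i else 0) f \<in> DV V"
  unfolding DV_def mem_Collect_eq sub_sub by (intro arg_cong[where f = "\<lambda>v. sub v f"] ext) auto

lemma DV_ev_cong:
  assumes R: "cring R" and f: "f \<in> DV V" and v: "\<And>i. v i \<in> carrier R" "\<And>i. w i \<in> carrier R"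
    and e: "\<And>i. i \<in> V \<Longrightarrow> v i = w i"
  shows "ev R v f = ev R w f"
proof -
  interpret cring R by (rule R)
  let ?s = "\<lambda>i. if i \<in> V then Var i else 0"
  have "ev R v (sub ?s f) = ev R w (sub ?s f)"
    unfolding ev_sub[OF R v(1)] ev_sub[OF R v(2)]
    by (intro arg_cong[where f = "\<lambda>v. ev R v f"] ext) (auto simp: ev_Var[of v, OF v(1)] ev_Var[of w, OF v(2)] e)
  then show ?thesis using f by (simp add: DV_def)
qed

text \<open>A copy of the algebra of polynomials in the variables \<open>V\<close>. With all variables it is the generic
  algebra; with \<open>q\<close> and the components of one vector it represents the functor of vectors.\<close>

definition EM :: "nat set \<Rightarrow> (int poly, 'u) module" where
  "EM V = \<lparr>carrier = emb ` DV V, mult = (\<lambda>x y. emb (unemb x * unemb y)), one = emb 1,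
     zero = emb 0, add = (\<lambda>x y. emb (unemb x + unemb y)), smult = (\<lambda>p x. emb (qpoly p * unemb x))\<rparr>"

lemma EM_simps [simp]:
  "carrier (EM V) = emb ` DV V" "x \<otimes>\<^bsub>EM V\<^esub> y = emb (unemb x * unemb y)" "\<one>\<^bsub>EM V\<^esub> = emb 1" "\<zero>\<^bsub>EM V\<^esub> = emb 0"
  "x \<oplus>\<^bsub>EM V\<^esub> y = emb (unemb x + unemb y)" "p \<odot>\<^bsub>EM V\<^esub> x = emb (qpoly p * unemb x)"
  by (simp_all add: EM_def)

context
  assumes inf: "infinite (UNIV :: 'u set)"
begin

lemma unemb_emb_EM [simp]: "unemb (emb f :: 'u) = f"
  using inf by (rule unemb_emb)

lemma algebra_EM:
  assumes V: "Qi \<in> V" shows "algebra Zq (EM V :: (int poly, 'u) module)"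
proof (rule algebraI[OF cring_Zq])
  show "cring (EM V :: (int poly, 'u) module)"
  proof (rule cringI)
    show "abelian_group (EM V :: (int poly, 'u) module)"
    proof (rule abelian_groupI)
      fix x :: 'u assume "x \<in> carrier (EM V)"
      then show "\<exists>y\<in>carrier (EM V). y \<oplus>\<^bsub>EM V\<^esub> x = \<zero>\<^bsub>EM V\<^esub>"
        by (intro bexI[of _ "emb (- unemb x)"]) auto
    qed (auto simp: algebra_simps)
    show "comm_monoid (EM V :: (int poly, 'u) module)"
      by (rule comm_monoidI) (auto simp: algebra_simps)
  qed (auto simp: algebra_simps)
qed (use V in \<open>auto simp: algebra_simps\<close>)

lemma torsion_free_EM:
  assumes V: "Qi \<in> V" shows "torsion_free (twist r (EM V :: (int poly, 'u) module))"
  unfolding torsion_free_def twist_additive[OF algebra_EM[OF V]] twist_simps[OF algebra_EM[OF V]]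
proof (intro allI impI ballI)
  fix n :: nat and x :: 'u assume n: "n > 0" and x: "x \<in> carrier (EM V)" and 0: "[n] \<cdot>\<^bsub>EM V\<^esub> x = \<zero>\<^bsub>EM V\<^esub>"
  have "emb (of_nat n * unemb x) = (emb 0 :: 'u)"
    using alg_smult_of_nat[OF algebra_EM[OF V] x, of n] 0 by simp
  then have "of_nat n * unemb x = 0" by (metis unemb_emb_EM)
  then show "x = \<zero>\<^bsub>EM V\<^esub>" using n x by auto
qed

lemma EM_hom:
  assumes V: "Qi \<in> V" and C: "algebra Zq C" and v: "\<And>i. v i \<in> carrier C" and q: "v Qi = [:0, 1:] \<odot>\<^bsub>C\<^esub> \<one>\<^bsub>C\<^esub>"
  shows "(\<lambda>y\<in>carrier (EM V). ev C v (unemb y)) \<in> alg_hom Zq (EM V :: (int poly, 'u) module) C"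
proof -
  interpret C: cring C using C by (rule alg_cring)
  note e = C.ev_add[of v, OF v] C.ev_mult[of v, OF v] C.ev_one[of v, OF v] ev_qpoly(1)[of C v, OF C v q]
  show ?thesis
    unfolding alg_hom_def ring_hom_def using V by (auto simp: e v alg_smult_mult[OF C])
qed

text \<open>Composing with the substitution that defines \<open>DV V\<close> reduces this to homomorphisms on all polynomials.\<close>

lemma EM_hom_eq:
  assumes V: "Qi \<in> V" and C: "algebra Zq C" and h: "h \<in> alg_hom Zq (EM V :: (int poly, 'u) module) C"
    and k: "k \<in> alg_hom Zq (EM V) C" and e: "\<And>i. i \<in> V - {Qi} \<Longrightarrow> h (emb (Var i)) = k (emb (Var i))"
  shows "h = k"
proof -
  interpret C: cring C using C by (rule alg_cring)
  interpret E: cring "EM V :: (int poly, 'u) module" by (rule alg_cring[OF algebra_EM[OF V]])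
  let ?s = "sub (\<lambda>i. if i \<in> V then Var i else 0)"
  have ev: "is_ev C (\<lambda>f. l (emb (?s f)))" if l: "l \<in> alg_hom Zq (EM V :: (int poly, 'u) module) C" for l
    unfolding is_ev_def
    using alg_homD(3)[OF l, of "emb (?s _)"] alg_homD(4)[OF l, of "emb (?s _)" "emb (?s _)"]
      alg_homD(5)[OF l, of "emb (?s _)" "emb (?s _)"] alg_homD(6)[OF l] DV_sub_in by simp
  have Q: "l (emb Q) = [:0, 1:] \<odot>\<^bsub>C\<^esub> \<one>\<^bsub>C\<^esub>" if l: "l \<in> alg_hom Zq (EM V :: (int poly, 'u) module) C" for l
    using alg_homD(7)[OF l, of "\<one>\<^bsub>EM V\<^esub>" "[:0, 1:]"] alg_homD(6)[OF l] by (simp add: qpoly_q)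
  have 0: "l (emb 0) = \<zero>\<^bsub>C\<^esub>" if l: "l \<in> alg_hom Zq (EM V :: (int poly, 'u) module) C" for l
    using C.is_ev_neg(2)[OF ev[OF l]] by simp
  have hk: "h (emb (?s f)) = k (emb (?s f))" for f
  proof (rule C.is_ev_eq[OF ev[OF h] ev[OF k]])
    fix i show "h (emb (?s (Var i))) = k (emb (?s (Var i)))"
      using e[of i] Q[OF h] Q[OF k] 0[OF h] 0[OF k] by (cases "i = Qi") auto
  qed
  have "h (emb f) = k (emb f)" if "f \<in> DV V" for f
    using hk[of f] that unfolding DV_def mem_Collect_eq by (simp only:)
  then show ?thesis by (intro extensionalityI[OF alg_homD(2)[OF h] alg_homD(2)[OF k]]) auto
qed

end

section \<open>The comparison polynomials\<close>

lemma Q_neq_X [simp]: "prod_encode (k, n) = Qi \<longleftrightarrow> k = 2 \<and> n = 0"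
  by (simp add: Qi_def)

lemma Var_nonzero [simp]: "Var i \<noteq> 0"
proof
  assume "Var i = 0"
  then have "sub (\<lambda>_. 1) (Var i) = sub (\<lambda>_. 1) 0" by simp
  then show False by simp
qed

text \<open>The difference of the Witt vectors \<open>(X\<^sub>d)\<close> and \<open>((1 - q) X\<^sub>d)\<close>. It vanishes at \<open>q = 0\<close>, so that its
  components are divisible by \<open>q\<close>; the quotients \<open>phi\<close> give the comparison map.\<close>

definition psi :: "nat \<Rightarrow> mpoly" where
  "psi = unghost (\<lambda>n. ghost (X 0) n + - ghost (\<lambda>d. (1 - Q) * X 0 d) n)"

lemma psi_ghost: "n > 0 \<Longrightarrow> ghost psi n = ghost (X 0) n - ghost (\<lambda>d. (1 - Q) * X 0 d) n"
  using ghost_unghost[OF ds_positive dwork_add[OF dwork_X dwork_minus[OF dwork_X]]]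
  by (simp add: psi_def)

text \<open>At \<open>q = 0\<close> the two vectors in the definition of \<open>psi\<close> coincide, and a polynomial differs from its
  value at \<open>q = 0\<close> by a multiple of \<open>q\<close>.\<close>

lemma Q_dvd_psi: assumes "n > 0" shows "Q dvd psi n"
proof -
  let ?s = "\<lambda>i. if i = Qi then 0 else Var i"
  have dv: "Q dvd f - sub ?s f" for f
  proof (induction f rule: mpoly_induct)
    case (add f g)
    have "Q dvd (f - sub ?s f) + (g - sub ?s g)" by (rule dvd_add[OF add])
    then show ?case by (simp add: algebra_simps)
  next
    case (neg f)
    have "Q dvd - (f - sub ?s f)" using neg by (simp only: dvd_minus_iff)
    then show ?case by (simp add: algebra_simps)
  next
    case (mult f g)
    have "Q dvd f * (g - sub ?s g) + (f - sub ?s f) * sub ?s g"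
      by (intro dvd_add dvd_mult dvd_mult2 mult)
    then show ?case by (simp add: algebra_simps)
  qed auto
  have "sub ?s (psi n) = 0"
  proof (rule ghost_inj[OF ds_positive])
    fix m :: nat assume m: "m \<in> {0<..}"
    have e: "(\<lambda>d. sub ?s (X 0 d)) = X 0" "(\<lambda>d. sub ?s ((1 - Q) * X 0 d)) = X 0"
      by (simp_all add: X_def fun_eq_iff)
    have "sub ?s (ghost psi m) = 0"
      using m unfolding greaterThan_iff psi_ghost[of m, OF m[unfolded greaterThan_iff]] sub_diff sub_ghost e by simp
    then show "ghost (\<lambda>d. sub ?s (psi d)) m = ghost (\<lambda>_. 0) m"
      using m by (simp add: sub_ghost)
  qed (use assms in simp)
  then show ?thesis using dv[of "psi n"] by simp
qed

definition phi :: "nat \<Rightarrow> mpoly" where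
  "phi n = (SOME c. psi n = Q * c)"

lemma phi: "n > 0 \<Longrightarrow> Q * phi n = psi n"
  using someI_ex[of "\<lambda>c. psi n = Q * c"] Q_dvd_psi[of n] by (simp add: phi_def dvd_def)

text \<open>After multiplication by \<open>q\<close> the left side becomes the ghost component of \<open>psi\<close>, and the right side
  becomes the difference of ghost components defining it, because \<open>q q_coeff m = 1 - (1 - q)\<^sup>m\<close>.\<close>

lemma phi_identity:
  assumes n: "n > 0"
  shows "(\<Sum>d | d dvd n. of_nat d * (Q ^ (n div d - 1) * phi d ^ (n div d)))
    = (\<Sum>d | d dvd n. qpoly (of_nat d * q_coeff (n div d)) * X 0 d ^ (n div d))"
proof -
  have d0: "d > 0" "n div d > 0" if "d dvd n" for d
    using that n by (auto simp: dvd_div_eq_0_iff intro!: Nat.gr0I)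
  have 1: "Q * (of_nat d * (Q ^ (n div d - 1) * phi d ^ (n div d))) = of_nat d * psi d ^ (n div d)"
    if d: "d dvd n" for d
  proof -
    have "psi d ^ (n div d) = Q ^ Suc (n div d - 1) * phi d ^ (n div d)"
      using d0(2)[OF d] by (simp add: phi[OF d0(1)[OF d], symmetric] power_mult_distrib del: power_Suc)
    then show ?thesis by (simp add: mult.left_commute)
  qed
  have 2: "Q * (qpoly (of_nat d * q_coeff (n div d)) * X 0 d ^ (n div d))
      = of_nat d * X 0 d ^ (n div d) - of_nat d * ((1 - Q) * X 0 d) ^ (n div d)" for d
  proof -
    have "Q * (qpoly (of_nat d * q_coeff (n div d)) * X 0 d ^ (n div d))
      = of_nat d * (Q * qpoly (q_coeff (n div d))) * X 0 d ^ (n div d)" by (simp add: mult_ac)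
    also have "\<dots> = of_nat d * X 0 d ^ (n div d) - of_nat d * ((1 - Q) * X 0 d) ^ (n div d)"
      unfolding qpoly_q_coeff power_mult_distrib by (simp add: algebra_simps)
    finally show ?thesis .
  qed
  have "Q * (\<Sum>d | d dvd n. of_nat d * (Q ^ (n div d - 1) * phi d ^ (n div d)))
    = (\<Sum>d | d dvd n. of_nat d * psi d ^ (n div d))"
    unfolding sum_distrib_left by (rule sum.cong) (simp_all only: 1 mem_Collect_eq)
  also have "\<dots> = ghost psi n" by (simp add: ghost_def)
  also have "\<dots> = Q * (\<Sum>d | d dvd n. qpoly (of_nat d * q_coeff (n div d)) * X 0 d ^ (n div d))"
    unfolding sum_distrib_left 2 psi_ghost[OF n] by (simp add: ghost_def sum_subtractf)
  finally show ?thesis unfolding mult_cancel_left by simp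
qed

lemma DV_of_nat_cancel: "n > 0 \<Longrightarrow> of_nat n * f \<in> DV V \<Longrightarrow> f \<in> DV V"
  by (simp add: DV_def)

definition proper_vars :: "nat \<Rightarrow> nat set" where
  "proper_vars n = insert Qi ((\<lambda>d. prod_encode (0, d)) ` {d. d dvd n \<and> d < n})"

text \<open>In \<open>phi_identity\<close> the terms with \<open>d = n\<close> are \<open>n \<phi>\<^sub>n\<close> and \<open>n X\<^sub>n\<close>, as
  \<open>q_coeff 1 = 1\<close>; all others involve proper divisors only. This makes the comparison map
  triangular, hence bijective over every algebra.\<close>

lemma phi_triangular: "n > 0 \<Longrightarrow> phi n - X 0 n \<in> DV (proper_vars n)"
proof (induction n rule: less_induct)
  case (less n)
  have X: "X 0 d \<in> DV (proper_vars n)" if "d dvd n" "d < n" for d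
    using that unfolding X_def proper_vars_def by (intro DV_closed) auto
  have ph: "phi d \<in> DV (proper_vars n)" if d: "d dvd n" "d < n" for d
  proof -
    have "d > 0" using d less(2) by (auto intro!: Nat.gr0I)
    moreover have "proper_vars d \<subseteq> proper_vars n" using d by (auto simp: proper_vars_def intro: dvd_trans)
    ultimately have "phi d - X 0 d \<in> DV (proper_vars n)" using less(1)[OF d(2)] DV_mono by blast
    from DV_closed(3)[OF this X[OF d]] show ?thesis by simp
  qed
  have Q: "Qi \<in> proper_vars n" by (simp add: proper_vars_def)
  let ?P = "{d. d dvd n \<and> d < n}"
  let ?L = "\<Sum>d\<in>?P. of_nat d * (Q ^ (n div d - 1) * phi d ^ (n div d))"
  let ?R = "\<Sum>d\<in>?P. qpoly (of_nat d * q_coeff (n div d)) * X 0 d ^ (n div d)"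
  have q1: "q_coeff (Suc 0) = 1" by (simp add: q_coeff_def)
  have "of_nat n * phi n + ?L = of_nat n * X 0 n + ?R"
    using phi_identity[OF less(2)] less(2) by (simp add: divisors_split[OF less(2)] q1)
  then have "of_nat n * (phi n - X 0 n) = ?R - ?L" by (simp add: algebra_simps)
  also have "\<dots> \<in> DV (proper_vars n)"
    by (intro DV_closed(5) DV_sum DV_closed(6,7,8,9,10) ph X Q) auto
  finally show ?case by (rule DV_of_nat_cancel[OF less(2)])
qed

section \<open>The comparison map\<close>

definition casg :: "(int poly, 'a) module \<Rightarrow> nat set \<Rightarrow> (nat \<Rightarrow> nat \<Rightarrow> 'a) \<Rightarrow> nat \<Rightarrow> 'a" where
  "casg C S x i = (case prod_decode i of (k, n) \<Rightarrow>
     if k \<ge> 2 then [:0, 1:] \<odot>\<^bsub>C\<^esub> \<one>\<^bsub>C\<^esub> else if n \<in> S then x k n else \<zero>\<^bsub>C\<^esub>)"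

lemma casg_simps [simp]:
  "casg C S x Qi = [:0, 1:] \<odot>\<^bsub>C\<^esub> \<one>\<^bsub>C\<^esub>" "k < 2 \<Longrightarrow> n \<in> S \<Longrightarrow> casg C S x (prod_encode (k, n)) = x k n"
  by (simp_all add: casg_def Qi_def)

lemma casg_closed:
  assumes C: "algebra Zq C" and x: "\<And>k n. n \<in> S \<Longrightarrow> x k n \<in> carrier C"
  shows "casg C S x i \<in> carrier C"
proof -
  interpret C: cring C by (rule alg_cring[OF C])
  show ?thesis using x alg_smult(1)[OF C, of "\<one>\<^bsub>C\<^esub>"] by (auto simp: casg_def split: prod.splits)
qed

lemma alg_hom_ev:
  assumes C: "cring C" and D: "cring D" and h: "h \<in> ring_hom C D" and v: "\<And>i. v i \<in> carrier C"
  shows "h (ev C v f) = ev D (\<lambda>i. h (v i)) f"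
proof -
  interpret C: cring C by (rule C)
  interpret D: cring D by (rule D)
  have hv: "h (v i) \<in> carrier D" for i using h v by (auto simp: ring_hom_def)
  show ?thesis
  proof (rule D.is_ev_eq)
    show "is_ev D (\<lambda>f. h (ev C v f))"
      using h v by (auto simp: is_ev_def ring_hom_def C.ev_add[of v, OF v] C.ev_mult[of v, OF v] C.ev_one[of v, OF v])
    show "is_ev D (ev D (\<lambda>i. h (v i)))" by (rule D.is_ev_ev[of "\<lambda>i. h (v i)", OF hv])
    show "h (ev C v (Var i)) = ev D (\<lambda>i. h (v i)) (Var i)" for i
      using C.ev_Var[of v, OF v] D.ev_Var[of "\<lambda>i. h (v i)", OF hv] by simp
  qed
qed

text \<open>The comparison map from the deformed Witt vectors over \<open>C\<close> to the Witt vectors over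
  \<open>twist q C\<close>.\<close>

definition Phi :: "nat set \<Rightarrow> (int poly, 'a) module \<Rightarrow> (nat \<Rightarrow> 'a) \<Rightarrow> nat \<Rightarrow> 'a" where
  "Phi S C a = (\<lambda>n\<in>S. ev C (casg C S (\<lambda>_. a)) (phi n))"

context
  fixes C :: "(int poly, 'a) module"
  assumes C: "algebra Zq C"
begin

interpretation C: cring C by (rule alg_cring[OF C])

lemma Phi_closed: "a \<in> S \<rightarrow>\<^sub>E carrier C \<Longrightarrow> Phi S C a \<in> S \<rightarrow>\<^sub>E carrier C"
proof -
  assume a: "a \<in> S \<rightarrow>\<^sub>E carrier C"
  have "casg C S (\<lambda>_. a) i \<in> carrier C" for i by (rule casg_closed[OF C PiE_mem[OF a]])
  then show ?thesis by (simp add: Phi_def)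
qed

lemma Phi_nat:
  assumes D: "algebra Zq D" and h: "h \<in> alg_hom Zq C D" and a: "a \<in> S \<rightarrow>\<^sub>E carrier C"
  shows "vec_map S h (Phi S C a) = Phi S D (vec_map S h a)"
proof -
  interpret D: cring D by (rule alg_cring[OF D])
  note hr = alg_homD(1)[OF h]
  have c: "casg C S (\<lambda>_. a) i \<in> carrier C" for i by (rule casg_closed[OF C PiE_mem[OF a]])
  have "h \<zero>\<^bsub>C\<^esub> = \<zero>\<^bsub>D\<^esub>" using ring_hom_zero[OF hr C.ring_axioms D.ring_axioms] .
  moreover have "h ([:0, 1:] \<odot>\<^bsub>C\<^esub> \<one>\<^bsub>C\<^esub>) = [:0, 1:] \<odot>\<^bsub>D\<^esub> \<one>\<^bsub>D\<^esub>"
    using alg_homD(6)[OF h] alg_homD(7)[OF h, of "\<one>\<^bsub>C\<^esub>"] by simp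
  ultimately have "h (casg C S (\<lambda>_. a) i) = casg D S (\<lambda>_. vec_map S h a) i" for i
    by (auto simp: casg_def vec_map_def split: prod.splits)
  then show ?thesis
    using alg_hom_ev[OF alg_cring[OF C] alg_cring[OF D] hr, of "casg C S (\<lambda>_. a)", OF c]
    by (auto simp: Phi_def vec_map_def)
qed

text \<open>The factors \<open>q\<close> in \<open>phi_identity\<close> are those of the powers in the twisted ring.\<close>

lemma Phi_ghost:
  assumes S: "divisor_stable S" and a: "a \<in> S \<rightarrow>\<^sub>E carrier C"
  shows "witt_ghost S (twist [:0, 1:] C) (Phi S C a) = wbar_ghost S C a"
proof
  fix n
  show "witt_ghost S (twist [:0, 1:] C) (Phi S C a) n = wbar_ghost S C a n"
  proof (cases "n \<in> S")
    case True
    have n0: "n > 0" using ds_pos[OF S True] .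
    let ?v = "casg C S (\<lambda>_. a)"
    have v: "?v i \<in> carrier C" for i by (rule casg_closed[OF C PiE_mem[OF a]])
    note is_ev = C.is_ev_ev[of ?v, OF v]
    have d: "d \<in> S" "n div d > 0" if "d dvd n" for d
      using ds_dvd[OF S True that] that n0 by (auto simp: dvd_div_eq_0_iff intro!: Nat.gr0I)
    have e: "ev C ?v f \<in> carrier C" for f by (rule C.ev_closed[of ?v, OF v])
    have vX: "ev C ?v (X 0 d) = a d" if "d \<in> S" for d
      using that by (simp add: X_def C.ev_Var[of ?v, OF v])
    have "witt_ghost S (twist [:0, 1:] C) (Phi S C a) n =
        (\<Oplus>\<^bsub>C\<^esub>d\<in>{d. d dvd n}. [d] \<cdot>\<^bsub>C\<^esub> nu_pow (twist [:0, 1:] C) (Phi S C a d) (n div d))"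
      using True by (simp add: witt_ghost_def twist_additive[OF C])
    also have "\<dots> = (\<Oplus>\<^bsub>C\<^esub>d\<in>{d. d dvd n}. ev C ?v (of_nat d * (Q ^ (n div d - 1) * phi d ^ (n div d))))"
    proof (rule C.finsum_cong')
      fix m assume m: "m \<in> {d. d dvd n}"
      then have ms: "m \<in> S" "n div m > 0" using d by auto
      have "nu_pow (twist [:0, 1:] C) (Phi S C a m) (n div m) = [:0, 1:] ^ (n div m - 1) \<odot>\<^bsub>C\<^esub> (ev C ?v (phi m) [^]\<^bsub>C\<^esub> (n div m))"
        using ms nu_pow_twist[OF C e ms(2)] by (simp add: Phi_def)
      also have "\<dots> = ev C ?v (qpoly ([:0, 1:] ^ (n div m - 1)) * phi m ^ (n div m))"
        unfolding ev_qpoly(2)[of C ?v, OF C v casg_simps(1)] C.is_ev_pow[OF is_ev] ..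
      finally show "[m] \<cdot>\<^bsub>C\<^esub> nu_pow (twist [:0, 1:] C) (Phi S C a m) (n div m)
        = ev C ?v (of_nat m * (Q ^ (n div m - 1) * phi m ^ (n div m)))"
        unfolding C.is_ev_of_nat_mult[OF is_ev] by (simp only: qpoly_power qpoly_q)
    qed (use e in auto)
    also have "\<dots> = ev C ?v (\<Sum>d | d dvd n. of_nat d * (Q ^ (n div d - 1) * phi d ^ (n div d)))"
      by (rule C.is_ev_sum[OF is_ev, symmetric])
    also have "\<dots> = ev C ?v (\<Sum>d | d dvd n. qpoly (of_nat d * q_coeff (n div d)) * X 0 d ^ (n div d))"
      unfolding phi_identity[OF n0] ..
    also have "\<dots> = (\<Oplus>\<^bsub>C\<^esub>d\<in>{d. d dvd n}. ev C ?v (qpoly (of_nat d * q_coeff (n div d)) * X 0 d ^ (n div d)))"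
      by (rule C.is_ev_sum[OF is_ev])
    also have "\<dots> = (\<Oplus>\<^bsub>C\<^esub>d\<in>{d. d dvd n}. (of_nat d * q_coeff (n div d)) \<odot>\<^bsub>C\<^esub> (a d [^]\<^bsub>C\<^esub> (n div d)))"
    proof (rule C.finsum_cong')
      fix m assume m: "m \<in> {d. d dvd n}"
      show "ev C ?v (qpoly (of_nat m * q_coeff (n div m)) * X 0 m ^ (n div m)) =
         (of_nat m * q_coeff (n div m)) \<odot>\<^bsub>C\<^esub> (a m [^]\<^bsub>C\<^esub> (n div m))"
        unfolding ev_qpoly(2)[of C ?v, OF C v casg_simps(1)] C.is_ev_pow[OF is_ev] using vX[OF d(1)] m by simp
    qed (use PiE_mem[OF a] d alg_smult(1)[OF C] in auto)
    finally show ?thesis using True by (simp add: wbar_ghost_def)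
  qed (simp_all add: witt_ghost_def wbar_ghost_def)
qed

definition lower_part :: "nat set \<Rightarrow> (nat \<Rightarrow> 'a) \<Rightarrow> nat \<Rightarrow> 'a" where
  "lower_part S a n = ev C (casg C S (\<lambda>_. a)) (phi n - X 0 n)"

lemma lower_part_closed: "(\<And>n. n \<in> S \<Longrightarrow> a n \<in> carrier C) \<Longrightarrow> lower_part S a n \<in> carrier C"
  unfolding lower_part_def using casg_closed[OF C, of S "\<lambda>_. a"] by simp

lemma lower_part_cong:
  assumes n: "n > 0" and ab: "\<And>n. n \<in> S \<Longrightarrow> a n \<in> carrier C" "\<And>n. n \<in> S' \<Longrightarrow> b n \<in> carrier C"
    and e: "\<And>d. d dvd n \<Longrightarrow> d < n \<Longrightarrow> d \<in> S \<and> d \<in> S' \<and> a d = b d"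
  shows "lower_part S a n = lower_part S' b n"
  unfolding lower_part_def
  by (rule DV_ev_cong[OF alg_cring[OF C] phi_triangular[OF n]])
    (auto intro!: casg_closed[OF C] ab simp: proper_vars_def e)

lemma Phi_eq_lower_part:
  assumes a: "\<And>n. n \<in> S \<Longrightarrow> a n \<in> carrier C" and n: "n \<in> S"
  shows "Phi S C a n = a n \<oplus>\<^bsub>C\<^esub> lower_part S a n"
proof -
  let ?v = "casg C S (\<lambda>_. a)"
  have v: "?v i \<in> carrier C" for i by (rule casg_closed[OF C a])
  have "ev C ?v (X 0 n + (phi n - X 0 n)) = a n \<oplus>\<^bsub>C\<^esub> lower_part S a n"
    unfolding lower_part_def C.ev_add[of ?v, OF v] using n by (simp add: X_def C.ev_Var[of ?v, OF v])
  then show ?thesis using n by (simp add: Phi_def)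
qed

lemma Phi_restrict:
  assumes S: "divisor_stable S'" "S' \<subseteq> S" and a: "a \<in> S \<rightarrow>\<^sub>E carrier C"
  shows "restrict (Phi S C a) S' = Phi S' C (restrict a S')"
proof
  fix n
  show "restrict (Phi S C a) S' n = Phi S' C (restrict a S') n"
  proof (cases "n \<in> S'")
    case True
    note a' = PiE_mem[OF a] and r' = PiE_mem[OF restrict_in[OF a S(2)]]
    have "lower_part S a n = lower_part S' (restrict a S') n"
    proof (rule lower_part_cong[OF ds_pos[OF S(1) True] a' r'])
      fix d assume "d dvd n" "d < n"
      then show "d \<in> S \<and> d \<in> S' \<and> a d = restrict a S' d" using ds_dvd[OF S(1) True] S(2) by auto
    qed
    then show ?thesis
      using True S(2) Phi_eq_lower_part[of S a n, OF a'] Phi_eq_lower_part[of S' "restrict a S'" n, OF r'] by auto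
  qed (simp add: Phi_def)
qed

text \<open>A vector with given image is found by recursion on divisibility, as \<open>lower_part\<close> at \<open>n\<close> depends only on
  the components at proper divisors of \<open>n\<close>.\<close>

theorem Phi_bij:
  assumes S: "divisor_stable S"
  shows "bij_betw (Phi S C) (S \<rightarrow>\<^sub>E carrier C) (S \<rightarrow>\<^sub>E carrier C)"
proof (rule bij_betw_imageI)
  show "inj_on (Phi S C) (S \<rightarrow>\<^sub>E carrier C)"
  proof (rule inj_onI)
    fix a b assume ab: "a \<in> S \<rightarrow>\<^sub>E carrier C" "b \<in> S \<rightarrow>\<^sub>E carrier C" and e: "Phi S C a = Phi S C b"
    note ab' = PiE_mem[OF ab(1)] PiE_mem[OF ab(2)]
    have "n \<in> S \<Longrightarrow> a n = b n" for n
    proof (induction n rule: less_induct)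
      case (less n)
      have L: "lower_part S a n = lower_part S b n"
        using less ds_dvd[OF S less(2)] by (intro lower_part_cong ds_pos[OF S] ab') auto
      have "a n \<oplus>\<^bsub>C\<^esub> lower_part S b n = b n \<oplus>\<^bsub>C\<^esub> lower_part S b n"
        using fun_cong[OF e, of n] Phi_eq_lower_part[OF ab'(1) less(2)] Phi_eq_lower_part[OF ab'(2) less(2)] L by simp
      then show ?case using ab' lower_part_closed[of S b n] less(2) by simp
    qed
    then show "a = b" by (intro PiE_ext[OF ab])
  qed
  show "Phi S C ` (S \<rightarrow>\<^sub>E carrier C) = S \<rightarrow>\<^sub>E carrier C"
  proof
    show "Phi S C ` (S \<rightarrow>\<^sub>E carrier C) \<subseteq> S \<rightarrow>\<^sub>E carrier C" using Phi_closed by blast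
    show "S \<rightarrow>\<^sub>E carrier C \<subseteq> Phi S C ` (S \<rightarrow>\<^sub>E carrier C)"
    proof
      fix b assume b: "b \<in> S \<rightarrow>\<^sub>E carrier C"
      define cutoff where "cutoff f n d = (if d < n then f d else \<zero>\<^bsub>C\<^esub>)" for f :: "nat \<Rightarrow> 'a" and n d
      define a where "a = wfrec less_than (\<lambda>f n. if n \<in> S then b n \<ominus>\<^bsub>C\<^esub> lower_part S (cutoff f n) n else undefined)"
      have a_eq: "a n = (if n \<in> S then b n \<ominus>\<^bsub>C\<^esub> lower_part S (cutoff a n) n else undefined)" for n
      proof -
        have "cutoff (cut a less_than n) n = cutoff a n" by (auto simp: cutoff_def cut_def)
        then show ?thesis unfolding a_def by (subst wfrec[OF wf_less_than]) (simp add: a_def)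
      qed
      have ac: "n \<in> S \<Longrightarrow> a n \<in> carrier C" for n
      proof (induction n rule: less_induct)
        case (less n)
        have "lower_part S (cutoff a n) n \<in> carrier C"
          using less(1) by (intro lower_part_closed) (simp add: cutoff_def)
        then show ?case using less(2) PiE_mem[OF b less(2)] a_eq[of n] by simp
      qed
      have aE: "a \<in> S \<rightarrow>\<^sub>E carrier C" using ac a_eq by (auto simp: PiE_iff extensional_def)
      have "Phi S C a = b"
      proof (rule PiE_ext[OF Phi_closed[OF aE] b])
        fix n assume n: "n \<in> S"
        have "lower_part S a n = lower_part S (cutoff a n) n"
          using ds_dvd[OF S n] by (intro lower_part_cong ds_pos[OF S n] ac) (auto simp: cutoff_def ac)
        then show "Phi S C a n = b n"
          using Phi_eq_lower_part[OF ac n] a_eq[of n] n PiE_mem[OF b n] lower_part_closed[of S a n, OF ac]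
          by (simp add: C.minus_eq C.a_assoc C.l_neg)
      qed
      then show "b \<in> Phi S C ` (S \<rightarrow>\<^sub>E carrier C)" using aE by blast
    qed
  qed
qed

end

section \<open>The rings of q-deformed Witt vectors\<close>

lemma nonunital_cring_transport:
  assumes W: "nonunital_cring W" and f: "bij_betw f (carrier V) (carrier W)"
    and closed: "\<zero>\<^bsub>V\<^esub> \<in> carrier V"
      "\<And>x y. x \<in> carrier V \<Longrightarrow> y \<in> carrier V \<Longrightarrow> x \<oplus>\<^bsub>V\<^esub> y \<in> carrier V"
      "\<And>x y. x \<in> carrier V \<Longrightarrow> y \<in> carrier V \<Longrightarrow> x \<otimes>\<^bsub>V\<^esub> y \<in> carrier V"
    and hom: "f \<zero>\<^bsub>V\<^esub> = \<zero>\<^bsub>W\<^esub>"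
      "\<And>x y. x \<in> carrier V \<Longrightarrow> y \<in> carrier V \<Longrightarrow> f (x \<oplus>\<^bsub>V\<^esub> y) = f x \<oplus>\<^bsub>W\<^esub> f y"
      "\<And>x y. x \<in> carrier V \<Longrightarrow> y \<in> carrier V \<Longrightarrow> f (x \<otimes>\<^bsub>V\<^esub> y) = f x \<otimes>\<^bsub>W\<^esub> f y"
  shows "nonunital_cring V"
proof -
  interpret W: nonunital_cring W by (rule W)
  have inj: "f x = f y \<Longrightarrow> x = y" if "x \<in> carrier V" "y \<in> carrier V" for x y
    using f that by (auto simp: bij_betw_def dest: inj_onD)
  have fc: "x \<in> carrier V \<Longrightarrow> f x \<in> carrier W" for x using f by (auto simp: bij_betw_def)
  have surj: "\<exists>x\<in>carrier V. f x = y" if "y \<in> carrier W" for y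
    using f that unfolding bij_betw_def by (metis imageE)
  show ?thesis
  proof (rule nonunital_cringI)
    fix x assume x: "x \<in> carrier V"
    obtain y where y: "y \<in> carrier V" "f y = \<ominus>\<^bsub>W\<^esub> f x" using surj[OF W.a_inv_closed[OF fc[OF x]]] by blast
    have "y \<oplus>\<^bsub>V\<^esub> x = \<zero>\<^bsub>V\<^esub>" by (rule inj) (simp_all add: closed hom x y fc W.l_neg)
    then show "\<exists>y\<in>carrier V. y \<oplus>\<^bsub>V\<^esub> x = \<zero>\<^bsub>V\<^esub>" using y by blast
  qed (rule closed inj; simp add: closed hom fc W.a_ac W.nu_m_assoc W.nu_m_comm W.nu_m_lcomm W.nu_r_distr W.nu_m_closed)+
qed

abbreviation qvar :: "int poly" where "qvar \<equiv> [:0, 1:]"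

definition PhiI :: "nat set \<Rightarrow> (int poly, 'a) module \<Rightarrow> (nat \<Rightarrow> 'a) \<Rightarrow> nat \<Rightarrow> 'a" where
  "PhiI S C = the_inv_into (S \<rightarrow>\<^sub>E carrier C) (Phi S C)"

lemma PhiI:
  assumes "algebra Zq C" "divisor_stable S"
  shows "y \<in> S \<rightarrow>\<^sub>E carrier C \<Longrightarrow> PhiI S C y \<in> S \<rightarrow>\<^sub>E carrier C"
    "y \<in> S \<rightarrow>\<^sub>E carrier C \<Longrightarrow> Phi S C (PhiI S C y) = y"
    "x \<in> S \<rightarrow>\<^sub>E carrier C \<Longrightarrow> PhiI S C (Phi S C x) = x"
proof -
  note b = Phi_bij[OF assms]
  note inj = bij_betw_imp_inj_on[OF b] and img = bij_betw_imp_surj_on[OF b]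
  show "PhiI S C y \<in> S \<rightarrow>\<^sub>E carrier C" if "y \<in> S \<rightarrow>\<^sub>E carrier C"
    unfolding PhiI_def by (rule the_inv_into_into[OF inj _ subset_refl]) (simp only: img that)
  show "Phi S C (PhiI S C y) = y" if "y \<in> S \<rightarrow>\<^sub>E carrier C"
    unfolding PhiI_def by (rule f_the_inv_into_f[OF inj]) (simp only: img that)
  show "PhiI S C (Phi S C x) = x" if "x \<in> S \<rightarrow>\<^sub>E carrier C"
    unfolding PhiI_def by (rule the_inv_into_f_f[OF inj that])
qed

lemma Phi_inj:
  assumes "algebra Zq C" "divisor_stable S" "x \<in> S \<rightarrow>\<^sub>E carrier C" "y \<in> S \<rightarrow>\<^sub>E carrier C" "Phi S C x = Phi S C y"
  shows "x = y"
  using arg_cong[OF assms(5), of "PhiI S C"]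
  unfolding PhiI(3)[OF assms(1,2,3)] PhiI(3)[OF assms(1,2,4)] .

lemma PhiI_nat:
  assumes C: "algebra Zq C" and D: "algebra Zq D" and S: "divisor_stable S" and h: "h \<in> alg_hom Zq C D"
    and y: "y \<in> S \<rightarrow>\<^sub>E carrier C"
  shows "vec_map S h (PhiI S C y) = PhiI S D (vec_map S h y)"
proof -
  note P = PhiI(1)[OF C S y]
  have hc: "vec_map S h z \<in> S \<rightarrow>\<^sub>E carrier D" if "z \<in> S \<rightarrow>\<^sub>E carrier C" for z
    by (rule vec_map_in[OF that]) (rule alg_homD(3)[OF h])
  show ?thesis
    by (rule Phi_inj[OF D S hc[OF P] PhiI(1)[OF D S hc[OF y]]])
      (simp only: Phi_nat[OF C D h P, symmetric] PhiI(2)[OF C S y] PhiI(2)[OF D S hc[OF y]])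
qed

text \<open>Transport of the ring structure along the comparison map shows that a structure as required exists.\<close>

definition wbar_model :: "nat set \<Rightarrow> (int poly, 'a) module \<Rightarrow> (nat \<Rightarrow> 'a) ring" where
  "wbar_model S C = (let W = witt_ring S (twist qvar C) in \<lparr>carrier = S \<rightarrow>\<^sub>E carrier C,
     mult = (\<lambda>x y. PhiI S C (Phi S C x \<otimes>\<^bsub>W\<^esub> Phi S C y)), one = undefined, zero = PhiI S C \<zero>\<^bsub>W\<^esub>,
     add = (\<lambda>x y. PhiI S C (Phi S C x \<oplus>\<^bsub>W\<^esub> Phi S C y))\<rparr>)"

lemma wbar_model_simps [simp]:
  "carrier (wbar_model S C) = S \<rightarrow>\<^sub>E carrier C"
  "x \<otimes>\<^bsub>wbar_model S C\<^esub> y = PhiI S C (Phi S C x \<otimes>\<^bsub>witt_ring S (twist qvar C)\<^esub> Phi S C y)"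
  "\<zero>\<^bsub>wbar_model S C\<^esub> = PhiI S C \<zero>\<^bsub>witt_ring S (twist qvar C)\<^esub>"
  "x \<oplus>\<^bsub>wbar_model S C\<^esub> y = PhiI S C (Phi S C x \<oplus>\<^bsub>witt_ring S (twist qvar C)\<^esub> Phi S C y)"
  by (simp_all add: wbar_model_def Let_def)

lemma nu_ring_hom_comp:
  "f \<in> nu_ring_hom A B \<Longrightarrow> g \<in> nu_ring_hom B C \<Longrightarrow> (\<lambda>x. g (f x)) \<in> nu_ring_hom A C"
  by (rule nu_ring_homI) (simp_all add: nu_ring_homD)

lemma add_hom_comp:
  "f \<in> add_hom A B \<Longrightarrow> g \<in> add_hom B C \<Longrightarrow> (\<lambda>x. g (f x)) \<in> add_hom A C"
  by (rule add_homI) (simp_all add: add_homD)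

context
  assumes inf: "infinite (UNIV :: 'u set)"
begin

abbreviation (input) "EU \<equiv> (EM UNIV :: (int poly, 'u) module)"

lemma algebra_EU: "algebra Zq EU"
  by (rule algebra_EM[OF inf]) simp

lemma GX_EU: "(GX S k :: nat \<Rightarrow> 'u) \<in> S \<rightarrow>\<^sub>E carrier (EM UNIV)"
  by (simp add: GX_def X_def)

lemma EU_cover:
  fixes C :: "(int poly, 'u) module"
  assumes C: "algebra Zq C" and x: "x \<in> S \<rightarrow>\<^sub>E carrier C" "y \<in> S \<rightarrow>\<^sub>E carrier C"
  shows "\<exists>h\<in>alg_hom Zq EU C. vec_map S h (GX S 0) = x \<and> vec_map S h (GX S 1) = y"
proof (intro bexI conjI)
  interpret C: cring C by (rule alg_cring[OF C])
  let ?v = "casg C S (two x y)"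
  let ?h = "\<lambda>z\<in>carrier EU. ev C ?v (unemb z)"
  have t: "two x y k \<in> S \<rightarrow>\<^sub>E carrier C" for k by (rule two_in[OF x])
  have v: "?v i \<in> carrier C" for i by (rule casg_closed[OF C PiE_mem[OF t]])
  show "?h \<in> alg_hom Zq EU C" by (rule EM_hom[OF inf _ C v]) simp_all
  have k: "vec_map S ?h (GX S k) = two x y k" if "k < 2" for k
  proof (rule PiE_ext[of _ S "\<lambda>_. carrier C"])
    fix n assume n: "n \<in> S"
    then show "vec_map S ?h (GX S k) n = two x y k n"
      using PiE_mem[OF GX_EU[of S k] n] that
      by (simp add: vec_map_def GX_def unemb_emb[OF inf] X_def C.ev_Var[of ?v, OF v])
  qed (use t C.ev_closed[of ?v, OF v] PiE_mem[OF GX_EU[of S k]] in \<open>auto simp: vec_map_def\<close>)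
  show "vec_map S ?h (GX S 0) = x" "vec_map S ?h (GX S 1) = y" using k[of 0] k[of 1] by simp_all
qed

text \<open>The analogue of \<open>witt_identity\<close> for algebras, with \<open>\<int>[q]\<close>-polynomials as the generic algebra.\<close>

lemma alg_identity:
  fixes C :: "(int poly, 'u) module"
  assumes S': "divisor_stable S'" and C: "algebra Zq C"
    and closed: "\<And>a b. a \<in> S \<rightarrow>\<^sub>E carrier EU \<Longrightarrow> b \<in> S \<rightarrow>\<^sub>E carrier EU \<Longrightarrow> f EU a b \<in> S' \<rightarrow>\<^sub>E carrier EU"
      "\<And>a b. a \<in> S \<rightarrow>\<^sub>E carrier EU \<Longrightarrow> b \<in> S \<rightarrow>\<^sub>E carrier EU \<Longrightarrow> g EU a b \<in> S' \<rightarrow>\<^sub>E carrier EU"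
    and ghost: "\<And>a b n. a \<in> S \<rightarrow>\<^sub>E carrier EU \<Longrightarrow> b \<in> S \<rightarrow>\<^sub>E carrier EU \<Longrightarrow> n \<in> S' \<Longrightarrow>
      witt_ghost S' (twist qvar EU) (f EU a b) n = witt_ghost S' (twist qvar EU) (g EU a b) n"
    and nat: "\<And>h a b. h \<in> alg_hom Zq EU C \<Longrightarrow> a \<in> S \<rightarrow>\<^sub>E carrier EU \<Longrightarrow> b \<in> S \<rightarrow>\<^sub>E carrier EU \<Longrightarrow>
        vec_map S' h (f EU a b) = f C (vec_map S h a) (vec_map S h b)"
      "\<And>h a b. h \<in> alg_hom Zq EU C \<Longrightarrow> a \<in> S \<rightarrow>\<^sub>E carrier EU \<Longrightarrow> b \<in> S \<rightarrow>\<^sub>E carrier EU \<Longrightarrow>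
        vec_map S' h (g EU a b) = g C (vec_map S h a) (vec_map S h b)"
    and x: "x \<in> S \<rightarrow>\<^sub>E carrier C" "y \<in> S \<rightarrow>\<^sub>E carrier C"
  shows "f C x y = g C x y"
proof -
  obtain h where h: "h \<in> alg_hom Zq EU C" "vec_map S h (GX S 0) = x" "vec_map S h (GX S 1) = y"
    using EU_cover[OF C x] by blast
  have G: "(GX S 0 :: nat \<Rightarrow> 'u) \<in> S \<rightarrow>\<^sub>E carrier EU" "(GX S 1 :: nat \<Rightarrow> 'u) \<in> S \<rightarrow>\<^sub>E carrier EU" by (rule GX_EU)+
  have tc: "carrier (twist qvar EU) = carrier EU" by (rule twist_simps[OF algebra_EU])
  have "witt_ghost S' (twist qvar EU) (f EU (GX S 0) (GX S 1)) = witt_ghost S' (twist qvar EU) (g EU (GX S 0) (GX S 1))"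
    by (rule witt_ghost_ext) (rule ghost[OF G])
  then have "f EU (GX S 0) (GX S 1) = g EU (GX S 0) (GX S 1)"
    by (rule witt_ghost_inj[OF nonunital_twist[OF algebra_EU, of qvar] torsion_free_EM[OF inf UNIV_I] S', unfolded tc,
        OF closed(1)[OF G] closed(2)[OF G]])
  then show ?thesis using nat(1)[OF h(1) G] nat(2)[OF h(1) G] h(2,3) by simp
qed

context
  fixes S :: "nat set"
  assumes S: "divisor_stable S"
begin

lemma witt_ring_twist:
  assumes C: "algebra Zq (C :: (int poly, 'u) module)"
  shows "nonunital_cring (witt_ring S (twist r C))" "carrier (witt_ring S (twist r C)) = S \<rightarrow>\<^sub>E carrier C"
    "x \<in> S \<rightarrow>\<^sub>E carrier C \<Longrightarrow> y \<in> S \<rightarrow>\<^sub>E carrier C \<Longrightarrow> x \<oplus>\<^bsub>witt_ring S (twist r C)\<^esub> y \<in> S \<rightarrow>\<^sub>E carrier C"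
    "x \<in> S \<rightarrow>\<^sub>E carrier C \<Longrightarrow> y \<in> S \<rightarrow>\<^sub>E carrier C \<Longrightarrow> x \<otimes>\<^bsub>witt_ring S (twist r C)\<^esub> y \<in> S \<rightarrow>\<^sub>E carrier C"
  using nonunital_witt_ring[OF inf S nonunital_twist[OF C]] carrier_witt_ring[OF inf S nonunital_twist[OF C]]
    witt_ring_closed[OF inf S nonunital_twist[OF C], of x r y] by (simp_all only: twist_simps[OF C])

lemma witt_ring_twist_nat:
  assumes C: "algebra Zq (C :: (int poly, 'u) module)" and D: "algebra Zq (D :: (int poly, 'u) module)"
    and h: "h \<in> alg_hom Zq C D"
  shows "vec_map S h \<in> nu_ring_hom (witt_ring S (twist r C)) (witt_ring S (twist r D))"
  by (rule vec_map_witt_hom[OF inf S nonunital_twist[OF C] nonunital_twist[OF D] alg_hom_twist[OF C h]])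

lemma Phi_model:
  assumes C: "algebra Zq (C :: (int poly, 'u) module)"
  shows "nonunital_cring (wbar_model S C)" "Phi S C \<in> nu_ring_hom (wbar_model S C) (witt_ring S (twist qvar C))"
proof -
  note P = Phi_closed[OF C] and I = PhiI[OF C S] and W = witt_ring_twist[OF C]
  interpret W: nonunital_cring "witt_ring S (twist qvar C)" by (rule W)
  have z: "\<zero>\<^bsub>witt_ring S (twist qvar C)\<^esub> \<in> S \<rightarrow>\<^sub>E carrier C" using W.zero_closed unfolding W(2) .
  show "Phi S C \<in> nu_ring_hom (wbar_model S C) (witt_ring S (twist qvar C))"
    unfolding wbar_model_simps
    by (rule nu_ring_homI) (simp_all only: wbar_model_simps W(2) P I(1,2) W(3,4))
  show "nonunital_cring (wbar_model S C)"
    by (rule nonunital_cring_transport[OF W(1), where f = "Phi S C"])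
      (simp_all only: wbar_model_simps W(2) P I(1,2) W(3,4) z Phi_bij[OF C S])
qed

lemma is_wbar_ring_model: "is_wbar_ring S (wbar_model S :: (int poly, 'u) module \<Rightarrow> _)"
  unfolding is_wbar_ring_def
proof (intro conjI allI impI ballI; (elim conjE)?)
  fix C :: "(int poly, 'u) module" assume C: "algebra Zq C"
  note P = Phi_closed[OF C] and I = PhiI[OF C S] and W = witt_ring_twist[OF C]
  show "nonunital_cring (wbar_model S C)" by (rule Phi_model[OF C])
  show "carrier (wbar_model S C) = S \<rightarrow>\<^sub>E carrier C" by simp
  have "(\<lambda>x. witt_ghost S (twist qvar C) (Phi S C x)) \<in> nu_ring_hom (wbar_model S C) (power_ring S (twist qvar C))"
    by (rule nu_ring_hom_comp[OF Phi_model(2)[OF C] witt_ghost_hom[OF inf S nonunital_twist[OF C]]])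
  note h = nu_ring_homD[OF this, unfolded wbar_model_simps(1)]
  show "wbar_ghost S C \<in> nu_ring_hom (wbar_model S C) (power_ring S (twist qvar C))"
    using h(2-4) unfolding wbar_model_simps
    by (intro nu_ring_homI) (simp_all only: Phi_ghost[OF C S, symmetric] wbar_model_simps I(1) P W(3,4))
next
  fix C D :: "(int poly, 'u) module" and h
  assume C: "algebra Zq C" and D: "algebra Zq D" and h: "h \<in> alg_hom Zq C D"
  note P = Phi_closed[OF C] and W = witt_ring_twist[OF C]
  note n = nu_ring_homD[OF witt_ring_twist_nat[OF C D h, of qvar], unfolded W(2)]
  show "vec_map S h \<in> nu_ring_hom (wbar_model S C) (wbar_model S D)"
    by (rule nu_ring_homI)
      (simp_all only: wbar_model_simps vec_map_in[OF _ alg_homD(3)[OF h]] PhiI_nat[OF C D S h] P W(3,4) n(3,4) Phi_nat[OF C D h])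
qed

lemma is_wbar_ring_wbar_ring: "is_wbar_ring S (wbar_ring S :: (int poly, 'u) module \<Rightarrow> _)"
  unfolding wbar_ring_def by (rule someI[where P = "is_wbar_ring S"]) (rule is_wbar_ring_model)

lemma wbar_ring_facts:
  assumes C: "algebra Zq (C :: (int poly, 'u) module)"
  shows "nonunital_cring (wbar_ring S C)" "carrier (wbar_ring S C) = S \<rightarrow>\<^sub>E carrier C"
    "wbar_ghost S C \<in> nu_ring_hom (wbar_ring S C) (power_ring S (twist qvar C))"
  using is_wbar_ring_wbar_ring C unfolding is_wbar_ring_def by blast+

lemma wbar_ring_closed:
  assumes C: "algebra Zq (C :: (int poly, 'u) module)" and x: "x \<in> S \<rightarrow>\<^sub>E carrier C" "y \<in> S \<rightarrow>\<^sub>E carrier C"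
  shows "x \<oplus>\<^bsub>wbar_ring S C\<^esub> y \<in> S \<rightarrow>\<^sub>E carrier C" "x \<otimes>\<^bsub>wbar_ring S C\<^esub> y \<in> S \<rightarrow>\<^sub>E carrier C"
  using abelian_monoid.a_closed[OF abelian_group.axioms(1)[OF nu_abelian[OF wbar_ring_facts(1)[OF C]]], of x y]
    nonunital_cring.nu_m_closed[OF wbar_ring_facts(1)[OF C], of x y] x by (simp_all only: wbar_ring_facts(2)[OF C])

lemma wbar_ring_nat:
  assumes C: "algebra Zq (C :: (int poly, 'u) module)" and D: "algebra Zq (D :: (int poly, 'u) module)"
    and h: "h \<in> alg_hom Zq C D"
  shows "vec_map S h \<in> nu_ring_hom (wbar_ring S C) (wbar_ring S D)"
  using is_wbar_ring_wbar_ring C D h unfolding is_wbar_ring_def by blast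

lemma wbar_ring_ghost:
  assumes C: "algebra Zq (C :: (int poly, 'u) module)" and x: "x \<in> S \<rightarrow>\<^sub>E carrier C" "y \<in> S \<rightarrow>\<^sub>E carrier C" and n: "n \<in> S"
  shows "wbar_ghost S C (x \<oplus>\<^bsub>wbar_ring S C\<^esub> y) n = wbar_ghost S C x n \<oplus>\<^bsub>twist qvar C\<^esub> wbar_ghost S C y n"
    "wbar_ghost S C (x \<otimes>\<^bsub>wbar_ring S C\<^esub> y) n = wbar_ghost S C x n \<otimes>\<^bsub>twist qvar C\<^esub> wbar_ghost S C y n"
  using nu_ring_homD(3,4)[OF wbar_ring_facts(3)[OF C], of x y] x n unfolding wbar_ring_facts(2)[OF C] by simp_all

text \<open>The selected structure is only known through its ghost map and its functoriality; over the generic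
  algebra these determine it, and the general case follows by \<open>alg_identity\<close>.\<close>

theorem Phi_hom:
  assumes C: "algebra Zq (C :: (int poly, 'u) module)"
  shows "Phi S C \<in> nu_ring_hom (wbar_ring S C) (witt_ring S (twist qvar C))"
proof -
  note E = algebra_EU
  note nt = nonunital_twist[OF E, of qvar] and tc = twist_simps(1)[OF E]
  note gh = witt_ghost_ops[OF inf S nt, unfolded tc]
  have add: "Phi S C (x \<oplus>\<^bsub>wbar_ring S C\<^esub> y) = Phi S C x \<oplus>\<^bsub>witt_ring S (twist qvar C)\<^esub> Phi S C y"
    if xy: "x \<in> S \<rightarrow>\<^sub>E carrier C" "y \<in> S \<rightarrow>\<^sub>E carrier C" for x y
    by (rule alg_identity[where f = "\<lambda>C x y. Phi S C (x \<oplus>\<^bsub>wbar_ring S C\<^esub> y)" and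
          g = "\<lambda>C x y. Phi S C x \<oplus>\<^bsub>witt_ring S (twist qvar C)\<^esub> Phi S C y", OF S C _ _ _ _ _ xy])
      (simp_all only: Phi_closed[OF E] wbar_ring_closed[OF E] witt_ring_twist[OF E] gh Phi_ghost[OF E S] wbar_ring_ghost[OF E]
        Phi_nat[OF E C] nu_ring_homD(3)[OF wbar_ring_nat[OF E C]] nu_ring_homD(3)[OF witt_ring_twist_nat[OF E C]] wbar_ring_facts(2)[OF E])
  have mult: "Phi S C (x \<otimes>\<^bsub>wbar_ring S C\<^esub> y) = Phi S C x \<otimes>\<^bsub>witt_ring S (twist qvar C)\<^esub> Phi S C y"
    if xy: "x \<in> S \<rightarrow>\<^sub>E carrier C" "y \<in> S \<rightarrow>\<^sub>E carrier C" for x y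
    by (rule alg_identity[where f = "\<lambda>C x y. Phi S C (x \<otimes>\<^bsub>wbar_ring S C\<^esub> y)" and
          g = "\<lambda>C x y. Phi S C x \<otimes>\<^bsub>witt_ring S (twist qvar C)\<^esub> Phi S C y", OF S C _ _ _ _ _ xy])
      (simp_all only: Phi_closed[OF E] wbar_ring_closed[OF E] witt_ring_twist[OF E] gh Phi_ghost[OF E S] wbar_ring_ghost[OF E]
        Phi_nat[OF E C] nu_ring_homD(4)[OF wbar_ring_nat[OF E C]] nu_ring_homD(4)[OF witt_ring_twist_nat[OF E C]] wbar_ring_facts(2)[OF E])
  show ?thesis
    by (rule nu_ring_homI) (simp_all only: wbar_ring_facts(2)[OF C] witt_ring_twist(2)[OF C] Phi_closed[OF C] add mult)
qed

lemma PhiI_hom: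
  assumes C: "algebra Zq (C :: (int poly, 'u) module)"
  shows "PhiI S C \<in> nu_ring_hom (witt_ring S (twist qvar C)) (wbar_ring S C)"
proof -
  note I = PhiI[OF C S] and h = nu_ring_homD(3,4)[OF Phi_hom[OF C], unfolded wbar_ring_facts(2)[OF C]]
  note inj = Phi_inj[OF C S]
  have "PhiI S C (x \<oplus>\<^bsub>witt_ring S (twist qvar C)\<^esub> y) = PhiI S C x \<oplus>\<^bsub>wbar_ring S C\<^esub> PhiI S C y"
    "PhiI S C (x \<otimes>\<^bsub>witt_ring S (twist qvar C)\<^esub> y) = PhiI S C x \<otimes>\<^bsub>wbar_ring S C\<^esub> PhiI S C y"
    if "x \<in> S \<rightarrow>\<^sub>E carrier C" "y \<in> S \<rightarrow>\<^sub>E carrier C" for x y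
    by (rule inj; simp only: I(1,2) witt_ring_twist(3,4)[OF C] wbar_ring_closed[OF C] h that)+
  then show ?thesis
    by (intro nu_ring_homI) (simp_all only: wbar_ring_facts(2)[OF C] witt_ring_twist(2)[OF C] I(1))
qed

end

end

section \<open>Frobenius and Verschiebung on the deformed Witt vectors\<close>

context
  assumes inf: "infinite (UNIV :: 'u set)"
begin

context
  fixes S :: "nat set" and p :: nat
  assumes S: "divisor_stable S" and p: "p \<in> S"
begin

lemma quot_stable: "divisor_stable (S /\<^sub>d p)" by (rule ds_quot[OF S p])

lemma witt_frob_twist:
  assumes C: "algebra Zq (C :: (int poly, 'u) module)" and a: "a \<in> S \<rightarrow>\<^sub>E carrier C"
  shows "witt_frob p S (twist r C) a \<in> S /\<^sub>d p \<rightarrow>\<^sub>E carrier C"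
    "\<nu> \<in> S /\<^sub>d p \<Longrightarrow> witt_ghost (S /\<^sub>d p) (twist r C) (witt_frob p S (twist r C) a) \<nu> = witt_ghost S (twist r C) a (p * \<nu>)"
  using witt_frob_closed[OF inf S p nonunital_twist[OF C]] witt_frob_ghost[OF inf S p nonunital_twist[OF C]] a
  by (simp_all only: twist_simps[OF C])

lemma witt_frob_twist_nat:
  assumes C: "algebra Zq (C :: (int poly, 'u) module)" and D: "algebra Zq (D :: (int poly, 'u) module)"
    and h: "h \<in> alg_hom Zq C D" and a: "a \<in> S \<rightarrow>\<^sub>E carrier C"
  shows "vec_map (S /\<^sub>d p) h (witt_frob p S (twist r C) a) = witt_frob p S (twist r D) (vec_map S h a)"
  using witt_frob_nat[OF inf S p nonunital_twist[OF C] nonunital_twist[OF D] alg_hom_twist[OF C h]] a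
  by (simp only: twist_simps[OF C])

lemma witt_ver_twist:
  assumes C: "algebra Zq (C :: (int poly, 'u) module)" and a: "a \<in> S /\<^sub>d p \<rightarrow>\<^sub>E carrier C"
  shows "witt_ver p S (twist r C) a \<in> S \<rightarrow>\<^sub>E carrier C"
    "n \<in> S \<Longrightarrow> witt_ghost S (twist r C) (witt_ver p S (twist r C) a) n =
       (if p dvd n then [p] \<cdot>\<^bsub>C\<^esub> witt_ghost (S /\<^sub>d p) (twist r C) a (n div p) else \<zero>\<^bsub>C\<^esub>)"
  using witt_ver_closed[OF inf S p nonunital_twist[OF C]] witt_ver_ghost[OF inf S p nonunital_twist[OF C]] a
  by (simp_all only: twist_simps[OF C] twist_additive[OF C])

lemma witt_ver_twist_nat:
  assumes C: "algebra Zq (C :: (int poly, 'u) module)" and D: "algebra Zq (D :: (int poly, 'u) module)"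
    and h: "h \<in> alg_hom Zq C D"
  shows "vec_map S h (witt_ver p S (twist r C) a) = witt_ver p S (twist r D) (vec_map (S /\<^sub>d p) h a)"
  by (rule witt_ver_nat[OF inf S p nonunital_twist[OF C] nonunital_twist[OF D] alg_hom_twist[OF C h]])

lemma is_wbar_frob_wbar_frob: "is_wbar_frob p S (wbar_frob p S :: (int poly, 'u) module \<Rightarrow> _)"
proof -
  let ?F = "\<lambda>(C :: (int poly, 'u) module) a. PhiI (S /\<^sub>d p) C (witt_frob p S (twist qvar C) (Phi S C a))"
  have "is_wbar_frob p S ?F"
    unfolding is_wbar_frob_def
  proof (intro conjI allI impI ballI; (elim conjE)?)
    fix C :: "(int poly, 'u) module" assume C: "algebra Zq C"
    note car = wbar_ring_facts(2)[OF inf S C] wbar_ring_facts(2)[OF inf quot_stable C]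
    show "?F C \<in> nu_ring_hom (wbar_ring S C) (wbar_ring (S /\<^sub>d p) C)"
      by (rule nu_ring_hom_comp[OF nu_ring_hom_comp[OF Phi_hom[OF inf S C] witt_frob_hom[OF inf S p nonunital_twist[OF C]]]
            PhiI_hom[OF inf quot_stable C]])
    fix a assume "a \<in> carrier (wbar_ring S C)"
    then have a: "a \<in> S \<rightarrow>\<^sub>E carrier C" by (simp only: car)
    note P = Phi_closed[OF C a]
    note F = witt_frob_twist[OF C P, where r = qvar]
    show "wbar_ghost (S /\<^sub>d p) C (?F C a) = (\<lambda>\<nu>\<in>S /\<^sub>d p. wbar_ghost S C a (p * \<nu>))"
    proof
      fix \<nu>
      show "wbar_ghost (S /\<^sub>d p) C (?F C a) \<nu> = (\<lambda>\<nu>\<in>S /\<^sub>d p. wbar_ghost S C a (p * \<nu>)) \<nu>"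
      proof (cases "\<nu> \<in> S /\<^sub>d p")
        case True
        then show ?thesis
          by (simp add: Phi_ghost[OF C quot_stable PhiI(1)[OF C quot_stable F(1)], symmetric] Phi_ghost[OF C S a, symmetric]
              PhiI(2)[OF C quot_stable F(1)] F(2)[OF True])
      qed (simp add: wbar_ghost_def)
    qed
  next
    fix C D :: "(int poly, 'u) module" and h a
    assume C: "algebra Zq C" and D: "algebra Zq D" and h: "h \<in> alg_hom Zq C D" and "a \<in> carrier (wbar_ring S C)"
    then have a: "a \<in> S \<rightarrow>\<^sub>E carrier C" by (simp only: wbar_ring_facts(2)[OF inf S C])
    note P = Phi_closed[OF C a]
    note F = witt_frob_twist(1)[OF C P, where r = qvar]
    show "?F D (vec_map S h a) = vec_map (S /\<^sub>d p) h (?F C a)"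
      unfolding PhiI_nat[OF C D quot_stable h F] witt_frob_twist_nat[OF C D h P] Phi_nat[OF C D h a] ..
  qed
  then show ?thesis unfolding wbar_frob_def by (rule someI[where P = "is_wbar_frob p S"])
qed

lemma is_wbar_ver_wbar_ver: "is_wbar_ver p S (wbar_ver p S :: (int poly, 'u) module \<Rightarrow> _)"
proof -
  let ?V = "\<lambda>(C :: (int poly, 'u) module) a. PhiI S C (witt_ver p S (twist qvar C) (Phi (S /\<^sub>d p) C a))"
  have "is_wbar_ver p S ?V"
    unfolding is_wbar_ver_def
  proof (intro conjI allI impI ballI; (elim conjE)?)
    fix C :: "(int poly, 'u) module" assume C: "algebra Zq C"
    note car = wbar_ring_facts(2)[OF inf S C] wbar_ring_facts(2)[OF inf quot_stable C]
    show "?V C \<in> add_hom (wbar_ring (S /\<^sub>d p) C) (wbar_ring S C)"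
      by (rule add_hom_comp[OF add_hom_comp[OF nu_ring_homD(1)[OF Phi_hom[OF inf quot_stable C]]
            witt_ver_hom[OF inf S p nonunital_twist[OF C]]] nu_ring_homD(1)[OF PhiI_hom[OF inf S C]]])
    fix a assume "a \<in> carrier (wbar_ring (S /\<^sub>d p) C)"
    then have a: "a \<in> S /\<^sub>d p \<rightarrow>\<^sub>E carrier C" by (simp only: car)
    note P = Phi_closed[OF C a]
    note V = witt_ver_twist[OF C P, where r = qvar]
    show "wbar_ghost S C (?V C a) =
        (\<lambda>\<nu>\<in>S. if p dvd \<nu> then [p] \<cdot>\<^bsub>C\<^esub> wbar_ghost (S /\<^sub>d p) C a (\<nu> div p) else \<zero>\<^bsub>C\<^esub>)" (is "_ = ?R")
    proof
      fix \<nu>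
      show "wbar_ghost S C (?V C a) \<nu> = ?R \<nu>"
      proof (cases "\<nu> \<in> S")
        case True
        then show ?thesis
          by (simp add: Phi_ghost[OF C S PhiI(1)[OF C S V(1)], symmetric] Phi_ghost[OF C quot_stable a, symmetric]
              PhiI(2)[OF C S V(1)] V(2)[OF True])
      qed (simp add: wbar_ghost_def)
    qed
  next
    fix C D :: "(int poly, 'u) module" and h a
    assume C: "algebra Zq C" and D: "algebra Zq D" and h: "h \<in> alg_hom Zq C D" and "a \<in> carrier (wbar_ring (S /\<^sub>d p) C)"
    then have a: "a \<in> S /\<^sub>d p \<rightarrow>\<^sub>E carrier C" by (simp only: wbar_ring_facts(2)[OF inf quot_stable C])
    note P = Phi_closed[OF C a]
    note V = witt_ver_twist(1)[OF C P, where r = qvar]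
    show "?V D (vec_map (S /\<^sub>d p) h a) = vec_map S h (?V C a)"
      unfolding PhiI_nat[OF C D S h V] witt_ver_twist_nat[OF C D h] Phi_nat[OF C D h a] ..
  qed
  then show ?thesis unfolding wbar_ver_def by (rule someI[where P = "is_wbar_ver p S"])
qed

context
  fixes C :: "(int poly, 'u) module"
  assumes C: "algebra Zq C"
begin

lemma wbar_frob_facts:
  assumes a: "a \<in> S \<rightarrow>\<^sub>E carrier C"
  shows "wbar_frob p S C a \<in> S /\<^sub>d p \<rightarrow>\<^sub>E carrier C"
    "\<nu> \<in> S /\<^sub>d p \<Longrightarrow> wbar_ghost (S /\<^sub>d p) C (wbar_frob p S C a) \<nu> = wbar_ghost S C a (p * \<nu>)"
proof -
  have h: "wbar_frob p S C \<in> nu_ring_hom (wbar_ring S C) (wbar_ring (S /\<^sub>d p) C)"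
    using is_wbar_frob_wbar_frob C unfolding is_wbar_frob_def by blast
  show "wbar_frob p S C a \<in> S /\<^sub>d p \<rightarrow>\<^sub>E carrier C"
    using nu_ring_homD(2)[OF h, of a] a by (simp only: wbar_ring_facts(2)[OF inf S C] wbar_ring_facts(2)[OF inf quot_stable C])
  have "wbar_ghost (S /\<^sub>d p) C (wbar_frob p S C a) = (\<lambda>\<nu>\<in>S /\<^sub>d p. wbar_ghost S C a (p * \<nu>))"
    using is_wbar_frob_wbar_frob C a wbar_ring_facts(2)[OF inf S C] unfolding is_wbar_frob_def by blast
  then show "\<nu> \<in> S /\<^sub>d p \<Longrightarrow> wbar_ghost (S /\<^sub>d p) C (wbar_frob p S C a) \<nu> = wbar_ghost S C a (p * \<nu>)" by simp
qed

lemma wbar_ver_facts: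
  assumes a: "a \<in> S /\<^sub>d p \<rightarrow>\<^sub>E carrier C"
  shows "wbar_ver p S C a \<in> S \<rightarrow>\<^sub>E carrier C"
    "n \<in> S \<Longrightarrow> wbar_ghost S C (wbar_ver p S C a) n =
       (if p dvd n then [p] \<cdot>\<^bsub>C\<^esub> wbar_ghost (S /\<^sub>d p) C a (n div p) else \<zero>\<^bsub>C\<^esub>)"
proof -
  have h: "wbar_ver p S C \<in> add_hom (wbar_ring (S /\<^sub>d p) C) (wbar_ring S C)"
    using is_wbar_ver_wbar_ver C unfolding is_wbar_ver_def by blast
  show "wbar_ver p S C a \<in> S \<rightarrow>\<^sub>E carrier C"
    using add_homD(1)[OF h, of a] a by (simp only: wbar_ring_facts(2)[OF inf S C] wbar_ring_facts(2)[OF inf quot_stable C])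
  have "wbar_ghost S C (wbar_ver p S C a) =
      (\<lambda>\<nu>\<in>S. if p dvd \<nu> then [p] \<cdot>\<^bsub>C\<^esub> wbar_ghost (S /\<^sub>d p) C a (\<nu> div p) else \<zero>\<^bsub>C\<^esub>)"
    using is_wbar_ver_wbar_ver C a wbar_ring_facts(2)[OF inf quot_stable C] unfolding is_wbar_ver_def by blast
  then show "n \<in> S \<Longrightarrow> wbar_ghost S C (wbar_ver p S C a) n =
       (if p dvd n then [p] \<cdot>\<^bsub>C\<^esub> wbar_ghost (S /\<^sub>d p) C a (n div p) else \<zero>\<^bsub>C\<^esub>)" by simp
qed

lemma wbar_frob_ver_nat:
  assumes D: "algebra Zq (D :: (int poly, 'u) module)" and h: "h \<in> alg_hom Zq C D"
  shows "a \<in> S \<rightarrow>\<^sub>E carrier C \<Longrightarrow> vec_map (S /\<^sub>d p) h (wbar_frob p S C a) = wbar_frob p S D (vec_map S h a)"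
    "a \<in> S /\<^sub>d p \<rightarrow>\<^sub>E carrier C \<Longrightarrow> vec_map S h (wbar_ver p S C a) = wbar_ver p S D (vec_map (S /\<^sub>d p) h a)"
proof -
  show "a \<in> S \<rightarrow>\<^sub>E carrier C \<Longrightarrow> vec_map (S /\<^sub>d p) h (wbar_frob p S C a) = wbar_frob p S D (vec_map S h a)"
    using is_wbar_frob_wbar_frob[unfolded is_wbar_frob_def, THEN conjunct2, rule_format, of C D h a] C D h
    by (simp only: wbar_ring_facts(2)[OF inf S C] simp_thms)
  show "a \<in> S /\<^sub>d p \<rightarrow>\<^sub>E carrier C \<Longrightarrow> vec_map S h (wbar_ver p S C a) = wbar_ver p S D (vec_map (S /\<^sub>d p) h a)"
    using is_wbar_ver_wbar_ver[unfolded is_wbar_ver_def, THEN conjunct2, rule_format, of C D h a] C D h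
    by (simp only: wbar_ring_facts(2)[OF inf quot_stable C] simp_thms)
qed

end

lemma Phi_frob:
  assumes C: "algebra Zq (C :: (int poly, 'u) module)" and a: "a \<in> S \<rightarrow>\<^sub>E carrier C"
  shows "Phi (S /\<^sub>d p) C (wbar_frob p S C a) = witt_frob p S (twist qvar C) (Phi S C a)"
proof (rule alg_identity[OF inf quot_stable C, where S = S and x = a and y = a
      and f = "\<lambda>C a _. Phi (S /\<^sub>d p) C (wbar_frob p S C a)" and g = "\<lambda>C a _. witt_frob p S (twist qvar C) (Phi S C a)"])
  note E = algebra_EU[OF inf]
  fix a :: "nat \<Rightarrow> 'u" assume a: "a \<in> S \<rightarrow>\<^sub>E carrier (EM UNIV)"
  note P = Phi_closed[OF E a] and B = wbar_frob_facts[OF E a]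
  note F = witt_frob_twist[OF E P, where r = qvar]
  show "Phi (S /\<^sub>d p) (EM UNIV) (wbar_frob p S (EM UNIV) a) \<in> S /\<^sub>d p \<rightarrow>\<^sub>E carrier (EM UNIV)" by (rule Phi_closed[OF E B(1)])
  show "witt_frob p S (twist qvar (EM UNIV)) (Phi S (EM UNIV) a) \<in> S /\<^sub>d p \<rightarrow>\<^sub>E carrier (EM UNIV)" by (rule F(1))
  show "witt_ghost (S /\<^sub>d p) (twist qvar (EM UNIV)) (Phi (S /\<^sub>d p) (EM UNIV) (wbar_frob p S (EM UNIV) a)) n
     = witt_ghost (S /\<^sub>d p) (twist qvar (EM UNIV)) (witt_frob p S (twist qvar (EM UNIV)) (Phi S (EM UNIV) a)) n"
    if n: "n \<in> S /\<^sub>d p" for n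
    unfolding Phi_ghost[OF E quot_stable B(1)] B(2)[OF n] F(2)[OF n] Phi_ghost[OF E S a] ..
  fix h assume h: "h \<in> alg_hom Zq (EM UNIV :: (int poly, 'u) module) C"
  show "vec_map (S /\<^sub>d p) h (Phi (S /\<^sub>d p) (EM UNIV) (wbar_frob p S (EM UNIV) a)) = Phi (S /\<^sub>d p) C (wbar_frob p S C (vec_map S h a))"
    unfolding Phi_nat[OF E C h B(1)] wbar_frob_ver_nat(1)[OF E C h a] ..
  show "vec_map (S /\<^sub>d p) h (witt_frob p S (twist qvar (EM UNIV)) (Phi S (EM UNIV) a)) = witt_frob p S (twist qvar C) (Phi S C (vec_map S h a))"
    unfolding witt_frob_twist_nat[OF E C h P] Phi_nat[OF E C h a] ..
qed (rule a)+

lemma Phi_ver: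
  assumes C: "algebra Zq (C :: (int poly, 'u) module)" and a: "a \<in> S /\<^sub>d p \<rightarrow>\<^sub>E carrier C"
  shows "Phi S C (wbar_ver p S C a) = witt_ver p S (twist qvar C) (Phi (S /\<^sub>d p) C a)"
proof (rule alg_identity[OF inf S C, where S = "S /\<^sub>d p" and x = a and y = a
      and f = "\<lambda>C a _. Phi S C (wbar_ver p S C a)" and g = "\<lambda>C a _. witt_ver p S (twist qvar C) (Phi (S /\<^sub>d p) C a)"])
  note E = algebra_EU[OF inf]
  fix a :: "nat \<Rightarrow> 'u" assume a: "a \<in> S /\<^sub>d p \<rightarrow>\<^sub>E carrier (EM UNIV)"
  note P = Phi_closed[OF E a] and B = wbar_ver_facts[OF E a]
  note V = witt_ver_twist[OF E P, where r = qvar]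
  show "Phi S (EM UNIV) (wbar_ver p S (EM UNIV) a) \<in> S \<rightarrow>\<^sub>E carrier (EM UNIV)" by (rule Phi_closed[OF E B(1)])
  show "witt_ver p S (twist qvar (EM UNIV)) (Phi (S /\<^sub>d p) (EM UNIV) a) \<in> S \<rightarrow>\<^sub>E carrier (EM UNIV)" by (rule V(1))
  show "witt_ghost S (twist qvar (EM UNIV)) (Phi S (EM UNIV) (wbar_ver p S (EM UNIV) a)) n
     = witt_ghost S (twist qvar (EM UNIV)) (witt_ver p S (twist qvar (EM UNIV)) (Phi (S /\<^sub>d p) (EM UNIV) a)) n"
    if n: "n \<in> S" for n
    unfolding Phi_ghost[OF E S B(1)] B(2)[OF n] V(2)[OF n] Phi_ghost[OF E quot_stable a] ..
  fix h assume h: "h \<in> alg_hom Zq (EM UNIV :: (int poly, 'u) module) C"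
  show "vec_map S h (Phi S (EM UNIV) (wbar_ver p S (EM UNIV) a)) = Phi S C (wbar_ver p S C (vec_map (S /\<^sub>d p) h a))"
    unfolding Phi_nat[OF E C h B(1)] wbar_frob_ver_nat(2)[OF E C h a] ..
  show "vec_map S h (witt_ver p S (twist qvar (EM UNIV)) (Phi (S /\<^sub>d p) (EM UNIV) a)) = witt_ver p S (twist qvar C) (Phi (S /\<^sub>d p) C (vec_map (S /\<^sub>d p) h a))"
    unfolding witt_ver_twist_nat[OF E C h] Phi_nat[OF E C h a] ..
qed (rule a)+

end

end

section \<open>Transport of structure along isomorphisms\<close>

text \<open>Each axiom of an object is an equation, a solvability statement or an exactness statement about
  the structure maps, and bijections commuting with these maps carry it over.\<close>

lemma RFV_object_transport:
  assumes M: "RFV_object T M"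
    and nu: "\<And>S. S \<preceq>\<^sub>d T \<Longrightarrow> nonunital_cring (Ring_at N S)"
    and bij: "\<And>S. S \<preceq>\<^sub>d T \<Longrightarrow> bij_betw (f S) (carrier (Ring_at N S)) (carrier (Ring_at M S))"
    and hom: "\<And>S. S \<preceq>\<^sub>d T \<Longrightarrow> f S \<in> nu_ring_hom (Ring_at N S) (Ring_at M S)"
    and trans: "\<And>S S' a. S \<preceq>\<^sub>d T \<Longrightarrow> S' \<preceq>\<^sub>d S \<Longrightarrow> a \<in> carrier (Ring_at N S) \<Longrightarrow>
        Trans N S S' a \<in> carrier (Ring_at N S') \<and> f S' (Trans N S S' a) = Trans M S S' (f S a)"
    and frob: "\<And>S p a. S \<preceq>\<^sub>d T \<Longrightarrow> p \<in> S \<Longrightarrow> a \<in> carrier (Ring_at N S) \<Longrightarrow>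
        Frob N p S a \<in> carrier (Ring_at N (S /\<^sub>d p)) \<and> f (S /\<^sub>d p) (Frob N p S a) = Frob M p S (f S a)"
    and ver: "\<And>S p a. S \<preceq>\<^sub>d T \<Longrightarrow> p \<in> S \<Longrightarrow> a \<in> carrier (Ring_at N (S /\<^sub>d p)) \<Longrightarrow>
        Ver N p S a \<in> carrier (Ring_at N S) \<and> f S (Ver N p S a) = Ver M p S (f (S /\<^sub>d p) a)"
  shows "RFV_object T N"
proof -
  have sub: "S' \<preceq>\<^sub>d T" if "S \<preceq>\<^sub>d T" "S' \<preceq>\<^sub>d S" for S S' using that by (auto simp: ds_subset_def)
  have quot: "S /\<^sub>d p \<preceq>\<^sub>d S" if "S \<preceq>\<^sub>d T" "p \<in> S" for S p
    using ds_quot[OF ds_subset_ds(1)[OF that(1)] that(2)] quot_mem(3) by (simp add: ds_subset_def)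
  have quotT: "S /\<^sub>d p \<preceq>\<^sub>d T" if "S \<preceq>\<^sub>d T" "p \<in> S" for S p by (rule sub[OF that(1) quot[OF that]])
  have prime_to: "set_prime_to S p \<preceq>\<^sub>d S" if "S \<preceq>\<^sub>d T" "prime p" for S p
    using set_prime_to_ds[OF ds_subset_ds(1)[OF that(1)] that(2)] by (auto simp: ds_subset_def set_prime_to_def)
  have quot_mono: "S1 /\<^sub>d p \<preceq>\<^sub>d S2 /\<^sub>d p" if "S2 \<preceq>\<^sub>d T" "S1 \<preceq>\<^sub>d S2" "p \<in> S1" for S1 S2 p
    using ds_quot[OF ds_subset_ds(1)[OF that(2)] that(3)] ds_subset_ds(2)[OF that(2)]
    by (auto simp: ds_subset_def set_quot_def)
  have inj: "x = y" if "S \<preceq>\<^sub>d T" "x \<in> carrier (Ring_at N S)" "y \<in> carrier (Ring_at N S)" "f S x = f S y" for S x y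
    using bij_betw_imp_inj_on[OF bij[OF that(1)]] that by (auto dest: inj_onD)
  have fc: "f S x \<in> carrier (Ring_at M S)" if "S \<preceq>\<^sub>d T" "x \<in> carrier (Ring_at N S)" for S x
    by (rule nu_ring_homD(2)[OF hom[OF that(1)] that(2)])
  have surj: "\<exists>x\<in>carrier (Ring_at N S). f S x = y" if "S \<preceq>\<^sub>d T" "y \<in> carrier (Ring_at M S)" for S y
    using bij_betw_imp_surj_on[OF bij[OF that(1)]] that(2) by (metis imageE)
  note ax = M[unfolded RFV_object_def]
  note A2 = ax[THEN conjunct2, THEN conjunct2, THEN conjunct1, THEN spec, THEN spec, THEN mp]
  note A3 = ax[THEN conjunct2, THEN conjunct2, THEN conjunct2, THEN conjunct1, THEN spec, THEN spec, THEN mp]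
  note A4 = ax[THEN conjunct2, THEN conjunct2, THEN conjunct2, THEN conjunct2, THEN conjunct1, THEN spec, THEN spec, THEN spec, THEN mp]
  note A5 = ax[THEN conjunct2, THEN conjunct2, THEN conjunct2, THEN conjunct2, THEN conjunct2, THEN conjunct1, THEN spec, THEN spec, THEN spec, THEN mp]
  note A6 = ax[THEN conjunct2, THEN conjunct2, THEN conjunct2, THEN conjunct2, THEN conjunct2, THEN conjunct2, THEN conjunct1, THEN spec, THEN spec, THEN spec, THEN mp]
  note A7 = ax[THEN conjunct2, THEN conjunct2, THEN conjunct2, THEN conjunct2, THEN conjunct2, THEN conjunct2, THEN conjunct2, THEN conjunct1, THEN spec, THEN spec, THEN spec, THEN mp]
  note A8 = ax[THEN conjunct2, THEN conjunct2, THEN conjunct2, THEN conjunct2, THEN conjunct2, THEN conjunct2, THEN conjunct2, THEN conjunct2, THEN conjunct1, THEN spec, THEN spec, THEN mp]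
  note A9 = ax[THEN conjunct2, THEN conjunct2, THEN conjunct2, THEN conjunct2, THEN conjunct2, THEN conjunct2, THEN conjunct2, THEN conjunct2, THEN conjunct2, THEN conjunct1, THEN spec, THEN spec, THEN spec, THEN mp]
  note A10 = ax[THEN conjunct2, THEN conjunct2, THEN conjunct2, THEN conjunct2, THEN conjunct2, THEN conjunct2, THEN conjunct2, THEN conjunct2, THEN conjunct2, THEN conjunct2, THEN spec, THEN spec, THEN mp]
  have mps: "projective_system T M" and mcs: "continuous_system T M" using ax by (rule conjunct1, rule conjunct1[OF conjunct2])
  have mnu: "nonunital_cring (Ring_at M S)" if "S \<preceq>\<^sub>d T" for S using mps that unfolding projective_system_def by blast
  note h = nu_ring_homD[OF hom] and tr1 = trans[THEN conjunct1] and tr2 = trans[THEN conjunct2]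
    and fr1 = frob[THEN conjunct1] and fr2 = frob[THEN conjunct2] and ve1 = ver[THEN conjunct1] and ve2 = ver[THEN conjunct2]
  have fzero: "f S \<zero>\<^bsub>Ring_at N S\<^esub> = \<zero>\<^bsub>Ring_at M S\<^esub>" if "S \<preceq>\<^sub>d T" for S
    by (rule add_hom_zero[OF nu_abelian[OF nu[OF that]] nu_abelian[OF mnu[OF that]] h(1)[OF that]])
  have fmul: "f S ([(k::nat)] \<cdot>\<^bsub>Ring_at N S\<^esub> x) = [k] \<cdot>\<^bsub>Ring_at M S\<^esub> f S x"
    if "S \<preceq>\<^sub>d T" "x \<in> carrier (Ring_at N S)" for S k x
    by (rule add_hom_nat_pow[OF nu_abelian[OF nu[OF that(1)]] nu_abelian[OF mnu[OF that(1)]] h(1)[OF that(1)] that(2)])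
  have fpow: "f S (nu_pow (Ring_at N S) x k) = nu_pow (Ring_at M S) (f S x) k"
    if "S \<preceq>\<^sub>d T" "x \<in> carrier (Ring_at N S)" for S k x
    by (rule nu_ring_hom_pow[OF nu[OF that(1)] hom[OF that(1)] that(2)])
  have ncl: "x \<oplus>\<^bsub>Ring_at N S\<^esub> y \<in> carrier (Ring_at N S)" "x \<otimes>\<^bsub>Ring_at N S\<^esub> y \<in> carrier (Ring_at N S)"
    "[(k::nat)] \<cdot>\<^bsub>Ring_at N S\<^esub> x \<in> carrier (Ring_at N S)" "nu_pow (Ring_at N S) x k \<in> carrier (Ring_at N S)"
    "\<zero>\<^bsub>Ring_at N S\<^esub> \<in> carrier (Ring_at N S)"
    if "S \<preceq>\<^sub>d T" "x \<in> carrier (Ring_at N S)" "y \<in> carrier (Ring_at N S)" for S x y k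
  proof -
    interpret N: nonunital_cring "Ring_at N S" by (rule nu[OF that(1)])
    show "x \<oplus>\<^bsub>Ring_at N S\<^esub> y \<in> carrier (Ring_at N S)" "x \<otimes>\<^bsub>Ring_at N S\<^esub> y \<in> carrier (Ring_at N S)"
      "[(k::nat)] \<cdot>\<^bsub>Ring_at N S\<^esub> x \<in> carrier (Ring_at N S)" "nu_pow (Ring_at N S) x k \<in> carrier (Ring_at N S)"
      "\<zero>\<^bsub>Ring_at N S\<^esub> \<in> carrier (Ring_at N S)"
      using that by (simp_all add: N.nu_m_closed)
  qed
  have nzero: "\<zero>\<^bsub>Ring_at N S\<^esub> \<in> carrier (Ring_at N S)" if "S \<preceq>\<^sub>d T" for S
    using abelian_monoid.zero_closed[OF abelian_group.axioms(1)[OF nu_abelian[OF nu[OF that]]]] .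
  have mtr: "Trans M S S' \<in> nu_ring_hom (Ring_at M S) (Ring_at M S')" if "S \<preceq>\<^sub>d T" "S' \<preceq>\<^sub>d S" for S S'
    using mps that unfolding projective_system_def by blast
  have mid: "Trans M S S a = a" if "S \<preceq>\<^sub>d T" "a \<in> carrier (Ring_at M S)" for S a
    using mps that unfolding projective_system_def by blast
  have mco: "Trans M S' S'' (Trans M S S' a) = Trans M S S'' a"
    if "S \<preceq>\<^sub>d T" "S' \<preceq>\<^sub>d S" "S'' \<preceq>\<^sub>d S'" "a \<in> carrier (Ring_at M S)" for S S' S'' a
    using mps that unfolding projective_system_def by blast
  have refl: "S \<preceq>\<^sub>d S" if "S \<preceq>\<^sub>d T" for S using that by (simp add: ds_subset_def)
  have tra: "S'' \<preceq>\<^sub>d S" if "S' \<preceq>\<^sub>d S" "S'' \<preceq>\<^sub>d S'" for S S' S'' using that by (auto simp: ds_subset_def)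
  have ps: "projective_system T N"
    unfolding projective_system_def
  proof (intro conjI allI impI ballI; (elim conjE)?)
    fix S S' assume s: "S \<preceq>\<^sub>d T" "S' \<preceq>\<^sub>d S"
    note s' = sub[OF s]
    show "Trans N S S' \<in> nu_ring_hom (Ring_at N S) (Ring_at N S')"
    proof (rule nu_ring_homI)
      show "Trans N S S' x \<in> carrier (Ring_at N S')" if "x \<in> carrier (Ring_at N S)" for x by (rule tr1[OF s that])
      fix x y assume xy: "x \<in> carrier (Ring_at N S)" "y \<in> carrier (Ring_at N S)"
      note t = tr1[OF s xy(1)] tr1[OF s xy(2)] and n = ncl[OF s(1) xy] and n' = ncl[OF s' tr1[OF s xy(1)] tr1[OF s xy(2)]]
      note m = nu_ring_homD(3,4)[OF mtr[OF s] fc[OF s(1) xy(1)] fc[OF s(1) xy(2)]]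
      show "Trans N S S' (x \<oplus>\<^bsub>Ring_at N S\<^esub> y) = Trans N S S' x \<oplus>\<^bsub>Ring_at N S'\<^esub> Trans N S S' y"
        by (rule inj[OF s' tr1[OF s n(1)] n'(1)])
          (simp only: tr2[OF s n(1)] h(3)[OF s(1) xy] h(3)[OF s' t] tr2[OF s xy(1)] tr2[OF s xy(2)] m)
      show "Trans N S S' (x \<otimes>\<^bsub>Ring_at N S\<^esub> y) = Trans N S S' x \<otimes>\<^bsub>Ring_at N S'\<^esub> Trans N S S' y"
        by (rule inj[OF s' tr1[OF s n(2)] n'(2)])
          (simp only: tr2[OF s n(2)] h(4)[OF s(1) xy] h(4)[OF s' t] tr2[OF s xy(1)] tr2[OF s xy(2)] m)
    qed
  next
    fix S a assume s: "S \<preceq>\<^sub>d T" and a: "a \<in> carrier (Ring_at N S)"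
    show "Trans N S S a = a"
      by (rule inj[OF s tr1[OF s refl[OF s] a] a]) (simp only: tr2[OF s refl[OF s] a] mid[OF s fc[OF s a]])
  next
    fix S S' S'' a assume s: "S \<preceq>\<^sub>d T" "S' \<preceq>\<^sub>d S" "S'' \<preceq>\<^sub>d S'" and a: "a \<in> carrier (Ring_at N S)"
    note s' = sub[OF s(1,2)] and t = tr1[OF s(1,2) a] and s2 = tra[OF s(2,3)]
    show "Trans N S' S'' (Trans N S S' a) = Trans N S S'' a"
      by (rule inj[OF sub[OF s' s(3)] tr1[OF s' s(3) t] tr1[OF s(1) s2 a]])
        (simp only: tr2[OF s' s(3) t] tr2[OF s(1,2) a] tr2[OF s(1) s2 a] mco[OF s fc[OF s(1) a]])
  qed (rule nu)
  have cs: "continuous_system T N"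
    unfolding continuous_system_def
  proof (intro allI impI, elim conjE)
    fix S x assume s: "S \<preceq>\<^sub>d T" and x: "\<forall>S0. S0 \<preceq>\<^sub>d S \<and> finite S0 \<longrightarrow> x S0 \<in> carrier (Ring_at N S0)"
      "\<forall>S0 S1. S0 \<preceq>\<^sub>d S \<and> finite S0 \<and> S1 \<preceq>\<^sub>d S0 \<longrightarrow> Trans N S0 S1 (x S0) = x S1"
    let ?y = "\<lambda>S0. f S0 (x S0)"
    have "\<exists>!b. b \<in> carrier (Ring_at M S) \<and> (\<forall>S0. S0 \<preceq>\<^sub>d S \<and> finite S0 \<longrightarrow> Trans M S S0 b = ?y S0)"
    proof -
      have y1: "?y S0 \<in> carrier (Ring_at M S0)" if "S0 \<preceq>\<^sub>d S" "finite S0" for S0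
        using fc[OF sub[OF s that(1)]] x(1) that by blast
      have y2: "Trans M S0 S1 (?y S0) = ?y S1" if "S0 \<preceq>\<^sub>d S" "finite S0" "S1 \<preceq>\<^sub>d S0" for S0 S1
        using tr2[OF sub[OF s that(1)] that(3), of "x S0"] x that by simp
      show ?thesis
        by (rule mcs[unfolded continuous_system_def, THEN spec, THEN mp, OF s, THEN spec[of _ ?y], THEN mp])
          (use y1 y2 in blast)
    qed
    then obtain b where b': "b \<in> carrier (Ring_at M S) \<and> (\<forall>S0. S0 \<preceq>\<^sub>d S \<and> finite S0 \<longrightarrow> Trans M S S0 b = ?y S0)"
      and u': "\<forall>c. c \<in> carrier (Ring_at M S) \<and> (\<forall>S0. S0 \<preceq>\<^sub>d S \<and> finite S0 \<longrightarrow> Trans M S S0 c = ?y S0) \<longrightarrow> c = b"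
      by (rule ex1E)
    have b: "b \<in> carrier (Ring_at M S)" "\<And>S0. S0 \<preceq>\<^sub>d S \<Longrightarrow> finite S0 \<Longrightarrow> Trans M S S0 b = ?y S0"
      using b' by blast+
    have u: "c = b" if "c \<in> carrier (Ring_at M S)" "\<And>S0. S0 \<preceq>\<^sub>d S \<Longrightarrow> finite S0 \<Longrightarrow> Trans M S S0 c = ?y S0" for c
      using u' that by blast
    obtain a where a: "a \<in> carrier (Ring_at N S)" "f S a = b" using surj[OF s b(1)] by blast
    show "\<exists>!a. a \<in> carrier (Ring_at N S) \<and> (\<forall>S0. S0 \<preceq>\<^sub>d S \<and> finite S0 \<longrightarrow> Trans N S S0 a = x S0)"
    proof (intro ex1I conjI allI impI; (elim conjE)?)
      show "a \<in> carrier (Ring_at N S)" by (rule a)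
      fix S0 assume S0: "S0 \<preceq>\<^sub>d S" "finite S0"
      have xc: "x S0 \<in> carrier (Ring_at N S0)" using x(1) S0 by blast
      show "Trans N S S0 a = x S0"
        by (rule inj[OF sub[OF s S0(1)] tr1[OF s S0(1) a(1)] xc]) (simp only: tr2[OF s S0(1) a(1)] a(2) b(2)[OF S0])
    next
      fix c assume c: "c \<in> carrier (Ring_at N S)" "\<forall>S0. S0 \<preceq>\<^sub>d S \<and> finite S0 \<longrightarrow> Trans N S S0 c = x S0"
      have "f S c = b"
        by (rule u[OF fc[OF s c(1)]]) (simp only: tr2[OF s _ c(1), symmetric] c(2)[rule_format])
      then show "c = a" by (intro inj[OF s c(1) a(1)]) (simp only: a(2))
    qed
  qed
  show ?thesis
    unfolding RFV_object_def
  proof (intro conjI allI impI ballI ps cs; (elim conjE)?)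
    fix p S assume s: "prime p" "p \<in> S" "S \<preceq>\<^sub>d T"
    note q = quotT[OF s(3,2)] and R = prime_to[OF s(3,1)]
    note t = sub[OF s(3) R]
    have mF: "Frob M p S \<in> nu_ring_hom (Ring_at M S) (Ring_at M (S /\<^sub>d p))"
      and mV: "Ver M p S \<in> add_hom (Ring_at M (S /\<^sub>d p)) (Ring_at M S)" using A2[of p S] s by blast+
    show "Frob N p S \<in> nu_ring_hom (Ring_at N S) (Ring_at N (S /\<^sub>d p))"
    proof (rule nu_ring_homI)
      show "Frob N p S x \<in> carrier (Ring_at N (S /\<^sub>d p))" if "x \<in> carrier (Ring_at N S)" for x by (rule fr1[OF s(3,2) that])
      fix x y assume xy: "x \<in> carrier (Ring_at N S)" "y \<in> carrier (Ring_at N S)"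
      note F = fr1[OF s(3,2)] fr2[OF s(3,2)] and n = ncl[OF s(3) xy]
      note n' = ncl[OF q F(1)[OF xy(1)] F(1)[OF xy(2)]]
      note m = nu_ring_homD(3,4)[OF mF fc[OF s(3) xy(1)] fc[OF s(3) xy(2)]]
      show "Frob N p S (x \<oplus>\<^bsub>Ring_at N S\<^esub> y) = Frob N p S x \<oplus>\<^bsub>Ring_at N (S /\<^sub>d p)\<^esub> Frob N p S y"
        by (rule inj[OF q F(1)[OF n(1)] n'(1)])
          (simp only: F(2)[OF n(1)] h(3)[OF s(3) xy] h(3)[OF q F(1)[OF xy(1)] F(1)[OF xy(2)]] F(2)[OF xy(1)] F(2)[OF xy(2)] m)
      show "Frob N p S (x \<otimes>\<^bsub>Ring_at N S\<^esub> y) = Frob N p S x \<otimes>\<^bsub>Ring_at N (S /\<^sub>d p)\<^esub> Frob N p S y"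
        by (rule inj[OF q F(1)[OF n(2)] n'(2)])
          (simp only: F(2)[OF n(2)] h(4)[OF s(3) xy] h(4)[OF q F(1)[OF xy(1)] F(1)[OF xy(2)]] F(2)[OF xy(1)] F(2)[OF xy(2)] m)
    qed
    show "Ver N p S \<in> add_hom (Ring_at N (S /\<^sub>d p)) (Ring_at N S)"
    proof (rule add_homI)
      show "Ver N p S x \<in> carrier (Ring_at N S)" if "x \<in> carrier (Ring_at N (S /\<^sub>d p))" for x by (rule ve1[OF s(3,2) that])
      fix x y assume xy: "x \<in> carrier (Ring_at N (S /\<^sub>d p))" "y \<in> carrier (Ring_at N (S /\<^sub>d p))"
      note V = ve1[OF s(3,2)] ve2[OF s(3,2)] and n = ncl[OF q xy]
      note n' = ncl[OF s(3) V(1)[OF xy(1)] V(1)[OF xy(2)]]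
      note m = add_homD(2)[OF mV fc[OF q xy(1)] fc[OF q xy(2)]]
      show "Ver N p S (x \<oplus>\<^bsub>Ring_at N (S /\<^sub>d p)\<^esub> y) = Ver N p S x \<oplus>\<^bsub>Ring_at N S\<^esub> Ver N p S y"
        by (rule inj[OF s(3) V(1)[OF n(1)] n'(1)])
          (simp only: V(2)[OF n(1)] h(3)[OF q xy] h(3)[OF s(3) V(1)[OF xy(1)] V(1)[OF xy(2)]] V(2)[OF xy(1)] V(2)[OF xy(2)] m)
    qed
    show "\<exists>b\<in>carrier (Ring_at N (S /\<^sub>d p)). Frob N p S a = nu_pow (Ring_at N (S /\<^sub>d p)) (Trans N S (S /\<^sub>d p) a) p
             \<oplus>\<^bsub>Ring_at N (S /\<^sub>d p)\<^esub> [p] \<cdot>\<^bsub>Ring_at N (S /\<^sub>d p)\<^esub> b" if a: "a \<in> carrier (Ring_at N S)" for a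
    proof -
      have "\<exists>c\<in>carrier (Ring_at M (S /\<^sub>d p)). Frob M p S (f S a) = nu_pow (Ring_at M (S /\<^sub>d p)) (Trans M S (S /\<^sub>d p) (f S a)) p
             \<oplus>\<^bsub>Ring_at M (S /\<^sub>d p)\<^esub> [p] \<cdot>\<^bsub>Ring_at M (S /\<^sub>d p)\<^esub> c" using A3[of p S] s fc[OF s(3) a] by blast
      then obtain c where c: "c \<in> carrier (Ring_at M (S /\<^sub>d p))" "Frob M p S (f S a) = nu_pow (Ring_at M (S /\<^sub>d p)) (Trans M S (S /\<^sub>d p) (f S a)) p
             \<oplus>\<^bsub>Ring_at M (S /\<^sub>d p)\<^esub> [p] \<cdot>\<^bsub>Ring_at M (S /\<^sub>d p)\<^esub> c" by blast
      obtain b where b: "b \<in> carrier (Ring_at N (S /\<^sub>d p))" "f (S /\<^sub>d p) b = c" using surj[OF q c(1)] by blast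
      note T = tr1[OF s(3) quot[OF s(3,2)] a]
      note n = ncl(4)[OF q T T, of p] ncl(3)[OF q b(1) b(1), of p]
      have "Frob N p S a = nu_pow (Ring_at N (S /\<^sub>d p)) (Trans N S (S /\<^sub>d p) a) p
             \<oplus>\<^bsub>Ring_at N (S /\<^sub>d p)\<^esub> [p] \<cdot>\<^bsub>Ring_at N (S /\<^sub>d p)\<^esub> b"
        by (rule inj[OF q fr1[OF s(3,2) a] ncl(1)[OF q n]])
          (simp only: fr2[OF s(3,2) a] h(3)[OF q n] fpow[OF q T] fmul[OF q b(1)] tr2[OF s(3) quot[OF s(3,2)] a] b(2) c(2))
      then show ?thesis using b(1) by blast
    qed
    show "Frob N p S (Ver N p S a) = [p] \<cdot>\<^bsub>Ring_at N (S /\<^sub>d p)\<^esub> a" if a: "a \<in> carrier (Ring_at N (S /\<^sub>d p))" for a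
    proof -
      have m: "Frob M p S (Ver M p S (f (S /\<^sub>d p) a)) = [p] \<cdot>\<^bsub>Ring_at M (S /\<^sub>d p)\<^esub> f (S /\<^sub>d p) a"
        using A8[of p S] s fc[OF q a] by blast
      note V = ve1[OF s(3,2) a]
      show ?thesis
        by (rule inj[OF q fr1[OF s(3,2) V] ncl(3)[OF q a a]]) (simp only: fr2[OF s(3,2) V] ve2[OF s(3,2) a] fmul[OF q a] m)
    qed
    have mE: "inj_on (Ver M p S) (carrier (Ring_at M (S /\<^sub>d p)))"
      "Ver M p S ` carrier (Ring_at M (S /\<^sub>d p)) =
          {a \<in> carrier (Ring_at M S). Trans M S (set_prime_to S p) a = \<zero>\<^bsub>Ring_at M (set_prime_to S p)\<^esub>}"
      "Trans M S (set_prime_to S p) ` carrier (Ring_at M S) = carrier (Ring_at M (set_prime_to S p))"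
      using A10[of p S] s by blast+
    show "inj_on (Ver N p S) (carrier (Ring_at N (S /\<^sub>d p)))"
    proof (rule inj_onI)
      fix x y assume xy: "x \<in> carrier (Ring_at N (S /\<^sub>d p))" "y \<in> carrier (Ring_at N (S /\<^sub>d p))" and e: "Ver N p S x = Ver N p S y"
      have "Ver M p S (f (S /\<^sub>d p) x) = Ver M p S (f (S /\<^sub>d p) y)"
        using arg_cong[OF e, of "f S"] unfolding ve2[OF s(3,2) xy(1)] ve2[OF s(3,2) xy(2)] .
      then have "f (S /\<^sub>d p) x = f (S /\<^sub>d p) y" by (rule inj_onD[OF mE(1) _ fc[OF q xy(1)] fc[OF q xy(2)]])
      then show "x = y" by (rule inj[OF q xy])
    qed
    show "Ver N p S ` carrier (Ring_at N (S /\<^sub>d p)) =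
          {a \<in> carrier (Ring_at N S). Trans N S (set_prime_to S p) a = \<zero>\<^bsub>Ring_at N (set_prime_to S p)\<^esub>}" (is "?L = ?R")
    proof (intro equalityI subsetI)
      fix b assume "b \<in> ?L"
      then obtain a where a: "a \<in> carrier (Ring_at N (S /\<^sub>d p))" and b: "b = Ver N p S a" by blast
      note V = ve1[OF s(3,2) a]
      have m: "Trans M S (set_prime_to S p) (Ver M p S (f (S /\<^sub>d p) a)) = \<zero>\<^bsub>Ring_at M (set_prime_to S p)\<^esub>"
        using mE(2) fc[OF q a] by blast
      have "Trans N S (set_prime_to S p) (Ver N p S a) = \<zero>\<^bsub>Ring_at N (set_prime_to S p)\<^esub>"
        by (rule inj[OF t tr1[OF s(3) R V] nzero[OF t]]) (simp only: tr2[OF s(3) R V] ve2[OF s(3,2) a] m fzero[OF t])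
      then show "b \<in> ?R" using V b by simp
    next
      fix b assume "b \<in> ?R"
      then have b: "b \<in> carrier (Ring_at N S)" and z: "Trans N S (set_prime_to S p) b = \<zero>\<^bsub>Ring_at N (set_prime_to S p)\<^esub>" by auto
      have "Trans M S (set_prime_to S p) (f S b) = \<zero>\<^bsub>Ring_at M (set_prime_to S p)\<^esub>"
        unfolding tr2[OF s(3) R b, symmetric] z by (rule fzero[OF t])
      then have "f S b \<in> Ver M p S ` carrier (Ring_at M (S /\<^sub>d p))" using mE(2) fc[OF s(3) b] by blast
      then obtain c where c: "c \<in> carrier (Ring_at M (S /\<^sub>d p))" "f S b = Ver M p S c" by blast
      obtain a where a: "a \<in> carrier (Ring_at N (S /\<^sub>d p))" "f (S /\<^sub>d p) a = c" using surj[OF q c(1)] by blast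
      have "b = Ver N p S a"
        by (rule inj[OF s(3) b ve1[OF s(3,2) a(1)]]) (simp only: ve2[OF s(3,2) a(1)] a(2) c(2))
      then show "b \<in> ?L" using a(1) by blast
    qed
    show "Trans N S (set_prime_to S p) ` carrier (Ring_at N S) = carrier (Ring_at N (set_prime_to S p))" (is "?L = ?R")
    proof (intro equalityI subsetI)
      show "b \<in> ?R" if "b \<in> ?L" for b using that tr1[OF s(3) R] by blast
      fix b assume b: "b \<in> ?R"
      have "f (set_prime_to S p) b \<in> Trans M S (set_prime_to S p) ` carrier (Ring_at M S)" using mE(3) fc[OF t b] by blast
      then obtain c where c: "c \<in> carrier (Ring_at M S)" "f (set_prime_to S p) b = Trans M S (set_prime_to S p) c" by blast
      obtain a where a: "a \<in> carrier (Ring_at N S)" "f S a = c" using surj[OF s(3) c(1)] by blast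
      have "b = Trans N S (set_prime_to S p) a"
        by (rule inj[OF t b tr1[OF s(3) R a(1)]]) (simp only: tr2[OF s(3) R a(1)] a(2) c(2))
      then show "b \<in> ?L" using a(1) by blast
    qed
  next
    fix p S1 S2 a assume s: "prime p" "p \<in> S1" "S1 \<preceq>\<^sub>d S2" "S2 \<preceq>\<^sub>d T" and a: "a \<in> carrier (Ring_at N S2)"
    have p2: "p \<in> S2" using ds_subset_ds(2)[OF s(3)] s(2) by auto
    note s1 = sub[OF s(4,3)] and q = quot_mono[OF s(4,3,2)] and q2 = quotT[OF s(4) p2]
    have m: "Trans M (S2 /\<^sub>d p) (S1 /\<^sub>d p) (Frob M p S2 (f S2 a)) = Frob M p S1 (Trans M S2 S1 (f S2 a))"
      using A4[of p S1 S2] s fc[OF s(4) a] by blast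
    note F = fr1[OF s(4) p2 a] and R = tr1[OF s(4,3) a]
    show "Trans N (S2 /\<^sub>d p) (S1 /\<^sub>d p) (Frob N p S2 a) = Frob N p S1 (Trans N S2 S1 a)"
      by (rule inj[OF quotT[OF s1 s(2)] tr1[OF q2 q F] fr1[OF s1 s(2) R]])
        (simp only: tr2[OF q2 q F] fr2[OF s(4) p2 a] fr2[OF s1 s(2) R] tr2[OF s(4,3) a] m)
  next
    fix p l S a assume s: "prime p" "prime l" "p * l \<in> S" "S \<preceq>\<^sub>d T" and a: "a \<in> carrier (Ring_at N S)"
    note dS = ds_subset_ds(1)[OF s(4)]
    have p: "p \<in> S" "l \<in> S" "l \<in> S /\<^sub>d p" "p \<in> S /\<^sub>d l"
      using ds_dvd[OF dS s(3)] quot_memI[OF dS s(3)] quot_memI[OF dS, of l p] s(3) by (auto simp: mult.commute)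
    have q: "S /\<^sub>d l /\<^sub>d p = S /\<^sub>d p /\<^sub>d l" by (simp add: quot_quot[OF dS] mult.commute)
    note t = quotT[OF s(4) p(1)] quotT[OF s(4) p(2)]
    have m: "Frob M l (S /\<^sub>d p) (Frob M p S (f S a)) = Frob M p (S /\<^sub>d l) (Frob M l S (f S a))"
      using A5[of p l S] s fc[OF s(4) a] by blast
    note F = fr1[OF s(4) p(1) a] fr1[OF s(4) p(2) a]
    show "Frob N l (S /\<^sub>d p) (Frob N p S a) = Frob N p (S /\<^sub>d l) (Frob N l S a)"
      by (rule inj[OF quotT[OF t(1) p(3)] fr1[OF t(1) p(3) F(1)] fr1[OF t(2) p(4) F(2), unfolded q]])
        (simp only: fr2[OF t(1) p(3) F(1)] fr2[OF t(2) p(4) F(2), unfolded q] fr2[OF s(4) p(1) a] fr2[OF s(4) p(2) a] m)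
  next
    fix p S1 S2 a assume s: "prime p" "p \<in> S1" "S1 \<preceq>\<^sub>d S2" "S2 \<preceq>\<^sub>d T" and a: "a \<in> carrier (Ring_at N (S2 /\<^sub>d p))"
    have p2: "p \<in> S2" using ds_subset_ds(2)[OF s(3)] s(2) by auto
    note s1 = sub[OF s(4,3)] and q = quot_mono[OF s(4,3,2)] and q2 = quotT[OF s(4) p2]
    have m: "Trans M S2 S1 (Ver M p S2 (f (S2 /\<^sub>d p) a)) = Ver M p S1 (Trans M (S2 /\<^sub>d p) (S1 /\<^sub>d p) (f (S2 /\<^sub>d p) a))"
      using A6[of p S1 S2] s fc[OF q2 a] by blast
    note V = ve1[OF s(4) p2 a] and R = tr1[OF q2 q a]
    show "Trans N S2 S1 (Ver N p S2 a) = Ver N p S1 (Trans N (S2 /\<^sub>d p) (S1 /\<^sub>d p) a)"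
      by (rule inj[OF s1 tr1[OF s(4,3) V] ve1[OF s1 s(2) R]])
        (simp only: tr2[OF s(4,3) V] ve2[OF s(4) p2 a] ve2[OF s1 s(2) R] tr2[OF q2 q a] m)
  next
    fix p l S a assume s: "prime p" "prime l" "p * l \<in> S" "S \<preceq>\<^sub>d T" and a: "a \<in> carrier (Ring_at N (S /\<^sub>d (p * l)))"
    note dS = ds_subset_ds(1)[OF s(4)]
    have p: "p \<in> S" "l \<in> S" "l \<in> S /\<^sub>d p" "p \<in> S /\<^sub>d l"
      using ds_dvd[OF dS s(3)] quot_memI[OF dS s(3)] quot_memI[OF dS, of l p] s(3) by (auto simp: mult.commute)
    have q: "S /\<^sub>d (p * l) = S /\<^sub>d p /\<^sub>d l" "S /\<^sub>d l /\<^sub>d p = S /\<^sub>d p /\<^sub>d l" by (simp_all add: quot_quot[OF dS] mult.commute)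
    note t = quotT[OF s(4) p(1)] quotT[OF s(4) p(2)]
    note a1 = a[unfolded q(1)] and a2 = a[unfolded q(1) q(2)[symmetric]]
    have m: "Ver M p S (Ver M l (S /\<^sub>d p) (f (S /\<^sub>d p /\<^sub>d l) a)) = Ver M l S (Ver M p (S /\<^sub>d l) (f (S /\<^sub>d p /\<^sub>d l) a))"
      using A7[of p l S] s fc[OF quotT[OF t(1) p(3)] a1] unfolding q(1)[symmetric] by blast
    note V = ve1[OF t(1) p(3) a1] ve1[OF t(2) p(4) a2]
    show "Ver N p S (Ver N l (S /\<^sub>d p) a) = Ver N l S (Ver N p (S /\<^sub>d l) a)"
      by (rule inj[OF s(4) ve1[OF s(4) p(1) V(1)] ve1[OF s(4) p(2) V(2)]])
        (simp only: ve2[OF s(4) p(1) V(1)] ve2[OF s(4) p(2) V(2)] ve2[OF t(1) p(3) a1] ve2[OF t(2) p(4) a2] q(2) m)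
  next
    fix p l S a assume s: "prime p" "prime l" "l \<noteq> p" "p * l \<in> S" "S \<preceq>\<^sub>d T" and a: "a \<in> carrier (Ring_at N (S /\<^sub>d p))"
    note dS = ds_subset_ds(1)[OF s(5)]
    have p: "p \<in> S" "l \<in> S" "l \<in> S /\<^sub>d p" "p \<in> S /\<^sub>d l"
      using ds_dvd[OF dS s(4)] quot_memI[OF dS s(4)] quot_memI[OF dS, of l p] s(4) by (auto simp: mult.commute)
    have q: "S /\<^sub>d p /\<^sub>d l = S /\<^sub>d l /\<^sub>d p" by (simp add: quot_quot[OF dS] mult.commute)
    note t = quotT[OF s(5) p(1)] quotT[OF s(5) p(2)]
    have m: "Frob M l S (Ver M p S (f (S /\<^sub>d p) a)) = Ver M p (S /\<^sub>d l) (Frob M l (S /\<^sub>d p) (f (S /\<^sub>d p) a))"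
      using A9[of p l S] s fc[OF t(1) a] by blast
    note V = ve1[OF s(5) p(1) a] and F = fr1[OF t(1) p(3) a, unfolded q]
    show "Frob N l S (Ver N p S a) = Ver N p (S /\<^sub>d l) (Frob N l (S /\<^sub>d p) a)"
      by (rule inj[OF t(2) fr1[OF s(5) p(2) V] ve1[OF t(2) p(4) F]])
        (simp only: fr2[OF s(5) p(2) V] ve2[OF s(5) p(1) a] ve2[OF t(2) p(4) F] fr2[OF t(1) p(3) a, unfolded q] m)
  qed
qed

section \<open>The objects over \<open>\<int>[q]\<close>\<close>

lemma vec_map_id:
  assumes x: "x \<in> S \<rightarrow>\<^sub>E D" shows "vec_map S (\<lambda>c\<in>D. c) x = x"
proof
  fix n show "vec_map S (\<lambda>c\<in>D. c) x n = x n"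
    using PiE_mem[OF x, of n] PiE_arb[OF x, of n] by (cases "n \<in> S") (simp_all add: vec_map_def)
qed

lemma vec_map_compose:
  assumes x: "x \<in> S \<rightarrow>\<^sub>E D" shows "vec_map S (compose D k h) x = vec_map S k (vec_map S h x)"
proof
  fix n show "vec_map S (compose D k h) x n = vec_map S k (vec_map S h x) n"
    using PiE_mem[OF x, of n] by (cases "n \<in> S") (simp_all add: vec_map_def compose_def)
qed

text \<open>A family of systems on the sets of vectors, with functoriality in each component, is an
  object as soon as its values are; it is represented by the polynomial ring in the components.\<close>

lemma AFVp_object_vectors:
  fixes P :: "(int poly, 'u) module \<Rightarrow> (nat \<Rightarrow> 'u) rfv_system"
  assumes inf: "infinite (UNIV :: 'u set)"
    and rfv: "\<And>C. algebra Zq C \<Longrightarrow> RFV_object T (P C)"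
    and nu: "\<And>C S. algebra Zq C \<Longrightarrow> divisor_stable S \<Longrightarrow> nonunital_cring (Ring_at (P C) S)"
    and car: "\<And>C S. algebra Zq C \<Longrightarrow> divisor_stable S \<Longrightarrow> carrier (Ring_at (P C) S) = S \<rightarrow>\<^sub>E carrier C"
    and trans: "\<And>C S S' a. algebra Zq C \<Longrightarrow> Trans (P C) S S' a = restrict a S'"
    and push: "\<And>C D S h. algebra Zq C \<Longrightarrow> algebra Zq D \<Longrightarrow> divisor_stable S \<Longrightarrow> h \<in> alg_hom Zq C D \<Longrightarrow>
       vec_map S h \<in> nu_ring_hom (Ring_at (P C) S) (Ring_at (P D) S)"
    and frob: "\<And>C S p a. algebra Zq C \<Longrightarrow> divisor_stable S \<Longrightarrow> p \<in> S \<Longrightarrow> a \<in> S \<rightarrow>\<^sub>E carrier C \<Longrightarrow>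
       Frob (P C) p S a \<in> S /\<^sub>d p \<rightarrow>\<^sub>E carrier C"
    and ver: "\<And>C S p a. algebra Zq C \<Longrightarrow> divisor_stable S \<Longrightarrow> p \<in> S \<Longrightarrow> a \<in> S /\<^sub>d p \<rightarrow>\<^sub>E carrier C \<Longrightarrow>
       Ver (P C) p S a \<in> S \<rightarrow>\<^sub>E carrier C"
    and frob_nat: "\<And>C D S p h a. algebra Zq C \<Longrightarrow> algebra Zq D \<Longrightarrow> divisor_stable S \<Longrightarrow> p \<in> S \<Longrightarrow> h \<in> alg_hom Zq C D \<Longrightarrow>
       a \<in> S \<rightarrow>\<^sub>E carrier C \<Longrightarrow> vec_map (S /\<^sub>d p) h (Frob (P C) p S a) = Frob (P D) p S (vec_map S h a)"
    and ver_nat: "\<And>C D S p h a. algebra Zq C \<Longrightarrow> algebra Zq D \<Longrightarrow> divisor_stable S \<Longrightarrow> p \<in> S \<Longrightarrow> h \<in> alg_hom Zq C D \<Longrightarrow>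
       a \<in> S /\<^sub>d p \<rightarrow>\<^sub>E carrier C \<Longrightarrow> vec_map S h (Ver (P C) p S a) = Ver (P D) p S (vec_map (S /\<^sub>d p) h a)"
    and zero: "\<And>C. algebra Zq C \<Longrightarrow> \<zero>\<^bsub>Ring_at (P C) {1}\<^esub> 1 = \<zero>\<^bsub>C\<^esub>"
  shows "AFVp_object T Zq (\<lparr>Points = P, Push = (\<lambda>S C D. vec_map S)\<rparr>, \<lambda>C a. a 1)"
proof -
  let ?M = "\<lparr>Points = P, Push = (\<lambda>S (C :: (int poly, 'u) module) (D :: (int poly, 'u) module). vec_map S)\<rparr>"
  have hc: "vec_map S h a \<in> S \<rightarrow>\<^sub>E carrier D" if "h \<in> alg_hom Zq C D" "a \<in> S \<rightarrow>\<^sub>E carrier C"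
    for S h a and C D :: "(int poly, 'u) module"
    by (rule vec_map_in[OF that(2)]) (rule alg_homD(3)[OF that(1)])
  have rf: "ring_functor Zq ?M S" if S: "divisor_stable S" for S
    unfolding ring_functor_def scheme_system.simps
  proof (intro conjI allI impI ballI; (elim conjE)?)
    fix C x assume C: "algebra Zq C" and "x \<in> carrier (Ring_at (P C) S)"
    then have "x \<in> S \<rightarrow>\<^sub>E carrier C" by (simp only: car[OF C S])
    then show "vec_map S (\<lambda>c\<in>carrier C. c) x = x" by (rule vec_map_id)
  next
    fix C D E h k x assume C: "algebra Zq C" "algebra Zq D" "algebra Zq E" and hk: "h \<in> alg_hom Zq C D" "k \<in> alg_hom Zq D E"
      and "x \<in> carrier (Ring_at (P C) S)"
    then have "x \<in> S \<rightarrow>\<^sub>E carrier C" by (simp only: car[OF C(1) S])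
    then show "vec_map S (compose (carrier C) k h) x = vec_map S k (vec_map S h x)"
      by (rule vec_map_compose)
  qed (use nu push S in auto)
  have aff: "affine Zq ?M S" if S: "divisor_stable S" for S
  proof -
    let ?V = "insert Qi ((\<lambda>n. prod_encode (0, n)) ` S)"
    let ?B = "EM ?V :: (int poly, 'u) module"
    have B: "algebra Zq ?B" by (rule algebra_EM[OF inf]) simp
    have u: "(GX S 0 :: nat \<Rightarrow> 'u) \<in> S \<rightarrow>\<^sub>E carrier ?B" by (simp add: GX_def X_def)
    have "\<exists>!h. h \<in> alg_hom Zq ?B C \<and> vec_map S h (GX S 0) = x" if C: "algebra Zq C" and x: "x \<in> S \<rightarrow>\<^sub>E carrier C" for C x
    proof (rule ex1I)
      interpret C: cring C by (rule alg_cring[OF C])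
      let ?v = "casg C S (\<lambda>_. x)"
      let ?h = "\<lambda>z\<in>carrier ?B. ev C ?v (unemb z)"
      have v: "?v i \<in> carrier C" for i by (rule casg_closed[OF C PiE_mem[OF x]])
      have h: "?h \<in> alg_hom Zq ?B C" by (rule EM_hom[OF inf _ C v]) simp_all
      have "vec_map S ?h (GX S 0) = x"
      proof (rule PiE_ext[OF hc[OF h u] x])
        fix n assume n: "n \<in> S"
        then show "vec_map S ?h (GX S 0) n = x n"
          using PiE_mem[OF u n] by (simp add: vec_map_def GX_def unemb_emb[OF inf] X_def C.ev_Var[of ?v, OF v])
      qed
      with h show "?h \<in> alg_hom Zq ?B C \<and> vec_map S ?h (GX S 0) = x" by simp
      fix k assume k: "k \<in> alg_hom Zq ?B C \<and> vec_map S k (GX S 0) = x"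
      show "k = ?h"
      proof (rule EM_hom_eq[OF inf _ C _ h])
        fix i assume "i \<in> ?V - {Qi}"
        then obtain n where n: "n \<in> S" "i = prod_encode (0, n)" by auto
        have "vec_map S k (GX S 0) n = vec_map S ?h (GX S 0) n" using k \<open>vec_map S ?h (GX S 0) = x\<close> by simp
        then show "k (emb (Var i)) = ?h (emb (Var i))" using n by (simp only: vec_map_def GX_def X_def restrict_apply' if_True simp_thms)
      qed (use k in auto)
    qed
    then show ?thesis
      unfolding affine_def scheme_system.simps using B u car[OF _ S] by (intro exI[of _ ?B] exI[of _ "GX S 0"]) simp
  qed
  have obj: "RFV_over_object T Zq ?M"
    unfolding RFV_over_object_def
  proof (intro conjI allI impI; (elim conjE)?)
    show "cring Zq" by (rule cring_Zq)
    show "ring_functor Zq ?M S" "affine Zq ?M S" if "S \<preceq>\<^sub>d T" for S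
      using rf[OF ds_subset_ds(1)[OF that]] aff[OF ds_subset_ds(1)[OF that]] by simp_all
    show "RFV_object T (Points ?M C)" if "algebra Zq C" for C using rfv[OF that] by simp
    fix S S' assume s: "S \<preceq>\<^sub>d T" "S' \<preceq>\<^sub>d S"
    note d = ds_subset_ds(1)[OF s(1)] ds_subset_ds[OF s(2)]
    show "natural_in_algebra Zq ?M S ?M S' (\<lambda>C. Trans (Points ?M C) S S')"
      unfolding natural_in_algebra_def scheme_system.simps
      using d restrict_in[OF _ d(3)] by (auto simp: car trans vec_map_restrict[OF d(3)] simp del: PiE_iff)
  next
    fix p S assume s: "prime p" "p \<in> S" "S \<preceq>\<^sub>d T"
    note d = ds_subset_ds(1)[OF s(3)] and d' = ds_quot[OF ds_subset_ds(1)[OF s(3)] s(2)]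
    show "natural_in_algebra Zq ?M S ?M (S /\<^sub>d p) (\<lambda>C. Frob (Points ?M C) p S)"
      unfolding natural_in_algebra_def scheme_system.simps
    proof (intro conjI allI impI ballI funcsetI; (elim conjE)?)
      fix C a assume C: "algebra Zq C" and "a \<in> carrier (Ring_at (P C) S)"
      then show "Frob (P C) p S a \<in> carrier (Ring_at (P C) (S /\<^sub>d p))"
        using frob[OF C d s(2), of a] by (simp only: car[OF C d] car[OF C d'])
    next
      fix C D h a assume C: "algebra Zq C" "algebra Zq D" and h: "h \<in> alg_hom Zq C D" and "a \<in> carrier (Ring_at (P C) S)"
      then show "Frob (P D) p S (vec_map S h a) = vec_map (S /\<^sub>d p) h (Frob (P C) p S a)"
        using frob_nat[OF C d s(2) h, of a] by (simp only: car[OF C(1) d])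
    qed
    show "natural_in_algebra Zq ?M (S /\<^sub>d p) ?M S (\<lambda>C. Ver (Points ?M C) p S)"
      unfolding natural_in_algebra_def scheme_system.simps
    proof (intro conjI allI impI ballI funcsetI; (elim conjE)?)
      fix C a assume C: "algebra Zq C" and "a \<in> carrier (Ring_at (P C) (S /\<^sub>d p))"
      then show "Ver (P C) p S a \<in> carrier (Ring_at (P C) S)"
        using ver[OF C d s(2), of a] by (simp only: car[OF C d] car[OF C d'])
    next
      fix C D h a assume C: "algebra Zq C" "algebra Zq D" and h: "h \<in> alg_hom Zq C D" and "a \<in> carrier (Ring_at (P C) (S /\<^sub>d p))"
      then show "Ver (P D) p S (vec_map (S /\<^sub>d p) h a) = vec_map S h (Ver (P C) p S a)"
        using ver_nat[OF C d s(2) h, of a] by (simp only: car[OF C(1) d'])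
    qed
  qed
  have d1: "divisor_stable {1}" by (simp add: divisor_stable_def)
  have cz: "coordinate Zq ?M (\<lambda>C a. a 1)"
    unfolding coordinate_def scheme_system.simps
  proof (intro conjI allI impI ballI; (elim conjE)?)
    fix C :: "(int poly, 'u) module" assume C: "algebra Zq C"
    show "bij_betw (\<lambda>a. a 1) (carrier (Ring_at (P C) {1})) (carrier C)"
      unfolding car[OF C d1]
    proof (rule bij_betwI[where g = "\<lambda>c. \<lambda>n\<in>{1::nat}. c"])
      have in_PiE: "(\<lambda>n\<in>{1::nat}. c) \<in> {1::nat} \<rightarrow>\<^sub>E carrier C" if "c \<in> carrier C" for c using that by auto
      show "(\<lambda>c. \<lambda>n\<in>{1::nat}. c) \<in> carrier C \<rightarrow> ({1::nat} \<rightarrow>\<^sub>E carrier C)" by (rule funcsetI, rule in_PiE)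
      show "(\<lambda>a. a 1) \<in> ({1::nat} \<rightarrow>\<^sub>E carrier C) \<rightarrow> carrier C" by (rule funcsetI, erule PiE_mem, simp)
      show "(\<lambda>n\<in>{1::nat}. x 1) = x" if "x \<in> {1::nat} \<rightarrow>\<^sub>E carrier C" for x
        by (rule PiE_ext[OF in_PiE[OF PiE_mem[OF that singletonI]] that]) simp
    qed simp
  next
    fix C D :: "(int poly, 'u) module" and h and x :: "nat \<Rightarrow> 'u"
    show "vec_map {1} h x 1 = h (x 1)" by (simp add: vec_map_def)
  qed
  show ?thesis
    unfolding AFVp_object_def AFV_object_def coordinate_in_zero_def using obj cz zero by auto
qed

lemma W_tw_eq: "W_tw r = (\<lparr>Points = (\<lambda>C. witt_system (twist r C)), Push = (\<lambda>S C D. vec_map S)\<rparr>, \<lambda>C a. a 1)"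
  by (simp add: W_tw_def witt_system_def)

definition wbar_system :: "(int poly, 'u) module \<Rightarrow> (nat \<Rightarrow> 'u) rfv_system" where
  "wbar_system C = \<lparr>Ring_at = (\<lambda>S. wbar_ring S C), Trans = (\<lambda>S S' a. restrict a S'),
     Frob = (\<lambda>p S. wbar_frob p S C), Ver = (\<lambda>p S. wbar_ver p S C)\<rparr>"

lemma wbar_system_simps [simp]:
  "Ring_at (wbar_system C) S = wbar_ring S C" "Trans (wbar_system C) S S' a = restrict a S'"
  "Frob (wbar_system C) p S = wbar_frob p S C" "Ver (wbar_system C) p S = wbar_ver p S C"
  by (simp_all add: wbar_system_def)

text \<open>Restriction of scalars along \<open>\<beta>\<close>. By \<open>twist_RS\<close> the twist by \<open>q\<close> of the restricted algebra is the
  twist by \<open>1 - g\<close>, so that the comparison over the restricted algebra is the one sought over \<open>C\<close>.\<close>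

definition RS :: "int poly \<Rightarrow> (int poly, 'u) module \<Rightarrow> (int poly, 'u) module" where
  "RS g = restrict_scalars (\<lambda>f. f \<circ>\<^sub>p (1 - g))"

lemma Wbar_eq: "Wbar g = (\<lparr>Points = (\<lambda>C. wbar_system (RS g C)), Push = (\<lambda>S C D. vec_map S)\<rparr>, \<lambda>C a. a 1)"
  by (simp add: Wbar_def base_change_def Wbar_one_minus_q_def wbar_system_def RS_def)

lemma RS_simps [simp]:
  "carrier (RS g C) = carrier C" "x \<otimes>\<^bsub>RS g C\<^esub> y = x \<otimes>\<^bsub>C\<^esub> y" "\<one>\<^bsub>RS g C\<^esub> = \<one>\<^bsub>C\<^esub>" "\<zero>\<^bsub>RS g C\<^esub> = \<zero>\<^bsub>C\<^esub>"
  "x \<oplus>\<^bsub>RS g C\<^esub> y = x \<oplus>\<^bsub>C\<^esub> y" "f \<odot>\<^bsub>RS g C\<^esub> x = (f \<circ>\<^sub>p (1 - g)) \<odot>\<^bsub>C\<^esub> x"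
  by (simp_all add: RS_def restrict_scalars_def)

lemma twist_RS: "twist qvar (RS g C) = twist (1 - g) C"
  by (simp add: twist_def pcompose_pCons) (simp add: RS_def restrict_scalars_def)

lemma algebra_RS:
  assumes C: "algebra Zq C" shows "algebra Zq (RS g C)"
proof (rule algebraI[OF cring_Zq])
  interpret C: cring C by (rule alg_cring[OF C])
  show "cring (RS g C)"
  proof (rule cringI)
    show "abelian_group (RS g C)"
      by (rule abelian_groupI) (auto simp: C.a_ac intro: bexI[of _ "\<ominus>\<^bsub>C\<^esub> _"] C.l_neg)
    show "comm_monoid (RS g C)" by (rule comm_monoidI) (auto simp: C.m_ac)
  qed (auto simp: C.l_distr)
qed (simp_all add: alg_smult[OF C] alg_smult_mult[OF C] pcompose_add pcompose_mult pcompose_1)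

lemma alg_hom_RS: "h \<in> alg_hom Zq C D \<Longrightarrow> h \<in> alg_hom Zq (RS g C) (RS g D)"
  by (auto simp: alg_hom_def ring_hom_def)

lemma ghost_one:
  "cring C \<Longrightarrow> 1 \<in> S \<Longrightarrow> a 1 \<in> carrier C \<Longrightarrow> (1 :: int poly) \<odot>\<^bsub>C\<^esub> a 1 = a 1 \<Longrightarrow> wbar_ghost S C a 1 = a 1"
proof -
  assume C: "cring C" and a: "1 \<in> S" "a 1 \<in> carrier C" "(1 :: int poly) \<odot>\<^bsub>C\<^esub> a 1 = a 1"
  interpret C: cring C by (rule C)
  have "{d :: nat. d dvd 1} = {1}" by auto
  then show "wbar_ghost S C a 1 = a 1" using a by (simp add: wbar_ghost_def q_coeff_def)
qed

lemma witt_ghost_one: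
  assumes A: "nonunital_cring A" and a: "1 \<in> S" "a 1 \<in> carrier A"
  shows "witt_ghost S A a 1 = a 1"
proof -
  interpret A: nonunital_cring A by (rule A)
  have "{d :: nat. d dvd 1} = {1}" by auto
  then show ?thesis using a by (simp add: witt_ghost_def)
qed

context
  assumes inf: "infinite (UNIV :: 'u set)"
begin

lemma RFV_object_wbar_system:
  assumes C: "algebra Zq (C :: (int poly, 'u) module)"
  shows "RFV_object T (wbar_system C)"
proof (rule RFV_object_transport[OF RFV_object_witt_system[OF inf nonunital_twist[OF C, of qvar]], where f = "\<lambda>S. Phi S C"])
  note ds = ds_subset_ds
  show "nonunital_cring (Ring_at (wbar_system C) S)" if "S \<preceq>\<^sub>d T" for S using wbar_ring_facts(1)[OF inf ds(1)[OF that] C] by simp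
  show "bij_betw (Phi S C) (carrier (Ring_at (wbar_system C) S)) (carrier (Ring_at (witt_system (twist qvar C)) S))"
    if "S \<preceq>\<^sub>d T" for S
    unfolding wbar_system_simps witt_system_simps wbar_ring_facts(2)[OF inf ds(1)[OF that] C] witt_ring_twist(2)[OF inf ds(1)[OF that] C]
    by (rule Phi_bij[OF C ds(1)[OF that]])
  show "Phi S C \<in> nu_ring_hom (Ring_at (wbar_system C) S) (Ring_at (witt_system (twist qvar C)) S)" if "S \<preceq>\<^sub>d T" for S
    unfolding wbar_system_simps witt_system_simps by (rule Phi_hom[OF inf ds(1)[OF that] C])
  show "Trans (wbar_system C) S S' a \<in> carrier (Ring_at (wbar_system C) S') \<and>
      Phi S' C (Trans (wbar_system C) S S' a) = Trans (witt_system (twist qvar C)) S S' (Phi S C a)"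
    if s: "S \<preceq>\<^sub>d T" "S' \<preceq>\<^sub>d S" and a: "a \<in> carrier (Ring_at (wbar_system C) S)" for S S' a
    using a restrict_in[OF _ ds(2)[OF s(2)], of a "carrier C"] Phi_restrict[OF C ds[OF s(2)], of a]
    unfolding wbar_system_simps witt_system_simps wbar_ring_facts(2)[OF inf ds(1)[OF s(1)] C] wbar_ring_facts(2)[OF inf ds(1)[OF s(2)] C]
    by metis
  show "Frob (wbar_system C) p S a \<in> carrier (Ring_at (wbar_system C) (S /\<^sub>d p)) \<and>
      Phi (S /\<^sub>d p) C (Frob (wbar_system C) p S a) = Frob (witt_system (twist qvar C)) p S (Phi S C a)"
    if s: "S \<preceq>\<^sub>d T" "p \<in> S" and a: "a \<in> carrier (Ring_at (wbar_system C) S)" for S p a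
    using a wbar_frob_facts(1)[OF inf ds(1)[OF s(1)] s(2) C, of a] Phi_frob[OF inf ds(1)[OF s(1)] s(2) C, of a]
    unfolding wbar_system_simps witt_system_simps wbar_ring_facts(2)[OF inf ds(1)[OF s(1)] C] wbar_ring_facts(2)[OF inf ds_quot[OF ds(1)[OF s(1)] s(2)] C]
    by metis
  show "Ver (wbar_system C) p S a \<in> carrier (Ring_at (wbar_system C) S) \<and>
      Phi S C (Ver (wbar_system C) p S a) = Ver (witt_system (twist qvar C)) p S (Phi (S /\<^sub>d p) C a)"
    if s: "S \<preceq>\<^sub>d T" "p \<in> S" and a: "a \<in> carrier (Ring_at (wbar_system C) (S /\<^sub>d p))" for S p a
    using a wbar_ver_facts(1)[OF inf ds(1)[OF s(1)] s(2) C, of a] Phi_ver[OF inf ds(1)[OF s(1)] s(2) C, of a]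
    unfolding wbar_system_simps witt_system_simps wbar_ring_facts(2)[OF inf ds(1)[OF s(1)] C] wbar_ring_facts(2)[OF inf ds_quot[OF ds(1)[OF s(1)] s(2)] C]
    by metis
qed

theorem AFVp_object_W_tw: "AFVp_object T Zq (W_tw r :: (int poly, 'u, nat \<Rightarrow> 'u) coord_system)"
  unfolding W_tw_eq
proof (rule AFVp_object_vectors[OF inf])
  fix C :: "(int poly, 'u) module" assume C: "algebra Zq C"
  have d1: "divisor_stable {1}" by (simp add: divisor_stable_def)
  show "\<zero>\<^bsub>Ring_at (witt_system (twist r C)) {1}\<^esub> 1 = \<zero>\<^bsub>C\<^esub>"
    by (simp add: witt_ring_zero[OF inf d1 nonunital_twist[OF C], unfolded One_nat_def] twist_simps[OF C])
next
  fix C D :: "(int poly, 'u) module" and S h assume "algebra Zq C" "algebra Zq D" "divisor_stable S" "h \<in> alg_hom Zq C D"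
  then show "vec_map S h \<in> nu_ring_hom (Ring_at (witt_system (twist r C)) S) (Ring_at (witt_system (twist r D)) S)"
    unfolding witt_system_simps by (intro witt_ring_twist_nat[OF inf])
qed (simp_all only: witt_system_simps RFV_object_witt_system[OF inf] nonunital_twist witt_ring_twist[OF inf] witt_frob_twist(1)[OF inf] witt_ver_twist(1)[OF inf]
    witt_frob_twist_nat[OF inf] witt_ver_twist_nat[OF inf])

theorem AFVp_object_Wbar: "AFVp_object T Zq (Wbar g :: (int poly, 'u, nat \<Rightarrow> 'u) coord_system)"
  unfolding Wbar_eq
proof (rule AFVp_object_vectors[OF inf])
  fix C :: "(int poly, 'u) module" assume C: "algebra Zq C"
  note R = algebra_RS[OF C, of g]
  have d1: "divisor_stable {1}" by (simp add: divisor_stable_def)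
  let ?W = "wbar_ring {1} (RS g C)"
  let ?z = "\<zero>\<^bsub>?W\<^esub>"
  interpret W: nonunital_cring ?W by (rule wbar_ring_facts(1)[OF inf d1 R])
  have z: "?z \<in> {1} \<rightarrow>\<^sub>E carrier C" using W.zero_closed unfolding wbar_ring_facts(2)[OF inf d1 R] by simp
  have "Phi {1} (RS g C) ?z = \<zero>\<^bsub>witt_ring {1} (twist qvar (RS g C))\<^esub>"
    by (rule add_hom_zero[OF nu_abelian nu_abelian nu_ring_homD(1)[OF Phi_hom[OF inf d1 R]]])
      (rule wbar_ring_facts(1)[OF inf d1 R] witt_ring_twist(1)[OF inf d1 R])+
  then have "Phi {1} (RS g C) ?z = (\<lambda>n\<in>{1}. \<zero>\<^bsub>C\<^esub>)"
    unfolding witt_ring_zero[OF inf d1 nonunital_twist[OF R]] by (simp add: twist_simps[OF R])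
  then have "wbar_ghost {1} (RS g C) ?z 1 = \<zero>\<^bsub>C\<^esub>"
    using Phi_ghost[OF R d1, of ?z] z witt_ghost_zero[OF d1 nonunital_twist[OF R], of 1 qvar] by (simp add: twist_simps[OF R])
  moreover have "wbar_ghost {1} (RS g C) ?z 1 = ?z 1"
    using z alg_smult(5)[OF R, of "?z 1"] by (intro ghost_one alg_cring[OF R]) auto
  ultimately show "\<zero>\<^bsub>Ring_at (wbar_system (RS g C)) {1}\<^esub> 1 = \<zero>\<^bsub>C\<^esub>" by simp
next
  fix C D :: "(int poly, 'u) module" and S h assume a: "algebra Zq C" "algebra Zq D" "divisor_stable S" "h \<in> alg_hom Zq C D"
  show "vec_map S h \<in> nu_ring_hom (Ring_at (wbar_system (RS g C)) S) (Ring_at (wbar_system (RS g D)) S)"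
    unfolding wbar_system_simps by (rule wbar_ring_nat[OF inf a(3) algebra_RS[OF a(1)] algebra_RS[OF a(2)] alg_hom_RS[OF a(4)]])
next
  fix C D :: "(int poly, 'u) module" and S p h and a :: "nat \<Rightarrow> 'u"
  assume C: "algebra Zq C" "algebra Zq D" and S: "divisor_stable S" "p \<in> S" and h: "h \<in> alg_hom Zq C D"
  note n = wbar_frob_ver_nat[OF inf S algebra_RS[OF C(1), of g] algebra_RS[OF C(2)] alg_hom_RS[OF h], unfolded RS_simps]
  show "a \<in> S \<rightarrow>\<^sub>E carrier C \<Longrightarrow> vec_map (S /\<^sub>d p) h (Frob (wbar_system (RS g C)) p S a) = Frob (wbar_system (RS g D)) p S (vec_map S h a)"
    unfolding wbar_system_simps by (rule n(1))
  show "a \<in> S /\<^sub>d p \<rightarrow>\<^sub>E carrier C \<Longrightarrow> vec_map S h (Ver (wbar_system (RS g C)) p S a) = Ver (wbar_system (RS g D)) p S (vec_map (S /\<^sub>d p) h a)"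
    unfolding wbar_system_simps by (rule n(2))
qed (use wbar_frob_facts(1)[OF inf _ _ algebra_RS, unfolded RS_simps] wbar_ver_facts(1)[OF inf _ _ algebra_RS, unfolded RS_simps]
    in \<open>simp_all only: wbar_system_simps RFV_object_wbar_system algebra_RS wbar_ring_facts[OF inf] RS_simps\<close>)

end

section \<open>The isomorphism and its uniqueness\<close>

lemma qpoly_inj: assumes "qpoly p = qpoly r" shows "p = r"
proof -
  let ?Z = "\<lparr>carrier = UNIV, mult = (*), one = 1, zero = 0, add = (+), smult = (*)\<rparr> :: (int poly, int poly) module"
  have Z: "algebra Zq ?Z"
  proof (rule algebraI[OF cring_Zq])
    show "cring ?Z"
    proof (rule cringI)
      show "abelian_group ?Z" by (rule abelian_groupI) (auto simp: algebra_simps intro: exI[of _ "- _"])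
      show "comm_monoid ?Z" by (rule comm_monoidI) (auto simp: algebra_simps)
    qed (auto simp: algebra_simps)
  qed (auto simp: algebra_simps)
  have "ev ?Z (\<lambda>_. qvar) (qpoly p) = p" for p
    using ev_qpoly(1)[OF Z, of "\<lambda>_. qvar" p] by simp
  then show ?thesis using assms by metis
qed

text \<open>The \<open>n\<close>-th ghost component is the first component of the image under the Frobenius maps at
  the prime factors of \<open>n\<close>; a morphism compatible with them, with restrictions and with the first
  component therefore transports ghost components.\<close>

lemma ghost_transport:
  fixes C :: "(int poly, 'u) module" and \<psi> :: "nat set \<Rightarrow> (nat \<Rightarrow> 'u) \<Rightarrow> nat \<Rightarrow> 'u"
  assumes inf: "infinite (UNIV :: 'u set)" and C: "algebra Zq C"
    and closed: "\<And>S x. S \<preceq>\<^sub>d T \<Longrightarrow> x \<in> S \<rightarrow>\<^sub>E carrier C \<Longrightarrow> \<psi> S x \<in> S \<rightarrow>\<^sub>E carrier C"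
    and first: "\<And>x. x \<in> {1} \<rightarrow>\<^sub>E carrier C \<Longrightarrow> \<psi> {1} x 1 = x 1"
    and restr: "\<And>S S' x. S \<preceq>\<^sub>d T \<Longrightarrow> S' \<preceq>\<^sub>d S \<Longrightarrow> x \<in> S \<rightarrow>\<^sub>E carrier C \<Longrightarrow>
       \<psi> S' (restrict x S') = restrict (\<psi> S x) S'"
    and frob: "\<And>S p x. prime p \<Longrightarrow> p \<in> S \<Longrightarrow> S \<preceq>\<^sub>d T \<Longrightarrow> x \<in> S \<rightarrow>\<^sub>E carrier C \<Longrightarrow>
       \<psi> (S /\<^sub>d p) (wbar_frob p S (RS g C) x) = witt_frob p S (twist r C) (\<psi> S x)"
  shows "n \<in> S \<Longrightarrow> S \<preceq>\<^sub>d T \<Longrightarrow> x \<in> S \<rightarrow>\<^sub>E carrier C \<Longrightarrow>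
    witt_ghost S (twist r C) (\<psi> S x) n = wbar_ghost S (RS g C) x n"
proof (induction n arbitrary: S x rule: less_induct)
  case (less n)
  note S = ds_subset_ds(1)[OF less(3)] and x = less(4)
  note R = algebra_RS[OF C, of g]
  show ?case
  proof (cases "n = 1")
    case True
    have 1: "1 \<in> S" using less(2) True by simp
    have d1: "{1} \<preceq>\<^sub>d S" using 1 by (simp add: ds_subset_def divisor_stable_def)
    have "\<psi> S x 1 = restrict (\<psi> S x) {1} 1" by simp
    also have "\<dots> = \<psi> {1} (restrict x {1}) 1" by (simp only: restr[OF less(3) d1 x])
    also have "\<dots> = x 1" using first[of "restrict x {1}"] PiE_mem[OF x 1] by simp
    finally have e: "\<psi> S x 1 = x 1" .
    have x1: "x 1 \<in> carrier C" by (rule PiE_mem[OF x 1])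
    have "witt_ghost S (twist r C) (\<psi> S x) 1 = \<psi> S x 1"
      by (rule witt_ghost_one[OF nonunital_twist[OF C] 1]) (simp only: e x1 twist_simps[OF C])
    moreover have "wbar_ghost S (RS g C) x 1 = x 1"
      using alg_smult(5)[OF R, of "x 1"] x1 by (intro ghost_one alg_cring[OF R] 1) auto
    ultimately show ?thesis using True e by simp
  next
    case False
    then obtain p where p: "prime p" "p dvd n" using prime_factor_nat by blast
    then obtain m where m: "n = p * m" by blast
    have n0: "n > 0" using ds_pos[OF S less(2)] .
    have mn: "m < n" using n0 m prime_gt_1_nat[OF p(1)] by auto
    have pS: "p \<in> S" using ds_dvd[OF S less(2) p(2)] .
    have mS: "m \<in> S /\<^sub>d p" using quot_memI[OF S] less(2) m by simp
    have q: "S /\<^sub>d p \<preceq>\<^sub>d T"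
      using ds_quot[OF S pS] quot_mem(3)[of S p] ds_subset_ds(2)[OF less(3)] by (auto simp: ds_subset_def)
    have xR: "x \<in> S \<rightarrow>\<^sub>E carrier (RS g C)" using x by simp
    note B = wbar_frob_facts[OF inf S pS R xR]
    have "witt_ghost S (twist r C) (\<psi> S x) n = witt_ghost (S /\<^sub>d p) (twist r C) (witt_frob p S (twist r C) (\<psi> S x)) m"
      using witt_frob_twist(2)[OF inf S pS C closed[OF less(3) x] mS, of r] m by simp
    also have "\<dots> = witt_ghost (S /\<^sub>d p) (twist r C) (\<psi> (S /\<^sub>d p) (wbar_frob p S (RS g C) x)) m"
      by (simp only: frob[OF p(1) pS less(3) x])
    also have "\<dots> = wbar_ghost (S /\<^sub>d p) (RS g C) (wbar_frob p S (RS g C) x) m"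
      by (rule less(1)[OF mn mS q]) (use B(1) in simp)
    also have "\<dots> = wbar_ghost S (RS g C) x n" using B(2)[OF mS] m by simp
    finally show ?thesis .
  qed
qed

context
  fixes T :: "nat set"
  assumes inf: "infinite (UNIV :: 'u set)" and T: "divisor_stable T"
begin

lemma carrier_points:
  assumes "S \<preceq>\<^sub>d T" "algebra Zq (C :: (int poly, 'u) module)"
  shows "carrier (wbar_ring S (RS g C)) = S \<rightarrow>\<^sub>E carrier C" "carrier (witt_ring S (twist r C)) = S \<rightarrow>\<^sub>E carrier C"
  using wbar_ring_facts(2)[OF inf ds_subset_ds(1)[OF assms(1)] algebra_RS[OF assms(2)]] witt_ring_twist(2)[OF inf ds_subset_ds(1)[OF assms(1)] assms(2)]
  by simp_all

text \<open>The values outside the relevant arguments are those prescribed for morphisms, so that morphisms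
  can be compared by equality.\<close>

definition iso_map :: "int poly \<Rightarrow> nat set \<Rightarrow> (int poly, 'u) module \<Rightarrow> (nat \<Rightarrow> 'u) \<Rightarrow> nat \<Rightarrow> 'u" where
  "iso_map g S C = (if S \<preceq>\<^sub>d T \<and> algebra Zq C then restrict (Phi S (RS g C)) (S \<rightarrow>\<^sub>E carrier C) else undefined)"

definition inv_map :: "int poly \<Rightarrow> nat set \<Rightarrow> (int poly, 'u) module \<Rightarrow> (nat \<Rightarrow> 'u) \<Rightarrow> nat \<Rightarrow> 'u" where
  "inv_map g S C = (if S \<preceq>\<^sub>d T \<and> algebra Zq C then restrict (PhiI S (RS g C)) (S \<rightarrow>\<^sub>E carrier C) else undefined)"

lemma iso_map: "S \<preceq>\<^sub>d T \<Longrightarrow> algebra Zq C \<Longrightarrow> x \<in> S \<rightarrow>\<^sub>E carrier C \<Longrightarrow> iso_map g S C x = Phi S (RS g C) x"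
  and inv_map: "S \<preceq>\<^sub>d T \<Longrightarrow> algebra Zq C \<Longrightarrow> x \<in> S \<rightarrow>\<^sub>E carrier C \<Longrightarrow> inv_map g S C x = PhiI S (RS g C) x"
  by (simp_all add: iso_map_def inv_map_def)

context
  fixes g :: "int poly"
begin

lemma Phi_RS:
  assumes S: "S \<preceq>\<^sub>d T" and C: "algebra Zq (C :: (int poly, 'u) module)"
  shows "x \<in> S \<rightarrow>\<^sub>E carrier C \<Longrightarrow> Phi S (RS g C) x \<in> S \<rightarrow>\<^sub>E carrier C"
    "x \<in> S \<rightarrow>\<^sub>E carrier C \<Longrightarrow> PhiI S (RS g C) x \<in> S \<rightarrow>\<^sub>E carrier C"
    "x \<in> S \<rightarrow>\<^sub>E carrier C \<Longrightarrow> Phi S (RS g C) (PhiI S (RS g C) x) = x"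
    "x \<in> S \<rightarrow>\<^sub>E carrier C \<Longrightarrow> PhiI S (RS g C) (Phi S (RS g C) x) = x"
    "x \<in> S \<rightarrow>\<^sub>E carrier C \<Longrightarrow> witt_ghost S (twist (1 - g) C) (Phi S (RS g C) x) = wbar_ghost S (RS g C) x"
  using Phi_closed[OF algebra_RS[OF C], of x S g] PhiI[OF algebra_RS[OF C] ds_subset_ds(1)[OF S], of x g]
    Phi_ghost[OF algebra_RS[OF C] ds_subset_ds(1)[OF S], of x g] by (simp_all only: RS_simps twist_RS)

lemma iso_map_closed: "S \<preceq>\<^sub>d T \<Longrightarrow> algebra Zq C \<Longrightarrow> x \<in> S \<rightarrow>\<^sub>E carrier C \<Longrightarrow> iso_map g S C x \<in> S \<rightarrow>\<^sub>E carrier C"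
  and inv_map_closed: "S \<preceq>\<^sub>d T \<Longrightarrow> algebra Zq C \<Longrightarrow> x \<in> S \<rightarrow>\<^sub>E carrier C \<Longrightarrow> inv_map g S C x \<in> S \<rightarrow>\<^sub>E carrier C"
  and iso_inv: "S \<preceq>\<^sub>d T \<Longrightarrow> algebra Zq C \<Longrightarrow> x \<in> S \<rightarrow>\<^sub>E carrier C \<Longrightarrow> iso_map g S C (inv_map g S C x) = x"
  and inv_iso: "S \<preceq>\<^sub>d T \<Longrightarrow> algebra Zq C \<Longrightarrow> x \<in> S \<rightarrow>\<^sub>E carrier C \<Longrightarrow> inv_map g S C (iso_map g S C x) = x"
  by (simp_all only: iso_map inv_map Phi_RS)

lemma quot_T: "S \<preceq>\<^sub>d T \<Longrightarrow> p \<in> S \<Longrightarrow> S /\<^sub>d p \<preceq>\<^sub>d T"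
  using ds_quot[of S p] quot_mem(3)[of S p] by (auto simp: ds_subset_def)

lemma sub_T: "S \<preceq>\<^sub>d T \<Longrightarrow> S' \<preceq>\<^sub>d S \<Longrightarrow> S' \<preceq>\<^sub>d T"
  by (auto simp: ds_subset_def)

lemma one_T: "{1} \<preceq>\<^sub>d T"
  using ds_one[OF T] by (simp add: ds_subset_def divisor_stable_def)

lemma iso_map_laws:
  assumes C: "algebra Zq (C :: (int poly, 'u) module)"
  shows "S \<preceq>\<^sub>d T \<Longrightarrow> iso_map g S C \<in> nu_ring_hom (wbar_ring S (RS g C)) (witt_ring S (twist (1 - g) C))"
    and "S \<preceq>\<^sub>d T \<Longrightarrow> S' \<preceq>\<^sub>d S \<Longrightarrow> x \<in> S \<rightarrow>\<^sub>E carrier C \<Longrightarrow> iso_map g S' C (restrict x S') = restrict (iso_map g S C x) S'"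
    and "S \<preceq>\<^sub>d T \<Longrightarrow> p \<in> S \<Longrightarrow> x \<in> S \<rightarrow>\<^sub>E carrier C \<Longrightarrow>
        iso_map g (S /\<^sub>d p) C (wbar_frob p S (RS g C) x) = witt_frob p S (twist (1 - g) C) (iso_map g S C x)"
    and "S \<preceq>\<^sub>d T \<Longrightarrow> p \<in> S \<Longrightarrow> x \<in> S /\<^sub>d p \<rightarrow>\<^sub>E carrier C \<Longrightarrow>
        iso_map g S C (wbar_ver p S (RS g C) x) = witt_ver p S (twist (1 - g) C) (iso_map g (S /\<^sub>d p) C x)"
    and "algebra Zq D \<Longrightarrow> h \<in> alg_hom Zq C D \<Longrightarrow> S \<preceq>\<^sub>d T \<Longrightarrow> x \<in> S \<rightarrow>\<^sub>E carrier C \<Longrightarrow>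
        iso_map g S D (vec_map S h x) = vec_map S h (iso_map g S C x)"
    and "x \<in> {1} \<rightarrow>\<^sub>E carrier C \<Longrightarrow> iso_map g {1} C x 1 = x 1"
proof -
  note R = algebra_RS[OF C, of g]
  note ds = ds_subset_ds
  show "iso_map g S C \<in> nu_ring_hom (wbar_ring S (RS g C)) (witt_ring S (twist (1 - g) C))" if s: "S \<preceq>\<^sub>d T"
  proof (rule nu_ring_homI; unfold carrier_points[OF s C])
    note h = nu_ring_homD[OF Phi_hom[OF inf ds(1)[OF s] R], unfolded carrier_points[OF s C] twist_RS]
    note cl = wbar_ring_closed[OF inf ds(1)[OF s] R, unfolded RS_simps]
    show "iso_map g S C x \<in> S \<rightarrow>\<^sub>E carrier C" if "x \<in> S \<rightarrow>\<^sub>E carrier C" for x by (rule iso_map_closed[OF s C that])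
    fix x y assume x: "x \<in> S \<rightarrow>\<^sub>E carrier C" "y \<in> S \<rightarrow>\<^sub>E carrier C"
    show "iso_map g S C (x \<oplus>\<^bsub>wbar_ring S (RS g C)\<^esub> y) = iso_map g S C x \<oplus>\<^bsub>witt_ring S (twist (1 - g) C)\<^esub> iso_map g S C y"
      by (simp only: iso_map[OF s C] cl x h(3))
    show "iso_map g S C (x \<otimes>\<^bsub>wbar_ring S (RS g C)\<^esub> y) = iso_map g S C x \<otimes>\<^bsub>witt_ring S (twist (1 - g) C)\<^esub> iso_map g S C y"
      by (simp only: iso_map[OF s C] cl x h(4))
  qed
  show "iso_map g S' C (restrict x S') = restrict (iso_map g S C x) S'"
    if s: "S \<preceq>\<^sub>d T" "S' \<preceq>\<^sub>d S" and x: "x \<in> S \<rightarrow>\<^sub>E carrier C"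
    using Phi_restrict[OF R ds[OF s(2)], unfolded RS_simps, OF x] restrict_in[OF x ds(2)[OF s(2)]]
    by (simp only: iso_map[OF s(1) C x] iso_map[OF sub_T[OF s] C])
  show "iso_map g (S /\<^sub>d p) C (wbar_frob p S (RS g C) x) = witt_frob p S (twist (1 - g) C) (iso_map g S C x)"
    if s: "S \<preceq>\<^sub>d T" "p \<in> S" and x: "x \<in> S \<rightarrow>\<^sub>E carrier C"
    using Phi_frob[OF inf ds(1)[OF s(1)] s(2) R, unfolded RS_simps twist_RS, OF x]
      wbar_frob_facts(1)[OF inf ds(1)[OF s(1)] s(2) R, unfolded RS_simps, OF x]
    by (simp only: iso_map[OF s(1) C x] iso_map[OF quot_T[OF s] C])
  show "iso_map g S C (wbar_ver p S (RS g C) x) = witt_ver p S (twist (1 - g) C) (iso_map g (S /\<^sub>d p) C x)"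
    if s: "S \<preceq>\<^sub>d T" "p \<in> S" and x: "x \<in> S /\<^sub>d p \<rightarrow>\<^sub>E carrier C"
    using Phi_ver[OF inf ds(1)[OF s(1)] s(2) R, unfolded RS_simps twist_RS, OF x]
      wbar_ver_facts(1)[OF inf ds(1)[OF s(1)] s(2) R, unfolded RS_simps, OF x]
    by (simp only: iso_map[OF s(1) C] iso_map[OF quot_T[OF s] C x])
  show "iso_map g S D (vec_map S h x) = vec_map S h (iso_map g S C x)"
    if D: "algebra Zq D" and h: "h \<in> alg_hom Zq C D" and s: "S \<preceq>\<^sub>d T" and x: "x \<in> S \<rightarrow>\<^sub>E carrier C"
  proof -
    have "vec_map S h x \<in> S \<rightarrow>\<^sub>E carrier D" by (rule vec_map_in[OF x]) (rule alg_homD(3)[OF h])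
    then show ?thesis
      using Phi_nat[OF R algebra_RS[OF D] alg_hom_RS[OF h], unfolded RS_simps, OF x] by (simp only: iso_map[OF s C x] iso_map[OF s D])
  qed
  show "iso_map g {1} C x 1 = x 1" if x: "x \<in> {1} \<rightarrow>\<^sub>E carrier C"
  proof -
    have x1: "x 1 \<in> carrier C" "Phi {1} (RS g C) x 1 \<in> carrier C"
      by (rule PiE_mem[OF x], simp) (rule PiE_mem[OF Phi_RS(1)[OF one_T C x]], simp)
    have "witt_ghost {1} (twist (1 - g) C) (Phi {1} (RS g C) x) 1 = Phi {1} (RS g C) x 1"
      by (rule witt_ghost_one[OF nonunital_twist[OF C]]) (simp_all only: x1 twist_simps[OF C] singleton_iff)
    moreover have "wbar_ghost {1} (RS g C) x 1 = x 1"
      using alg_smult(5)[OF R, of "x 1"] x1(1) by (intro ghost_one alg_cring[OF R]) auto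
    ultimately show ?thesis using Phi_RS(5)[OF one_T C x] iso_map[OF one_T C x, of g] by simp
  qed
qed

lemma iso_map_morphism:
  "AFVp_morphism T Zq (Wbar g :: (int poly, 'u, nat \<Rightarrow> 'u) coord_system) (W_tw (1 - g)) (iso_map g)"
  unfolding AFVp_morphism_def
proof (intro conjI AFVp_object_Wbar[OF inf] AFVp_object_W_tw[OF inf])
  show "\<forall>C. algebra Zq C \<longrightarrow> (\<forall>x\<in>carrier (Pts (fst (Wbar g)) {1} C). snd (Wbar g) C x = snd (W_tw (1 - g)) C (iso_map g {1} C x))"
    unfolding Wbar_eq W_tw_eq fst_conv snd_conv scheme_system.simps wbar_system_simps
    using iso_map_laws(6) carrier_points[OF one_T] by metis
  show "RFV_over_morphism T Zq (fst (Wbar g)) (fst (W_tw (1 - g))) (iso_map g)"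
    unfolding RFV_over_morphism_def Wbar_eq W_tw_eq fst_conv scheme_system.simps wbar_system_simps witt_system_simps
      natural_in_algebra_def
  proof (intro conjI allI impI ballI funcsetI; (elim conjE)?)
    show "iso_map g S C = undefined" if "\<not> (S \<preceq>\<^sub>d T \<and> algebra Zq C)" for S C unfolding iso_map_def by (rule if_not_P[OF that])
    show "iso_map g S C \<in> nu_ring_hom (wbar_ring S (RS g C)) (witt_ring S (twist (1 - g) C)) \<inter> extensional (carrier (wbar_ring S (RS g C)))"
      if s: "S \<preceq>\<^sub>d T" "algebra Zq C" for S C
      using iso_map_laws(1)[OF s(2,1)] s unfolding carrier_points[OF s] by (simp add: iso_map_def)
    show "iso_map g S C x \<in> carrier (witt_ring S (twist (1 - g) C))"
      if s: "S \<preceq>\<^sub>d T" "algebra Zq C" "x \<in> carrier (wbar_ring S (RS g C))" for S C x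
      using iso_map_closed[OF s(1,2)] s(3) unfolding carrier_points[OF s(1,2)] .
    show "iso_map g S D (vec_map S h x) = vec_map S h (iso_map g S C x)"
      if s: "S \<preceq>\<^sub>d T" and C: "algebra Zq C" "algebra Zq D" and h: "h \<in> alg_hom Zq C D" and x: "x \<in> carrier (wbar_ring S (RS g C))" for S C D h x
      using iso_map_laws(5)[OF C h s] x unfolding carrier_points[OF s C(1)] .
    show "iso_map g S' C (restrict x S') = restrict (iso_map g S C x) S'"
      if s: "S \<preceq>\<^sub>d T" "S' \<preceq>\<^sub>d S" and C: "algebra Zq C" and x: "x \<in> carrier (wbar_ring S (RS g C))" for S S' C x
      using iso_map_laws(2)[OF C s] x unfolding carrier_points[OF s(1) C] .
    fix p S C x assume s: "prime p" "p \<in> S" "S \<preceq>\<^sub>d T" and C: "algebra Zq (C :: (int poly, 'u) module)"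
    show "x \<in> carrier (wbar_ring S (RS g C)) \<Longrightarrow> iso_map g (S /\<^sub>d p) C (wbar_frob p S (RS g C) x) = witt_frob p S (twist (1 - g) C) (iso_map g S C x)"
      unfolding carrier_points[OF s(3) C] by (rule iso_map_laws(3)[OF C s(3,2)])
    show "x \<in> carrier (wbar_ring (S /\<^sub>d p) (RS g C)) \<Longrightarrow> iso_map g S C (wbar_ver p S (RS g C) x) = witt_ver p S (twist (1 - g) C) (iso_map g (S /\<^sub>d p) C x)"
      unfolding carrier_points[OF quot_T[OF s(3,2)] C] by (rule iso_map_laws(4)[OF C s(3,2)])
  qed
qed

lemma iso_map_inj:
  assumes "S \<preceq>\<^sub>d T" "algebra Zq (C :: (int poly, 'u) module)" "x \<in> S \<rightarrow>\<^sub>E carrier C" "y \<in> S \<rightarrow>\<^sub>E carrier C"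
    "iso_map g S C x = iso_map g S C y"
  shows "x = y"
  using arg_cong[OF assms(5), of "inv_map g S C"] unfolding inv_iso[OF assms(1,2,3)] inv_iso[OF assms(1,2,4)] .

lemma inv_map_morphism:
  "AFVp_morphism T Zq (W_tw (1 - g) :: (int poly, 'u, nat \<Rightarrow> 'u) coord_system) (Wbar g) (inv_map g)"
  unfolding AFVp_morphism_def
proof (intro conjI AFVp_object_Wbar[OF inf] AFVp_object_W_tw[OF inf])
  note ds = ds_subset_ds
  show "\<forall>C. algebra Zq C \<longrightarrow> (\<forall>x\<in>carrier (Pts (fst (W_tw (1 - g))) {1} C). snd (W_tw (1 - g)) C x = snd (Wbar g) C (inv_map g {1} C x))"
    unfolding Wbar_eq W_tw_eq fst_conv snd_conv scheme_system.simps witt_system_simps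
  proof (intro allI impI ballI)
    fix C :: "(int poly, 'u) module" and x assume C: "algebra Zq C" and "x \<in> carrier (witt_ring {1} (twist (1 - g) C))"
    then have x: "x \<in> {1} \<rightarrow>\<^sub>E carrier C" unfolding carrier_points[OF one_T C] by simp
    show "x 1 = inv_map g {1} C x 1"
      using iso_map_laws(6)[OF C inv_map_closed[OF one_T C x]] unfolding iso_inv[OF one_T C x] .
  qed
  show "RFV_over_morphism T Zq (fst (W_tw (1 - g))) (fst (Wbar g)) (inv_map g)"
    unfolding RFV_over_morphism_def Wbar_eq W_tw_eq fst_conv scheme_system.simps wbar_system_simps witt_system_simps
      natural_in_algebra_def
  proof (intro conjI allI impI ballI funcsetI; (elim conjE)?)
    show "inv_map g S C = undefined" if "\<not> (S \<preceq>\<^sub>d T \<and> algebra Zq C)" for S C unfolding inv_map_def by (rule if_not_P[OF that])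
    show "inv_map g S C \<in> nu_ring_hom (witt_ring S (twist (1 - g) C)) (wbar_ring S (RS g C)) \<inter> extensional (carrier (witt_ring S (twist (1 - g) C)))"
      if s: "S \<preceq>\<^sub>d T" "algebra Zq C" for S C
    proof (intro IntI)
      show "inv_map g S C \<in> extensional (carrier (witt_ring S (twist (1 - g) C)))"
        using s unfolding carrier_points[OF s] by (simp add: inv_map_def)
      note h = nu_ring_homD[OF iso_map_laws(1)[OF s(2,1)], unfolded carrier_points[OF s]]
      note i = inv_map_closed[OF s] and cl = wbar_ring_closed[OF inf ds(1)[OF s(1)] algebra_RS[OF s(2)], unfolded RS_simps]
      note cl' = witt_ring_twist(3,4)[OF inf ds(1)[OF s(1)] s(2)]
      show "inv_map g S C \<in> nu_ring_hom (witt_ring S (twist (1 - g) C)) (wbar_ring S (RS g C))"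
      proof (rule nu_ring_homI; unfold carrier_points[OF s])
        fix x y assume x: "x \<in> S \<rightarrow>\<^sub>E carrier C" "y \<in> S \<rightarrow>\<^sub>E carrier C"
        show "inv_map g S C (x \<oplus>\<^bsub>witt_ring S (twist (1 - g) C)\<^esub> y) = inv_map g S C x \<oplus>\<^bsub>wbar_ring S (RS g C)\<^esub> inv_map g S C y"
          by (rule iso_map_inj[OF s]; simp only: i cl cl' x h(3) iso_inv[OF s])
        show "inv_map g S C (x \<otimes>\<^bsub>witt_ring S (twist (1 - g) C)\<^esub> y) = inv_map g S C x \<otimes>\<^bsub>wbar_ring S (RS g C)\<^esub> inv_map g S C y"
          by (rule iso_map_inj[OF s]; simp only: i cl cl' x h(4) iso_inv[OF s])
      qed (rule i)
    qed
    show "inv_map g S C x \<in> carrier (wbar_ring S (RS g C))"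
      if s: "S \<preceq>\<^sub>d T" "algebra Zq C" "x \<in> carrier (witt_ring S (twist (1 - g) C))" for S C x
      using inv_map_closed[OF s(1,2)] s(3) unfolding carrier_points[OF s(1,2)] .
    show "inv_map g S D (vec_map S h x) = vec_map S h (inv_map g S C x)"
      if s: "S \<preceq>\<^sub>d T" and C: "algebra Zq C" "algebra Zq D" and h: "h \<in> alg_hom Zq C D" and x: "x \<in> carrier (witt_ring S (twist (1 - g) C))" for S C D h x
    proof -
      have x: "x \<in> S \<rightarrow>\<^sub>E carrier C" using x unfolding carrier_points[OF s C(1)] .
      have hc: "vec_map S h y \<in> S \<rightarrow>\<^sub>E carrier D" if "y \<in> S \<rightarrow>\<^sub>E carrier C" for y
        by (rule vec_map_in[OF that]) (rule alg_homD(3)[OF h])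
      note i = inv_map_closed[OF s C(1) x]
      show ?thesis
        by (rule iso_map_inj[OF s C(2) inv_map_closed[OF s C(2) hc[OF x]] hc[OF i]])
          (simp only: iso_map_laws(5)[OF C h s i] iso_inv[OF s C(1) x] iso_inv[OF s C(2) hc[OF x]])
    qed
    show "inv_map g S' C (restrict x S') = restrict (inv_map g S C x) S'"
      if s: "S \<preceq>\<^sub>d T" "S' \<preceq>\<^sub>d S" and C: "algebra Zq C" and x: "x \<in> carrier (witt_ring S (twist (1 - g) C))" for S S' C x
    proof -
      have x: "x \<in> S \<rightarrow>\<^sub>E carrier C" using x unfolding carrier_points[OF s(1) C] .
      note r = restrict_in[OF _ ds(2)[OF s(2)]]
      note i = inv_map_closed[OF s(1) C x] and s' = sub_T[OF s]
      show ?thesis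
        by (rule iso_map_inj[OF s' C inv_map_closed[OF s' C r[OF x]] r[OF i]])
          (simp only: iso_map_laws(2)[OF C s i] iso_inv[OF s(1) C x] iso_inv[OF s' C r[OF x]])
    qed
    fix p S C x assume s: "prime p" "p \<in> S" "S \<preceq>\<^sub>d T" and C: "algebra Zq (C :: (int poly, 'u) module)"
    note q = quot_T[OF s(3,2)] and R = algebra_RS[OF C, of g]
    note tf = witt_frob_twist(1)[OF inf ds(1)[OF s(3)] s(2) C] and tv = witt_ver_twist(1)[OF inf ds(1)[OF s(3)] s(2) C]
    note bf = wbar_frob_facts(1)[OF inf ds(1)[OF s(3)] s(2) R, unfolded RS_simps] and bv = wbar_ver_facts(1)[OF inf ds(1)[OF s(3)] s(2) R, unfolded RS_simps]
    show "inv_map g (S /\<^sub>d p) C (witt_frob p S (twist (1 - g) C) x) = wbar_frob p S (RS g C) (inv_map g S C x)"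
      if "x \<in> carrier (witt_ring S (twist (1 - g) C))"
    proof -
      have x: "x \<in> S \<rightarrow>\<^sub>E carrier C" using that unfolding carrier_points[OF s(3) C] .
      note i = inv_map_closed[OF s(3) C x]
      show ?thesis
        by (rule iso_map_inj[OF q C inv_map_closed[OF q C tf[OF x]] bf[OF i]])
          (simp only: iso_map_laws(3)[OF C s(3,2) i] iso_inv[OF s(3) C x] iso_inv[OF q C tf[OF x]])
    qed
    show "inv_map g S C (witt_ver p S (twist (1 - g) C) x) = wbar_ver p S (RS g C) (inv_map g (S /\<^sub>d p) C x)"
      if "x \<in> carrier (witt_ring (S /\<^sub>d p) (twist (1 - g) C))"
    proof -
      have x: "x \<in> S /\<^sub>d p \<rightarrow>\<^sub>E carrier C" using that unfolding carrier_points[OF q C] .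
      note i = inv_map_closed[OF q C x]
      show ?thesis
        by (rule iso_map_inj[OF s(3) C inv_map_closed[OF s(3) C tv[OF x]] bv[OF i]])
          (simp only: iso_map_laws(4)[OF C s(3,2) i] iso_inv[OF q C x] iso_inv[OF s(3) C tv[OF x]])
    qed
  qed
qed

theorem iso_map_iso: "AFVp_iso T Zq (Wbar g :: (int poly, 'u, nat \<Rightarrow> 'u) coord_system) (W_tw (1 - g)) (iso_map g)"
  unfolding AFVp_iso_def
proof (intro conjI exI[of _ "inv_map g"] iso_map_morphism inv_map_morphism allI impI ballI; (elim conjE)?)
  fix S and C :: "(int poly, 'u) module" and x assume s: "S \<preceq>\<^sub>d T" and C: "algebra Zq C"
  show "x \<in> carrier (Pts (fst (Wbar g)) S C) \<Longrightarrow> inv_map g S C (iso_map g S C x) = x"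
    unfolding Wbar_eq fst_conv scheme_system.simps wbar_system_simps carrier_points[OF s C] by (rule inv_iso[OF s C])
  show "x \<in> carrier (Pts (fst (W_tw (1 - g))) S C) \<Longrightarrow> iso_map g S C (inv_map g S C x) = x"
    unfolding W_tw_eq fst_conv scheme_system.simps witt_system_simps carrier_points[OF s C] by (rule iso_inv[OF s C])
qed

text \<open>By \<open>ghost_transport\<close> the morphism has the same effect on ghost components as the comparison map.
  Over the torsion-free generic algebra this determines it, and naturality carries the equality to
  every algebra. Multiplication on \<open>{1}\<close> determines \<open>r\<close>.\<close>

theorem morphism_unique:
  assumes M: "AFVp_morphism T Zq (Wbar g :: (int poly, 'u, nat \<Rightarrow> 'u) coord_system) (W_tw r) \<psi>"
  shows "r = 1 - g \<and> \<psi> = iso_map g"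
proof -
  note ds = ds_subset_ds
  have mor: "RFV_over_morphism T Zq (fst (Wbar g)) (fst (W_tw r)) \<psi>"
    and coord: "\<forall>C. algebra Zq C \<longrightarrow> (\<forall>x\<in>carrier (Pts (fst (Wbar g)) {1} C). snd (Wbar g) C x = snd (W_tw r) C (\<psi> {1} C x))"
    using M unfolding AFVp_morphism_def by blast+
  note m = mor[unfolded RFV_over_morphism_def Wbar_eq W_tw_eq fst_conv scheme_system.simps wbar_system_simps witt_system_simps natural_in_algebra_def]
  have undef: "\<psi> S C = undefined" if "\<not> (S \<preceq>\<^sub>d T \<and> algebra Zq C)" for S C
    using m[THEN conjunct1] that by blast
  have hom: "\<psi> S C \<in> nu_ring_hom (wbar_ring S (RS g C)) (witt_ring S (twist r C))"
    "\<psi> S C \<in> extensional (S \<rightarrow>\<^sub>E carrier C)" if s: "S \<preceq>\<^sub>d T" "algebra Zq C" for S C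
    using m[THEN conjunct2, THEN conjunct1] s unfolding carrier_points(1)[OF s, symmetric, where g = g] by blast+
  have closed: "\<psi> S C x \<in> S \<rightarrow>\<^sub>E carrier C" if s: "S \<preceq>\<^sub>d T" "algebra Zq C" "x \<in> S \<rightarrow>\<^sub>E carrier C" for S C x
    using nu_ring_homD(2)[OF hom(1)[OF s(1,2)], of x] s(3) unfolding carrier_points[OF s(1,2)] .
  have nat: "\<psi> S D (vec_map S h x) = vec_map S h (\<psi> S C x)"
    if s: "S \<preceq>\<^sub>d T" and C: "algebra Zq C" "algebra Zq D" and h: "h \<in> alg_hom Zq C D" and x: "x \<in> S \<rightarrow>\<^sub>E carrier C" for S C D h x
    using m[THEN conjunct2, THEN conjunct2, THEN conjunct1] s C h x unfolding carrier_points(1)[OF s C(1), symmetric, where g = g] by blast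
  have restr: "\<psi> S' C (restrict x S') = restrict (\<psi> S C x) S'"
    if s: "S \<preceq>\<^sub>d T" "S' \<preceq>\<^sub>d S" and C: "algebra Zq C" and x: "x \<in> S \<rightarrow>\<^sub>E carrier C" for S S' C x
    using m[THEN conjunct2, THEN conjunct2, THEN conjunct2, THEN conjunct1] s C x unfolding carrier_points(1)[OF s(1) C, symmetric, where g = g] by blast
  have frob: "\<psi> (S /\<^sub>d p) C (wbar_frob p S (RS g C) x) = witt_frob p S (twist r C) (\<psi> S C x)"
    if s: "prime p" "p \<in> S" "S \<preceq>\<^sub>d T" and C: "algebra Zq C" and x: "x \<in> S \<rightarrow>\<^sub>E carrier C" for S p C x
    using m[THEN conjunct2, THEN conjunct2, THEN conjunct2, THEN conjunct2] s C x unfolding carrier_points(1)[OF s(3) C, symmetric, where g = g] by blast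
  have first: "\<psi> {1} C x 1 = x 1" if C: "algebra Zq C" and x: "x \<in> {1} \<rightarrow>\<^sub>E carrier C" for C x
    using coord[unfolded Wbar_eq W_tw_eq fst_conv snd_conv scheme_system.simps wbar_system_simps, THEN spec, THEN mp, OF C,
        unfolded carrier_points[OF one_T C], THEN bspec, OF x] by (rule sym)
  have gh: "witt_ghost S (twist r C) (\<psi> S C x) n = wbar_ghost S (RS g C) x n"
    if s: "S \<preceq>\<^sub>d T" and C: "algebra Zq C" and x: "x \<in> S \<rightarrow>\<^sub>E carrier C" and n: "n \<in> S" for S C x n
    by (rule ghost_transport[OF inf C, where T = T and \<psi> = "\<lambda>S. \<psi> S C"])
      (simp_all only: closed C first restr frob n s x)
  have E: "algebra Zq (EM UNIV :: (int poly, 'u) module)" by (rule algebra_EU[OF inf])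
  let ?E = "EM UNIV :: (int poly, 'u) module"
  have r: "r = 1 - g"
  proof -
    \<comment> \<open>On \<open>{1}\<close> the ghost maps are the identity, so the square of the vector \<open>1\<close> exhibits the twist.\<close>
    note R = algebra_RS[OF E, of g] and d1 = ds(1)[OF one_T]
    let ?e = "\<lambda>n\<in>{1::nat}. \<one>\<^bsub>?E\<^esub>"
    have e: "?e \<in> {1} \<rightarrow>\<^sub>E carrier ?E" by auto
    have e1: "?e 1 = \<one>\<^bsub>?E\<^esub>" by simp
    have i1: "1 \<in> {1::nat}" by simp
    note B = wbar_ring_closed(2)[OF inf d1 R, unfolded RS_simps, OF e e]
    have "wbar_ghost {1} (RS g ?E) (?e \<otimes>\<^bsub>wbar_ring {1} (RS g ?E)\<^esub> ?e) 1
        = wbar_ghost {1} (RS g ?E) ?e 1 \<otimes>\<^bsub>twist (1 - g) ?E\<^esub> wbar_ghost {1} (RS g ?E) ?e 1"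
      using wbar_ring_ghost(2)[OF inf d1 R, unfolded RS_simps, OF e e i1] unfolding twist_RS .
    moreover have "witt_ghost {1} (twist r ?E) (\<psi> {1} ?E (?e \<otimes>\<^bsub>wbar_ring {1} (RS g ?E)\<^esub> ?e)) 1
       = witt_ghost {1} (twist r ?E) (\<psi> {1} ?E ?e) 1 \<otimes>\<^bsub>twist r ?E\<^esub> witt_ghost {1} (twist r ?E) (\<psi> {1} ?E ?e) 1"
    proof -
      have "\<psi> {1} ?E (?e \<otimes>\<^bsub>wbar_ring {1} (RS g ?E)\<^esub> ?e) = \<psi> {1} ?E ?e \<otimes>\<^bsub>witt_ring {1} (twist r ?E)\<^esub> \<psi> {1} ?E ?e"
        by (rule nu_ring_homD(4)[OF hom(1)[OF one_T E]]; unfold carrier_points[OF one_T E]; rule e)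
      then show ?thesis
        using witt_ghost_ops(2)[OF inf d1 nonunital_twist[OF E], unfolded twist_simps[OF E], OF closed[OF one_T E e] closed[OF one_T E e] i1]
        by (simp add: twist_simps[OF E])
    qed
    moreover have "wbar_ghost {1} (RS g ?E) ?e 1 = \<one>\<^bsub>?E\<^esub>"
    proof -
      have ec: "?e 1 \<in> carrier (RS g ?E)" using PiE_mem[OF e i1] by (simp only: RS_simps)
      show ?thesis using ghost_one[of "RS g ?E" "{1}" ?e, OF alg_cring[OF R] i1 ec alg_smult(5)[OF R ec]] unfolding e1 .
    qed
    ultimately have "r \<odot>\<^bsub>?E\<^esub> (\<one>\<^bsub>?E\<^esub> \<otimes>\<^bsub>?E\<^esub> \<one>\<^bsub>?E\<^esub>) = (1 - g) \<odot>\<^bsub>?E\<^esub> (\<one>\<^bsub>?E\<^esub> \<otimes>\<^bsub>?E\<^esub> \<one>\<^bsub>?E\<^esub>)"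
      using gh[OF one_T E B i1] gh[OF one_T E e i1] unfolding twist_simps[OF E] by (simp only:)
    then have "qpoly r = qpoly (1 - g)" using inj_emb[OF inf] by (simp add: unemb_emb[OF inf] inj_eq)
    then show ?thesis by (rule qpoly_inj)
  qed
  have eqE: "\<psi> S ?E x = iso_map g S ?E x" if s: "S \<preceq>\<^sub>d T" and x: "x \<in> S \<rightarrow>\<^sub>E carrier ?E" for S x
  proof (rule witt_ghost_inj[OF nonunital_twist[OF E] torsion_free_EM[OF inf UNIV_I] ds(1)[OF s], unfolded twist_simps[OF E]])
    show "witt_ghost S (twist r ?E) (\<psi> S ?E x) = witt_ghost S (twist r ?E) (iso_map g S ?E x)"
      by (rule witt_ghost_ext) (simp only: gh[OF s E x, unfolded r] iso_map[OF s E x] Phi_RS(5)[OF s E x] r)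
  qed (simp_all only: closed[OF s E x] iso_map_closed[OF s E x])
  have "\<psi> S C = iso_map g S C" for S C
  proof (cases "S \<preceq>\<^sub>d T \<and> algebra Zq C")
    case False
    show ?thesis unfolding undef[OF False] iso_map_def if_not_P[OF False] ..
  next
    case True
    then have s: "S \<preceq>\<^sub>d T" and C: "algebra Zq C" by auto
    show ?thesis
    proof (rule extensionalityI[OF hom(2)[OF s C]])
      show "iso_map g S C \<in> extensional (S \<rightarrow>\<^sub>E carrier C)" using True by (simp add: iso_map_def)
      fix x assume x: "x \<in> S \<rightarrow>\<^sub>E carrier C"
      obtain h where h: "h \<in> alg_hom Zq ?E C" "vec_map S h (GX S 0) = x"
        using EU_cover[OF inf C x x] by blast
      have G: "(GX S 0 :: nat \<Rightarrow> 'u) \<in> S \<rightarrow>\<^sub>E carrier ?E" by (rule GX_EU[OF inf])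
      show "\<psi> S C x = iso_map g S C x"
        using nat[OF s E C h(1) G] iso_map_laws(5)[OF E C h(1) s G] eqE[OF s G] h(2) by simp
    qed
  qed
  then show ?thesis using r by blast
qed

end

end

theorem mainTheorem6:
  fixes T :: "nat set" and g :: "int poly"
  assumes "divisor_stable T"
    and "infinite (UNIV :: 'u set)"
  shows "\<exists>\<phi>. AFVp_iso T Zq (Wbar g :: (int poly, 'u, nat \<Rightarrow> 'u) coord_system) (W_tw (1 - g)) \<phi> \<and>
           (\<forall>\<psi>. AFVp_iso T Zq (Wbar g :: (int poly, 'u, nat \<Rightarrow> 'u) coord_system) (W_tw (1 - g)) \<psi>
              \<longrightarrow> \<psi> = \<phi>) \<and>
           (\<forall>r \<psi>. AFVp_iso T Zq (Wbar g :: (int poly, 'u, nat \<Rightarrow> 'u) coord_system) (W_tw r) \<psi>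
              \<longrightarrow> r = 1 - g \<and> \<psi> = \<phi>)"
proof (intro exI conjI allI impI)
  show "AFVp_iso T Zq (Wbar g :: (int poly, 'u, nat \<Rightarrow> 'u) coord_system) (W_tw (1 - g)) (iso_map T g)"
    by (rule iso_map_iso[OF assms(2,1)])
  have u: "r = 1 - g \<and> \<psi> = iso_map T g"
    if "AFVp_iso T Zq (Wbar g :: (int poly, 'u, nat \<Rightarrow> 'u) coord_system) (W_tw r) \<psi>" for r \<psi>
    using morphism_unique[OF assms(2,1)] that unfolding AFVp_iso_def by blast
  show "\<psi> = iso_map T g" if "AFVp_iso T Zq (Wbar g :: (int poly, 'u, nat \<Rightarrow> 'u) coord_system) (W_tw (1 - g)) \<psi>" for \<psi>
    using u[OF that] by blast
  show "r = 1 - g" "\<psi> = iso_map T g" if "AFVp_iso T Zq (Wbar g :: (int poly, 'u, nat \<Rightarrow> 'u) coord_system) (W_tw r) \<psi>" for r \<psi>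
    using u[OF that] by blast+
qed

end
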